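(* Let $s\in(0,1)$ and let $\Omega=\bigcup_{i=1}^M(a_i,b_i)$ be a finite union of bounded open intervals with pairwise disjoint closures. Then, given $f\in L^2_s(\Omega)$, there exists a unique $\phi\in L^2_s(\Omega)$ such that $(-\Delta)^s_\omega\phi=f$. Moreover, for $f\in H^r_s(\Omega)$ with $r\ge0$ (resp. $f\in A_\rho(\Omega)$ with $\rho>1$) we have $\phi\in H^{r+2s}_s(\Omega)$ (resp. $\phi\in A_\nu(\Omega)$ for some $\nu>1$).
   Context: Let $\omega^s(x)=\sum_{i=1}^M(x-a_i)^s(b_i-x)^s\chi_{(a_i,b_i)}(x)$ and $L^2_s(\Omega)=\{\phi:\int_\Omega|\phi|^2\omega^s<\infty\}$. Spaces: on $(-1,1)$, with weight $(1-x^2)^s$, let $\tilde C_j^{(s+1/2)}$ be the $L^2_s(-1,1)$-normalized Gegenbauer polynomials of parameter $s+1/2$, $v_j=\int_{-1}^1v\,\tilde C_j^{(s+1/2)}(1-x^2)^s\,dx$, and $H^r_s(-1,1)=\{v\in L^2_s(-1,1):\sum_{j\ge0}(1+j^2)^r|v_j|^2<\infty\}$. For $\rho>1$, $A_\rho$ is the space of functions analytic on (a neighborhood of) the closed region $\mathcal{B}_\rho\subset\mathbb{C}$ bounded by the ellipse with foci $\pm1$ whose semiaxes add up to $\rho$. A function $v$ on $\Omega$ belongs to $H^r_s(\Omega)$ (resp. $A_\rho(\Omega)$) if for every $i$ the function $\xi\mapsto v\big(a_i+\frac{(b_i-a_i)(\xi+1)}2\big)$ belongs to $H^r_s(-1,1)$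 (resp. is the restriction of an element of $A_\rho$). Operator: $(-\Delta)^s_\omega\phi=(-\Delta)^s[\omega^s\phi]$ in $\Omega$, where $(-\Delta)^su(x)=C_1(s)\,\mathrm{P.V.}\int_{\mathbb{R}}\frac{u(x)-u(y)}{|x-y|^{1+2s}}\,dy$ and $C_1(s)=\frac{2^{2s}s\,\Gamma(s+1/2)}{\pi^{1/2}\Gamma(1-s)}$. It decomposes as $(-\Delta)^s_\omega=\mathcal{K}_s+\mathcal{R}_s$. Here $\mathcal{K}_s$ is block diagonal: on each $(a_i,b_i)$ it is the single-interval operator $$K_s(\phi)(x)=C_s\frac{d}{dx}\int_{a_i}^{b_i}|x-y|^{1-2s}\frac{d}{dy}(\omega^s\phi)(y)\,dy,\qquad C_s=-\Gamma(2s-1)\sin(\pi s)/\pi\quad(s\ne1/2)$$ (with $C_s|x-y|^{1-2s}$ replaced by $\frac1\pi\ln|x-y|$ if $s=1/2$), extended to the continuous bijection $H^{2s}_s(a_i,b_i)\to L^2_s(a_i,b_i)$ which is diagonal in the Gegenbauer basis with eigenvalues $\lambda_j^s=\Gamma(2s+j+1)/j!$. The off-diagonal remainder is $$\mathcal{R}_s\phi(x)=-C_1(s)\int_{\Omega\setminus(a_j,b_j)}|x-y|^{-1-2s}\omega^s(y)\phi(y)\,dy,\qquad x\in(a_j,b_j).$$ For $\phi\in L^2_s(\Omega)$ the equation $(-\Delta)^s_\omega\phi=f$ is understood as $\mathcal{K}_s\phi+\mathcal{R}_s\phi=f$, equivalently $(I+\mathcal{K}_s^{-1}\mathcal{R}_s)\phi=\mathcal{K}_s^{-1}f$.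 *)

theory Defs
  imports "HOL-Analysis.Analysis" "HOL-Computational_Algebra.Polynomial"
begin

section \<open>Domain, weight and weighted square-integrable functions\<close>

text \<open>
  Functions on a subset of the line are total functions of type \<open>real \<Rightarrow> real\<close>; no
  definition below looks at their values outside the relevant set. Elements of an
  \<open>L\<^sup>2\<close> space are represented by functions, and are compared with \<open>ae_eq_on\<close>.
\<close>

definition ivl_union :: "nat \<Rightarrow> (nat \<Rightarrow> real) \<Rightarrow> (nat \<Rightarrow> real) \<Rightarrow> real set" where
  "ivl_union M a b = (\<Union>i<M. {a i<..<b i})"

definition ivl_weight :: "real \<Rightarrow> real \<Rightarrow> real \<Rightarrow> real \<Rightarrow> real" where
  "ivl_weight s a b x = (x - a) powr s * (b - x) powr s * indicator {a<..<b} x"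

definition weight :: "real \<Rightarrow> nat \<Rightarrow> (nat \<Rightarrow> real) \<Rightarrow> (nat \<Rightarrow> real) \<Rightarrow> real \<Rightarrow> real" where
  "weight s M a b x = (\<Sum>i<M. ivl_weight s (a i) (b i) x)"

definition ae_eq_on :: "real set \<Rightarrow> (real \<Rightarrow> real) \<Rightarrow> (real \<Rightarrow> real) \<Rightarrow> bool" where
  "ae_eq_on S u v \<longleftrightarrow> (AE x in lebesgue. x \<in> S \<longrightarrow> u x = v x)"

definition weighted_L2 :: "real set \<Rightarrow> (real \<Rightarrow> real) \<Rightarrow> (real \<Rightarrow> real) set" where
  "weighted_L2 S w = {v. set_borel_measurable lebesgue S v \<and>
                         set_integrable lebesgue S (\<lambda>x. \<bar>v x\<bar>\<^sup>2 * w x)}"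

definition L2s :: "real \<Rightarrow> nat \<Rightarrow> (nat \<Rightarrow> real) \<Rightarrow> (nat \<Rightarrow> real) \<Rightarrow> (real \<Rightarrow> real) set" where
  "L2s s M a b = weighted_L2 (ivl_union M a b) (weight s M a b)"


section \<open>Gegenbauer expansions and the weighted Sobolev spaces\<close>

fun gegenbauer :: "real \<Rightarrow> nat \<Rightarrow> real poly" where
  "gegenbauer \<alpha> 0 = 1"
| "gegenbauer \<alpha> (Suc 0) = [:0, 2 * \<alpha>:]"
| "gegenbauer \<alpha> (Suc (Suc n)) =
     smult (1 / (real n + 2))
       ([:0, 2 * (real n + 1 + \<alpha>):] * gegenbauer \<alpha> (Suc n)
        - smult (real n + 2 * \<alpha>) (gegenbauer \<alpha> n))"

definition gegenbauer_norm :: "real \<Rightarrow> nat \<Rightarrow> real" where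
  "gegenbauer_norm s j =
     sqrt (LINT x:{-1<..<1}|lebesgue. (poly (gegenbauer (s + 1/2) j) x)\<^sup>2 * (1 - x\<^sup>2) powr s)"

definition normalized_gegenbauer :: "real \<Rightarrow> nat \<Rightarrow> real \<Rightarrow> real" where
  "normalized_gegenbauer s j x = poly (gegenbauer (s + 1/2) j) x / gegenbauer_norm s j"

definition gegenbauer_coeff :: "real \<Rightarrow> (real \<Rightarrow> real) \<Rightarrow> nat \<Rightarrow> real" where
  "gegenbauer_coeff s v j =
     (LINT x:{-1<..<1}|lebesgue. v x * normalized_gegenbauer s j x * (1 - x\<^sup>2) powr s)"

definition sobolev_term :: "real \<Rightarrow> real \<Rightarrow> (real \<Rightarrow> real) \<Rightarrow> nat \<Rightarrow> real" where
  "sobolev_term s r v j = (1 + (real j)\<^sup>2) powr r * \<bar>gegenbauer_coeff s v j\<bar>\<^sup>2"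

definition Hs_ref :: "real \<Rightarrow> real \<Rightarrow> (real \<Rightarrow> real) set" where
  "Hs_ref s r = {v \<in> weighted_L2 {-1<..<1} (\<lambda>x. (1 - x\<^sup>2) powr s). summable (sobolev_term s r v)}"

definition pullback :: "real \<Rightarrow> real \<Rightarrow> (real \<Rightarrow> real) \<Rightarrow> real \<Rightarrow> real" where
  "pullback a b v \<xi> = v (a + (b - a) * (\<xi> + 1) / 2)"

definition Hs :: "real \<Rightarrow> real \<Rightarrow> nat \<Rightarrow> (nat \<Rightarrow> real) \<Rightarrow> (nat \<Rightarrow> real) \<Rightarrow> (real \<Rightarrow> real) set" where
  "Hs s r M a b = {v. \<forall>i<M. pullback (a i) (b i) v \<in> Hs_ref s r}"


section \<open>Analytic functions\<close>

text \<open>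
  The ellipse with foci \<open>-1\<close>, \<open>1\<close> and semiaxes \<open>A > B\<close> has \<open>A\<^sup>2 - B\<^sup>2 = 1\<close>; so
  \<open>A + B = \<rho>\<close> means \<open>A - B = 1 / \<rho>\<close>, and the sum of the distances to the foci is
  \<open>2 * A = \<rho> + 1 / \<rho>\<close>.
\<close>

definition ellipse_region :: "real \<Rightarrow> complex set" where
  "ellipse_region \<rho> = {z. cmod (z - 1) + cmod (z + 1) \<le> \<rho> + 1 / \<rho>}"

definition A_space :: "real \<Rightarrow> nat \<Rightarrow> (nat \<Rightarrow> real) \<Rightarrow> (nat \<Rightarrow> real) \<Rightarrow> (real \<Rightarrow> real) set" where
  "A_space \<rho> M a b = {v. \<forall>i<M. \<exists>F. F analytic_on ellipse_region \<rho> \<and>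
     (\<forall>\<xi>\<in>{-1<..<1}. complex_of_real (pullback (a i) (b i) v \<xi>) = F (complex_of_real \<xi>))}"


section \<open>The weighted fractional Laplacian\<close>

definition C1 :: "real \<Rightarrow> real" where
  "C1 s = 2 powr (2 * s) * s * Gamma (s + 1/2) / (sqrt pi * Gamma (1 - s))"

definition Cs :: "real \<Rightarrow> real" where
  "Cs s = - Gamma (2 * s - 1) * sin (pi * s) / pi"

definition K_kernel :: "real \<Rightarrow> real \<Rightarrow> real" where
  "K_kernel s t = (if s = 1/2 then ln \<bar>t\<bar> / pi else Cs s * \<bar>t\<bar> powr (1 - 2 * s))"

text \<open>The integral operator on one interval; below it is only applied to polynomials.\<close>

definition K_integral :: "real \<Rightarrow> real \<Rightarrow> real \<Rightarrow> (real \<Rightarrow> real) \<Rightarrow> real \<Rightarrow> real" where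
  "K_integral s a b \<phi> =
     deriv (\<lambda>x. LINT y:{a<..<b}|lebesgue.
                  K_kernel s (x - y) * deriv (\<lambda>t. ivl_weight s a b t * \<phi> t) y)"

text \<open>
  \<open>K_ext s a b \<phi> g\<close>: \<open>\<phi>\<close> is in \<open>H\<^sup>2\<^sup>s\<close> and \<open>g\<close> represents its image under the extension
  by continuity of the integral operator, from the polynomials (a dense subspace, spanned
  by the Gegenbauer basis) to a map from \<open>H\<^sup>2\<^sup>s\<close> to \<open>L\<^sup>2\<close> on the interval. That this
  extension is well defined, bijective and diagonal in the Gegenbauer basis with eigenvalues
  \<open>Gamma (2 * s + j + 1) / fact j\<close> is a property of the integral operator and is not built
  into the definition.
\<close>

definition K_ext :: "real \<Rightarrow> real \<Rightarrow> real \<Rightarrow> (real \<Rightarrow> real) \<Rightarrow> (real \<Rightarrow> real) \<Rightarrow> bool" where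
  "K_ext s a b \<phi> g \<longleftrightarrow>
     pullback a b \<phi> \<in> Hs_ref s (2 * s) \<and>
     g \<in> weighted_L2 {a<..<b} (ivl_weight s a b) \<and>
     (\<exists>p :: nat \<Rightarrow> real poly.
        (\<lambda>n. \<Sum>j. sobolev_term s (2 * s) (pullback a b (\<lambda>x. poly (p n) x - \<phi> x)) j)
          \<longlonglongrightarrow> 0 \<and>
        (\<lambda>n. \<integral>\<^sup>+x\<in>{a<..<b}. ennreal (\<bar>K_integral s a b (poly (p n)) x - g x\<bar>\<^sup>2
                                     * ivl_weight s a b x) \<partial>lebesgue)
          \<longlonglongrightarrow> 0)"

text \<open>The off-diagonal remainder, evaluated at points of the \<open>j\<close>-th interval.\<close>

definition R_op :: "real \<Rightarrow> nat \<Rightarrow> (nat \<Rightarrow> real) \<Rightarrow> (nat \<Rightarrow> real) \<Rightarrow> nat \<Rightarrow> (real \<Rightarrow> real) \<Rightarrow> real \<Rightarrow> real" where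
  "R_op s M a b j \<phi> x =
     - C1 s * (LINT y:(ivl_union M a b - {a j<..<b j})|lebesgue.
                 \<bar>x - y\<bar> powr (- 1 - 2 * s) * weight s M a b y * \<phi> y)"

text \<open>The equation with right-hand side \<open>f\<close>: diagonal part plus remainder equals \<open>f\<close>.\<close>

definition frac_laplace_eq ::
  "real \<Rightarrow> nat \<Rightarrow> (nat \<Rightarrow> real) \<Rightarrow> (nat \<Rightarrow> real) \<Rightarrow> (real \<Rightarrow> real) \<Rightarrow> (real \<Rightarrow> real) \<Rightarrow> bool" where
  "frac_laplace_eq s M a b \<phi> f \<longleftrightarrow>
     (\<exists>g. \<forall>i<M. K_ext s (a i) (b i) \<phi> g \<and>
                ae_eq_on {a i<..<b i} (\<lambda>x. g x + R_op s M a b i \<phi> x) f)"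

end

theory Submission
 imports Defs "HOL-Complex_Analysis.Complex_Analysis" "HOL-Real_Asymp.Real_Asymp"
begin

text \<open>
 On the reference interval \<open>(-1, 1)\<close> of each component the equation reads \<open>K v\<^sub>i + (R v)\<^sub>i = f\<^sub>i\<close>. The
 proof rests on four facts.

 The operator \<open>K\<close> is diagonal in the Gegenbauer basis, with positive eigenvalues comparable to
 \<open>(1 + j\<^sup>2) powr s\<close> (\<open>K_ext_iff\<close>, \<open>K_eigenvalue_bounds\<close>). The reason is that the Riesz potential of
 \<open>(1 - y\<^sup>2) powr (s - 1)\<close> is constant on the interval; the potentials of the other monomials then
 follow by recursion and are polynomials of at most the same degree, so \<open>K\<close> preserves degrees, and being
 symmetric for the weight it has the orthogonal polynomials as eigenvectors.

 The quadratic form of \<open>K\<close> is an energy of \<open>u = (1 - x\<^sup>2) powr s * v\<close>, an integral of squared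
 increments of \<open>u\<close> against \<open>\<bar>x - y\<bar> powr (- 1 - 2 s)\<close>. The part where one of the points lies outside
 the interval gives the Hardy inequality: the form is at least \<open>C1 s\<close> times the integral of \<open>u\<^sup>2\<close>
 against the kernel mass of the whole complement of the interval (\<open>Hardy_inequality\<close>).

 The remainder couples different intervals through \<open>C1 s\<close> times the same kernel. By the arithmetic-geometric mean
 inequality \<open>\<langle>R v, v'\<rangle>\<close> is bounded by the integrals of \<open>u\<^sup>2\<close> and \<open>u'\<^sup>2\<close> against the kernel mass of the
 other intervals only, and since the closures are disjoint this mass is at most \<open>\<theta> < 1\<close> times
 that of the complement (\<open>potential_bound\<close>). Hence \<open>\<bar>\<langle>R v, v'\<rangle>\<bar> \<le> \<theta> / 2 (E v + E v')\<close> for the energy \<open>E\<close>, and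
 \<open>v \<mapsto> - K\<^sup>-\<^sup>1 R v\<close> contracts the energy by \<open>\<theta> / (2 - \<theta>)\<close> (\<open>energy_contraction\<close>). Uniqueness is immediate,
 and existence follows by iterating \<open>v \<mapsto> K\<^sup>-\<^sup>1 (f - R v)\<close>.

 The kernel of \<open>R\<close> is analytic, so the Gegenbauer coefficients of \<open>R v\<close> decay exponentially for
 every \<open>v\<close> in \<open>L\<^sup>2\<close> (\<open>remainder_coeff_decay\<close>). Dividing \<open>f\<^sub>j - (R v)\<^sub>j\<close> by the eigenvalue gains the
 exponent \<open>2 s\<close> on the Sobolev scale; and if \<open>f\<close> is analytic its coefficients decay exponentially too
 (\<open>analytic_coeff_decay\<close>), so those of the solution do, and such a series converges in an ellipse
 (\<open>gegenbauer_series_analytic\<close>).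
\<close>

section \<open>Square-integrable functions and orthonormal bases\<close>

definition L2 :: "'a measure => ('a => real) set" where
 "L2 M = {v. v \<in> borel_measurable M \<and> integrable M (%x. (v x)\<^sup>2)}"

definition L2_inner :: "'a measure => ('a => real) => ('a => real) => real" where
 "L2_inner M u v = (LINT x|M. u x * v x)"

definition L2_norm :: "'a measure => ('a => real) => real" where
 "L2_norm M v = sqrt (LINT x|M. (v x)\<^sup>2)"

lemma L2_measurable [measurable_dest, dest]: "v \<in> L2 M ==> v \<in> borel_measurable M"
 by (simp add: L2_def)

lemma L2_mult:
 assumes "u \<in> L2 M" "v \<in> L2 M"
 shows "integrable M (%x. u x * v x)"
proof (rule Bochner_Integration.integrable_bound[where f="%x. (u x)\<^sup>2 + (v x)\<^sup>2"])
 show "integrable M (%x. (u x)\<^sup>2 + (v x)\<^sup>2)"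
  using assms by (auto simp: L2_def)
 show "(%x. u x * v x) \<in> borel_measurable M"
  using assms by (auto simp: L2_def)
 have "norm (x*y) <= norm (x\<^sup>2 + y\<^sup>2)" for x y :: real
 proof -
  have "2*(\<bar>x\<bar>*\<bar>y\<bar>) <= x\<^sup>2 + y\<^sup>2"
   using sum_squares_bound[of "\<bar>x\<bar>" "\<bar>y\<bar>"] by simp
  moreover have "0 <= \<bar>x\<bar>*\<bar>y\<bar>"
   by simp
  ultimately have "\<bar>x\<bar>*\<bar>y\<bar> <= x\<^sup>2 + y\<^sup>2"
   by linarith
  then show ?thesis
   by (simp add: abs_mult)
 qed
 then show "AE x in M. norm (u x * v x) <= norm ((u x)\<^sup>2 + (v x)\<^sup>2)"
  by blast
qed

lemma L2_add:
 assumes "u \<in> L2 M" "v \<in> L2 M"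
 shows "(%x. u x + v x) \<in> L2 M"
 using assms L2_mult[OF assms]
 by (auto simp: L2_def power2_sum mult.assoc)

lemma L2_scale:
 "u \<in> L2 M ==> (%x. c*u x) \<in> L2 M"
 by (auto simp: L2_def power_mult_distrib)

lemma L2_diff:
 assumes "u \<in> L2 M" "v \<in> L2 M"
 shows "(%x. u x - v x) \<in> L2 M"
 using L2_add[OF assms(1) L2_scale[OF assms(2), of "-1"]] by simp

lemma L2_zero: "(%x. 0) \<in> L2 M"
 by (simp add: L2_def)

lemma L2_sum:
 "(!!i. i \<in> I ==> u i \<in> L2 M) ==> (%x. \<Sum>i\<in>I. u i x) \<in> L2 M"
 by (induction I rule: infinite_finite_induct) (auto intro: L2_zero L2_add)

lemma L2_bounded:
 assumes "finite_measure M" "v \<in> borel_measurable M" "AE x in M. \<bar>v x\<bar> <= B"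
 shows "v \<in> L2 M"
proof -
 interpret finite_measure M by fact
 have "AE x in M. (v x)\<^sup>2 <= B\<^sup>2"
  using assms(3) by eventually_elim (metis abs_ge_zero power2_abs power_mono)
 then have "integrable M (%x. (v x)\<^sup>2)"
  using assms(2) by (intro integrable_const_bound[where B="B\<^sup>2"]) auto
 then show ?thesis
  using assms by (simp add: L2_def)
qed

lemma L2_inner_commute: "L2_inner M u v = L2_inner M v u"
 by (simp add: L2_inner_def mult.commute)

lemma L2_inner_diff_left:
 assumes "u \<in> L2 M" "v \<in> L2 M" "w \<in> L2 M"
 shows "L2_inner M (%x. u x - v x) w = L2_inner M u w - L2_inner M v w"
 unfolding L2_inner_def left_diff_distrib
 by (rule Bochner_Integration.integral_diff) (use assms L2_mult in auto)

lemma L2_inner_scale_left: "L2_inner M (%x. c*u x) w = c*L2_inner M u w"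
 by (simp add: L2_inner_def mult.assoc)

lemma L2_inner_sum_left:
 assumes "!!i. i \<in> I ==> u i \<in> L2 M" "w \<in> L2 M"
 shows "L2_inner M (%x. \<Sum>i\<in>I. u i x) w = (\<Sum>i\<in>I. L2_inner M (u i) w)"
 unfolding L2_inner_def sum_distrib_right
 by (rule Bochner_Integration.integral_sum) (use assms L2_mult in auto)

lemma L2_norm_nonneg [simp]: "0 <= L2_norm M v"
 by (simp add: L2_norm_def)

lemma L2_norm_sq: "(L2_norm M v)\<^sup>2 = (LINT x|M. (v x)\<^sup>2)"
 by (simp add: L2_norm_def)

lemma L2_norm_sq_inner: "(L2_norm M v)\<^sup>2 = L2_inner M v v"
 by (simp add: L2_norm_def L2_inner_def power2_eq_square)

lemma L2_norm_scale: "L2_norm M (%x. c * v x) = \<bar>c\<bar>*L2_norm M v"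
 by (simp add: L2_norm_def power_mult_distrib real_sqrt_mult)

lemma L2_norm_minus_commute: "L2_norm M (%x. u x - v x) = L2_norm M (%x. v x - u x)"
 by (simp add: L2_norm_def power2_commute)

lemma L2_norm_eq_0:
 assumes "v \<in> L2 M" "L2_norm M v = 0"
 shows "AE x in M. v x = 0"
proof -
 have "(LINT x|M. (v x)\<^sup>2) = 0"
  using assms(2) L2_norm_sq[of M v] by simp
 then have "AE x in M. (v x)\<^sup>2 = 0"
  using integral_nonneg_eq_0_iff_AE[of M "%x. (v x)\<^sup>2"] assms(1) by (simp add: L2_def)
 then show ?thesis by simp
qed

lemma L2_norm_add_sq:
 assumes "u \<in> L2 M" "v \<in> L2 M"
 shows "(L2_norm M (%x. u x + v x))\<^sup>2 = (L2_norm M u)\<^sup>2 + 2*L2_inner M u v + (L2_norm M v)\<^sup>2"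
proof -
 have "(LINT x|M. (u x + v x)\<^sup>2) = (LINT x|M. (u x)\<^sup>2 + 2*(u x * v x) + (v x)\<^sup>2)"
  by (rule Bochner_Integration.integral_cong) (auto simp: power2_sum)
 also have "... = (LINT x|M. (u x)\<^sup>2) + 2*(LINT x|M. u x * v x) + (LINT x|M. (v x)\<^sup>2)"
  using assms L2_mult[OF assms] by (auto simp: L2_def)
 finally show ?thesis by (simp add: L2_norm_sq L2_inner_def)
qed

lemma L2_Cauchy_Schwarz:
 assumes "u \<in> L2 M" "v \<in> L2 M"
 shows "\<bar>L2_inner M u v\<bar> <= L2_norm M u*L2_norm M v"
proof -
 define A where "A = (L2_norm M u)\<^sup>2"
 define B where "B = L2_inner M u v"
 define C where "C = (L2_norm M v)\<^sup>2"
 have q: "0 <= A + 2*(t*B) + t\<^sup>2*C" for t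
 proof -
  have "0 <= (L2_norm M (%x. u x + t * v x))\<^sup>2" by simp
  also have "... = A + 2*(t*B) + t\<^sup>2*C"
   using L2_norm_add_sq[OF assms(1) L2_scale[OF assms(2), of t]]
   by (simp add: A_def B_def C_def L2_norm_scale power_mult_distrib L2_inner_commute[of M u]
     L2_inner_scale_left)
  finally show ?thesis .
 qed
 have "B\<^sup>2 <= A*C"
 proof (cases "C = 0")
  case True
  have "B = 0"
  proof (rule ccontr)
   assume "B ~= 0"
   then show False
    using q[of "- (A + 1)/(2*B)"] True by (simp add: field_simps)
  qed
  then show ?thesis using True by simp
 next
  case False
  then have "C > 0" by (simp add: C_def)
  then show ?thesis
   using q[of "- B/C"] by (simp add: field_simps power2_eq_square)
 qed
 then have "\<bar>B\<bar> <= sqrt (A*C)"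
  by (metis real_sqrt_abs real_sqrt_le_mono)
 then show ?thesis
  by (simp add: A_def B_def C_def real_sqrt_mult)
qed

lemma L2_norm_triangle:
 assumes "u \<in> L2 M" "v \<in> L2 M"
 shows "L2_norm M (%x. u x + v x) <= L2_norm M u + L2_norm M v"
proof (rule power2_le_imp_le)
 show "(L2_norm M (%x. u x + v x))\<^sup>2 <= (L2_norm M u + L2_norm M v)\<^sup>2"
  using L2_norm_add_sq[OF assms] L2_Cauchy_Schwarz[OF assms] by (simp add: power2_sum)
qed simp

lemma L2_norm_triangle_diff:
 assumes "u \<in> L2 M" "v \<in> L2 M" "w \<in> L2 M"
 shows "L2_norm M (%x. u x - w x) <= L2_norm M (%x. u x - v x) + L2_norm M (%x. v x - w x)"
 using L2_norm_triangle[OF L2_diff[OF assms(1,2)] L2_diff[OF assms(2,3)]]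
 by simp

lemma L1_le_L2:
 assumes "finite_measure M" "v \<in> L2 M"
 shows "integrable M v" "(LINT x|M. \<bar>v x\<bar>) <= sqrt (measure M (space M))*L2_norm M v"
proof -
 interpret finite_measure M by fact
 have one: "(%x. 1) \<in> L2 M"
  by (simp add: L2_def)
 from L2_mult[OF one assms(2)] show "integrable M v" by simp
 have av: "(%x. \<bar>v x\<bar>) \<in> L2 M"
  using assms(2) by (auto simp: L2_def)
 from L2_Cauchy_Schwarz[OF one av]
 show "(LINT x|M. \<bar>v x\<bar>) <= sqrt (measure M (space M))*L2_norm M v"
  by (simp add: L2_inner_def L2_norm_def)
qed

text \<open>A rapidly convergent subsequence converges absolutely in \<open>L\<^sup>1\<close>, hence pointwise almost
 everywhere, and Fatou's lemma turns the pointwise limit into an \<open>L\<^sup>2\<close> limit.\<close>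

theorem L2_complete:
 assumes "finite_measure M"
  and S: "!!n. S n \<in> L2 M"
  and B: "!!m n. n <= m ==> L2_norm M (%x. S m x - S n x) <= B n" and lim: "B \<longlonglongrightarrow> 0"
 obtains v where "v \<in> L2 M" "(%n. L2_norm M (%x. S n x - v x)) \<longlonglongrightarrow> 0"
proof -
 interpret finite_measure M by fact
 have Sm [measurable]: "S n \<in> borel_measurable M" for n
  using S by auto
 have "\<exists>N. \<forall>n\<ge>N. B n < (1/2)^k" for k
  using order_tendstoD(2)[OF lim, of "(1/2)^k"] by (simp add: eventually_sequentially)
 then obtain N0 where N0: "!!k n. N0 k <= n ==> B n < (1/2)^k" by metis
 (* The sum dominates every earlier threshold and makes r monotone. *)
 define r where "r k = (\<Sum>i\<le>k. N0 i) + k" for k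
 have r: "r k >= N0 k" "r (Suc k) >= r k" "r k >= k" for k
 proof -
  have "N0 k <= (\<Sum>i\<le>k. N0 i)" by (rule member_le_sum) auto
  then show "r k >= N0 k" "r (Suc k) >= r k" "r k >= k" by (auto simp: r_def)
 qed
 define d where "d k x = S (r (Suc k)) x - S (r k) x" for k x
 have d: "d k \<in> L2 M" for k
  unfolding d_def by (intro L2_diff S)
 have [measurable]: "d k \<in> borel_measurable M" for k
  using d by auto
 define c where "c = sqrt (measure M (space M))"
 have d1: "(LINT x|M. \<bar>d k x\<bar>) <= c*(1/2)^k" for k
 proof -
  have "L2_norm M (d k) <= (1/2)^k"
   unfolding d_def using N0[of k "r k"] B[of "r k" "r (Suc k)"] r[of k] by simp
  then show ?thesis
   using L1_le_L2(2)[OF \<open>finite_measure M\<close> d, of k] mult_left_mono[of "L2_norm M (d k)" "(1/2)^k" c]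
   by (force simp: c_def)
 qed
 have sm: "summable (%k. (LINT x|M. \<bar>d k x\<bar>))"
  by (rule summable_comparison_test'[of "%k. c*(1/2)^k" 0])
    (use d1 in \<open>auto intro!: summable_mult summable_geometric\<close>)
 have "(\<integral>\<^sup>+x. (\<Sum>k. ennreal \<bar>d k x\<bar>) \<partial>M) = (\<Sum>k. \<integral>\<^sup>+x. ennreal \<bar>d k x\<bar> \<partial>M)"
  by (rule nn_integral_suminf) auto
 also have "... = (\<Sum>k. ennreal (LINT x|M. \<bar>d k x\<bar>))"
  using L1_le_L2(1)[OF \<open>finite_measure M\<close> d] by (subst nn_integral_eq_integral) auto
 also have "... < \<infinity>"
  using sm by (subst suminf_ennreal2) auto
 finally have "AE x in M. (\<Sum>k. ennreal \<bar>d k x\<bar>) ~= \<infinity>"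
  by (intro nn_integral_PInf_AE) auto
 then have AEs: "AE x in M. summable (%k. d k x)"
 proof eventually_elim
  case (elim x)
  have "summable (%k. \<bar>d k x\<bar>)"
   by (rule summable_suminf_not_top) (use elim in auto)
  then show ?case by (rule summable_rabs_cancel)
 qed
 define v where "v x = lim (%k. S (r k) x)" for x
 have [measurable]: "v \<in> borel_measurable M"
  unfolding v_def by measurable
 have AEl: "AE x in M. (%k. S (r k) x) \<longlonglongrightarrow> v x"
  using AEs
 proof eventually_elim
  case (elim x)
  then have "convergent (%n. \<Sum>k<n. d k x)"
   by (simp add: summable_iff_convergent)
  moreover have "(\<Sum>k<n. d k x) = S (r n) x - S (r 0) x" for n
   unfolding d_def by (rule sum_lessThan_telescope)
  ultimately have "convergent (%n. S (r n) x - S (r 0) x)" by simp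
  then have "convergent (%n. (S (r n) x - S (r 0) x) + S (r 0) x)"
   by (intro convergent_add convergent_const)
  then show ?case by (simp add: v_def convergent_LIMSEQ_iff)
 qed
 have fatou: "(\<integral>\<^sup>+x. ennreal ((S n x - v x)\<^sup>2) \<partial>M) <= ennreal ((B n)\<^sup>2)" for n
 proof -
  have "(\<integral>\<^sup>+x. ennreal ((S n x - v x)\<^sup>2) \<partial>M) = (\<integral>\<^sup>+x. liminf (%k. ennreal ((S n x - S (r k) x)\<^sup>2)) \<partial>M)"
   using AEl
  proof (intro nn_integral_cong_AE, eventually_elim)
   case (elim x)
   have "(%k. ennreal ((S n x - S (r k) x)\<^sup>2)) \<longlonglongrightarrow> ennreal ((S n x - v x)\<^sup>2)"
    by (intro tendsto_intros elim)
   then show ?case by (intro lim_imp_Liminf[symmetric]) simp_all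
  qed
  also have "... <= liminf (%k. \<integral>\<^sup>+x. ennreal ((S n x - S (r k) x)\<^sup>2) \<partial>M)"
   by (rule nn_integral_liminf) auto
  also have "... <= limsup (%k. \<integral>\<^sup>+x. ennreal ((S n x - S (r k) x)\<^sup>2) \<partial>M)"
   by (rule Liminf_le_Limsup) simp
  also have "... <= ennreal ((B n)\<^sup>2)"
  proof (rule Limsup_bounded)
   show "\<forall>\<^sub>F k in sequentially. (\<integral>\<^sup>+x. ennreal ((S n x - S (r k) x)\<^sup>2) \<partial>M) <= ennreal ((B n)\<^sup>2)"
    using eventually_ge_at_top[of n]
   proof eventually_elim
    case (elim k)
    have "integrable M (%x. (S n x - S (r k) x)\<^sup>2)"
     using L2_diff[OF S S] by (auto simp: L2_def)
    then have "(\<integral>\<^sup>+x. ennreal ((S n x - S (r k) x)\<^sup>2) \<partial>M) = ennreal ((L2_norm M (%x. S n x - S (r k) x))\<^sup>2)"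
     by (subst nn_integral_eq_integral) (auto simp: L2_norm_sq)
    also have "... <= ennreal ((B n)\<^sup>2)"
     using B[of n "r k"] elim r(3)[of k] L2_norm_minus_commute[of M "S n" "S (r k)"] by (intro ennreal_leI power_mono) auto
    finally show ?case .
   qed
  qed
  finally show ?thesis .
 qed
 have diff: "(%x. S n x - v x) \<in> L2 M" "L2_norm M (%x. S n x - v x) <= B n" for n
 proof -
  have i: "integrable M (%x. (S n x - v x)\<^sup>2)"
   by (rule integrableI_bounded) (use fatou[of n] in \<open>auto intro: le_less_trans\<close>)
  then show "(%x. S n x - v x) \<in> L2 M" by (simp add: L2_def)
  have "ennreal (LINT x|M. (S n x - v x)\<^sup>2) <= ennreal ((B n)\<^sup>2)"
   using fatou[of n] nn_integral_eq_integral[OF i] by simp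
  then have "(L2_norm M (%x. S n x - v x))\<^sup>2 <= (B n)\<^sup>2"
   by (subst (asm) ennreal_le_iff) (auto simp: L2_norm_sq)
  then show "L2_norm M (%x. S n x - v x) <= B n"
   by (rule power2_le_imp_le) (use B[of n n] L2_norm_nonneg order_trans in blast)
 qed
 have "(%x. S 0 x - (S 0 x - v x)) \<in> L2 M" by (rule L2_diff[OF S diff(1)])
 then have "v \<in> L2 M" by simp
 moreover have "(%n. L2_norm M (%x. S n x - v x)) \<longlonglongrightarrow> 0"
  by (rule Lim_null_comparison[OF always_eventually lim]) (use diff(2) in simp)
 ultimately show ?thesis by (rule that)
qed

lemma L2_inner_tendsto:
 assumes "!!n. S n \<in> L2 M" "v \<in> L2 M" "w \<in> L2 M"
  and "(%n. L2_norm M (%x. S n x - v x)) \<longlonglongrightarrow> 0"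
 shows "(%n. L2_inner M (S n) w) \<longlonglongrightarrow> L2_inner M v w"
proof -
 have "(%n. L2_inner M (S n) w - L2_inner M v w) \<longlonglongrightarrow> 0"
 proof (rule Lim_null_comparison)
  show "\<forall>\<^sub>F n in sequentially. norm (L2_inner M (S n) w - L2_inner M v w)
    <= L2_norm M (%x. S n x - v x)*L2_norm M w"
   using L2_Cauchy_Schwarz[OF L2_diff[OF assms(1,2)] assms(3)]
   by (auto simp: L2_inner_diff_left assms)
  show "(%n. L2_norm M (%x. S n x - v x)*L2_norm M w) \<longlonglongrightarrow> 0"
   using tendsto_mult_left_zero[OF assms(4)] .
 qed
 then show ?thesis by (simp add: LIM_zero_iff)
qed

locale L2_basis = finite_measure M for M :: "'a measure" +
 fixes e :: "nat => 'a => real"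
 assumes e_sq: "!!n. e n \<in> L2 M"
  and e_on: "!!m n. L2_inner M (e m) (e n) = (if m = n then 1 else 0)"
  and e_total: "!!v. v \<in> L2 M ==> (!!n. L2_inner M v (e n) = 0) ==> AE x in M. v x = 0"
begin

lemma partial_sq: "(%x. \<Sum>j\<in>J. c j*e j x) \<in> L2 M"
 by (intro L2_sum L2_scale e_sq)

lemma inner_partial:
 "finite J ==> L2_inner M (%x. \<Sum>j\<in>J. c j*e j x) (e n) = (if n \<in> J then c n else 0)"
 using L2_inner_sum_left[of J "%j x. c j*e j x" M "e n"] L2_scale[OF e_sq]
 by (simp add: L2_inner_scale_left e_on e_sq if_distrib cong: if_cong)

lemma inner_partial2:
 assumes "finite J" "v \<in> L2 M"
 shows "L2_inner M (%x. \<Sum>j\<in>J. c j*e j x) v = (\<Sum>j\<in>J. c j*L2_inner M v (e j))"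
 using L2_inner_sum_left[of J "%j x. c j*e j x" M v] L2_scale[OF e_sq] assms(2)
 by (simp add: L2_inner_scale_left L2_inner_commute[of M v])

lemma norm_partial: "finite J ==> (L2_norm M (%x. \<Sum>j\<in>J. c j*e j x))\<^sup>2 = (\<Sum>j\<in>J. (c j)\<^sup>2)"
 by (subst L2_norm_sq_inner, subst inner_partial2)
   (auto simp: partial_sq inner_partial power2_eq_square)

lemma norm_residual:
 assumes "finite J" "v \<in> L2 M"
 shows "(L2_norm M (%x. v x - (\<Sum>j\<in>J. L2_inner M v (e j)*e j x)))\<^sup>2
  = (L2_norm M v)\<^sup>2 - (\<Sum>j\<in>J. (L2_inner M v (e j))\<^sup>2)"
proof -
 let ?p = "%x. \<Sum>j\<in>J. (- L2_inner M v (e j))*e j x"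
 have "(L2_norm M (%x. v x + ?p x))\<^sup>2 = (L2_norm M v)\<^sup>2 + 2*L2_inner M v ?p + (L2_norm M ?p)\<^sup>2"
  by (rule L2_norm_add_sq[OF assms(2) partial_sq])
 also have "L2_inner M v ?p = - (\<Sum>j\<in>J. (L2_inner M v (e j))\<^sup>2)"
  unfolding L2_inner_commute[of M v] inner_partial2[OF assms]
  by (simp add: power2_eq_square sum_negf)
 also have "(L2_norm M ?p)\<^sup>2 = (\<Sum>j\<in>J. (L2_inner M v (e j))\<^sup>2)"
  by (subst norm_partial[OF assms(1)]) simp
 finally show ?thesis by (simp add: sum_negf)
qed

lemma Bessel:
 assumes "v \<in> L2 M"
 shows "summable (%j. (L2_inner M v (e j))\<^sup>2)"
proof (rule summableI_nonneg_bounded)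
 show "(\<Sum>j<n. (L2_inner M v (e j))\<^sup>2) <= (L2_norm M v)\<^sup>2" for n
  using norm_residual[OF _ assms, of "{..<n}"] zero_le_power2[of "L2_norm M (%x. v x - (\<Sum>j<n. L2_inner M v (e j)*e j x))"]
  by simp
qed auto

text \<open>The squared norm of a difference of partial sums is a block of the convergent series, so the tails of that
 series control the partial sums.\<close>

theorem Riesz_Fischer:
 assumes c: "summable (%j. (c j)\<^sup>2)"
 obtains v where "v \<in> L2 M" "!!j. L2_inner M v (e j) = c j"
  "(%n. L2_norm M (%x. (\<Sum>j<n. c j*e j x) - v x)) \<longlonglongrightarrow> 0"
proof -
 let ?S = "%n x. \<Sum>j<n. c j*e j x"
 let ?B = "%n. sqrt ((\<Sum>j. (c j)\<^sup>2) - (\<Sum>j<n. (c j)\<^sup>2))"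
 have B: "L2_norm M (%x. ?S m x - ?S n x) <= ?B n" if mn: "n <= m" for m n
 proof -
  have split: "sum f {..<m} - sum f {..<n} = sum f {n..<m}" for f :: "nat => real"
   using sum_diff_nat_ivl[of 0 n m f] mn by (simp add: atLeast0LessThan)
  have "(L2_norm M (%x. ?S m x - ?S n x))\<^sup>2 = (\<Sum>j<m. (c j)\<^sup>2) - (\<Sum>j<n. (c j)\<^sup>2)"
   unfolding split by (rule norm_partial) simp
  also have "... <= (\<Sum>j. (c j)\<^sup>2) - (\<Sum>j<n. (c j)\<^sup>2)"
   using sum_le_suminf[OF c, of "{..<m}"] by simp
  finally show ?thesis by (rule real_le_rsqrt)
 qed
 have "?B \<longlonglongrightarrow> sqrt ((\<Sum>j. (c j)\<^sup>2) - (\<Sum>j. (c j)\<^sup>2))"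
  by (intro tendsto_intros summable_LIMSEQ c)
 then obtain v where v: "v \<in> L2 M" "(%n. L2_norm M (%x. ?S n x - v x)) \<longlonglongrightarrow> 0"
  using L2_complete[OF finite_measure_axioms, of ?S ?B] partial_sq B by auto
 have "L2_inner M v (e j) = c j" for j
 proof (rule LIMSEQ_unique)
  show "(%n. L2_inner M (?S n) (e j)) \<longlonglongrightarrow> L2_inner M v (e j)"
   by (rule L2_inner_tendsto[OF partial_sq v(1) e_sq v(2)])
  have "\<forall>\<^sub>F n in sequentially. L2_inner M (?S n) (e j) = c j"
   using eventually_gt_at_top[of j] by eventually_elim (simp add: inner_partial)
  then show "(%n. L2_inner M (?S n) (e j)) \<longlonglongrightarrow> c j"
   by (rule tendsto_eventually)
 qed
 with v that show ?thesis by blast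
qed

lemma coeff_unique:
 assumes "u \<in> L2 M" "v \<in> L2 M"
  and "!!j. L2_inner M u (e j) = L2_inner M v (e j)"
 shows "AE x in M. u x = v x"
proof -
 have "AE x in M. u x - v x = 0"
  by (rule e_total) (use assms in \<open>auto intro: L2_diff simp: L2_inner_diff_left e_sq\<close>)
 then show ?thesis by simp
qed

theorem expansion_tendsto:
 assumes v: "v \<in> L2 M"
 shows "(%n. L2_norm M (%x. (\<Sum>j<n. L2_inner M v (e j)*e j x) - v x)) \<longlonglongrightarrow> 0"
proof -
 obtain w where w: "w \<in> L2 M" "!!j. L2_inner M w (e j) = L2_inner M v (e j)"
  "(%n. L2_norm M (%x. (\<Sum>j<n. L2_inner M v (e j)*e j x) - w x)) \<longlonglongrightarrow> 0"
  using Riesz_Fischer[OF Bessel[OF v]] by blast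
 have "AE x in M. w x = v x"
  by (rule coeff_unique) (use w v in auto)
 then have "L2_norm M (%x. (\<Sum>j<n. L2_inner M v (e j)*e j x) - w x)
   = L2_norm M (%x. (\<Sum>j<n. L2_inner M v (e j)*e j x) - v x)" for n
  unfolding L2_norm_def using w v partial_sq e_sq
  by (intro arg_cong[where f=sqrt] integral_cong_AE)
    (auto intro!: borel_measurable_power borel_measurable_diff simp: L2_measurable)
 with w(3) show ?thesis by simp
qed

theorem Parseval:
 assumes "v \<in> L2 M"
 shows "(%j. (L2_inner M v (e j))\<^sup>2) sums (L2_norm M v)\<^sup>2"
proof -
 have "(%n. (L2_norm M (%x. (\<Sum>j<n. L2_inner M v (e j)*e j x) - v x))\<^sup>2) \<longlonglongrightarrow> 0"
  using tendsto_power[OF expansion_tendsto[OF assms], of 2] by simp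
 then have "(%n. (L2_norm M v)\<^sup>2 - (\<Sum>j<n. (L2_inner M v (e j))\<^sup>2)) \<longlonglongrightarrow> 0"
  by (simp add: L2_norm_minus_commute[of M _ v] norm_residual assms)
 then have "(%n. (L2_norm M v)\<^sup>2 - ((L2_norm M v)\<^sup>2 - (\<Sum>j<n. (L2_inner M v (e j))\<^sup>2))) \<longlonglongrightarrow> (L2_norm M v)\<^sup>2 - 0"
  by (intro tendsto_intros)
 then show ?thesis by (simp add: sums_def)
qed

end

section \<open>The weighted interval and the completeness of polynomials\<close>

definition jacobi :: "real => real => real" where
 "jacobi c x = indicator {-1<..<1} x*(1 - x\<^sup>2) powr c"

definition jacobi_measure :: "real => real measure" where
 "jacobi_measure s = density lebesgue (%x. ennreal (jacobi s x))"

lemma one_minus_sq_pos: "x \<in> {-1<..<1} ==> 0 < 1 - x\<^sup>2" for x :: real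
proof -
 assume "x \<in> {-1<..<1}"
 then have "0 < (1 - x)*(1 + x)" by (intro mult_pos_pos) auto
 then show ?thesis by (simp add: algebra_simps power2_eq_square)
qed

lemma jacobi_nonneg [simp]: "0 <= jacobi c x"
 by (simp add: jacobi_def)

lemma jacobi_pos: "x \<in> {-1<..<1} ==> 0 < jacobi c x"
 using one_minus_sq_pos[of x] by (simp add: jacobi_def)

lemma jacobi_outside: "x \<notin> {-1<..<1} ==> jacobi c x = 0"
 by (simp add: jacobi_def)

lemma jacobi_borel [measurable]: "jacobi c \<in> borel_measurable borel"
 unfolding jacobi_def by measurable

lemma lebesgue_measurableI: "f \<in> borel_measurable borel ==> f \<in> borel_measurable lebesgue"
 by (simp add: measurable_completion)

lemma jacobi_lebesgue [measurable]: "jacobi c \<in> borel_measurable lebesgue"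
 by (intro lebesgue_measurableI jacobi_borel)

text \<open>At each end point only one of the two factors of \<open>1 - x\<^sup>2\<close> is small, which separates
 the two end point singularities of a negative exponent.\<close>

lemma jacobi_bound:
 assumes "c > -1" shows "jacobi c x <= indicator {-1<..<1} x*(1 + (1 - x) powr c + (1 + x) powr c)"
proof (cases "x \<in> {-1<..<1}")
 case True
 have f: "1 - x\<^sup>2 = (1 - x)*(1 + x)"
  by (simp add: algebra_simps power2_eq_square)
 have main: ?thesis if "(1 - x\<^sup>2) powr c <= max 1 (max ((1 - x) powr c) ((1 + x) powr c))"
 proof -
  have "(1 - x\<^sup>2) powr c <= 1 + (1 - x) powr c + (1 + x) powr c"
   using that powr_ge_zero[of "1 - x" c] powr_ge_zero[of "1 + x" c] by linarith
  then show ?thesis using True by (simp add: jacobi_def)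
 qed
 show ?thesis
 proof (cases "c >= 0")
  case c: True
  have "(1 - x\<^sup>2) powr c <= 1 powr c"
   using True c one_minus_sq_pos[OF True] by (intro powr_mono2) auto
  then show ?thesis by (intro main) simp
 next
  case c: False
  consider "x >= 0" | "x <= 0" by linarith
  then show ?thesis
  proof cases
   case 1
   have "1*(1 - x) <= (1 + x)*(1 - x)"
    using True 1 by (intro mult_right_mono) auto
   then have "(1 - x) <= 1 - x\<^sup>2"
    by (simp add: f mult.commute)
   then have "(1 - x\<^sup>2) powr c <= (1 - x) powr c"
    using c True by (intro powr_mono2') auto
   then show ?thesis by (intro main) linarith
  next
   case 2
   have "1*(1 + x) <= (1 - x)*(1 + x)"
    using True 2 by (intro mult_right_mono) auto
   then have "(1 + x) <= 1 - x\<^sup>2"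
    by (simp add: f)
   then have "(1 - x\<^sup>2) powr c <= (1 + x) powr c"
    using c True by (intro powr_mono2') auto
   then show ?thesis by (intro main) linarith
  qed
 qed
qed (simp add: jacobi_def)

lemma integrable_jacobi:
 assumes "c > -1" shows "integrable lebesgue (jacobi c)"
proof -
 have "(%x::real. x powr c) absolutely_integrable_on {0..2}"
  using assms by (intro nonnegative_absolutely_integrable_1 integrable_on_powr_from_0) auto
 then have i0: "integrable lebesgue (%x::real. indicator {0..2} x*x powr c)"
  by (simp add: set_integrable_def)
 have i1: "integrable lebesgue (%x. indicator {0..2} (1 + 1*x)*(1 + 1*x :: real) powr c)"
  by (rule lebesgue_integrable_real_affine[OF i0]) simp
 have i2: "integrable lebesgue (%x. indicator {0..2} (1 + (-1)*x)*(1 + (-1)*x :: real) powr c)"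
  by (rule lebesgue_integrable_real_affine[OF i0]) simp
 have i3: "integrable lebesgue (indicator {-1..1::real} :: real => real)"
  by (subst integrable_indicator_iff) (auto simp: emeasure_lborel_Icc)
 show ?thesis
 proof (rule Bochner_Integration.integrable_bound)
  show "integrable lebesgue (%x. indicator {-1..1::real} x +
    (indicator {0..2} (1 + (-1)*x)*(1 + (-1)*x :: real) powr c +
    indicator {0..2} (1 + 1*x)*(1 + 1*x :: real) powr c))"
   by (intro Bochner_Integration.integrable_add i1 i2 i3)
  show "AE x in lebesgue. norm (jacobi c x) <= norm (indicator {-1..1::real} x +
    (indicator {0..2} (1 + (-1)*x)*(1 + (-1)*x :: real) powr c +
    indicator {0..2} (1 + 1*x)*(1 + 1*x :: real) powr c))"
  proof (rule AE_I2)
   fix x :: real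
   show "norm (jacobi c x) <= norm (indicator {-1..1::real} x +
    (indicator {0..2} (1 + (-1)*x)*(1 + (-1)*x :: real) powr c +
    indicator {0..2} (1 + 1*x)*(1 + 1*x :: real) powr c))"
    using jacobi_bound[OF assms, of x]
    by (cases "x \<in> {-1<..<1}") (simp_all add: jacobi_outside)
  qed
 qed (rule jacobi_lebesgue)
qed

lemma jacobi_mult_measurable:
 assumes "continuous_on {-1..1} h"
 shows "(%x. jacobi c x*h x) \<in> borel_measurable borel"
proof -
 have "(%x. indicator {-1<..<1} x *\<^sub>R h x) \<in> borel_measurable borel"
  by (rule borel_measurable_continuous_on_indicator)
    (auto intro: continuous_on_subset[OF assms])
 then have "(%x. jacobi c x*(indicator {-1<..<1} x *\<^sub>R h x)) \<in> borel_measurable borel"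
  by measurable
 also have "(%x. jacobi c x*(indicator {-1<..<1} x *\<^sub>R h x)) = (%x. jacobi c x*h x)"
  by (auto simp: fun_eq_iff jacobi_def indicator_def)
 finally show ?thesis .
qed

lemma integrable_jacobi_mult:
 assumes "c > -1" "continuous_on {-1..1} h"
 shows "integrable lebesgue (%x. jacobi c x*h x)"
proof -
 have "bounded (h ` {-1..1})"
  by (intro compact_imp_bounded compact_continuous_image assms) auto
 then obtain B where B: "!!x. x \<in> {-1..1} ==> \<bar>h x\<bar> <= B"
  unfolding bounded_iff by (metis imageI real_norm_def)
 show ?thesis
 proof (rule Bochner_Integration.integrable_bound)
  show "integrable lebesgue (%x. B*jacobi c x)"
   using integrable_jacobi[OF assms(1)] by simp
  show "(%x. jacobi c x*h x) \<in> borel_measurable lebesgue"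
   by (intro lebesgue_measurableI jacobi_mult_measurable assms)
  have "\<bar>jacobi c x*h x\<bar> <= \<bar>B*jacobi c x\<bar>" for x
  proof (cases "x \<in> {-1<..<1}")
   case True
   have "jacobi c x*\<bar>h x\<bar> <= jacobi c x*B"
    using B[of x] True by (intro mult_left_mono) auto
   also have "... <= \<bar>B*jacobi c x\<bar>" by (simp add: mult.commute)
   finally show ?thesis by (simp add: abs_mult)
  qed (simp add: jacobi_outside)
  then show "AE x in lebesgue. norm (jacobi c x*h x) <= norm (B*jacobi c x)"
   by simp
 qed
qed

lemma sets_jacobi_measure [measurable_cong, simp]: "sets (jacobi_measure s) = sets lebesgue"
 by (simp add: jacobi_measure_def)

lemma space_jacobi_measure [simp]: "space (jacobi_measure s) = UNIV"
 by (simp add: jacobi_measure_def)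

lemma borel_measurable_jacobi [simp]: "borel_measurable (jacobi_measure s) = borel_measurable lebesgue"
 by (rule measurable_cong_sets) simp_all

lemma finite_jacobi_measure:
 assumes "s > -1" shows "finite_measure (jacobi_measure s)"
proof
 have "emeasure (jacobi_measure s) (space (jacobi_measure s)) = (\<integral>\<^sup>+x. ennreal (jacobi s x) \<partial>lebesgue)"
  by (simp add: jacobi_measure_def emeasure_density)
 also have "... = ennreal (LINT x|lebesgue. jacobi s x)"
  by (rule nn_integral_eq_integral[OF integrable_jacobi[OF assms]]) simp
 finally show "emeasure (jacobi_measure s) (space (jacobi_measure s)) ~= \<infinity>"
  by simp
qed

lemma integrable_jacobi_iff:
 fixes f :: "real => real"
 assumes "f \<in> borel_measurable lebesgue"
 shows "integrable (jacobi_measure s) f \<longleftrightarrow> integrable lebesgue (%x. jacobi s x*f x)"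
 unfolding jacobi_measure_def using assms by (subst integrable_density) auto

lemma integral_jacobi:
 fixes f :: "real => real"
 assumes "f \<in> borel_measurable lebesgue"
 shows "integral\<^sup>L (jacobi_measure s) f = (LINT x|lebesgue. jacobi s x*f x)"
 unfolding jacobi_measure_def using assms by (subst integral_density) auto

lemma AE_jacobi_iff: "(AE x in jacobi_measure s. P x) \<longleftrightarrow> (AE x in lebesgue. x \<in> {-1<..<1} --> P x)"
proof -
 have "ennreal (jacobi s x) > 0 \<longleftrightarrow> x \<in> {-1<..<1}" for x
  using jacobi_pos[of x s] jacobi_outside[of x s] by force
 then show ?thesis
  unfolding jacobi_measure_def by (subst AE_density) auto
qed

lemma AE_jacobi_interval: "AE x in jacobi_measure s. x \<in> {-1<..<1}"
 by (simp add: AE_jacobi_iff)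

lemma L2_jacobi_bounded:
 assumes "s > -1" "v \<in> borel_measurable lebesgue" "!!x. x \<in> {-1<..<1} ==> \<bar>v x\<bar> <= B"
 shows "v \<in> L2 (jacobi_measure s)"
proof (rule L2_bounded[OF finite_jacobi_measure[OF assms(1)]])
 show "AE x in jacobi_measure s. \<bar>v x\<bar> <= B"
  using AE_jacobi_interval by eventually_elim (rule assms(3))
qed (use assms in simp)

lemma L2_jacobi_continuous:
 assumes "s > -1" "continuous_on UNIV h"
 shows "h \<in> L2 (jacobi_measure s)"
proof -
 have "bounded (h ` {-1..1})"
  by (intro compact_imp_bounded compact_continuous_image continuous_on_subset[OF assms(2)]) auto
 then obtain B where "!!x. x \<in> {-1..1} ==> \<bar>h x\<bar> <= B"
  unfolding bounded_iff by (metis imageI real_norm_def)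
 then show ?thesis
  by (intro L2_jacobi_bounded[where B=B] assms lebesgue_measurableI
    borel_measurable_continuous_onI) auto
qed

lemma L2_jacobi_poly: "s > -1 ==> poly p \<in> L2 (jacobi_measure s)"
 by (intro L2_jacobi_continuous continuous_intros)

text \<open>The sign of \<open>v\<close> is an almost everywhere limit of continuous functions bounded by one,
 and each of these is a uniform limit of polynomials on the interval; so vanishing moments
 force the integral of \<open>\<bar>v\<bar>\<close> to vanish.\<close>

theorem moments_determine_zero:
 assumes "s > -1" and v: "v \<in> L2 (jacobi_measure s)"
  and moments: "!!n. (LINT x|jacobi_measure s. v x*x^n) = 0"
 shows "AE x in jacobi_measure s. v x = 0"
proof -
 let ?M = "jacobi_measure s"
 interpret finite_measure ?M by (rule finite_jacobi_measure) fact
 have vm [measurable]: "v \<in> borel_measurable lebesgue"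
  using v by (auto simp: L2_def)
 have vi: "integrable ?M v"
  by (rule L1_le_L2(1)[OF finite_measure_axioms v])
 have mono_i: "integrable ?M (%x. v x*x^n)" for n
  by (intro L2_mult v L2_jacobi_continuous assms(1) continuous_intros)
 have cont: "(LINT x|?M. v x*g x) = 0" if g: "continuous_on UNIV g" for g
 proof -
  have small: "\<bar>(LINT x|?M. v x*g x)\<bar> <= e*(LINT x|?M. \<bar>v x\<bar>)" if "e > 0" for e
  proof -
   obtain p where p: "real_polynomial_function p" "!!x. x \<in> {-1..1} ==> \<bar>g x - p x\<bar> < e"
    using Stone_Weierstrass_real_polynomial_function[of "{-1..1::real}" g e] g \<open>e > 0\<close>
    by (auto intro: continuous_on_subset)
   then obtain a n where pa: "p = (%x. \<Sum>i\<le>n. a i*x^i)"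
    using real_polynomial_function_iff_sum by blast
   have pc: "continuous_on UNIV p" unfolding pa by (intro continuous_intros)
   have "(LINT x|?M. v x*p x) = (LINT x|?M. (\<Sum>i\<le>n. a i*(v x*x^i)))"
    by (rule Bochner_Integration.integral_cong) (auto simp: pa sum_distrib_left ac_simps)
   also have "... = 0"
    using mono_i moments by (subst Bochner_Integration.integral_sum) auto
   finally have p0: "(LINT x|?M. v x*p x) = 0" .
   have ig: "integrable ?M (%x. v x*g x)" and ip: "integrable ?M (%x. v x*p x)"
    by (intro L2_mult v L2_jacobi_continuous assms(1) g pc)+
   have "\<bar>(LINT x|?M. v x*g x)\<bar> = \<bar>(LINT x|?M. v x*g x - v x*p x)\<bar>"
    using p0 ig ip by simp
   also have "... <= (LINT x|?M. \<bar>v x*g x - v x*p x\<bar>)"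
    by (rule integral_abs_bound)
   also have "... <= (LINT x|?M. e*\<bar>v x\<bar>)"
   proof (rule integral_mono_AE)
    show "AE x in ?M. \<bar>v x*g x - v x*p x\<bar> <= e*\<bar>v x\<bar>"
     using AE_jacobi_interval
    proof eventually_elim
     case (elim x)
     have "\<bar>v x\<bar>*\<bar>g x - p x\<bar> <= \<bar>v x\<bar>*e"
      using p(2)[of x] elim by (intro mult_left_mono) auto
     moreover have "\<bar>v x*g x - v x*p x\<bar> = \<bar>v x\<bar>*\<bar>g x - p x\<bar>"
      by (simp add: abs_mult[symmetric] right_diff_distrib)
     ultimately show ?case by (simp add: mult.commute)
    qed
   qed (use ig ip vi in auto)
   finally show ?thesis by simp
  qed
  have "\<bar>(LINT x|?M. v x*g x)\<bar> <= 0 + e" if "e > 0" for e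
  proof -
   define I where "I = (LINT x|?M. \<bar>v x\<bar>)"
   have "I >= 0" by (simp add: I_def)
   have "e/(I + 1)*I <= e"
    using \<open>e > 0\<close> \<open>I \<ge> 0\<close> by (simp add: field_simps)
   moreover have "\<bar>(LINT x|?M. v x*g x)\<bar> <= e/(I + 1)*I"
    using small[of "e/(I + 1)", folded I_def] divide_pos_pos[of e "I + 1"] \<open>e > 0\<close> \<open>I \<ge> 0\<close>
    by simp
   ultimately show ?thesis by simp
  qed
  then have "\<bar>(LINT x|?M. v x*g x)\<bar> <= 0"
   by (rule field_le_epsilon)
  then show ?thesis by simp
 qed
 have "(%x. sgn (v x)) \<in> borel_measurable lebesgue"
  by measurable
 then have "(%x. sgn (v x)) measurable_on UNIV"
  by (rule lebesgue_measurable_imp_measurable_on_real) simp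
 then obtain N g where N: "negligible N" and gc: "!!n. continuous_on UNIV (g n)"
  and gl: "!!x. x \<notin> N ==> (%n. g n x) \<longlonglongrightarrow> sgn (v x)"
  unfolding measurable_on_def by auto
 define h where "h n x = max (-1) (min 1 (g n x))" for n x
 have hc: "continuous_on UNIV (h n)" for n
  unfolding h_def by (intro continuous_intros gc)
 have hb: "\<bar>h n x\<bar> <= 1" for n x
  by (auto simp: h_def)
 have [measurable]: "h n \<in> borel_measurable lebesgue" for n
  by (intro lebesgue_measurableI borel_measurable_continuous_onI hc)
 have "AE x in lebesgue. x \<notin> N"
  using N by (intro AE_not_in) (simp add: negligible_iff_null_sets)
 then have "AE x in ?M. x \<notin> N"
  unfolding AE_jacobi_iff by eventually_elim simp
 then have hl: "AE x in ?M. (%n. v x*h n x) \<longlonglongrightarrow> \<bar>v x\<bar>"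
 proof eventually_elim
  case (elim x)
  have "(%n. v x*h n x) \<longlonglongrightarrow> v x*max (-1) (min 1 (sgn (v x)))"
   unfolding h_def by (intro tendsto_intros gl elim)
  also have "v x*max (-1) (min 1 (sgn (v x))) = \<bar>v x\<bar>"
   by (auto simp: sgn_real_def)
  finally show ?case .
 qed
 have "(%n. (LINT x|?M. v x*h n x)) \<longlonglongrightarrow> (LINT x|?M. \<bar>v x\<bar>)"
 proof (rule integral_dominated_convergence[where w="%x. \<bar>v x\<bar>"])
  show "AE x in ?M. norm (v x*h n x) <= \<bar>v x\<bar>" for n
   using hb[of n] by (intro AE_I2) (auto simp: abs_mult intro: mult_left_le)
 qed (use vi hl in auto)
 then have "(LINT x|?M. \<bar>v x\<bar>) = 0"
  using cont[OF hc] by (simp add: LIMSEQ_const_iff)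
 then have "AE x in ?M. \<bar>v x\<bar> = 0"
  using integral_nonneg_eq_0_iff_AE[of ?M "%x. \<bar>v x\<bar>"] vi by simp
 then show ?thesis by simp
qed

section \<open>Gegenbauer polynomials\<close>

lemma gegenbauer_recurrence:
 "(real n + 2)*poly (gegenbauer \<alpha> (Suc (Suc n))) x =
  2*(real n + 1 + \<alpha>)*(x*poly (gegenbauer \<alpha> (Suc n)) x) - (real n + 2*\<alpha>)*poly (gegenbauer \<alpha> n) x"
 by (simp add: field_simps)

lemma gegenbauer_recurrence_deriv:
 "(real n + 2)*poly (pderiv (gegenbauer \<alpha> (Suc (Suc n)))) x =
  2*(real n + 1 + \<alpha>)*(poly (gegenbauer \<alpha> (Suc n)) x + x*poly (pderiv (gegenbauer \<alpha> (Suc n))) x)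
  - (real n + 2*\<alpha>)*poly (pderiv (gegenbauer \<alpha> n)) x"
 by (simp add: pderiv_smult pderiv_diff pderiv_add pderiv_pCons field_simps)

text \<open>Both relations are carried through one induction: the second one at \<open>n + 1\<close> needs the
 first one at \<open>n\<close>, and together they give the first one at \<open>n + 1\<close>.\<close>

lemma gegenbauer_deriv_relations:
 "(real n + 1)*poly (gegenbauer \<alpha> (Suc n)) x =
   x*poly (pderiv (gegenbauer \<alpha> (Suc n))) x - poly (pderiv (gegenbauer \<alpha> n)) x"
 "poly (pderiv (gegenbauer \<alpha> (Suc n))) x =
   x*poly (pderiv (gegenbauer \<alpha> n)) x + (real n + 2*\<alpha>)*poly (gegenbauer \<alpha> n) x"
proof (induction n)
 case 0
 {
  case 1
  show ?case by (simp add: pderiv_pCons)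
 next
  case 2
  show ?case by (simp add: pderiv_pCons)
 }
next
 case (Suc n)
 define c0 c1 c2 d0 d1 d2 where
  defs: "c0 = poly (gegenbauer \<alpha> n) x" "c1 = poly (gegenbauer \<alpha> (Suc n)) x"
   "c2 = poly (gegenbauer \<alpha> (Suc (Suc n))) x"
   "d0 = poly (pderiv (gegenbauer \<alpha> n)) x" "d1 = poly (pderiv (gegenbauer \<alpha> (Suc n))) x"
   "d2 = poly (pderiv (gegenbauer \<alpha> (Suc (Suc n)))) x"
 have IH1: "(real n + 1)*c1 = x*d1 - d0" and IH2: "d1 = x*d0 + (real n + 2*\<alpha>)*c0"
  using Suc.IH unfolding defs by blast+
 have r: "(real n + 2)*c2 = 2*(real n + 1 + \<alpha>)*(x*c1) - (real n + 2*\<alpha>)*c0"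
  unfolding defs by (rule gegenbauer_recurrence)
 have rd: "(real n + 2)*d2 = 2*(real n + 1 + \<alpha>)*(c1 + x*d1) - (real n + 2*\<alpha>)*d0"
  unfolding defs by (rule gegenbauer_recurrence_deriv)
 have d0: "d0 = x*d1 - (real n + 1)*c1" using IH1 by simp
 have "(real n + 2)*d2 = (real n + 2)*(x*d1 + (real n + 1 + 2*\<alpha>)*c1)"
  unfolding rd d0 by (simp add: algebra_simps)
 then have B: "d2 = x*d1 + (real n + 1 + 2*\<alpha>)*c1"
  by simp
 have "x*d2 - d1 = x*(x*d1) + (real n + 1 + 2*\<alpha>)*(x*c1) - (x*d0 + (real n + 2*\<alpha>)*c0)"
  unfolding B IH2 by (simp add: algebra_simps)
 also have "... = (real n + 2)*c2"
  unfolding r d0 by (simp add: algebra_simps)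
 finally have A: "(real n + 2)*c2 = x*d2 - d1" ..
 {
  case 1
  show ?case using A unfolding defs by (simp add: add.commute)
 next
  case 2
  show ?case using B unfolding defs by (simp add: add.commute add.left_commute)
 }
qed

lemma gegenbauer_first_order:
 "(1 - x\<^sup>2)*poly (pderiv (gegenbauer \<alpha> (Suc n))) x =
  (real n + 2*\<alpha>)*poly (gegenbauer \<alpha> n) x - (real n + 1)*(x*poly (gegenbauer \<alpha> (Suc n)) x)"
proof -
 have "x*((real n + 1)*poly (gegenbauer \<alpha> (Suc n)) x) =
   x*(x*poly (pderiv (gegenbauer \<alpha> (Suc n))) x - poly (pderiv (gegenbauer \<alpha> n)) x)"
  by (simp only: gegenbauer_deriv_relations(1))
 with gegenbauer_deriv_relations(2)[of \<alpha> n x] show ?thesis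
  by (simp add: algebra_simps power2_eq_square del: gegenbauer.simps)
qed

theorem gegenbauer_ode:
 "(1 - x\<^sup>2)*poly (pderiv (pderiv (gegenbauer \<alpha> n))) x
   - (2*\<alpha> + 1)*x*poly (pderiv (gegenbauer \<alpha> n)) x
  = - (real n*(real n + 2*\<alpha>))*poly (gegenbauer \<alpha> n) x"
proof (cases n)
 case (Suc m)
 let ?c = "gegenbauer \<alpha> (Suc m)" and ?b = "gegenbauer \<alpha> m"
 have "[:1, 0, -1:]*pderiv ?c = smult (real m + 2*\<alpha>) ?b - smult (real m + 1) ([:0, 1:]*?c)"
  by (rule poly_eq_poly_eq_iff[THEN iffD1])
    (use gegenbauer_first_order[of _ \<alpha> m] in
     \<open>simp add: fun_eq_iff algebra_simps power2_eq_square del: gegenbauer.simps\<close>)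
 then have "poly (pderiv ([:1, 0, -1:]*pderiv ?c)) x =
   poly (pderiv (smult (real m + 2*\<alpha>) ?b - smult (real m + 1) ([:0, 1:]*?c))) x"
  by (simp only:)
 then have e: "(1 - x\<^sup>2)*poly (pderiv (pderiv ?c)) x - 2*x*poly (pderiv ?c) x
   = (real m + 2*\<alpha>)*poly (pderiv ?b) x - (real m + 1)*(poly ?c x + x*poly (pderiv ?c) x)"
  unfolding pderiv_mult pderiv_diff pderiv_smult
  by (simp add: pderiv_pCons algebra_simps power2_eq_square del: gegenbauer.simps)
 have b: "poly (pderiv ?b) x = x*poly (pderiv ?c) x - (real m + 1)*poly ?c x"
  using gegenbauer_deriv_relations(1)[of m \<alpha> x] by (simp del: gegenbauer.simps)
 show ?thesis
  using e unfolding b Suc by (simp add: algebra_simps del: gegenbauer.simps)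
qed simp

lemma gegenbauer_degree_lead:
 assumes "\<alpha> > 0"
 shows "degree (gegenbauer \<alpha> n) <= n \<and> coeff (gegenbauer \<alpha> n) n > 0"
 using assms
proof (induction \<alpha> n rule: gegenbauer.induct)
 case (3 \<alpha> n)
 let ?c = "gegenbauer \<alpha> (Suc n)" and ?b = "gegenbauer \<alpha> n"
 have d: "degree ([:0, 2*(real n + 1 + \<alpha>):]*?c) <= Suc (Suc n)"
  using 3 degree_mult_le[of "[:0, 2*(real n + 1 + \<alpha>):]" ?c]
  by (force simp del: gegenbauer.simps)
 moreover have d2: "degree (smult (real n + 2*\<alpha>) ?b) <= n"
  using 3 degree_smult_le[of "real n + 2*\<alpha>" ?b] by force
 ultimately have "degree (gegenbauer \<alpha> (Suc (Suc n))) <= Suc (Suc n)"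
  unfolding gegenbauer.simps(3)
  by (intro order_trans[OF degree_smult_le degree_diff_le]) linarith+
 moreover have "coeff (smult (real n + 2*\<alpha>) ?b) (Suc (Suc n)) = 0"
  by (rule coeff_eq_0) (use d2 in linarith)
 then have "coeff (gegenbauer \<alpha> (Suc (Suc n))) (Suc (Suc n)) =
   1/(real n + 2)*(2*(real n + 1 + \<alpha>)*coeff ?c (Suc n))"
  unfolding gegenbauer.simps(3) coeff_smult coeff_diff by simp
 then have "coeff (gegenbauer \<alpha> (Suc (Suc n))) (Suc (Suc n)) > 0"
  using 3 by (simp del: gegenbauer.simps)
 ultimately show ?case by blast
qed auto

lemma gegenbauer_span:
 assumes "\<alpha> > 0" "degree p <= n"
 obtains c where "p = (\<Sum>j\<le>n. smult (c j) (gegenbauer \<alpha> j))"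
proof -
 have "\<exists>c. p = (\<Sum>j\<le>n. smult (c j) (gegenbauer \<alpha> j))"
  using assms(2)
 proof (induction n arbitrary: p)
  case 0
  then obtain a where "p = [:a:]" using degree_eq_zeroE by blast
  then show ?case by (intro exI[of _ "%_. a"]) simp
 next
  case (Suc n)
  let ?g = "gegenbauer \<alpha> (Suc n)"
  define a where "a = coeff p (Suc n)/coeff ?g (Suc n)"
  have g: "degree ?g <= Suc n" "coeff ?g (Suc n) > 0"
   using gegenbauer_degree_lead[OF assms(1)] by auto
  have "degree (p - smult a ?g) <= Suc n"
   using Suc.prems g(1) by (intro degree_diff_le) (auto intro: order_trans[OF degree_smult_le])
  moreover have "coeff (p - smult a ?g) (Suc n) = 0"
   using g(2) by (simp add: a_def del: gegenbauer.simps)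
  ultimately have "degree (p - smult a ?g) <= n"
   by (metis le_SucE degree_0 leading_coeff_0_iff le0)
  then obtain c where c: "p - smult a ?g = (\<Sum>j\<le>n. smult (c j) (gegenbauer \<alpha> j))"
   using Suc.IH by blast
  have "p = (\<Sum>j\<le>n. smult (c j) (gegenbauer \<alpha> j)) + smult a ?g"
   unfolding c[symmetric] by simp
  also have "... = (\<Sum>j\<le>Suc n. smult ((c(Suc n := a)) j) (gegenbauer \<alpha> j))"
   by simp
  finally show ?case by blast
 qed
 with that show ?thesis by blast
qed

definition wint :: "real => (real => real) => real" where
 "wint c h = (LINT x|lebesgue. jacobi c x*h x)"

lemma wint_eq_L2_inner:
 assumes "u \<in> L2 (jacobi_measure s)" "v \<in> L2 (jacobi_measure s)"
 shows "wint s (%x. u x * v x) = L2_inner (jacobi_measure s) u v"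
 unfolding wint_def L2_inner_def using assms
 by (subst integral_jacobi) (auto simp: L2_def)

lemma wint_cong:
 assumes "!!x. x \<in> {-1<..<1} ==> g x = h x"
 shows "wint c g = wint c h"
proof -
 have "jacobi c x*g x = jacobi c x*h x" for x
  using assms[of x] by (cases "x \<in> {-1<..<1}") (auto simp: jacobi_outside)
 then show ?thesis by (simp only: wint_def)
qed

lemma wint_add:
 assumes "c > -1" "continuous_on {-1..1} g" "continuous_on {-1..1} h"
 shows "wint c (%x. g x + h x) = wint c g + wint c h"
 unfolding wint_def distrib_left
 by (intro Bochner_Integration.integral_add integrable_jacobi_mult assms)

lemma wint_diff:
 assumes "c > -1" "continuous_on {-1..1} g" "continuous_on {-1..1} h"
 shows "wint c (%x. g x - h x) = wint c g - wint c h"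
 unfolding wint_def right_diff_distrib
 by (intro Bochner_Integration.integral_diff integrable_jacobi_mult assms)

lemma wint_scale:
 "wint c (%x. k*h x) = k*wint c h"
 unfolding wint_def by (simp add: mult.left_commute)

lemma wint_sum:
 assumes "c > -1" "!!i. i \<in> I ==> continuous_on {-1..1} (h i)"
 shows "wint c (%x. \<Sum>i\<in>I. h i x) = (\<Sum>i\<in>I. wint c (h i))"
 unfolding wint_def sum_distrib_left
 by (intro Bochner_Integration.integral_sum integrable_jacobi_mult assms)

lemma wint_eq_integral:
 assumes "c > -1" "continuous_on {-1..1} h"
 shows "((%x. (1 - x\<^sup>2) powr c*h x) has_integral wint c h) {-1..1}"
proof -
 have "set_integrable lebesgue {-1<..<1} (%x. (1 - x\<^sup>2) powr c*h x)"
  using integrable_jacobi_mult[OF assms]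
  by (simp add: set_integrable_def jacobi_def mult.assoc)
 from has_integral_set_lebesgue[OF this]
 have "((%x. (1 - x\<^sup>2) powr c*h x) has_integral wint c h) {-1<..<1}"
  by (simp add: wint_def set_lebesgue_integral_def jacobi_def mult.assoc)
 then show ?thesis
  using has_integral_Icc_iff_Ioo by blast
qed

lemma wint_nonneg:
 "(!!x. x \<in> {-1<..<1} ==> 0 <= h x) ==> 0 <= wint c h"
 unfolding wint_def
 by (intro Bochner_Integration.integral_nonneg) (metis jacobi_outside jacobi_nonneg mult_eq_0_iff mult_nonneg_nonneg order_refl)

lemma wint_mono:
 assumes "c > -1" "continuous_on {-1..1} g" "continuous_on {-1..1} h"
  "!!x. x \<in> {-1<..<1} ==> g x <= h x"
 shows "wint c g <= wint c h"
 using wint_nonneg[of "%x. h x - g x" c] wint_diff[OF assms(1,3,2)] assms(4)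
 by force

lemma wint_one_pos:
 assumes "c > -1" shows "0 < wint c (%x. 1)"
proof (rule ccontr)
 assume "\<not> ?thesis"
 moreover have "0 <= (LINT x|lebesgue. jacobi c x)"
  by (rule Bochner_Integration.integral_nonneg) simp
 ultimately have "(LINT x|lebesgue. jacobi c x) = 0"
  unfolding wint_def mult_1_right by linarith
 then have "AE x in lebesgue. jacobi c x = 0"
  using integral_nonneg_eq_0_iff_AE[OF integrable_jacobi[OF assms]] by simp
 then have "AE x in lebesgue. x \<notin> {-1<..<1::real}"
  by eventually_elim (use jacobi_pos[of _ c] in force)
 then have "{-1<..<1::real} \<in> null_sets lebesgue"
  by (subst (asm) AE_iff_null_sets[symmetric]) auto
 then have "emeasure lebesgue {-1<..<1::real} = 0" by auto
 then show False by simp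
qed

text \<open>Integrating by parts twice against \<open>(1 - x\<^sup>2) powr (s + 1)\<close>, which vanishes at the end
 points, moves the Gegenbauer differential operator from one factor to the other.\<close>

lemma gegenbauer_operator_symmetric:
 fixes g g1 g2 e e1 e2 :: "real => real"
 assumes s: "s > -1"
  and c: "continuous_on {-1..1} g" "continuous_on {-1..1} g1" "continuous_on {-1..1} g2"
   "continuous_on {-1..1} e" "continuous_on {-1..1} e1" "continuous_on {-1..1} e2"
  and d: "!!x. x \<in> {-1<..<1} ==> (g has_real_derivative g1 x) (at x)"
   "!!x. x \<in> {-1<..<1} ==> (g1 has_real_derivative g2 x) (at x)"
   "!!x. x \<in> {-1<..<1} ==> (e has_real_derivative e1 x) (at x)"
   "!!x. x \<in> {-1<..<1} ==> (e1 has_real_derivative e2 x) (at x)"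
 shows "wint s (%x. ((1 - x\<^sup>2)*g2 x - (2 * s + 2)*x*g1 x)*e x) =
     wint s (%x. g x*((1 - x\<^sup>2)*e2 x - (2 * s + 2)*x*e1 x))"
proof -
 let ?G = "%x. ((1 - x\<^sup>2)*g2 x - (2 * s + 2)*x*g1 x)*e x"
 let ?E = "%x. g x*((1 - x\<^sup>2)*e2 x - (2 * s + 2)*x*e1 x)"
 let ?W = "%x. (1 - x\<^sup>2) powr (s + 1)*(g1 x*e x - g x*e1 x)"
 have cG: "continuous_on {-1..1} ?G" and cE: "continuous_on {-1..1} ?E"
  by (intro continuous_intros c)+
 have "((%x. (1 - x\<^sup>2) powr s*(?G x - ?E x)) has_integral (?W 1 - ?W (-1))) {-1..1}"
 proof (rule fundamental_theorem_of_calculus_interior)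
  show "continuous_on {-1..1} ?W"
   using s by (intro continuous_on_mult continuous_on_powr' continuous_intros c)
    (auto simp: abs_square_le_1)
  fix x :: real assume x: "x \<in> {-1<..<1}"
  have p: "1 - x\<^sup>2 > 0" by (rule one_minus_sq_pos[OF x])
  have q: "(1 - x\<^sup>2) powr (s + 1) = (1 - x\<^sup>2) powr s*(1 - x\<^sup>2)"
   using p by (simp add: powr_add)
  have "(?W has_real_derivative (1 - x\<^sup>2) powr (s + 1)*(g2 x*e x + g1 x*e1 x - (g1 x*e1 x + g x*e2 x))
    + ((s + 1)*(1 - x\<^sup>2) powr s*(- 2*x))*(g1 x*e x - g x*e1 x)) (at x)"
  proof (rule DERIV_mult')
   show "((%x. (1 - x\<^sup>2) powr (s + 1)) has_real_derivative (s + 1)*(1 - x\<^sup>2) powr s*(- 2*x)) (at x)"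
    using DERIV_fun_powr[of "%x. 1 - x\<^sup>2" "- 2*x" x "s + 1"] p
    by (force intro!: derivative_eq_intros)
   show "((%x. g1 x*e x - g x*e1 x) has_real_derivative
     (g2 x*e x + g1 x*e1 x - (g1 x*e1 x + g x*e2 x))) (at x)"
    by (rule DERIV_cong[OF DERIV_diff[OF DERIV_mult'[OF d(2)[OF x] d(3)[OF x]]
       DERIV_mult'[OF d(1)[OF x] d(4)[OF x]]]]) simp
  qed
  also have "(1 - x\<^sup>2) powr (s + 1)*(g2 x*e x + g1 x*e1 x - (g1 x*e1 x + g x*e2 x))
    + ((s + 1)*(1 - x\<^sup>2) powr s*(- 2*x))*(g1 x*e x - g x*e1 x)
    = (1 - x\<^sup>2) powr s*(?G x - ?E x)"
   unfolding q by (simp add: algebra_simps)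
  finally show "(?W has_vector_derivative (1 - x\<^sup>2) powr s*(?G x - ?E x)) (at x)"
   by (simp add: has_real_derivative_iff_has_vector_derivative)
 qed simp
 then have "((%x. (1 - x\<^sup>2) powr s*(?G x - ?E x)) has_integral 0) {-1..1}"
  by simp
 moreover have "((%x. (1 - x\<^sup>2) powr s*(?G x - ?E x)) has_integral wint s (%x. ?G x - ?E x)) {-1..1}"
  by (rule wint_eq_integral[OF s]) (intro continuous_intros cG cE)
 ultimately have "wint s (%x. ?G x - ?E x) = 0"
  using has_integral_unique by blast
 then show ?thesis
  using wint_diff[OF s cG cE] by simp
qed

abbreviation geg :: "real => nat => real poly" where
 "geg s n \<equiv> gegenbauer (s + 1/2) n"

lemma geg_operator:
 "(1 - x\<^sup>2)*poly (pderiv (pderiv (geg s n))) x - (2 * s + 2)*x*poly (pderiv (geg s n)) x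
  = - (real n*(real n + 2 * s + 1))*poly (geg s n) x"
 using gegenbauer_ode[of x "s + 1/2" n] by (simp add: algebra_simps)

lemma gegenbauer_operator_coefficient:
 assumes s: "s > -1"
  and c: "continuous_on {-1..1} g" "continuous_on {-1..1} g1" "continuous_on {-1..1} g2"
  and d: "!!x. x \<in> {-1<..<1} ==> (g has_real_derivative g1 x) (at x)"
   "!!x. x \<in> {-1<..<1} ==> (g1 has_real_derivative g2 x) (at x)"
 shows "wint s (%x. ((1 - x\<^sup>2)*g2 x - (2 * s + 2)*x*g1 x)*poly (geg s n) x) =
     - (real n*(real n + 2 * s + 1))*wint s (%x. g x*poly (geg s n) x)"
proof -
 have "wint s (%x. ((1 - x\<^sup>2)*g2 x - (2 * s + 2)*x*g1 x)*poly (geg s n) x) =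
   wint s (%x. g x*((1 - x\<^sup>2)*poly (pderiv (pderiv (geg s n))) x
    - (2 * s + 2)*x*poly (pderiv (geg s n)) x))"
  by (intro gegenbauer_operator_symmetric s c d continuous_intros) (auto intro: poly_DERIV)
 also have "... = wint s (%x. - (real n*(real n + 2 * s + 1))*(g x*poly (geg s n) x))"
  unfolding geg_operator by (simp add: mult_ac)
 finally show ?thesis unfolding wint_scale .
qed

lemma gegenbauer_orthogonal:
 assumes s: "s > -1/2" and "m ~= n"
 shows "wint s (%x. poly (geg s m) x*poly (geg s n) x) = 0"
proof -
 have "wint s (%x. ((1 - x\<^sup>2)*poly (pderiv (pderiv (geg s m))) x
    - (2 * s + 2)*x*poly (pderiv (geg s m)) x)*poly (geg s n) x)
   = - (real n*(real n + 2 * s + 1))*wint s (%x. poly (geg s m) x*poly (geg s n) x)"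
  using s by (intro gegenbauer_operator_coefficient continuous_intros) (auto intro: poly_DERIV)
 then have "- (real m*(real m + 2 * s + 1))*wint s (%x. poly (geg s m) x*poly (geg s n) x)
   = - (real n*(real n + 2 * s + 1))*wint s (%x. poly (geg s m) x*poly (geg s n) x)"
  unfolding geg_operator mult.assoc[of "- (real m*(real m + 2 * s + 1))"] wint_scale .
 moreover have "real m*(real m + 2 * s + 1) ~= real n*(real n + 2 * s + 1)"
 proof -
  have "real m*(real m + 2 * s + 1) - real n*(real n + 2 * s + 1) = (real m - real n)*(real m + real n + 2 * s + 1)"
   by (simp add: algebra_simps)
  moreover have "real m + real n + 2 * s + 1 ~= 0" using s by simp
  ultimately show ?thesis using \<open>m \<noteq> n\<close> by auto
 qed
 ultimately show ?thesis by simp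
qed

definition geg_sqnorm :: "real => nat => real" where
 "geg_sqnorm s n = wint s (%x. (poly (geg s n) x)\<^sup>2)"

lemma gegenbauer_norm_eq: "gegenbauer_norm s n = sqrt (geg_sqnorm s n)"
 unfolding gegenbauer_norm_def geg_sqnorm_def wint_def set_lebesgue_integral_def
 by (simp add: jacobi_def mult_ac)

lemma geg_sqnorm_0_pos:
 assumes "s > -1" shows "0 < geg_sqnorm s 0"
 using wint_one_pos[OF assms] by (simp add: geg_sqnorm_def)

text \<open>Expanding \<open>x C\<^sub>n C\<^sub>n\<^sub>+\<^sub>1\<close> once by the recurrence for \<open>C\<^sub>n\<close> and once by the one for
 \<open>C\<^sub>n\<^sub>+\<^sub>1\<close> expresses the ratio of consecutive norms.\<close>

lemma geg_sqnorm_Suc: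
 assumes s: "s > -1/2"
 shows "(real n + 1)*(real n + s + 3/2)*geg_sqnorm s (Suc n)
  = (real n + 2 * s + 1)*(real n + s + 1/2)*geg_sqnorm s n"
proof -
 let ?c = "%n x. poly (geg s n) x" and ?I = "wint s"
 have cc: "continuous_on {-1..1} (%x. ?c m x*?c n x)" for m n
  by (intro continuous_intros)
 let ?X = "?I (%x. x*(?c n x*?c (Suc n) x))"
 have s1: "s > -1" using s by simp
 have up: "2*(real n + s + 1/2)*?X = (real n + 1)*geg_sqnorm s (Suc n)"
 proof (cases n)
  case 0
  have "?I (%x. (2*(s + 1/2))*(x*(?c 0 x*?c 1 x))) = ?I (%x. (?c 1 x)\<^sup>2)"
   by (rule wint_cong) (simp add: power2_eq_square)
  then show ?thesis unfolding wint_scale by (simp add: 0 geg_sqnorm_def)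
 next
  case (Suc m)
  have "?I (%x. 2*(real n + s + 1/2)*(x*(?c n x*?c (Suc n) x)))
    = ?I (%x. (real n + 1)*(?c (Suc n) x*?c (Suc n) x) + (real m + 2 * s + 1)*(?c m x*?c (Suc n) x))"
  proof (rule wint_cong)
   fix x :: real
   have "(2*(real n + s + 1/2)*x*?c n x)*?c (Suc n) x
     = ((real n + 1)*?c (Suc n) x + (real m + 2 * s + 1)*?c m x)*?c (Suc n) x"
    using gegenbauer_recurrence[of m "s+1/2"] Suc by (simp add: algebra_simps del: gegenbauer.simps)
   then show "2*(real n + s + 1/2)*(x*(?c n x*?c (Suc n) x)) =
    (real n + 1)*(?c (Suc n) x*?c (Suc n) x) + (real m + 2 * s + 1)*(?c m x*?c (Suc n) x)"
    by (simp only: ring_distribs mult.assoc)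
  qed
  also have "... = (real n + 1)*?I (%x. ?c (Suc n) x*?c (Suc n) x) + (real m + 2 * s + 1)*?I (%x. ?c m x*?c (Suc n) x)"
   by (subst wint_add) (intro s1 continuous_intros | simp only: wint_scale)+
  also have "?I (%x. ?c m x*?c (Suc n) x) = 0"
   by (rule gegenbauer_orthogonal[OF s]) (simp add: Suc)
  finally show ?thesis unfolding wint_scale by (simp add: geg_sqnorm_def power2_eq_square)
 qed
 have dn: "2*(real n + s + 3/2)*?X = (real n + 2 * s + 1)*geg_sqnorm s n"
 proof -
  have "?I (%x. 2*(real n + s + 3/2)*(x*(?c n x*?c (Suc n) x)))
    = ?I (%x. (real n + 2)*(?c n x*?c (Suc (Suc n)) x) + (real n + 2 * s + 1)*(?c n x*?c n x))"
  proof (rule wint_cong)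
   fix x :: real
   have "?c n x*(2*(real n + s + 3/2)*x*?c (Suc n) x)
     = ?c n x*((real n + 2)*?c (Suc (Suc n)) x + (real n + 2 * s + 1)*?c n x)"
    using gegenbauer_recurrence[of n "s+1/2"] by (simp add: algebra_simps del: gegenbauer.simps)
   then show "2*(real n + s + 3/2)*(x*(?c n x*?c (Suc n) x)) =
    (real n + 2)*(?c n x*?c (Suc (Suc n)) x) + (real n + 2 * s + 1)*(?c n x*?c n x)"
    by (simp add: algebra_simps del: gegenbauer.simps)
  qed
  also have "... = (real n + 2)*?I (%x. ?c n x*?c (Suc (Suc n)) x) + (real n + 2 * s + 1)*?I (%x. ?c n x*?c n x)"
   by (subst wint_add) (intro s1 continuous_intros | simp only: wint_scale)+
  also have "?I (%x. ?c n x*?c (Suc (Suc n)) x) = 0"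
   by (rule gegenbauer_orthogonal[OF s]) simp
  finally show ?thesis unfolding wint_scale by (simp add: geg_sqnorm_def power2_eq_square)
 qed
 have "(real n + 1)*(real n + s + 3/2)*geg_sqnorm s (Suc n) = (real n + s + 3/2)*((real n + 1)*geg_sqnorm s (Suc n))"
  by (simp only: mult_ac)
 also have "... = (real n + s + 1/2)*((real n + 2 * s + 1)*geg_sqnorm s n)"
  unfolding up[symmetric] dn[symmetric] by (simp only: mult_ac)
 finally show ?thesis by (simp only: mult_ac)
qed

text \<open>By the recurrence \<open>(n + s + 1/2) * geg_sqnorm s n\<close> does not decrease in \<open>n\<close> when
 \<open>s \<ge> 0\<close>.\<close>

lemma geg_sqnorm_lower:
 assumes s: "s >= 0"
 shows "geg_sqnorm s 0*(s + 1/2) <= geg_sqnorm s n*(real n + s + 1/2)" "0 < geg_sqnorm s n"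
proof -
 have "geg_sqnorm s 0*(s + 1/2) <= geg_sqnorm s n*(real n + s + 1/2) \<and> 0 < geg_sqnorm s n"
 proof (induction n)
  case 0
  then show ?case using geg_sqnorm_0_pos[of s] s by simp
 next
  case (Suc n)
  let ?h = "geg_sqnorm s n" and ?k = "geg_sqnorm s (Suc n)"
  have e: "(real n + 1)*(?k*(real n + s + 3/2)) = (real n + 2 * s + 1)*(?h*(real n + s + 1/2))"
   using geg_sqnorm_Suc[of s n] s by (simp add: mult_ac)
  have "(real n + 1)*(?h*(real n + s + 1/2)) <= (real n + 2 * s + 1)*(?h*(real n + s + 1/2))"
   using Suc s by (intro mult_right_mono) auto
  then have "(real n + 1)*(?h*(real n + s + 1/2)) <= (real n + 1)*(?k*(real n + s + 3/2))"
   unfolding e .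
  then have m: "?h*(real n + s + 1/2) <= ?k*(real n + s + 3/2)"
   by (rule mult_left_le_imp_le) simp
  moreover have "0 < ?h*(real n + s + 1/2)"
   using Suc s by simp
  ultimately have "0 < ?k*(real n + s + 3/2)" by linarith
  then have "0 < ?k" using s by (simp add: zero_less_mult_iff)
  with m Suc show ?case by (simp add: algebra_simps)
 qed
 then show "geg_sqnorm s 0*(s + 1/2) <= geg_sqnorm s n*(real n + s + 1/2)" "0 < geg_sqnorm s n"
  by auto
qed

lemma normalized_gegenbauer_alt:
 "normalized_gegenbauer s n = (%x. (1/sqrt (geg_sqnorm s n))*poly (geg s n) x)"
 by (simp add: fun_eq_iff normalized_gegenbauer_def gegenbauer_norm_eq)

lemma normalized_gegenbauer_poly:
 "normalized_gegenbauer s n = poly (smult (1/sqrt (geg_sqnorm s n)) (geg s n))"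
 by (simp add: fun_eq_iff normalized_gegenbauer_def gegenbauer_norm_eq)

lemma normalized_gegenbauer_continuous: "continuous_on A (normalized_gegenbauer s n)"
 unfolding normalized_gegenbauer_poly by (intro continuous_intros)

lemma normalized_gegenbauer_L2:
 "s > -1 ==> normalized_gegenbauer s n \<in> L2 (jacobi_measure s)"
 unfolding normalized_gegenbauer_poly by (rule L2_jacobi_poly)

text \<open>Orthogonality holds because the polynomials belong to different eigenvalues of a symmetric operator. They
 are total because they span all polynomials, and the moments determine a function.\<close>

theorem gegenbauer_basis:
 assumes s: "s >= 0"
 shows "L2_basis (jacobi_measure s) (normalized_gegenbauer s)"
proof -
 have s1: "s > -1" using s by simp
 interpret finite_measure "jacobi_measure s" by (rule finite_jacobi_measure[OF s1])
 show ?thesis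
 proof
  show sq: "normalized_gegenbauer s n \<in> L2 (jacobi_measure s)" for n
   by (rule normalized_gegenbauer_L2[OF s1])
  show "L2_inner (jacobi_measure s) (normalized_gegenbauer s m) (normalized_gegenbauer s n) = (if m = n then 1 else 0)" for m n
  proof -
   have "L2_inner (jacobi_measure s) (normalized_gegenbauer s m) (normalized_gegenbauer s n)
     = wint s (%x. (1/sqrt (geg_sqnorm s m)*(1/sqrt (geg_sqnorm s n)))*(poly (geg s m) x*poly (geg s n) x))"
    unfolding wint_eq_L2_inner[OF sq sq, symmetric]
    by (simp add: normalized_gegenbauer_alt mult_ac)
   also have "... = 1/sqrt (geg_sqnorm s m)*(1/sqrt (geg_sqnorm s n))*wint s (%x. poly (geg s m) x*poly (geg s n) x)"
    by (rule wint_scale)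
   also have "... = (if m = n then 1 else 0)"
   proof (cases "m = n")
    case True
    then show ?thesis
     using geg_sqnorm_lower(2)[OF s, of n] by (simp add: geg_sqnorm_def power2_eq_square)
   next
    case False
    then show ?thesis using gegenbauer_orthogonal[of s m n] s by simp
   qed
   finally show ?thesis .
  qed
  fix v assume v: "v \<in> L2 (jacobi_measure s)"
   and 0: "!!n. L2_inner (jacobi_measure s) v (normalized_gegenbauer s n) = 0"
  have g0: "L2_inner (jacobi_measure s) (poly (geg s n)) v = 0" for n
  proof -
   have "(1/sqrt (geg_sqnorm s n))*L2_inner (jacobi_measure s) (poly (geg s n)) v = 0"
    using 0[of n] unfolding L2_inner_commute[of _ v] normalized_gegenbauer_alt L2_inner_scale_left .
   then show ?thesis using geg_sqnorm_lower(2)[OF s, of n] by simp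
  qed
  have p0: "L2_inner (jacobi_measure s) (poly p) v = 0" for p
  proof -
   obtain c where c: "p = (\<Sum>j\<le>degree p. smult (c j) (geg s j))"
    using gegenbauer_span[of "s + 1/2" p "degree p"] s by auto
   have "L2_inner (jacobi_measure s) (%x. \<Sum>j\<le>degree p. c j*poly (geg s j) x) v
     = (\<Sum>j\<le>degree p. L2_inner (jacobi_measure s) (%x. c j*poly (geg s j) x) v)"
    by (intro L2_inner_sum_left v L2_scale L2_jacobi_poly s1)
   also have "... = 0"
    by (simp only: L2_inner_scale_left g0) simp
   also have "(%x. \<Sum>j\<le>degree p. c j*poly (geg s j) x) = poly p"
    by (subst (2) c) (simp add: fun_eq_iff poly_sum)
   finally show ?thesis .
  qed
  show "AE x in jacobi_measure s. v x = 0"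
  proof (rule moments_determine_zero[OF s1 v])
   show "(LINT x|jacobi_measure s. v x*x^n) = 0" for n
    using p0[of "monom 1 n"] by (simp add: L2_inner_def poly_monom mult.commute)
  qed
 qed
qed

section \<open>The Riesz potential of the singular weight is constant\<close>

definition chord_ratio :: "real => real => real" where
 "chord_ratio x y = (y - x)/sqrt (1 - y\<^sup>2)"

definition chord_inverse :: "real => real => real" where
 "chord_inverse x t = (x + t * sqrt (1 + t\<^sup>2 - x\<^sup>2))/(1 + t\<^sup>2)"

lemma chord_ratio_aux:
 assumes x: "x \<in> {-1<..<1}" and y: "y \<in> {-1<..<1}"
 shows "1 + (chord_ratio x y)\<^sup>2 = (1 - 2*x*y + x\<^sup>2)/(1 - y\<^sup>2)"
  "sqrt (1 + (chord_ratio x y)\<^sup>2 - x\<^sup>2) = (1 - x*y)/sqrt (1 - y\<^sup>2)"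
  "0 < 1 - x*y" "0 < 1 - 2*x*y + x\<^sup>2"
proof -
 have p: "1 - y\<^sup>2 > 0" using one_minus_sq_pos[OF y] .
 have q: "1 - x\<^sup>2 > 0" using one_minus_sq_pos[OF x] .
 show xy: "0 < 1 - x*y"
 proof -
  have "\<bar>x\<bar> < 1" "\<bar>y\<bar> < 1" using x y by auto
  then have "\<bar>x*y\<bar> < 1" using abs_mult_less[of x 1 y 1] by (simp add: abs_mult)
  then show ?thesis by simp
 qed
 have "1 - 2*x*y + x\<^sup>2 = (1 - y\<^sup>2) + (x - y)\<^sup>2"
  by (simp add: power2_eq_square algebra_simps)
 then show "0 < 1 - 2*x*y + x\<^sup>2"
  using p zero_le_power2[of "x - y"] by linarith
 have t2: "(chord_ratio x y)\<^sup>2 = (y - x)\<^sup>2/(1 - y\<^sup>2)"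
  using p by (simp add: chord_ratio_def power_divide)
 show "1 + (chord_ratio x y)\<^sup>2 = (1 - 2*x*y + x\<^sup>2)/(1 - y\<^sup>2)"
  unfolding t2 using p by (simp add: field_simps power2_eq_square)
 have "1 + (chord_ratio x y)\<^sup>2 - x\<^sup>2 = (1 - x*y)\<^sup>2/(1 - y\<^sup>2)"
  unfolding t2 using p by (simp add: field_simps power2_eq_square)
 then show "sqrt (1 + (chord_ratio x y)\<^sup>2 - x\<^sup>2) = (1 - x*y)/sqrt (1 - y\<^sup>2)"
  using xy by (simp add: real_sqrt_divide)
qed

lemma chord_inverse_ratio:
 assumes x: "x \<in> {-1<..<1}" and y: "y \<in> {-1<..<1}"
 shows "chord_inverse x (chord_ratio x y) = y"
proof -
 define r where "r = sqrt (1 - y\<^sup>2)"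
 have r: "r > 0" "r*r = 1 - y\<^sup>2"
  using one_minus_sq_pos[OF y] by (auto simp: r_def)
 note a = chord_ratio_aux[OF x y]
 have n: "x + chord_ratio x y * sqrt (1 + (chord_ratio x y)\<^sup>2 - x\<^sup>2) = y*((1 - 2*x*y + x\<^sup>2)/(1 - y\<^sup>2))"
 proof -
  have "chord_ratio x y*((1 - x*y)/sqrt (1 - y\<^sup>2)) = (y - x)*(1 - x*y)/(1 - y\<^sup>2)"
   unfolding chord_ratio_def using r by (simp add: r_def[symmetric])
  then show ?thesis
   unfolding a(2) using one_minus_sq_pos[OF y] by (simp add: field_simps power2_eq_square)
 qed
 show ?thesis
  unfolding chord_inverse_def n unfolding a(1) using a(4) one_minus_sq_pos[OF y] by simp
qed

lemma chord_ratio_inverse: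
 assumes x: "x \<in> {-1<..<1}"
 shows "chord_inverse x t \<in> {-1<..<1}" "chord_ratio x (chord_inverse x t) = t"
proof -
 define S where "S = sqrt (1 + t\<^sup>2 - x\<^sup>2)"
 have q: "1 - x\<^sup>2 > 0" using one_minus_sq_pos[OF x] .
 have "1 + t\<^sup>2 - x\<^sup>2 > 0" using q zero_le_power2[of t] by linarith
 then have S2: "S\<^sup>2 = 1 + t\<^sup>2 - x\<^sup>2" and Sp: "S > 0"
  by (simp_all add: S_def)
 have T: "1 + t\<^sup>2 > 0" by (simp add: add_pos_nonneg)
 have "(x*t)\<^sup>2 < S\<^sup>2"
 proof -
  have "S\<^sup>2 - (x*t)\<^sup>2 = (1 - x\<^sup>2)*(1 + t\<^sup>2)"
   unfolding S2 by (simp add: algebra_simps power2_eq_square)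
  then show ?thesis using q T by (metis diff_gt_0_iff_gt mult_pos_pos)
 qed
 then have "\<bar>x*t\<bar> < S"
  using Sp by (metis abs_le_square_iff abs_of_pos not_le)
 then have R: "S - x*t > 0" by linarith
 have e: "1 - (chord_inverse x t)\<^sup>2 = ((S - x*t)/(1 + t\<^sup>2))\<^sup>2"
 proof -
  have "(1 + t\<^sup>2)\<^sup>2 - (x + t*S)\<^sup>2 = (1 + t\<^sup>2)\<^sup>2 - (x\<^sup>2 + 2*x*t*S + t\<^sup>2*S\<^sup>2)"
   by (simp add: power2_eq_square algebra_simps)
  also have "... = S\<^sup>2 - 2*x*t*S + x\<^sup>2*t\<^sup>2"
   unfolding S2 by (simp add: power2_eq_square algebra_simps)
  also have "... = (S - x*t)\<^sup>2"
   by (simp add: power2_eq_square algebra_simps)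
  finally have "(1 + t\<^sup>2)\<^sup>2 - (x + t*S)\<^sup>2 = (S - x*t)\<^sup>2" .
  then have "((1 + t\<^sup>2)\<^sup>2 - (x + t*S)\<^sup>2)/(1 + t\<^sup>2)\<^sup>2 = (S - x*t)\<^sup>2/(1 + t\<^sup>2)\<^sup>2"
   by simp
  then have "1 - (x + t*S)\<^sup>2/(1 + t\<^sup>2)\<^sup>2 = (S - x*t)\<^sup>2/(1 + t\<^sup>2)\<^sup>2"
   using T unfolding diff_divide_distrib by simp
  then show ?thesis
   unfolding chord_inverse_def S_def[symmetric] power_divide .
 qed
 have "(chord_inverse x t)\<^sup>2 < 1"
 proof -
  have "0 < ((S - x*t)/(1 + t\<^sup>2))\<^sup>2" using R T by simp
  then show ?thesis using e by linarith
 qed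
 then show "chord_inverse x t \<in> {-1<..<1}"
  by (simp add: abs_square_less_1 abs_less_iff)
 have sq: "sqrt (1 - (chord_inverse x t)\<^sup>2) = (S - x*t)/(1 + t\<^sup>2)"
  unfolding e using R T by (intro real_sqrt_unique) auto
 have "chord_inverse x t - x = t*((S - x*t)/(1 + t\<^sup>2))"
  unfolding chord_inverse_def S_def[symmetric] using T by (simp add: field_simps power2_eq_square)
 then show "chord_ratio x (chord_inverse x t) = t"
  unfolding chord_ratio_def sq using R T by simp
qed

lemma chord_ratio_deriv:
 assumes y: "y \<in> {-1<..<1}"
 shows "((chord_ratio x) has_real_derivative (1 - x*y)/((1 - y\<^sup>2) * sqrt (1 - y\<^sup>2))) (at y)"
proof -
 have p: "1 - y\<^sup>2 > 0" using one_minus_sq_pos[OF y] .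
 have ds: "((%y. sqrt (1 - y\<^sup>2)) has_real_derivative (- y/sqrt (1 - y\<^sup>2))) (at y)"
  by (rule derivative_eq_intros refl | use p in \<open>simp add: field_simps\<close>)+
 have "(chord_ratio x has_real_derivative ((1 - 0) * sqrt (1 - y\<^sup>2) - (y - x)*(- y/sqrt (1 - y\<^sup>2)))
   / (sqrt (1 - y\<^sup>2) * sqrt (1 - y\<^sup>2))) (at y)"
  unfolding chord_ratio_def[abs_def]
  by (intro DERIV_divide DERIV_diff DERIV_ident DERIV_const ds) (use p in simp)
 also have "((1 - 0) * sqrt (1 - y\<^sup>2) - (y - x)*(- y/sqrt (1 - y\<^sup>2)))/(sqrt (1 - y\<^sup>2) * sqrt (1 - y\<^sup>2))
   = (1 - x*y)/((1 - y\<^sup>2) * sqrt (1 - y\<^sup>2))"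
 proof -
  define r where "r = sqrt (1 - y\<^sup>2)"
  have r: "r > 0" "r*r = 1 - y\<^sup>2" using p by (auto simp: r_def)
  have "(1 - 0)*r - (y - x)*(- y/r) = (r*r + (y - x)*y)/r"
   using r(1) by (simp add: field_simps)
  also have "r*r + (y - x)*y = 1 - x*y"
   unfolding r(2) by (simp add: power2_eq_square algebra_simps)
  finally show ?thesis
   unfolding r_def[symmetric] unfolding r(2)[symmetric] using r(1) by simp
 qed
 finally show ?thesis .
qed

text \<open>With \<open>t = (y - x) / sqrt (1 - y\<^sup>2)\<close> the measure \<open>dy / sqrt (1 - y\<^sup>2)\<close> on the interval
 becomes \<open>dt / (1 + t\<^sup>2)\<close> on the line plus a term that is odd in \<open>t\<close>; the odd term is all
 that depends on \<open>x\<close>, and it integrates to zero against an even function.\<close>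

theorem chord_substitution:
 fixes h :: "real => real"
 assumes x: "x \<in> {-1<..<1}" and hb [measurable]: "h \<in> borel_measurable borel"
  and even: "!!t. h (- t) = h t" and hi: "integrable lebesgue (%t. h t/(1 + t\<^sup>2))"
 shows "integrable lebesgue (%y. jacobi (-1/2) y*h (chord_ratio x y))"
  and "(LINT y|lebesgue. jacobi (-1/2) y*h (chord_ratio x y)) = (LINT t|lebesgue. h t/(1 + t\<^sup>2))"
proof -
 define S where "S t = sqrt (1 + t\<^sup>2 - x\<^sup>2)" for t
 define o1 where "o1 t = h t/(1 + t\<^sup>2)*(x*t/S t)" for t
 define f where "f t = h t/(1 + t\<^sup>2) - o1 t" for t
 have q: "1 - x\<^sup>2 > 0" using one_minus_sq_pos[OF x] .
 have Sp: "S t > 0" for t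
 proof -
  have "1 + t\<^sup>2 - x\<^sup>2 > 0" using q zero_le_power2[of t] by linarith
  then show ?thesis by (simp add: S_def)
 qed
 have b: "\<bar>x*t/S t\<bar> <= 1" for t
 proof -
  have "(x*t)\<^sup>2 <= (S t)\<^sup>2"
  proof -
   have "(S t)\<^sup>2 = 1 + t\<^sup>2 - x\<^sup>2"
    using Sp[of t] unfolding S_def by simp
   moreover have "1 + t\<^sup>2 - x\<^sup>2 - (x*t)\<^sup>2 = (1 - x\<^sup>2)*(1 + t\<^sup>2)"
    by (simp add: algebra_simps power2_eq_square)
   moreover have "0 <= (1 - x\<^sup>2)*(1 + t\<^sup>2)"
    using q by (intro mult_nonneg_nonneg) auto
   ultimately show ?thesis by linarith
  qed
  then have "\<bar>x*t\<bar> <= S t"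
   using Sp[of t] abs_le_square_iff[of "x*t" "S t"] by simp
  then show ?thesis using Sp[of t] by simp
 qed
 have o1i: "integrable lebesgue o1"
 proof (rule Bochner_Integration.integrable_bound[OF hi])
  have "o1 \<in> borel_measurable borel"
   unfolding o1_def S_def by measurable
  then show "o1 \<in> borel_measurable lebesgue" by (rule lebesgue_measurableI)
  have "\<bar>o1 t\<bar> <= \<bar>h t/(1 + t\<^sup>2)\<bar>" for t
   unfolding o1_def abs_mult using mult_left_le[OF b[of t], of "\<bar>h t/(1 + t\<^sup>2)\<bar>"] by simp
  then show "AE t in lebesgue. norm (o1 t) <= norm (h t/(1 + t\<^sup>2))" by simp
 qed
 have "(LINT t|lebesgue. o1 t) = (LINT t|lebesgue. o1 (- t))"
  using lebesgue_integral_real_affine[of "-1" o1 0] by simp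
 also have "(%t. o1 (- t)) = (%t. - o1 t)"
  by (simp add: o1_def even S_def fun_eq_iff)
 finally have o0: "(LINT t|lebesgue. o1 t) = 0" by simp
 have fi: "integrable lebesgue f" and fv: "(LINT t|lebesgue. f t) = (LINT t|lebesgue. h t/(1 + t\<^sup>2))"
  unfolding f_def using hi o1i o0 by simp_all
 let ?g' = "%y. (1 - x*y)/((1 - y\<^sup>2) * sqrt (1 - y\<^sup>2))"
 let ?A = "{-1<..<1::real}"
 have img: "chord_ratio x ` ?A = UNIV"
  using chord_ratio_inverse[OF x] by (metis UNIV_eq_I image_eqI)
 have inj: "inj_on (chord_ratio x) ?A"
  by (rule inj_on_inverseI[where g="chord_inverse x"]) (rule chord_inverse_ratio[OF x])
 have "f absolutely_integrable_on (chord_ratio x ` ?A) \<and> integral (chord_ratio x ` ?A) f = (LINT t|lebesgue. f t)"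
  unfolding img using fi by (simp add: set_integrable_def integral_lebesgue)
 then have *: "(%y. \<bar>?g' y\<bar>*f (chord_ratio x y)) absolutely_integrable_on ?A \<and>
   integral ?A (%y. \<bar>?g' y\<bar>*f (chord_ratio x y)) = (LINT t|lebesgue. f t)"
  by (subst has_absolute_integral_change_of_variables_1'[OF _ _ inj, where g'="?g'"])
    (auto intro!: has_field_derivative_at_within[OF chord_ratio_deriv])
 have e: "\<bar>?g' y\<bar>*f (chord_ratio x y) = (1 - y\<^sup>2) powr (-1/2)*h (chord_ratio x y)" if y: "y \<in> ?A" for y
 proof -
  define r where "r = sqrt (1 - y\<^sup>2)"
  have r: "r > 0" "r*r = 1 - y\<^sup>2"
   using one_minus_sq_pos[OF y] by (auto simp: r_def)
  define B where "B = 1 - 2*x*y + x\<^sup>2"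
  note a = chord_ratio_aux[OF x y]
  have B: "B > 0" using a(4) by (simp add: B_def)
  have cr: "chord_ratio x y = (y - x)/r" by (simp add: chord_ratio_def r_def)
  have S: "S (chord_ratio x y) = (1 - x*y)/r"
   unfolding S_def a(2) r_def ..
  have "f (chord_ratio x y) = h (chord_ratio x y)*((r*r/B)*(1 - x*((y - x)/r)/((1 - x*y)/r)))"
   unfolding f_def o1_def S a(1) B_def[symmetric] r(2)[symmetric] unfolding cr
   by (simp add: right_diff_distrib)
  also have "1 - x*((y - x)/r)/((1 - x*y)/r) = B/(1 - x*y)"
   using r(1) a(3) by (simp add: B_def field_simps power2_eq_square)
  also have "(r*r/B)*(B/(1 - x*y)) = (1 - y\<^sup>2)/(1 - x*y)"
   using B r by simp
  finally have f: "f (chord_ratio x y) = h (chord_ratio x y)*((1 - y\<^sup>2)/(1 - x*y))" .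
  have g: "\<bar>?g' y\<bar> = (1 - x*y)/((1 - y\<^sup>2)*r)"
   unfolding r_def using a(3) one_minus_sq_pos[OF y] by simp
  have p: "(1 - y\<^sup>2) powr (-1/2) = 1/r"
  proof -
   have "(1 - y\<^sup>2) powr (- (1/2)) = inverse ((1 - y\<^sup>2) powr (1/2))" by (rule powr_minus)
   then show ?thesis
    using one_minus_sq_pos[OF y] by (simp add: r_def powr_half_sqrt inverse_eq_divide)
  qed
  have cancel: "A/(P*r)*(H*(P/A)) = 1/r*H" if "A > 0" "P > 0" for A P H
   using that by simp
  show ?thesis unfolding f g p
   by (rule cancel[OF a(3) one_minus_sq_pos[OF y]])
 qed
 have si: "set_integrable lebesgue ?A (%y. (1 - y\<^sup>2) powr (-1/2)*h (chord_ratio x y))"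
  using conjunct1[OF *] by (rule set_integrable_cong[THEN iffD1, rotated 3]) (use e in auto)
 then show "integrable lebesgue (%y. jacobi (-1/2) y*h (chord_ratio x y))"
  by (simp add: set_integrable_def jacobi_def mult.assoc)
 have "(LINT y|lebesgue. jacobi (-1/2) y*h (chord_ratio x y))
   = (LINT y:?A|lebesgue. (1 - y\<^sup>2) powr (-1/2)*h (chord_ratio x y))"
  by (simp add: set_lebesgue_integral_def jacobi_def mult.assoc)
 also have "... = integral ?A (%y. (1 - y\<^sup>2) powr (-1/2)*h (chord_ratio x y))"
  by (rule set_lebesgue_integral_eq_integral(2)[OF si])
 also have "... = integral ?A (%y. \<bar>?g' y\<bar>*f (chord_ratio x y))"
  by (rule Henstock_Kurzweil_Integration.integral_cong) (use e in simp)
 also have "... = (LINT t|lebesgue. h t/(1 + t\<^sup>2))"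
  using * fv by simp
 finally show "(LINT y|lebesgue. jacobi (-1/2) y*h (chord_ratio x y)) = (LINT t|lebesgue. h t/(1 + t\<^sup>2))" .
qed

lemma integrable_abs_powr:
 fixes R :: real
 assumes "c > -1" "R >= 0" shows "integrable lebesgue (%t. indicator {-R..R} t*\<bar>t\<bar> powr c)"
proof -
 have "(%x::real. x powr c) absolutely_integrable_on {0..R}"
  using assms by (intro nonnegative_absolutely_integrable_1 integrable_on_powr_from_0) auto
 then have i0: "integrable lebesgue (%x::real. indicator {0..R} x*x powr c)"
  by (simp add: set_integrable_def)
 have i2: "integrable lebesgue (%x. indicator {0..R} (0 + (-1)*x)*(0 + (-1)*x :: real) powr c)"
  by (rule lebesgue_integrable_real_affine[OF i0]) simp
 have "integrable lebesgue (%x. indicator {0..R} x*x powr c + indicator {0..R} (0 + (-1)*x)*(0 + (-1)*x) powr c)"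
  by (intro Bochner_Integration.integrable_add i0 i2)
 also have "(%x. indicator {0..R} x*x powr c + indicator {0..R} (0 + (-1)*x)*(0 + (-1)*x) powr c)
   = (%t. indicator {-R..R} t*\<bar>t\<bar> powr c)"
  using assms by (auto simp: fun_eq_iff indicator_def)
 finally show ?thesis .
qed

lemma integrable_abs_powr_rational:
 assumes "-1 < c" "c < 1" shows "integrable lebesgue (%t::real. \<bar>t\<bar> powr c/(1 + t\<^sup>2))"
proof -
 have "((%t::real. t powr (c - 2)) has_integral (-(1 powr (c - 2 + 1))/(c - 2 + 1))) {1..}"
  using assms by (intro has_integral_powr_to_inf) auto
 then have "(%x::real. x powr (c - 2)) absolutely_integrable_on {1..}"
  by (intro nonnegative_absolutely_integrable_1) auto
 then have i0: "integrable lebesgue (%x::real. indicator {1..} x*x powr (c - 2))"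
  by (simp add: set_integrable_def)
 have i2: "integrable lebesgue (%x. indicator {1..} (0 + (-1)*x)*(0 + (-1)*x :: real) powr (c - 2))"
  by (rule lebesgue_integrable_real_affine[OF i0]) simp
 have i3: "integrable lebesgue (%t::real. indicator {-1..1} t*\<bar>t\<bar> powr c)"
  using assms by (intro integrable_abs_powr) auto
 show ?thesis
 proof (rule Bochner_Integration.integrable_bound)
  show "integrable lebesgue (%t::real. indicator {-1..1} t*\<bar>t\<bar> powr c + (indicator {1..} t*t powr (c - 2)
    + indicator {1..} (0 + (-1)*t)*(0 + (-1)*t) powr (c - 2)))"
   by (intro Bochner_Integration.integrable_add i0 i2 i3)
  show "(%t::real. \<bar>t\<bar> powr c/(1 + t\<^sup>2)) \<in> borel_measurable lebesgue"
   by (intro lebesgue_measurableI) measurable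
  have "\<bar>t\<bar> powr c/(1 + t\<^sup>2) <= indicator {-1..1} t*\<bar>t\<bar> powr c + (indicator {1..} t*t powr (c - 2)
    + indicator {1..} (-t)*(-t) powr (c - 2))" for t :: real
  proof (cases "\<bar>t\<bar> <= 1")
   case True
   have "\<bar>t\<bar> powr c/(1 + t\<^sup>2) <= \<bar>t\<bar> powr c/1"
    by (intro divide_left_mono) (auto simp: add_pos_nonneg)
   also have "... = indicator {-1..1} t*\<bar>t\<bar> powr c"
    using True by (simp add: abs_le_iff)
   also have "... <= ... + (indicator {1..} t*t powr (c - 2) + indicator {1..} (-t)*(-t) powr (c - 2))"
    by simp
   finally show ?thesis .
  next
   case False
   then have "\<bar>t\<bar> powr c/(1 + t\<^sup>2) <= \<bar>t\<bar> powr c/\<bar>t\<bar>\<^sup>2"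
    by (intro divide_left_mono) (auto simp: add_pos_nonneg)
   also have "... = \<bar>t\<bar> powr (c - 2)"
    using False by (simp add: powr_diff powr_realpow)
   also have "... = indicator {1..} t*t powr (c - 2) + indicator {1..} (-t)*(-t) powr (c - 2)"
    using False by (auto simp: indicator_def abs_if)
   also have "... <= indicator {-1..1} t*\<bar>t\<bar> powr c + ..."
    by simp
   finally show ?thesis .
  qed
  then have "norm (\<bar>t\<bar> powr c/(1 + t\<^sup>2)) <= norm (indicator {-1..1} t*\<bar>t\<bar> powr c + (indicator {1..} t*t powr (c - 2)
    + indicator {1..} (0 + (-1)*t)*(0 + (-1)*t) powr (c - 2)))" for t :: real
   by (simp add: order_trans[OF _ abs_ge_self])
  then show "AE t in lebesgue. norm (\<bar>t\<bar> powr c/(1 + t\<^sup>2)) <= norm (indicator {-1..1::real} t*\<bar>t\<bar> powr c + (indicator {1..} t*t powr (c - 2)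
    + indicator {1..} (0 + (-1)*t)*(0 + (-1)*t) powr (c - 2)))"
   by blast
 qed
qed

lemma abs_ln_bound:
 fixes t :: real assumes "t >= 0" "0 < a"
 shows "\<bar>ln t\<bar> <= (t powr a + t powr (- a))/a"
proof (cases "t = 0")
 case False
 then have t: "t > 0" using assms by simp
 show ?thesis
 proof (cases "t >= 1")
  case True
  have "\<bar>ln t\<bar> <= t powr a/a"
   using ln_powr_bound[OF True assms(2)] True by simp
  also have "... <= (t powr a + t powr (- a))/a"
   using assms by (intro divide_right_mono) auto
  finally show ?thesis .
 next
  case False
  have "ln (1/t) <= (1/t) powr a/a"
   by (rule ln_powr_bound) (use t False assms in auto)
  then have "\<bar>ln t\<bar> <= t powr (- a)/a"
   using t False by (simp add: ln_div powr_minus_divide powr_divide)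
  also have "... <= (t powr a + t powr (- a))/a"
   using assms by (intro divide_right_mono) auto
  finally show ?thesis .
 qed
qed simp

lemma integrable_abs_ln_rational: "integrable lebesgue (%t::real. \<bar>ln \<bar>t\<bar>\<bar>/(1 + t\<^sup>2))"
proof (rule Bochner_Integration.integrable_bound)
 show "integrable lebesgue (%t::real. 2*(\<bar>t\<bar> powr (1/2)/(1 + t\<^sup>2)) + 2*(\<bar>t\<bar> powr (-1/2)/(1 + t\<^sup>2)))"
  by (intro Bochner_Integration.integrable_add integrable_mult_right integrable_abs_powr_rational) auto
 show "(%t::real. \<bar>ln \<bar>t\<bar>\<bar>/(1 + t\<^sup>2)) \<in> borel_measurable lebesgue"
  by (intro lebesgue_measurableI) measurable
 have "\<bar>ln \<bar>t\<bar>\<bar>/(1 + t\<^sup>2) <= 2*(\<bar>t\<bar> powr (1/2)/(1 + t\<^sup>2)) + 2*(\<bar>t\<bar> powr (-1/2)/(1 + t\<^sup>2))" for t :: real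
 proof -
  have "\<bar>ln \<bar>t\<bar>\<bar>/(1 + t\<^sup>2) <= ((\<bar>t\<bar> powr (1/2) + \<bar>t\<bar> powr (- (1/2)))/(1/2))/(1 + t\<^sup>2)"
   by (intro divide_right_mono abs_ln_bound) auto
  then show ?thesis by (simp add: add_divide_distrib distrib_left mult.commute)
 qed
 then have "norm (\<bar>ln \<bar>t\<bar>\<bar>/(1 + t\<^sup>2)) <= norm (2*(\<bar>t\<bar> powr (1/2)/(1 + t\<^sup>2)) + 2*(\<bar>t\<bar> powr (-1/2)/(1 + t\<^sup>2)))" for t :: real
  by (simp add: order_trans[OF _ abs_ge_self])
 then show "AE t in lebesgue. norm (\<bar>ln \<bar>t :: real\<bar>\<bar>/(1 + t\<^sup>2)) <= norm (2*(\<bar>t\<bar> powr (1/2)/(1 + t\<^sup>2)) + 2*(\<bar>t\<bar> powr (-1/2)/(1 + t\<^sup>2)))"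
  by blast
qed

lemma K_kernel_borel [measurable]: "K_kernel s \<in> borel_measurable borel"
 unfolding K_kernel_def by measurable

lemma Cs_times: 
 assumes "0 < s" "s < 1" "s ~= 1/2" shows "Cs s*(1 - 2 * s) = Gamma (2 * s) * sin (pi * s)/pi"
proof -
 have "2 * s - 1 \<notin> \<int>\<^sub>\<le>\<^sub>0"
 proof
  assume "2 * s - 1 \<in> \<int>\<^sub>\<le>\<^sub>0"
  then obtain n where "2 * s - 1 = - real n" by (auto elim!: nonpos_Ints_cases')
  with assms show False by (cases n) auto
 qed
 then have "Gamma (2 * s) = (2 * s - 1)*Gamma (2 * s - 1)"
  using Gamma_plus1[of "2 * s - 1"] by simp
 then show ?thesis unfolding Cs_def by (simp only:) (simp add: field_simps)
qed

lemma jacobi_chord: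
 assumes y: "y \<in> {-1<..<1}"
 shows "jacobi (s - 1) y*\<bar>x - y\<bar> powr (1 - 2 * s) = jacobi (-1/2) y*\<bar>chord_ratio x y\<bar> powr (1 - 2 * s)"
proof -
 have p: "1 - y\<^sup>2 > 0" by (rule one_minus_sq_pos[OF y])
 have "\<bar>chord_ratio x y\<bar> powr (1 - 2 * s) = \<bar>x - y\<bar> powr (1 - 2 * s)/(sqrt (1 - y\<^sup>2)) powr (1 - 2 * s)"
  using p unfolding chord_ratio_def by (simp add: abs_divide powr_divide abs_minus_commute)
 also have "(sqrt (1 - y\<^sup>2)) powr (1 - 2 * s) = (1 - y\<^sup>2) powr (1/2 - s)"
  using p by (simp add: powr_half_sqrt[symmetric] powr_powr) (simp add: field_simps)
 finally have "(1 - y\<^sup>2) powr (-1/2)*\<bar>chord_ratio x y\<bar> powr (1 - 2 * s)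
   = ((1 - y\<^sup>2) powr (-1/2)/(1 - y\<^sup>2) powr (1/2 - s))*\<bar>x - y\<bar> powr (1 - 2 * s)"
  by simp
 also have "(1 - y\<^sup>2) powr (-1/2)/(1 - y\<^sup>2) powr (1/2 - s) = (1 - y\<^sup>2) powr (s - 1)"
  by (simp add: powr_diff[symmetric])
 finally show ?thesis using y by (simp add: jacobi_def)
qed

text \<open>For \<open>s \<noteq> 1/2\<close> the constant potential and \<open>1 - 2 s\<close> combine to a positive number, because
 \<open>(1 - 2 s) Cs s\<close> is positive; for \<open>s = 1/2\<close> the same role is played by the mass of the weight.\<close>

definition riesz_const :: "real => real" where
 "riesz_const s = (if s = 1/2 then wint (-1/2) (%_. 1)/pi
   else (1 - 2 * s)*Cs s*(LINT t|lebesgue. \<bar>t\<bar> powr (1 - 2 * s)/(1 + t\<^sup>2)))"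

text \<open>By \<open>jacobi_chord\<close> the integrand is a function of the chord ratio times \<open>(1 - y\<^sup>2)
 powr (-1/2)\<close>, and the chord substitution removes \<open>x\<close>. For \<open>s = 1/2\<close> the logarithm of
 the chord ratio differs from that of the distance by a function of \<open>y\<close> alone, whose integral is again
 independent of \<open>x\<close>.\<close>

lemma riesz_potential_weight:
 assumes s: "0 < s" "s < 1"
 obtains c C where
  "!!x. x \<in> {-1<..<1} ==> integrable lebesgue (%y. K_kernel s (x - y)*jacobi (s - 1) y)"
  "!!x. x \<in> {-1<..<1} ==> (LINT y|lebesgue. K_kernel s (x - y)*jacobi (s - 1) y) = c"
  "!!x. x \<in> {-1<..<1} ==> (LINT y|lebesgue. \<bar>K_kernel s (x - y)*jacobi (s - 1) y\<bar>) <= C"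
  "s ~= 1/2 ==> (1 - 2 * s)*c = riesz_const s"
proof (cases "s = 1/2")
 case False
 let ?h = "%t::real. \<bar>t\<bar> powr (1 - 2 * s)"
 let ?c = "(LINT t|lebesgue. \<bar>t\<bar> powr (1 - 2 * s)/(1 + t\<^sup>2))"
 have hi: "integrable lebesgue (%t::real. ?h t/(1 + t\<^sup>2))"
  using s by (intro integrable_abs_powr_rational) auto
 have hm: "?h \<in> borel_measurable borel" by measurable
 have e: "K_kernel s (x - y)*jacobi (s - 1) y = Cs s*(jacobi (-1/2) y*?h (chord_ratio x y))" for x y
  using jacobi_chord[of y s x] False
  by (cases "y \<in> {-1<..<1}") (simp_all add: K_kernel_def jacobi_outside mult_ac)
 have ea: "\<bar>K_kernel s (x - y)*jacobi (s - 1) y\<bar> = \<bar>Cs s\<bar>*(jacobi (-1/2) y*?h (chord_ratio x y))" for x y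
  unfolding e by (simp add: abs_mult)
 show ?thesis
 proof (rule that[of "Cs s*?c" "\<bar>Cs s\<bar>*?c"])
  fix x :: real assume x: "x \<in> {-1<..<1}"
  note c = chord_substitution[OF x hm _ hi]
  show "integrable lebesgue (%y. K_kernel s (x - y)*jacobi (s - 1) y)"
   unfolding e by (intro integrable_mult_right c) simp
  show "(LINT y|lebesgue. K_kernel s (x - y)*jacobi (s - 1) y) = Cs s*?c"
   unfolding e using c(2) by simp
  show "(LINT y|lebesgue. \<bar>K_kernel s (x - y)*jacobi (s - 1) y\<bar>) <= \<bar>Cs s\<bar>*?c"
   unfolding ea using c(2) by simp
 qed (simp add: riesz_const_def)
next
 case True
 let ?h = "%t::real. ln \<bar>t\<bar>"
 let ?ha = "%t::real. \<bar>ln \<bar>t\<bar>\<bar>"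
 have hai: "integrable lebesgue (%t::real. ?ha t/(1 + t\<^sup>2))"
  by (rule integrable_abs_ln_rational)
 have hi: "integrable lebesgue (%t::real. ?h t/(1 + t\<^sup>2))"
 proof (rule Bochner_Integration.integrable_bound[OF hai])
  show "(%t::real. ?h t/(1 + t\<^sup>2)) \<in> borel_measurable lebesgue"
   by (intro lebesgue_measurableI) measurable
 qed simp
 have hm: "?h \<in> borel_measurable borel" "?ha \<in> borel_measurable borel" by measurable
 let ?W = "%y. jacobi (-1/2) y*ln (1 - y\<^sup>2)"
 have Wi: "integrable lebesgue ?W"
 proof (rule Bochner_Integration.integrable_bound)
  show "integrable lebesgue (%y. 4*jacobi (-1/4) y + 4*jacobi (-3/4) y)"
   by (intro Bochner_Integration.integrable_add integrable_mult_right integrable_jacobi) auto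
  show "?W \<in> borel_measurable lebesgue"
   by (intro lebesgue_measurableI) measurable
  have "\<bar>?W y\<bar> <= \<bar>4*jacobi (-1/4) y + 4*jacobi (-3/4) y\<bar>" for y
  proof (cases "y \<in> {-1<..<1}")
   case True
   have p: "1 - y\<^sup>2 > 0" by (rule one_minus_sq_pos[OF True])
   have "\<bar>?W y\<bar> = (1 - y\<^sup>2) powr (-1/2)*\<bar>ln (1 - y\<^sup>2)\<bar>"
    using True by (simp add: jacobi_def abs_mult)
   also have "... <= (1 - y\<^sup>2) powr (-1/2)*(((1 - y\<^sup>2) powr (1/4) + (1 - y\<^sup>2) powr (- (1/4)))/(1/4))"
    using p by (intro mult_left_mono abs_ln_bound) auto
   also have "... = 4*jacobi (-1/4) y + 4*jacobi (-3/4) y"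
   proof -
    have "(1 - y\<^sup>2) powr (-1/2)*(1 - y\<^sup>2) powr (1/4) = (1 - y\<^sup>2) powr (-1/4)"
     "(1 - y\<^sup>2) powr (-1/2)*(1 - y\<^sup>2) powr (- (1/4)) = (1 - y\<^sup>2) powr (-3/4)"
     by (simp_all add: powr_add[symmetric])
    then show ?thesis using True by (simp add: jacobi_def algebra_simps)
   qed
   finally show ?thesis by simp
  qed (simp add: jacobi_outside)
  then show "AE y in lebesgue. norm (?W y) <= norm (4*jacobi (-1/4) y + 4*jacobi (-3/4) y)"
   by simp
 qed
 have e: "jacobi (-1/2) y*ln \<bar>x - y\<bar> = jacobi (-1/2) y*?h (chord_ratio x y) + ?W y/2" if "x ~= y" for x y
 proof (cases "y \<in> {-1<..<1}")
  case True
  have p: "1 - y\<^sup>2 > 0" by (rule one_minus_sq_pos[OF True])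
  have "?h (chord_ratio x y) = ln \<bar>x - y\<bar> - ln (1 - y\<^sup>2)/2"
   using p that unfolding chord_ratio_def by (simp add: abs_divide ln_div abs_minus_commute ln_sqrt)
  then have "ln \<bar>x - y\<bar> = ?h (chord_ratio x y) + ln (1 - y\<^sup>2)/2" by simp
  then show ?thesis by (simp only: distrib_left)
 qed (simp add: jacobi_outside)
 have AEe: "AE y in lebesgue. K_kernel s (x - y)*jacobi (s - 1) y
   = (jacobi (-1/2) y*?h (chord_ratio x y) + ?W y/2)/pi" for x
 proof -
  have "AE y in lebesgue. y ~= x"
   by (intro AE_completion AE_lborel_singleton)
  then show ?thesis
  proof eventually_elim
   case (elim y)
   have sm: "s - 1 = -1/2" using True by simp
   have k: "K_kernel s (x - y) = ln \<bar>x - y\<bar>/pi" using True by (simp add: K_kernel_def)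
   show ?case
    unfolding sm k using e[of x y] elim by (simp add: mult.commute)
  qed
 qed
 have m: "(%y. K_kernel s (x - y)*jacobi (s - 1) y) \<in> borel_measurable lebesgue" for x
  by (intro lebesgue_measurableI) measurable
 have m2: "(%y. (jacobi (-1/2) y*?h (chord_ratio x y) + ?W y/2)/pi) \<in> borel_measurable lebesgue" for x
  unfolding chord_ratio_def by (intro lebesgue_measurableI) measurable
 let ?c = "((LINT t|lebesgue. ?h t/(1 + t\<^sup>2)) + (LINT y|lebesgue. ?W y)/2)/pi"
 let ?C = "((LINT t|lebesgue. ?ha t/(1 + t\<^sup>2)) + (LINT y|lebesgue. \<bar>?W y\<bar>)/2)/pi"
 show ?thesis
 proof (rule that[of ?c ?C])
  fix x :: real assume x: "x \<in> {-1<..<1}"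
  note c = chord_substitution[OF x hm(1) _ hi]
  note ca = chord_substitution[OF x hm(2) _ hai]
  have i: "integrable lebesgue (%y. (jacobi (-1/2) y*?h (chord_ratio x y) + ?W y/2)/pi)"
   by (intro integrable_divide Bochner_Integration.integrable_add c Wi) simp
  show int: "integrable lebesgue (%y. K_kernel s (x - y)*jacobi (s - 1) y)"
   using integrable_cong_AE[OF m m2 AEe] i by blast
  have "(LINT y|lebesgue. K_kernel s (x - y)*jacobi (s - 1) y)
    = (LINT y|lebesgue. (jacobi (-1/2) y*?h (chord_ratio x y) + ?W y/2)/pi)"
   by (rule integral_cong_AE[OF m m2 AEe])
  also have "... = ((LINT y|lebesgue. jacobi (-1/2) y*?h (chord_ratio x y)) + (LINT y|lebesgue. ?W y/2))/pi"
   using c(1) Wi by (subst Bochner_Integration.integral_divide_zero, subst Bochner_Integration.integral_add) auto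
  also have "... = ?c" using c(2) by simp
  finally show "(LINT y|lebesgue. K_kernel s (x - y)*jacobi (s - 1) y) = ?c" .
  have "(LINT y|lebesgue. \<bar>K_kernel s (x - y)*jacobi (s - 1) y\<bar>)
    <= (LINT y|lebesgue. (jacobi (-1/2) y*?ha (chord_ratio x y) + \<bar>?W y\<bar>/2)/pi)"
  proof (rule integral_mono_AE)
   show "integrable lebesgue (%y. (jacobi (-1/2) y*?ha (chord_ratio x y) + \<bar>?W y\<bar>/2)/pi)"
    by (intro integrable_divide Bochner_Integration.integrable_add ca integrable_abs Wi) simp
   show "AE y in lebesgue. \<bar>K_kernel s (x - y)*jacobi (s - 1) y\<bar>
     <= (jacobi (-1/2) y*?ha (chord_ratio x y) + \<bar>?W y\<bar>/2)/pi"
    using AEe[of x]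
   proof eventually_elim
    case (elim y)
    have "\<bar>jacobi (-1/2) y*?h (chord_ratio x y) + ?W y/2\<bar>
      <= jacobi (-1/2) y*?ha (chord_ratio x y) + \<bar>?W y\<bar>/2"
     using abs_triangle_ineq[of "jacobi (-1/2) y*?h (chord_ratio x y)" "?W y/2"]
     by (simp add: abs_mult)
    then show ?case unfolding elim by (simp add: abs_divide divide_right_mono)
   qed
  qed (use int in simp)
  also have "... = ((LINT y|lebesgue. jacobi (-1/2) y*?ha (chord_ratio x y)) + (LINT y|lebesgue. \<bar>?W y\<bar>/2))/pi"
   using ca(1) Wi by (subst Bochner_Integration.integral_divide_zero, subst Bochner_Integration.integral_add) auto
  also have "... = ?C" using ca(2) by simp
  finally show "(LINT y|lebesgue. \<bar>K_kernel s (x - y)*jacobi (s - 1) y\<bar>) <= ?C" .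
 qed (use True in simp)
qed

lemma riesz_const_pos:
 assumes s: "0 < s" "s < 1" shows "0 < riesz_const s"
proof (cases "s = 1/2")
 case True
 then show ?thesis using wint_one_pos[of "-1/2"] by (simp add: riesz_const_def)
next
 case False
 have c: "Cs s*(1 - 2 * s) > 0"
  unfolding Cs_times[OF s False] using s
  by (intro divide_pos_pos mult_pos_pos Gamma_real_pos sin_gt_zero) auto
 let ?f = "%t::real. \<bar>t\<bar> powr (1 - 2 * s)/(1 + t\<^sup>2)"
 have i: "integrable lebesgue ?f"
  using s by (intro integrable_abs_powr_rational) auto
 have "(LINT t|lebesgue. ?f t) ~= 0"
 proof
  assume "(LINT t|lebesgue. ?f t) = 0"
  then have "AE t in lebesgue. ?f t = 0"
   using integral_nonneg_eq_0_iff_AE[OF i] by (simp add: add_nonneg_nonneg)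
  then have "AE t in lebesgue. t \<notin> {1<..<2::real}"
  proof eventually_elim
   case (elim t)
   moreover have "1 + t\<^sup>2 > 0" by (simp add: add_pos_nonneg)
   ultimately show ?case by auto
  qed
  then have "{1<..<2::real} \<in> null_sets lebesgue"
   by (subst (asm) AE_iff_null_sets[symmetric]) auto
  then have "emeasure lebesgue {1<..<2::real} = 0" by auto
  then show False by simp
 qed
 moreover have "(LINT t|lebesgue. ?f t) >= 0"
  by (intro Bochner_Integration.integral_nonneg) (simp add: add_nonneg_nonneg)
 ultimately have "(LINT t|lebesgue. ?f t) > 0" by linarith
 with c False show ?thesis
  by (simp add: riesz_const_def mult.commute mult_pos_pos)
qed

section \<open>The integral operator on polynomials\<close>

definition riesz_op :: "real => (real => real) => real => real" where
 "riesz_op s q x = (LINT y|lborel. K_kernel s (x - y)*(jacobi (s - 1) y*q y))"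

lemma continuous_bounded_Icc:
 fixes h :: "real => real"
 assumes "continuous_on {-1..1} h"
 obtains B where "B >= 0" "!!x. x \<in> {-1..1} ==> \<bar>h x\<bar> <= B"
proof -
 have "bounded (h ` {-1..1})"
  by (intro compact_imp_bounded compact_continuous_image assms) auto
 then obtain B where B: "!!x. x \<in> {-1..1} ==> \<bar>h x\<bar> <= B"
  unfolding bounded_iff by (metis imageI real_norm_def)
 moreover have "B >= 0" using B[of 0] by simp
 ultimately show ?thesis using that by blast
qed

lemma integrable_lborel_jacobi_mult:
 assumes "c > -1" "continuous_on {-1..1} h"
 shows "integrable lborel (%x. jacobi c x*h x)"
proof -
 have "(%x. jacobi c x*h x) \<in> borel_measurable lborel"
  using jacobi_mult_measurable[OF assms(2)] by (simp only: measurable_lborel2)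
 from integrable_completion[OF this] integrable_jacobi_mult[OF assms] show ?thesis
  by blast
qed

lemma wint_lborel:
 assumes "continuous_on {-1..1} h"
 shows "wint c h = (LINT x|lborel. jacobi c x*h x)"
 unfolding wint_def
 by (rule integral_completion) (simp only: measurable_lborel2 jacobi_mult_measurable[OF assms])

lemma riesz_integrable:
 assumes s: "0 < s" "s < 1" and x: "x \<in> {-1<..<1}" and q: "continuous_on {-1..1} q"
 shows "integrable lborel (%y. K_kernel s (x - y)*(jacobi (s - 1) y*q y))"
proof -
 obtain B where B: "B >= 0" "!!x. x \<in> {-1..1} ==> \<bar>q x\<bar> <= B"
  using continuous_bounded_Icc[OF q] by blast
 have [measurable]: "(%y. jacobi (s - 1) y*q y) \<in> borel_measurable borel"
  by (rule jacobi_mult_measurable[OF q])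
 obtain c C where "!!x. x \<in> {-1<..<1} ==> integrable lebesgue (%y. K_kernel s (x - y)*jacobi (s - 1) y)"
  using riesz_potential_weight[OF s] by blast
 with x have i: "integrable lborel (%y. K_kernel s (x - y)*jacobi (s - 1) y)"
  by (subst integrable_completion[symmetric]) auto
 show ?thesis
 proof (rule Bochner_Integration.integrable_bound)
  show "integrable lborel (%y. B*(K_kernel s (x - y)*jacobi (s - 1) y))"
   by (intro integrable_mult_right i)
  show "(%y. K_kernel s (x - y)*(jacobi (s - 1) y*q y)) \<in> borel_measurable lborel"
   by measurable
  have "\<bar>K_kernel s (x - y)*(jacobi (s - 1) y*q y)\<bar> <= \<bar>B*(K_kernel s (x - y)*jacobi (s - 1) y)\<bar>" for y
  proof (cases "y \<in> {-1<..<1}")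
   case True
   have "\<bar>q y\<bar>*\<bar>K_kernel s (x - y)*jacobi (s - 1) y\<bar> <= B*\<bar>K_kernel s (x - y)*jacobi (s - 1) y\<bar>"
    by (intro mult_right_mono B) (use True in auto)
   then show ?thesis using B(1) by (simp add: abs_mult mult_ac)
  qed (simp add: jacobi_outside)
  then show "AE y in lborel. norm (K_kernel s (x - y)*(jacobi (s - 1) y*q y))
    <= norm (B*(K_kernel s (x - y)*jacobi (s - 1) y))"
   by simp
 qed
qed

lemma riesz_abs_bound:
 assumes s: "0 < s" "s < 1" and q: "continuous_on {-1..1} q"
 obtains C where "C >= 0" "!!x. x \<in> {-1<..<1} ==>
  (LINT y|lborel. \<bar>K_kernel s (x - y)*(jacobi (s - 1) y*q y)\<bar>) <= C"
proof -
 obtain B where B: "B >= 0" "!!x. x \<in> {-1..1} ==> \<bar>q x\<bar> <= B"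
  using continuous_bounded_Icc[OF q] by blast
 have "\<exists>C. \<forall>x\<in>{-1<..<1}. integrable lebesgue (%y. K_kernel s (x - y)*jacobi (s - 1) y) \<and>
   (LINT y|lebesgue. \<bar>K_kernel s (x - y)*jacobi (s - 1) y\<bar>) <= C"
 proof (rule riesz_potential_weight[OF s])
  fix c C
  assume "!!x. x \<in> {-1<..<1} ==> integrable lebesgue (%y. K_kernel s (x - y)*jacobi (s - 1) y)"
   "!!x. x \<in> {-1<..<1} ==> (LINT y|lebesgue. \<bar>K_kernel s (x - y)*jacobi (s - 1) y\<bar>) <= C"
  then show ?thesis by (intro exI[of _ C] ballI conjI)
 qed
 then obtain C where
  i: "!!x. x \<in> {-1<..<1} ==> integrable lebesgue (%y. K_kernel s (x - y)*jacobi (s - 1) y)" and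
  C: "!!x. x \<in> {-1<..<1} ==> (LINT y|lebesgue. \<bar>K_kernel s (x - y)*jacobi (s - 1) y\<bar>) <= C"
  by blast
 show ?thesis
 proof (rule that[of "B*\<bar>C\<bar>"])
  fix x :: real assume x: "x \<in> {-1<..<1}"
  have i': "integrable lborel (%y. K_kernel s (x - y)*jacobi (s - 1) y)"
   using i[OF x] by (subst integrable_completion[symmetric]) auto
  have "(LINT y|lborel. \<bar>K_kernel s (x - y)*(jacobi (s - 1) y*q y)\<bar>)
    <= (LINT y|lborel. B*\<bar>K_kernel s (x - y)*jacobi (s - 1) y\<bar>)"
  proof (rule integral_mono)
   show "integrable lborel (%y. \<bar>K_kernel s (x - y)*(jacobi (s - 1) y*q y)\<bar>)"
    by (intro integrable_abs riesz_integrable[OF s x q])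
   show "integrable lborel (%y. B*\<bar>K_kernel s (x - y)*jacobi (s - 1) y\<bar>)"
    by (intro integrable_mult_right integrable_abs i')
   show "\<bar>K_kernel s (x - y)*(jacobi (s - 1) y*q y)\<bar> <= B*\<bar>K_kernel s (x - y)*jacobi (s - 1) y\<bar>" for y
   proof (cases "y \<in> {-1<..<1}")
    case True
    have "\<bar>q y\<bar>*\<bar>K_kernel s (x - y)*jacobi (s - 1) y\<bar> <= B*\<bar>K_kernel s (x - y)*jacobi (s - 1) y\<bar>"
     by (intro mult_right_mono B) (use True in auto)
    then show ?thesis by (simp add: abs_mult mult_ac)
   qed (simp add: jacobi_outside)
  qed
  also have "... = B*(LINT y|lebesgue. \<bar>K_kernel s (x - y)*jacobi (s - 1) y\<bar>)"
   by (subst integral_completion) auto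
  also have "... <= B*\<bar>C\<bar>"
   using C[OF x] B(1) by (intro mult_left_mono) auto
  finally show "(LINT y|lborel. \<bar>K_kernel s (x - y)*(jacobi (s - 1) y*q y)\<bar>) <= B*\<bar>C\<bar>" .
 qed (use B in simp)
qed

lemma K_kernel_growth:
 assumes s: "0 < s" "s < 1"
 obtains B c1 c2 where "B >= 0" "c1 > -1" "c2 > -1"
  "!!t. \<bar>K_kernel s t\<bar> <= B*(\<bar>t\<bar> powr c1 + \<bar>t\<bar> powr c2)"
proof (cases "s = 1/2")
 case True
 have "\<bar>K_kernel s t\<bar> <= 2/pi*(\<bar>t\<bar> powr (1/2) + \<bar>t\<bar> powr (-1/2))" for t
  using abs_ln_bound[of "\<bar>t\<bar>" "1/2"] True by (simp add: K_kernel_def divide_right_mono)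
 then show ?thesis by (intro that[of "2/pi" "1/2" "-1/2"]) auto
next
 case False
 have "\<bar>K_kernel s t\<bar> <= \<bar>Cs s\<bar>*(\<bar>t\<bar> powr (1 - 2 * s) + \<bar>t\<bar> powr (1 - 2 * s))" for t
  using False by (simp add: K_kernel_def abs_mult mult_left_mono)
 then show ?thesis using s by (intro that[of "\<bar>Cs s\<bar>" "1 - 2 * s" "1 - 2 * s"]) auto
qed

text \<open>Differentiating \<open>t ln \<bar>t\<bar>\<close> leaves a constant that powers do not produce;
 \<open>log_const\<close> carries it, so that both kernels share the formulas below.\<close>

definition log_const :: "real => real" where
 "log_const s = (if s = 1/2 then 1/pi else 0)"

lemma K_kernel_primitive_deriv:
 assumes "t ~= 0"
 shows "((%t. t*K_kernel s t) has_real_derivative ((2 - 2 * s)*K_kernel s t + log_const s)) (at t)"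
proof (cases "s = 1/2")
 case True
 have "((%t. t*(ln \<bar>t\<bar>/pi)) has_real_derivative (ln \<bar>t\<bar>/pi + 1/pi)) (at t)"
 proof (cases "t > 0")
  case True
  have "((%t. t*(ln t/pi)) has_real_derivative (ln t/pi + 1/pi)) (at t)"
   by (rule derivative_eq_intros refl | use True in \<open>simp add: field_simps\<close>)+
  then show ?thesis
   using True by (simp, elim has_field_derivative_transform_within_open[where S="{0<..}"]) auto
 next
  case False
  then have t: "t < 0" using assms by simp
  have "((%t. t*(ln (-t)/pi)) has_real_derivative (ln (-t)/pi + 1/pi)) (at t)"
   by (rule derivative_eq_intros refl | use t in \<open>simp add: field_simps\<close>)+
  then show ?thesis
   using t by (simp, elim has_field_derivative_transform_within_open[where S="{..<0}"]) auto
 qed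
 moreover have "2 - 2 * s = 1" using True by simp
 ultimately show ?thesis
  using True by (simp only: K_kernel_def[abs_def] log_const_def if_True refl mult_1)
next
 case False
 have pw: "\<tau> powr (1 - 2 * s) = \<tau> powr (-2 * s)*\<tau>" if "\<tau> > 0" for \<tau> :: real
  using that powr_add[of \<tau> "-2 * s" 1] by simp
 have "((%t. t*(Cs s*\<bar>t\<bar> powr (1 - 2 * s))) has_real_derivative ((2 - 2 * s)*(Cs s*\<bar>t\<bar> powr (1 - 2 * s)))) (at t)"
 proof (cases "t > 0")
  case True
  have "((%t. t*(Cs s*t powr (1 - 2 * s))) has_real_derivative
    (t*(Cs s*((1 - 2 * s)*t powr (1 - 2 * s - 1))) + 1*(Cs s*t powr (1 - 2 * s)))) (at t)"
   by (intro DERIV_mult' DERIV_cmult DERIV_ident has_real_derivative_powr True)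
  also have "t*(Cs s*((1 - 2 * s)*t powr (1 - 2 * s - 1))) + 1*(Cs s*t powr (1 - 2 * s))
    = (2 - 2 * s)*(Cs s*t powr (1 - 2 * s))"
   using pw[OF True] by (simp add: algebra_simps)
  finally show ?thesis
   using True by (simp, elim has_field_derivative_transform_within_open[where S="{0<..}"]) auto
 next
  case F: False
  then have t: "t < 0" using assms by simp
  have d: "((%t. (-t) powr (1 - 2 * s)) has_real_derivative ((1 - 2 * s)*(-t) powr (1 - 2 * s - of_nat 1)*(-1))) (at t)"
   by (rule DERIV_fun_powr) (use t in \<open>auto intro!: derivative_eq_intros\<close>)
  have "((%t. t*(Cs s*(-t) powr (1 - 2 * s))) has_real_derivative
    (t*(Cs s*((1 - 2 * s)*(-t) powr (1 - 2 * s - of_nat 1)*(-1))) + 1*(Cs s*(-t) powr (1 - 2 * s)))) (at t)"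
   by (intro DERIV_mult' DERIV_cmult DERIV_ident d)
  also have "t*(Cs s*((1 - 2 * s)*(-t) powr (1 - 2 * s - of_nat 1)*(-1))) + 1*(Cs s*(-t) powr (1 - 2 * s))
    = (2 - 2 * s)*(Cs s*(-t) powr (1 - 2 * s))"
   using pw[of "-t"] t by (simp add: algebra_simps)
  finally show ?thesis
   using t by (simp, elim has_field_derivative_transform_within_open[where S="{..<0}"]) auto
 qed
 then show ?thesis using False by (simp add: K_kernel_def[abs_def] log_const_def)
qed

lemma K_kernel_primitive_continuous:
 assumes s: "0 < s" "s < 1"
 shows "continuous_on UNIV (%t. t*K_kernel s t)"
proof -
 obtain B c1 c2 where B: "B >= 0" "c1 > -1" "c2 > -1"
  "!!t. \<bar>K_kernel s t\<bar> <= B*(\<bar>t\<bar> powr c1 + \<bar>t\<bar> powr c2)"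
  using K_kernel_growth[OF s] by blast
 have "isCont (%t. t*K_kernel s t) t" for t
 proof (cases "t = 0")
  case False
  show ?thesis by (rule DERIV_isCont[OF K_kernel_primitive_deriv[OF False]])
 next
  case True
  have "((%t. t*K_kernel s t) \<longlongrightarrow> 0) (at 0)"
  proof (rule Lim_null_comparison)
   have "((%t. B*(\<bar>t\<bar> powr (c1 + 1) + \<bar>t\<bar> powr (c2 + 1))) \<longlongrightarrow> B*(\<bar>0\<bar> powr (c1 + 1) + \<bar>0\<bar> powr (c2 + 1))) (at (0::real))"
    using B by (intro tendsto_intros tendsto_powr') auto
   then show "((%t. B*(\<bar>t\<bar> powr (c1 + 1) + \<bar>t\<bar> powr (c2 + 1))) \<longlongrightarrow> 0) (at (0::real))"
    by simp
   have "\<bar>t*K_kernel s t\<bar> <= B*(\<bar>t\<bar> powr (c1 + 1) + \<bar>t\<bar> powr (c2 + 1))" for t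
   proof -
    have "\<bar>t*K_kernel s t\<bar> <= \<bar>t\<bar>*(B*(\<bar>t\<bar> powr c1 + \<bar>t\<bar> powr c2))"
     unfolding abs_mult by (intro mult_left_mono B) auto
    also have "... = B*(\<bar>t\<bar> powr (c1 + 1) + \<bar>t\<bar> powr (c2 + 1))"
     by (simp add: powr_add algebra_simps)
    finally show ?thesis .
   qed
   then show "\<forall>\<^sub>F t in at 0. norm (t*K_kernel s t) <= B*(\<bar>t\<bar> powr (c1 + 1) + \<bar>t\<bar> powr (c2 + 1))"
    by simp
  qed
  then show ?thesis using True by (simp add: isCont_def)
 qed
 then show ?thesis by (simp add: continuous_at_imp_continuous_on)
qed

lemma K_kernel_locally_integrable:
 assumes s: "0 < s" "s < 1" and "R >= 0"
 shows "integrable lborel (%t. indicator {-R..R} t*K_kernel s t)"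
proof -
 obtain B c1 c2 where B: "B >= 0" "c1 > -1" "c2 > -1"
  "!!t. \<bar>K_kernel s t\<bar> <= B*(\<bar>t\<bar> powr c1 + \<bar>t\<bar> powr c2)"
  using K_kernel_growth[OF s] by blast
 have "integrable lebesgue (%t. indicator {-R..R} t*K_kernel s t)"
 proof (rule Bochner_Integration.integrable_bound)
  show "integrable lebesgue (%t::real. B*(indicator {-R..R} t*\<bar>t\<bar> powr c1 + indicator {-R..R} t*\<bar>t\<bar> powr c2))"
   using B assms(3) by (intro integrable_mult_right Bochner_Integration.integrable_add integrable_abs_powr)
  show "(%t. indicator {-R..R} t*K_kernel s t) \<in> borel_measurable lebesgue"
   by (intro lebesgue_measurableI) measurable
  have "\<bar>indicator {-R..R} t*K_kernel s t\<bar> <= \<bar>B*(indicator {-R..R} t*\<bar>t\<bar> powr c1 + indicator {-R..R} t*\<bar>t\<bar> powr c2)\<bar>" for t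
   using B(4)[of t] by (auto simp: indicator_def)
  then show "AE t in lebesgue. norm (indicator {-R..R} t*K_kernel s t)
    <= norm (B*(indicator {-R..R} t*\<bar>t\<bar> powr c1 + indicator {-R..R} t*\<bar>t\<bar> powr c2))"
   by simp
 qed
 then show ?thesis by (subst integrable_completion[symmetric]) auto
qed

lemma K_kernel_primitive_integral:
 assumes s: "0 < s" "s < 1" and u: "-1 < u" "u <= v" "v < 1" and y: "y \<in> {-1<..<1}"
 shows "integrable lborel (%x. indicator {u..v} x*((2 - 2 * s)*K_kernel s (x - y) + log_const s))" (is ?i)
  and "(LINT x|lborel. indicator {u..v} x*((2 - 2 * s)*K_kernel s (x - y) + log_const s))
   = (v - y)*K_kernel s (v - y) - (u - y)*K_kernel s (u - y)"
proof -
 let ?k = "%x. (2 - 2 * s)*K_kernel s (x - y) + log_const s"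
 have "integrable lborel (%t. indicator {-2..2} t*K_kernel s t)"
  using s by (intro K_kernel_locally_integrable) auto
 from lborel_integrable_real_affine[OF this, of 1 "-y"]
 have i1: "integrable lborel (%x. indicator {-2..2} (x - y)*K_kernel s (x - y))"
  by simp
 have i2: "integrable lborel (%x. indicator {u..v} x*(indicator {-2..2} (x - y)*K_kernel s (x - y)))"
  by (rule Bochner_Integration.integrable_bound[OF i1]) (auto simp: indicator_def)
 have "indicator {u..v} x*(indicator {-2..2} (x - y)*K_kernel s (x - y)) = indicator {u..v} x*K_kernel s (x - y)" for x
  using u y by (auto simp: indicator_def)
 with i2 have i3: "integrable lborel (%x. indicator {u..v} x*K_kernel s (x - y))" by simp
 have i4: "integrable lborel (%x. indicator {u..v} x*log_const s)"
  by (intro integrable_mult_left) (simp add: emeasure_lborel_Icc_eq integrable_indicator_iff)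
 have "integrable lborel (%x. (2 - 2 * s)*(indicator {u..v} x*K_kernel s (x - y)) + indicator {u..v} x*log_const s)"
  by (intro Bochner_Integration.integrable_add integrable_mult_right i3 i4)
 then show i: ?i by (simp add: algebra_simps)
 then have si: "set_integrable lborel {u..v} ?k" by (simp add: set_integrable_def)
 have "(?k has_integral ((v - y)*K_kernel s (v - y) - (u - y)*K_kernel s (u - y))) {u..v}"
 proof (rule fundamental_theorem_of_calculus_interior_strong[where S="{y}"])
  show "continuous_on {u..v} (%x. (x - y)*K_kernel s (x - y))"
   by (rule continuous_on_compose2[OF K_kernel_primitive_continuous[OF s]]) (auto intro!: continuous_intros)
  fix x assume "x \<in> {u<..<v} - {y}"
  then have "x - y ~= 0" by auto
  have d: "((%x. x - y) has_real_derivative 1) (at x)"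
   by (auto intro!: derivative_eq_intros)
  from DERIV_chain2[where f="%t. t*K_kernel s t" and g="%x. x - y",
    OF K_kernel_primitive_deriv[OF \<open>x - y \<noteq> 0\<close>] d]
  show "((%x. (x - y)*K_kernel s (x - y)) has_vector_derivative ?k x) (at x)"
   by (simp add: has_real_derivative_iff_has_vector_derivative[symmetric])
 qed (use u in auto)
 then have "integral {u..v} ?k = (v - y)*K_kernel s (v - y) - (u - y)*K_kernel s (u - y)"
  by (rule integral_unique)
 with set_borel_integral_eq_integral(2)[OF si]
 show "(LINT x|lborel. indicator {u..v} x*((2 - 2 * s)*K_kernel s (x - y) + log_const s))
   = (v - y)*K_kernel s (v - y) - (u - y)*K_kernel s (u - y)"
  by (simp add: set_lebesgue_integral_def)
qed

lemma poly_antiderivative: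
 fixes p :: "real poly"
 obtains R where "pderiv R = p"
proof -
 have "\<exists>R. pderiv R = (\<Sum>i\<le>n. monom (c i) i)" for n and c :: "nat => real"
 proof (induction n)
  case 0
  have "pderiv (monom (c 0) 1) = monom (c 0) 0" by (simp add: pderiv_monom)
  then show ?case by auto
 next
  case (Suc n)
  then obtain R where R: "pderiv R = (\<Sum>i\<le>n. monom (c i) i)" by blast
  have "pderiv (R + monom (c (Suc n)/(real n + 2)) (Suc (Suc n))) = (\<Sum>i\<le>Suc n. monom (c i) i)"
   by (simp add: pderiv_add R pderiv_monom add_ac)
  then show ?case by blast
 qed
 from this[of "coeff p" "degree p"] that show ?thesis
  unfolding poly_as_sum_of_monoms by blast
qed

lemma poly_fundamental_theorem:
 fixes R p :: "real poly"
 assumes "pderiv R = p" "u <= v"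
 shows "integral {u..v} (poly p) = poly R v - poly R u"
proof -
 have "(poly R has_vector_derivative poly p x) (at x within {u..v})" for x
  using poly_DERIV[of R x] assms(1)
  by (simp add: has_real_derivative_iff_has_vector_derivative has_vector_derivative_at_within)
 then have "(poly p has_integral (poly R v - poly R u)) {u..v}"
  by (intro fundamental_theorem_of_calculus assms(2))
 then show ?thesis by (rule Henstock_Kurzweil_Integration.integral_unique)
qed

text \<open>Since \<open>t K(t)\<close> has derivative \<open>(2 - 2 s) K(t)\<close> up to a constant, integrating the potential
 of \<open>q\<close> over an interval gives the increment of \<open>\<integral> (x - y) K(x - y) w(y) q(y) dy\<close>, which is
 \<open>x\<close> times the potential of \<open>q\<close> minus the potential of \<open>y q(y)\<close>.\<close>

lemma riesz_increment:
 assumes s: "0 < s" "s < 1" and uv: "-1 < u" "u <= v" "v < 1" and q: "continuous_on {-1..1} q"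
  and cont: "continuous_on {u..v} (riesz_op s q)"
 shows "(v * riesz_op s q v - riesz_op s (%y. y*q y) v) - (u*riesz_op s q u - riesz_op s (%y. y*q y) u)
  = integral {u..v} (%x. (2 - 2 * s)*riesz_op s q x + log_const s*wint (s - 1) q)"
proof -
 let ?w = "%y. jacobi (s - 1) y*q y"
 let ?k = "%x y. (2 - 2 * s)*K_kernel s (x - y) + log_const s"
 let ?P = "%t. t*K_kernel s t"
 have wm [measurable]: "?w \<in> borel_measurable borel"
  by (rule jacobi_mult_measurable[OF q])
 have wi: "integrable lborel ?w"
  using s q by (intro integrable_lborel_jacobi_mult) auto
 let ?f = "%y x. indicator {u..v} x*?k x y*?w y"
 obtain C where C: "!!y. y \<in> {-1<..<1} ==> (LINT x|lborel. \<bar>indicator {u..v} x*?k x y\<bar>) <= C"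
 proof -
  define I where "I = (LINT t|lborel. \<bar>indicator {-2..2} t*K_kernel s t\<bar>)"
  have Ki: "integrable lborel (%t. indicator {-2..2} t*K_kernel s t)"
   using s by (intro K_kernel_locally_integrable) auto
  show ?thesis
  proof (rule that[of "\<bar>2 - 2 * s\<bar>*I + \<bar>log_const s\<bar>*(v - u)"])
   fix y :: real assume y: "y \<in> {-1<..<1}"
   from lborel_integrable_real_affine[OF Ki, of 1 "-y"]
   have i1: "integrable lborel (%x. indicator {-2..2} (x - y)*K_kernel s (x - y))" by simp
   have ii: "integrable lborel (%x. indicator {u..v} x :: real)"
    by (simp add: integrable_indicator_iff emeasure_lborel_Icc_eq)
   have "(LINT x|lborel. \<bar>indicator {u..v} x*?k x y\<bar>) \<le>
    (LINT x|lborel. \<bar>2 - 2 * s\<bar>*\<bar>indicator {-2..2} (x - y)*K_kernel s (x - y)\<bar> + \<bar>log_const s\<bar>*indicator {u..v} x)"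
   proof (rule integral_mono)
    show "integrable lborel (%x. \<bar>indicator {u..v} x*?k x y\<bar>)"
     by (intro integrable_abs K_kernel_primitive_integral[OF s uv y])
    show "integrable lborel (%x. \<bar>2 - 2 * s\<bar>*\<bar>indicator {-2..2} (x - y)*K_kernel s (x - y)\<bar> + \<bar>log_const s\<bar>*indicator {u..v} x)"
     by (intro Bochner_Integration.integrable_add integrable_mult_right integrable_abs i1 ii)
    fix x
    show "\<bar>indicator {u..v} x*?k x y\<bar> <= \<bar>2 - 2 * s\<bar>*\<bar>indicator {-2..2} (x - y)*K_kernel s (x - y)\<bar> + \<bar>log_const s\<bar>*indicator {u..v} x"
    proof (cases "x \<in> {u..v}")
     case True
     then have "x - y \<in> {-2..2}" using y uv by auto
     then show ?thesis
      using True abs_triangle_ineq[of "(2 - 2 * s)*K_kernel s (x - y)" "log_const s"] by (simp add: abs_mult)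
    qed simp
   qed
   also have "... = \<bar>2 - 2 * s\<bar>*(LINT x|lborel. \<bar>indicator {-2..2} (x - y)*K_kernel s (x - y)\<bar>) + \<bar>log_const s\<bar>*(v - u)"
    using i1 ii uv by (subst Bochner_Integration.integral_add) auto
   also have "(LINT x|lborel. \<bar>indicator {-2..2} (x - y)*K_kernel s (x - y)\<bar>) = I"
    unfolding I_def using lborel_integral_real_affine[of 1 "%t. \<bar>indicator {-2..2} t*K_kernel s t\<bar>" "-y"] by simp
   finally show "(LINT x|lborel. \<bar>indicator {u..v} x*?k x y\<bar>) <= \<bar>2 - 2 * s\<bar>*I + \<bar>log_const s\<bar>*(v - u)" .
  qed
 qed
 have pi: "integrable (lborel \<Otimes>\<^sub>M lborel) (%(y, x). ?f y x)"
 proof (rule lborel_pair.Fubini_integrable)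
  show "(%(y, x). ?f y x) \<in> borel_measurable (lborel \<Otimes>\<^sub>M lborel)"
   by measurable
  have inner: "(LINT x|lborel. norm (?f y x)) = \<bar>?w y\<bar>*(LINT x|lborel. \<bar>indicator {u..v} x*?k x y\<bar>)" for y
   by (simp add: abs_mult[of _ "?w y"] mult.commute[of _ "\<bar>?w y\<bar>"])
  show "integrable lborel (%y. (LINT x|lborel. norm ((%(y, x). ?f y x) (y, x))))"
  proof (rule Bochner_Integration.integrable_bound)
   show "integrable lborel (%y. C*?w y)" by (intro integrable_mult_right wi)
   have "\<bar>?w y\<bar>*(LINT x|lborel. \<bar>indicator {u..v} x*?k x y\<bar>) <= \<bar>C*?w y\<bar>" for y
   proof (cases "y \<in> {-1<..<1}")
    case True
    have "\<bar>?w y\<bar>*(LINT x|lborel. \<bar>indicator {u..v} x*?k x y\<bar>) <= \<bar>?w y\<bar>*\<bar>C\<bar>"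
     using C[OF True] by (intro mult_left_mono) auto
    then show ?thesis by (simp add: abs_mult mult_ac)
   qed (simp add: jacobi_outside)
   then show "AE y in lborel. norm (LINT x|lborel. norm ((%(y, x). ?f y x) (y, x))) <= norm (C*?w y)"
    by (simp only: inner prod.case) (simp add: abs_mult)
  qed (measurable)
  show "AE y in lborel. integrable lborel (%x. (%(y, x). ?f y x) (y, x))"
  proof (rule AE_I2)
   fix y
   show "integrable lborel (%x. (%(y, x). ?f y x) (y, x))"
   proof (cases "y \<in> {-1<..<1}")
    case True
    show ?thesis unfolding prod.case
     by (intro integrable_mult_left K_kernel_primitive_integral[OF s uv True])
   qed (simp add: jacobi_outside)
  qed
 qed
 have Ji: "integrable lborel (%y. K_kernel s (x - y)*?w y)" if "x \<in> {u..v}" for x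
  using that uv by (intro riesz_integrable s q) auto
 have J1i: "integrable lborel (%y. K_kernel s (x - y)*(jacobi (s - 1) y*(y*q y)))" if "x \<in> {u..v}" for x
  using that uv by (intro riesz_integrable s continuous_intros q) auto
 have F: "x*riesz_op s q x - riesz_op s (%y. y*q y) x = (LINT y|lborel. ?P (x - y)*?w y)"
  and Fi: "integrable lborel (%y. ?P (x - y)*?w y)" if x: "x \<in> {u..v}" for x
 proof -
  have e: "?P (x - y)*?w y = x*(K_kernel s (x - y)*?w y) - K_kernel s (x - y)*(jacobi (s - 1) y*(y*q y))" for y
   by (simp add: algebra_simps)
  show "integrable lborel (%y. ?P (x - y)*?w y)"
   unfolding e by (intro Bochner_Integration.integrable_diff integrable_mult_right Ji J1i x)
  show "x*riesz_op s q x - riesz_op s (%y. y*q y) x = (LINT y|lborel. ?P (x - y)*?w y)"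
   unfolding e riesz_op_def using Ji[OF x] J1i[OF x] by simp
 qed
 have uv': "u \<in> {u..v}" "v \<in> {u..v}" using uv by auto
 have "(v * riesz_op s q v - riesz_op s (%y. y*q y) v) - (u*riesz_op s q u - riesz_op s (%y. y*q y) u)
   = (LINT y|lborel. (?P (v - y) - ?P (u - y))*?w y)"
  unfolding F[OF uv'(1)] F[OF uv'(2)] left_diff_distrib[of "?P _" "?P _"]
  using Fi[OF uv'(1)] Fi[OF uv'(2)] by simp
 also have "... = (LINT y|lborel. (LINT x|lborel. ?f y x))"
 proof (rule Bochner_Integration.integral_cong[OF refl])
  fix y
  show "(?P (v - y) - ?P (u - y))*?w y = (LINT x|lborel. ?f y x)"
  proof (cases "y \<in> {-1<..<1}")
   case True
   show ?thesis
    using K_kernel_primitive_integral(2)[OF s uv True] by simp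
  qed (simp add: jacobi_outside)
 qed
 also have "... = (LINT x|lborel. (LINT y|lborel. ?f y x))"
  by (rule lborel_pair.Fubini_integral[symmetric, OF pi])
 also have "... = (LINT x|lborel. indicator {u..v} x*((2 - 2 * s)*riesz_op s q x + log_const s*wint (s - 1) q))"
 proof (rule Bochner_Integration.integral_cong[OF refl])
  fix x
  show "(LINT y|lborel. ?f y x) = indicator {u..v} x*((2 - 2 * s)*riesz_op s q x + log_const s*wint (s - 1) q)"
  proof (cases "x \<in> {u..v}")
   case True
   have e: "?f y x = (2 - 2 * s)*(K_kernel s (x - y)*?w y) + log_const s*?w y" for y
    using True by (simp add: algebra_simps)
   show ?thesis
    unfolding e riesz_op_def wint_lborel[OF q] using True Ji[OF True] wi by simp
  qed simp
 qed
 also have "... = integral {u..v} (%x. (2 - 2 * s)*riesz_op s q x + log_const s*wint (s - 1) q)"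
 proof -
  have "set_integrable lborel {u..v} (%x. (2 - 2 * s)*riesz_op s q x + log_const s*wint (s - 1) q)"
   by (rule borel_integrable_atLeastAtMost') (intro continuous_intros cont)
  from set_borel_integral_eq_integral(2)[OF this] show ?thesis
   by (simp add: set_lebesgue_integral_def)
 qed
 finally show ?thesis .
qed

definition riesz_lead :: "real => nat => real" where
 "riesz_lead s n = - riesz_const s*pochhammer (2 * s) (n - 1)/fact n"

lemma riesz_op_one:
 assumes s: "0 < s" "s < 1"
 obtains c where "!!x. x \<in> {-1<..<1} ==> riesz_op s (%y. 1) x = c" "s ~= 1/2 ==> (1 - 2 * s)*c = riesz_const s"
proof (rule riesz_potential_weight[OF s])
 fix c C
 assume 1: "!!x. x \<in> {-1<..<1} ==> (LINT y|lebesgue. K_kernel s (x - y)*jacobi (s - 1) y) = c"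
  and 2: "s ~= 1/2 ==> (1 - 2 * s)*c = riesz_const s"
 have "riesz_op s (%y. 1) x = c" if "x \<in> {-1<..<1}" for x
  unfolding 1[OF that, symmetric] riesz_op_def by (subst integral_completion) auto
 with 2 show thesis using that by blast
qed

text \<open>The derivative of the potential of \<open>y\<^sup>n\<^sup>+\<^sup>1\<close> is \<open>x\<close> times the derivative of the potential of
 \<open>y\<^sup>n\<close> plus \<open>2 s - 1\<close> times that potential, up to a constant. So the potentials are polynomials
 and their leading coefficients satisfy a two-term recurrence.\<close>

lemma riesz_monomial:
 assumes s: "0 < s" "s < 1"
 shows "\<exists>P. degree P <= n \<and> (\<forall>x\<in>{-1<..<1}. riesz_op s (%y. y^n) x = poly P x) \<and>
   (n >= 1 --> coeff P n = riesz_lead s n) \<and> (n = 0 --> s ~= 1/2 --> (1 - 2 * s)*coeff P 0 = riesz_const s)"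
proof (induction n)
 case 0
 obtain c where c: "!!x. x \<in> {-1<..<1} ==> riesz_op s (%y. 1) x = c" "s ~= 1/2 ==> (1 - 2 * s)*c = riesz_const s"
  using riesz_op_one[OF s] by blast
 then show ?case by (intro exI[of _ "[:c:]"]) simp
next
 case (Suc n)
 then obtain Q where Q: "degree Q <= n" "!!x. x \<in> {-1<..<1} ==> riesz_op s (%y. y^n) x = poly Q x"
  "n >= 1 ==> coeff Q n = riesz_lead s n" "n = 0 ==> s ~= 1/2 ==> (1 - 2 * s)*coeff Q 0 = riesz_const s"
  by blast
 define m where "m = log_const s*wint (s - 1) (%y. y^n)"
 obtain R where R: "pderiv R = smult (2 - 2 * s) Q + [:m:]"
  using poly_antiderivative by blast
 let ?J = "riesz_op s (%y. y^Suc n)"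
 have cq: "continuous_on {-1..1} (%y::real. y^n)" by (intro continuous_intros)
 have inc: "(v * poly Q v - ?J v) - (u*poly Q u - ?J u) = poly R v - poly R u"
  if uv: "-1 < u" "u <= v" "v < 1" for u v
 proof -
  have "continuous_on {u..v} (riesz_op s (%y. y^n)) = continuous_on {u..v} (poly Q)"
   using uv by (intro continuous_on_cong) (auto simp: Q(2))
  then have c: "continuous_on {u..v} (riesz_op s (%y. y^n))"
   by (simp add: continuous_on_poly)
  have "(v * riesz_op s (%y. y^n) v - ?J v) - (u*riesz_op s (%y. y^n) u - ?J u)
    = integral {u..v} (%x. (2 - 2 * s)*riesz_op s (%y. y^n) x + m)"
   using riesz_increment[OF s uv cq c] by (simp add: m_def)
  also have "... = integral {u..v} (poly (smult (2 - 2 * s) Q + [:m:]))"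
   using uv by (intro Henstock_Kurzweil_Integration.integral_cong) (auto simp: Q(2))
  also have "... = poly R v - poly R u"
   by (rule poly_fundamental_theorem[OF R uv(2)])
  finally show ?thesis using uv by (simp add: Q(2))
 qed
 define P where "P = [:0, 1:]*Q - R + [:?J 0 + poly R 0:]"
 have J: "?J x = poly P x" if "x \<in> {-1<..<1}" for x
  using inc[of 0 x] inc[of x 0] that by (cases "x >= 0") (auto simp: P_def)
 have "degree R - 1 <= n"
  using degree_pderiv[of R] degree_add_le[of "smult (2 - 2 * s) Q" n "[:m:]"] Q(1) unfolding R
  by (simp add: order_trans[OF degree_smult_le])
 then have dR: "degree R <= Suc n" by simp
 have cR: "real (Suc n)*coeff R (Suc n) = (2 - 2 * s)*coeff Q n + (if n = 0 then m else 0)"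
  using arg_cong[OF R, of "%p. coeff p n"] by (simp add: coeff_pderiv coeff_pCons split: nat.split)
 have dP: "degree P <= Suc n"
  unfolding P_def using dR Q(1)
  by (intro degree_add_le degree_diff_le) (auto simp: degree_pCons_le intro: order_trans[OF degree_mult_le])
 have "coeff P (Suc n) = coeff Q n - coeff R (Suc n)"
  by (simp add: P_def)
 then have "real (Suc n)*coeff P (Suc n) = real (Suc n)*coeff Q n - ((2 - 2 * s)*coeff Q n + (if n = 0 then m else 0))"
  by (simp only: right_diff_distrib cR)
 then have "real (Suc n)*coeff P (Suc n) = (real n + 2 * s - 1)*coeff Q n - (if n = 0 then m else 0)"
  by (simp add: algebra_simps)
 also have "... = real (Suc n)*riesz_lead s (Suc n)"
 proof (cases "n = 0")
  case True
  show ?thesis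
  proof (cases "s = 1/2")
   case s': True
   have "s - 1 = - (1/2)" using s' by simp
   then have w: "wint (s - 1) = wint (- (1/2))" by (simp only:)
   have e: "2 * s - 1 = 0" using s' by simp
   show ?thesis
    using True s' w e by (simp add: riesz_lead_def riesz_const_def m_def log_const_def)
  next
   case False
   then have "m = 0" by (simp add: m_def log_const_def)
   then show ?thesis
    using True Q(4)[OF True False] by (simp add: riesz_lead_def algebra_simps)
  qed
 next
  case False
  then obtain k where k: "n = Suc k" by (cases n) auto
  have "coeff Q n = riesz_lead s n" using Q(3) False by simp
  moreover have "riesz_lead s (Suc (Suc k)) = (2 * s + real k)/(real k + 2)*riesz_lead s (Suc k)"
  proof -
   have f: "(fact (Suc (Suc k)) :: real) = (real k + 2)*fact (Suc k)"
    by (simp add: algebra_simps)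
   have "- c*(p*(2 * s + real k))/((real k + 2)*F) = (2 * s + real k)/(real k + 2)*(- c*p/F)" for c p F :: real
    by simp
   then show ?thesis
    unfolding riesz_lead_def diff_Suc_1 pochhammer_Suc f by blast
  qed
  ultimately show ?thesis
   by (simp add: k add.commute)
 qed
 finally have "coeff P (Suc n) = riesz_lead s (Suc n)" by simp
 with J dP show ?case by (intro exI[of _ P]) auto
qed

text \<open>By linearity from the monomials.\<close>

lemma riesz_polynomial:
 assumes s: "0 < s" "s < 1"
 obtains P where "!!n. degree q <= n ==> degree P <= n"
  "!!x. x \<in> {-1<..<1} ==> riesz_op s (poly q) x = poly P x"
  "!!n. degree q <= n ==> n >= 1 ==> coeff P n = riesz_lead s n*coeff q n"
proof -
 from riesz_monomial[OF s] obtain M where M: "!!n. degree (M n) <= n"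
  "!!n x. x \<in> {-1<..<1} ==> riesz_op s (%y. y^n) x = poly (M n) x"
  "!!n. n >= 1 ==> coeff (M n) n = riesz_lead s n"
  by metis
 define P where "P = (\<Sum>i\<le>degree q. smult (coeff q i) (M i))"
 have dP: "degree P <= n" if "degree q <= n" for n
  unfolding P_def
 proof (rule degree_sum_le)
  fix i assume "i \<in> {..degree q}"
  then show "degree (smult (coeff q i) (M i)) <= n"
   using M(1)[of i] that by (intro order_trans[OF degree_smult_le]) auto
 qed simp
 show ?thesis
 proof (rule that[of P])
  show "degree q <= n ==> degree P <= n" for n by (rule dP)
  fix x :: real assume x: "x \<in> {-1<..<1}"
  have "riesz_op s (poly q) x = (LINT y|lborel. (\<Sum>i\<le>degree q. coeff q i*(K_kernel s (x - y)*(jacobi (s - 1) y*y^i))))"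
   unfolding riesz_op_def poly_altdef by (simp add: sum_distrib_left mult_ac)
  also have "... = (\<Sum>i\<le>degree q. coeff q i*riesz_op s (%y. y^i) x)"
   unfolding riesz_op_def
   by (subst Bochner_Integration.integral_sum)
     (auto intro!: integrable_mult_right riesz_integrable s x[simplified] continuous_intros)
  also have "... = poly P x"
   by (simp add: M(2)[OF x] P_def poly_sum)
  finally show "riesz_op s (poly q) x = poly P x" .
 next
  fix n assume n: "degree q <= n" "n >= 1"
  show "coeff P n = riesz_lead s n*coeff q n"
  proof (cases "degree q = n")
   case True
   have "coeff P n = (\<Sum>i\<le>n. coeff q i*coeff (M i) n)"
    by (simp add: P_def True coeff_sum)
   also have "... = (\<Sum>i\<le>n. if i = n then coeff q n*coeff (M n) n else 0)"
   proof (intro sum.cong refl)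
    fix i assume "i \<in> {..n}"
    moreover have "i < n ==> coeff (M i) n = 0"
     using M(1)[of i] by (intro coeff_eq_0) simp
    ultimately show "coeff q i*coeff (M i) n = (if i = n then coeff q n*coeff (M n) n else 0)"
     by auto
   qed
   also have "... = riesz_lead s n*coeff q n"
    using M(3)[OF n(2)] by simp
   finally show ?thesis .
  next
   case False
   then have "degree q <= n - 1" "degree q < n" using n by auto
   then have "degree P < n" using dP[of "n - 1"] n(2) by linarith
   then show ?thesis using \<open>degree q < n\<close> by (simp add: coeff_eq_0)
  qed
 qed
qed

definition riesz_poly :: "real => real poly => real poly" where
 "riesz_poly s q = (SOME P. (\<forall>n. degree q <= n --> degree P <= n) \<and>
   (\<forall>x\<in>{-1<..<1}. riesz_op s (poly q) x = poly P x) \<and>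
   (\<forall>n. degree q <= n --> n >= 1 --> coeff P n = riesz_lead s n*coeff q n))"

lemma riesz_poly:
 assumes s: "0 < s" "s < 1"
 shows "degree q <= n ==> degree (riesz_poly s q) <= n"
  "x \<in> {-1<..<1} ==> riesz_op s (poly q) x = poly (riesz_poly s q) x"
  "degree q <= n ==> n >= 1 ==> coeff (riesz_poly s q) n = riesz_lead s n*coeff q n"
proof -
 let ?R = "%P. (\<forall>n. degree q <= n --> degree P <= n) \<and>
   (\<forall>x\<in>{-1<..<1}. riesz_op s (poly q) x = poly P x) \<and>
   (\<forall>n. degree q <= n --> n >= 1 --> coeff P n = riesz_lead s n*coeff q n)"
 have "\<exists>P. ?R P"
  by (rule riesz_polynomial[OF s, of q]) blast
 then have "?R (riesz_poly s q)"
  unfolding riesz_poly_def by (rule someI_ex)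
 then show "degree q <= n ==> degree (riesz_poly s q) <= n"
  "x \<in> {-1<..<1} ==> riesz_op s (poly q) x = poly (riesz_poly s q) x"
  "degree q <= n ==> n >= 1 ==> coeff (riesz_poly s q) n = riesz_lead s n*coeff q n"
  by auto
qed

text \<open>The derivative of \<open>(1 - x\<^sup>2) powr s * p\<close> is \<open>(1 - x\<^sup>2) powr (s - 1)\<close> times this polynomial.\<close>

definition weight_deriv :: "real => real poly => real poly" where
 "weight_deriv s p = [:1, 0, -1:]*pderiv p - smult (2 * s) ([:0, 1:]*p)"

lemma weight_deriv_degree:
 assumes "degree p <= n"
 shows "degree (weight_deriv s p) <= Suc n" "coeff (weight_deriv s p) (Suc n) = - (real n + 2 * s)*coeff p n"
proof -
 show "degree (weight_deriv s p) <= Suc n"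
 proof (rule degree_le, intro allI impI)
  fix i assume i: "Suc n < i"
  then obtain k where k: "i = Suc (Suc k)" by (cases i; cases "i - 1") auto
  with i assms have "coeff p (Suc k) = 0" "coeff p (Suc (Suc (Suc k))) = 0"
   by (auto intro!: coeff_eq_0)
  then show "coeff (weight_deriv s p) i = 0"
   by (simp add: weight_deriv_def k coeff_pderiv)
 qed
 show "coeff (weight_deriv s p) (Suc n) = - (real n + 2 * s)*coeff p n"
 proof (cases n)
  case 0
  with assms have "coeff p (Suc (Suc 0)) = 0" by (intro coeff_eq_0) simp
  then show ?thesis using 0 by (simp add: weight_deriv_def coeff_pderiv)
 next
  case (Suc k)
  with assms have "coeff p (Suc (Suc (Suc k))) = 0" by (intro coeff_eq_0) simp
  then show ?thesis using Suc by (simp add: weight_deriv_def coeff_pderiv algebra_simps)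
 qed
qed

lemma weight_poly_deriv:
 assumes x: "x \<in> {-1<..<1}"
 shows "((%t. (1 - t\<^sup>2) powr s*poly p t) has_real_derivative (1 - x\<^sup>2) powr (s - 1)*poly (weight_deriv s p) x) (at x)"
proof -
 have p: "1 - x\<^sup>2 > 0" by (rule one_minus_sq_pos[OF x])
 have d: "((%t. (1 - t\<^sup>2) powr s) has_real_derivative s*(1 - x\<^sup>2) powr (s - of_nat 1)*(- 2*x)) (at x)"
  by (rule DERIV_fun_powr) (use p in \<open>auto intro!: derivative_eq_intros\<close>)
 have "((%t. (1 - t\<^sup>2) powr s*poly p t) has_real_derivative
   (1 - x\<^sup>2) powr s*poly (pderiv p) x + (s*(1 - x\<^sup>2) powr (s - of_nat 1)*(- 2*x))*poly p x) (at x)"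
  by (intro DERIV_mult' d poly_DERIV)
 also have "(1 - x\<^sup>2) powr s = (1 - x\<^sup>2) powr (s - 1)*(1 - x\<^sup>2)"
  using powr_add[of "1 - x\<^sup>2" "s - 1" 1] p by simp
 also have "(1 - x\<^sup>2) powr (s - 1)*(1 - x\<^sup>2)*poly (pderiv p) x + (s*(1 - x\<^sup>2) powr (s - of_nat 1)*(- 2*x))*poly p x
   = (1 - x\<^sup>2) powr (s - 1)*poly (weight_deriv s p) x"
  by (simp add: weight_deriv_def algebra_simps power2_eq_square)
 finally show ?thesis .
qed

text \<open>The operator in reference coordinates: the derivative of the potential of \<open>d/dy ((1 - y\<^sup>2)
 powr s * p)\<close>.\<close>

definition K_poly :: "real => real poly => real poly" where
 "K_poly s p = pderiv (riesz_poly s (weight_deriv s p))"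

text \<open>The product of the leading coefficients contributed by \<open>weight_deriv\<close>, the potential and the
 outer derivative.\<close>

definition K_eigenvalue :: "real => nat => real" where
 "K_eigenvalue s n = riesz_const s*pochhammer (2 * s) (Suc n)/fact n"

lemma K_eigenvalue_pos:
 assumes s: "0 < s" "s < 1" shows "K_eigenvalue s n > 0"
 unfolding K_eigenvalue_def using s riesz_const_pos[OF s]
 by (intro divide_pos_pos mult_pos_pos pochhammer_pos) auto

lemma K_poly_degree:
 assumes s: "0 < s" "s < 1" and p: "degree p <= n"
 shows "degree (K_poly s p) <= n" "coeff (K_poly s p) n = K_eigenvalue s n*coeff p n"
proof -
 note w = weight_deriv_degree[OF p, of s]
 have d: "degree (riesz_poly s (weight_deriv s p)) <= Suc n"
  by (rule riesz_poly(1)[OF s w(1)])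
 then show "degree (K_poly s p) <= n"
  by (simp add: K_poly_def degree_pderiv)
 have "coeff (K_poly s p) n = real (Suc n)*(riesz_lead s (Suc n)*(- (real n + 2 * s)*coeff p n))"
  unfolding K_poly_def coeff_pderiv riesz_poly(3)[OF s w(1), of, simplified] w(2) by simp
 also have "... = K_eigenvalue s n*coeff p n"
  by (simp add: riesz_lead_def K_eigenvalue_def pochhammer_Suc field_simps del: of_nat_Suc)
 finally show "coeff (K_poly s p) n = K_eigenvalue s n*coeff p n" .
qed

lemma affine_mem_iff:
 assumes "a < b" shows "(a + b)/2 + (b - a)/2*z \<in> {a<..<b} \<longleftrightarrow> z \<in> {-1<..<1::real}"
proof -
 define m h where "m = (a + b)/2" and "h = (b - a)/2"
 have h: "h > 0" and ab: "a = m - h" "b = m + h"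
  using assms by (auto simp: m_def h_def field_simps)
 have "(- h < h*z \<longleftrightarrow> -1 < z) \<and> (h*z < h \<longleftrightarrow> z < 1)"
  using h mult_less_cancel_left_pos[of h "-1" z] mult_less_cancel_left_pos[of h z 1] by simp
 then show ?thesis unfolding m_def[symmetric] h_def[symmetric] ab by auto
qed

lemma ivl_weight_affine:
 assumes "a < b"
 shows "ivl_weight s a b ((a + b)/2 + (b - a)/2*z) = ((b - a)/2) powr (2 * s)*jacobi s z"
proof (cases "z \<in> {-1<..<1}")
 case True
 define h where "h = (b - a)/2"
 have h: "h > 0" using assms by (simp add: h_def)
 have e: "(a + b)/2 + h*z - a = h*(1 + z)" "b - ((a + b)/2 + h*z) = h*(1 - z)"
  by (simp_all add: h_def field_simps)
 have "(h*(1 + z)) powr s*(h*(1 - z)) powr s = (h powr s*h powr s)*((1 + z) powr s*(1 - z) powr s)"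
  using h True by (simp add: powr_mult)
 also have "h powr s*h powr s = h powr (2 * s)"
  by (simp add: powr_add[symmetric])
 also have "(1 + z) powr s*(1 - z) powr s = ((1 + z)*(1 - z)) powr s"
  using True by (simp add: powr_mult)
 also have "(1 + z)*(1 - z) = 1 - z\<^sup>2" by (simp add: algebra_simps power2_eq_square)
 finally show ?thesis
  using True affine_mem_iff[OF assms, of z] unfolding ivl_weight_def h_def[symmetric] e
  by (simp add: jacobi_def)
next
 case False
 then show ?thesis using affine_mem_iff[OF assms, of z] by (simp add: ivl_weight_def jacobi_def)
qed

lemma weighted_poly_deriv_affine:
 assumes ab: "a < b" and z: "z \<in> {-1<..<1}"
 defines "m \<equiv> (a + b)/2" and "h \<equiv> (b - a)/2"
 shows "deriv (%t. ivl_weight s a b t*poly p t) (m + h*z)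
   = h powr (2 * s - 1)*((1 - z\<^sup>2) powr (s - 1)*poly (weight_deriv s (pcompose p [:m, h:])) z)"
proof -
 let ?ph = "pcompose p [:m, h:]"
 let ?q = "(1 - z\<^sup>2) powr (s - 1)*poly (weight_deriv s ?ph) z"
 have h: "h > 0" using ab by (simp add: h_def)
 have i: "((%t. (t - m)/h) has_real_derivative 1/h) (at (m + h*z))"
  using h by (auto intro!: derivative_eq_intros)
 have x: "(m + h*z - m)/h = z" using h by simp
 have "((%t. (1 - ((t - m)/h)\<^sup>2) powr s*poly ?ph ((t - m)/h)) has_real_derivative ?q*(1/h)) (at (m + h*z))"
  using DERIV_chain2[where f="%t. (1 - t\<^sup>2) powr s*poly ?ph t" and g="%t. (t - m)/h" and x="m + h*z", OF _ i]
   weight_poly_deriv[OF z, of s ?ph] x by simp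
 then have "((%t. h powr (2 * s)*((1 - ((t - m)/h)\<^sup>2) powr s*poly ?ph ((t - m)/h))) has_real_derivative
   h powr (2 * s)*(?q*(1/h))) (at (m + h*z))"
  by (rule DERIV_cmult)
 then have "((%t. ivl_weight s a b t*poly p t) has_real_derivative h powr (2 * s)*(?q*(1/h))) (at (m + h*z))"
 proof (rule has_field_derivative_transform_within_open[where S="{a<..<b}"])
  show "m + h*z \<in> {a<..<b}"
   unfolding m_def h_def using affine_mem_iff[OF ab] z by blast
  fix t assume t: "t \<in> {a<..<b}"
  define \<tau> where "\<tau> = (t - m)/h"
  have te: "t = m + h*\<tau>" using h by (simp add: \<tau>_def)
  have "\<tau> \<in> {-1<..<1}" using t affine_mem_iff[OF ab, of \<tau>] unfolding te m_def h_def by simp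
  moreover have "ivl_weight s a b t = h powr (2 * s)*jacobi s \<tau>"
   unfolding te m_def h_def by (rule ivl_weight_affine[OF ab])
  ultimately have "ivl_weight s a b t = h powr (2 * s)*(1 - \<tau>\<^sup>2) powr s"
   by (simp add: jacobi_def)
  then show "h powr (2 * s)*((1 - ((t - m)/h)\<^sup>2) powr s*poly ?ph ((t - m)/h)) = ivl_weight s a b t*poly p t"
   unfolding \<tau>_def[symmetric] by (simp add: poly_pcompose te mult.commute)
 qed simp
 then have "deriv (%t. ivl_weight s a b t*poly p t) (m + h*z) = h powr (2 * s)*(?q*(1/h))"
  by (rule DERIV_imp_deriv)
 also have "... = h powr (2 * s - 1)*?q"
  using h by (simp add: powr_diff)
 finally show ?thesis .
qed

lemma K_kernel_scale:
 assumes "h > 0" "t ~= 0"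
 shows "h powr (2 * s - 1)*K_kernel s (h*t) = K_kernel s t + log_const s*ln h"
proof (cases "s = 1/2")
 case True
 then show ?thesis unfolding True using assms
  by (simp add: K_kernel_def log_const_def abs_mult ln_mult add_divide_distrib)
next
 case False
 have "h powr (2 * s - 1)*h powr (1 - 2 * s) = 1"
  using assms by (simp add: powr_add[symmetric])
 then show ?thesis using False assms
  by (simp add: K_kernel_def log_const_def abs_mult powr_mult)
qed

text \<open>The scaling of the kernel cancels the scaling of the weight and of the two derivatives, so
 in the reference coordinate the operator does not depend on the interval; for the logarithmic
 kernel the scaling leaves an additive constant, which the outer derivative removes.\<close>

theorem K_integral_poly:
 assumes s: "0 < s" "s < 1" and ab: "a < b" and z: "z \<in> {-1<..<1}"
 shows "K_integral s a b (poly p) ((a + b)/2 + (b - a)/2*z)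
   = poly (K_poly s (pcompose p [:(a + b)/2, (b - a)/2:])) z"
proof -
 define m h where "m = (a + b)/2" and "h = (b - a)/2"
 have h: "h > 0" using ab by (simp add: h_def)
 let ?ph = "pcompose p [:m, h:]"
 let ?q = "poly (weight_deriv s ?ph)"
 let ?w = "%y. jacobi (s - 1) y*?q y"
 let ?R = "riesz_poly s (weight_deriv s ?ph)"
 define k where "k = h*(log_const s*ln h*(LINT y|lebesgue. ?w y))"
 let ?D = "deriv (%t. ivl_weight s a b t*poly p t)"
 have cq: "continuous_on {-1..1} ?q" by (intro continuous_intros)
 have wi: "integrable lebesgue ?w"
  using s by (intro integrable_jacobi_mult cq) auto
 have inner: "(LINT y:{a<..<b}|lebesgue. K_kernel s (m + h*\<zeta> - y)*?D y) = h*poly ?R \<zeta> + k"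
  if \<zeta>: "\<zeta> \<in> {-1<..<1}" for \<zeta>
 proof -
  have Ji: "integrable lebesgue (%y. K_kernel s (\<zeta> - y)*?w y)"
   using riesz_integrable[OF s \<zeta> cq] by (subst integrable_completion) auto
  have "(LINT y:{a<..<b}|lebesgue. K_kernel s (m + h*\<zeta> - y)*?D y)
    = h*(LINT t|lebesgue. indicator {a<..<b} (m + h*t)*(K_kernel s (m + h*\<zeta> - (m + h*t))*?D (m + h*t)))"
   unfolding set_lebesgue_integral_def
   using lebesgue_integral_real_affine[of h "%y. indicator {a<..<b} y *\<^sub>R (K_kernel s (m + h*\<zeta> - y)*?D y)" m] h
   by simp
  also have "(LINT t|lebesgue. indicator {a<..<b} (m + h*t)*(K_kernel s (m + h*\<zeta> - (m + h*t))*?D (m + h*t)))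
    = (LINT t|lebesgue. K_kernel s (\<zeta> - t)*?w t + log_const s*ln h*?w t)"
  proof -
   let ?L = "%t. indicator {a<..<b} (m + h*t)*(K_kernel s (m + h*\<zeta> - (m + h*t))*?D (m + h*t))"
   let ?F = "%t. K_kernel s (\<zeta> - t)*?w t + log_const s*ln h*?w t"
   have Fm: "?F \<in> borel_measurable lebesgue"
    using Ji wi by (intro borel_measurable_add borel_measurable_times borel_measurable_integrable) auto
   have LF: "?L t = ?F t" if elim: "t ~= \<zeta>" for t
    proof (cases "t \<in> {-1<..<1}")
     case True
     have "m + h*t \<in> {a<..<b}" unfolding m_def h_def using affine_mem_iff[OF ab] True by blast
     moreover have "m + h*\<zeta> - (m + h*t) = h*(\<zeta> - t)" by (simp add: algebra_simps)
     moreover have "?D (m + h*t) = h powr (2 * s - 1)*?w t"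
      using weighted_poly_deriv_affine[OF ab True, of s p] True
      unfolding m_def[symmetric] h_def[symmetric] by (simp add: jacobi_def)
     ultimately have "indicator {a<..<b} (m + h*t)*(K_kernel s (m + h*\<zeta> - (m + h*t))*?D (m + h*t))
       = (h powr (2 * s - 1)*K_kernel s (h*(\<zeta> - t)))*?w t"
      by simp
     also have "... = (K_kernel s (\<zeta> - t) + log_const s*ln h)*?w t"
      by (subst K_kernel_scale) (use h elim in auto)
     finally show ?thesis by (simp add: algebra_simps)
    next
     case False
     then have "m + h*t \<notin> {a<..<b}" unfolding m_def h_def using affine_mem_iff[OF ab] by blast
     then show ?thesis using False by (simp add: jacobi_outside)
    qed
   have "?L = (%t. if t = \<zeta> then ?L \<zeta> else ?F t)"
    using LF by (auto simp: fun_eq_iff)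
   moreover have "(LINT t|lebesgue. (if t = \<zeta> then ?L \<zeta> else ?F t)) = (LINT t|lebesgue. ?F t)"
   proof (rule integral_cong_AE)
    show "(%t. if t = \<zeta> then ?L \<zeta> else ?F t) \<in> borel_measurable lebesgue"
     by (rule measurable_If[OF measurable_const Fm]) auto
    have "AE t in lebesgue. t ~= \<zeta>"
     by (intro AE_completion AE_lborel_singleton)
    then show "AE t in lebesgue. (if t = \<zeta> then ?L \<zeta> else ?F t) = ?F t"
     by eventually_elim simp
   qed (rule Fm)
   ultimately show ?thesis by (simp only:)
  qed
  also have "... = riesz_op s ?q \<zeta> + log_const s*ln h*(LINT y|lebesgue. ?w y)"
  proof -
   have "riesz_op s ?q \<zeta> = (LINT y|lebesgue. K_kernel s (\<zeta> - y)*?w y)"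
    unfolding riesz_op_def using borel_measurable_integrable[OF riesz_integrable[OF s \<zeta> cq]]
    by (intro integral_completion[symmetric])
   then show ?thesis using Ji wi by simp
  qed
  also have "riesz_op s ?q \<zeta> = poly ?R \<zeta>"
   by (rule riesz_poly(2)[OF s \<zeta>])
  finally show ?thesis by (simp add: k_def distrib_left)
 qed
 have i: "((%t. (t - m)/h) has_real_derivative 1/h) (at (m + h*z))"
  using h by (auto intro!: derivative_eq_intros)
 have x: "(m + h*z - m)/h = z" using h by simp
 have "((%t. poly ?R ((t - m)/h)) has_real_derivative poly (pderiv ?R) z*(1/h)) (at (m + h*z))"
  using DERIV_chain2[where f="poly ?R" and g="%t. (t - m)/h" and x="m + h*z", OF poly_DERIV i] x by simp
 then have "((%t. h*poly ?R ((t - m)/h) + k) has_real_derivative h*(poly (pderiv ?R) z*(1/h)) + 0) (at (m + h*z))"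
  by (intro DERIV_add DERIV_cmult DERIV_const)
 then have "((%x. LINT y:{a<..<b}|lebesgue. K_kernel s (x - y)*?D y) has_real_derivative h*(poly (pderiv ?R) z*(1/h)) + 0) (at (m + h*z))"
 proof (rule has_field_derivative_transform_within_open[where S="{a<..<b}"])
  show "m + h*z \<in> {a<..<b}"
   unfolding m_def h_def using affine_mem_iff[OF ab] z by blast
  fix t assume t: "t \<in> {a<..<b}"
  define \<tau> where "\<tau> = (t - m)/h"
  have te: "t = m + h*\<tau>" using h by (simp add: \<tau>_def)
  have "\<tau> \<in> {-1<..<1}" using t affine_mem_iff[OF ab, of \<tau>] unfolding te m_def h_def by simp
  from inner[OF this] show "h*poly ?R ((t - m)/h) + k = (LINT y:{a<..<b}|lebesgue. K_kernel s (t - y)*?D y)"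
   unfolding \<tau>_def[symmetric] te[symmetric] by simp
 qed simp
 then have "K_integral s a b (poly p) (m + h*z) = h*(poly (pderiv ?R) z*(1/h)) + 0"
  unfolding K_integral_def by (rule DERIV_imp_deriv)
 then show ?thesis
  using h by (simp add: m_def[symmetric] h_def[symmetric] K_poly_def)
qed

lemma riesz_pair_integrable:
 assumes s: "0 < s" "s < 1" and q: "continuous_on {-1..1} q" and r: "continuous_on {-1..1} r"
 shows "integrable (lborel \<Otimes>\<^sub>M lborel) (%(x, y). jacobi (s - 1) x*r x*(K_kernel s (x - y)*(jacobi (s - 1) y*q y)))"
proof (rule lborel_pair.Fubini_integrable)
 let ?w = "%y. jacobi (s - 1) y*q y" and ?v = "%x. jacobi (s - 1) x*r x"
 have wm [measurable]: "?w \<in> borel_measurable borel" "?v \<in> borel_measurable borel"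
  by (intro jacobi_mult_measurable q r)+
 have vi: "integrable lborel ?v"
  using s r by (intro integrable_lborel_jacobi_mult) auto
 show "(%(x, y). ?v x*(K_kernel s (x - y)*?w y)) \<in> borel_measurable (lborel \<Otimes>\<^sub>M lborel)"
  by measurable
 obtain C where C: "C >= 0" "!!x. x \<in> {-1<..<1} ==> (LINT y|lborel. \<bar>K_kernel s (x - y)*?w y\<bar>) <= C"
  using riesz_abs_bound[OF s q] by blast
 have inner: "(LINT y|lborel. norm (?v x*(K_kernel s (x - y)*?w y))) = \<bar>?v x\<bar>*(LINT y|lborel. \<bar>K_kernel s (x - y)*?w y\<bar>)" for x
  by (simp only: real_norm_def abs_mult[of "?v x"]) simp
 show "integrable lborel (%x. (LINT y|lborel. norm ((%(x, y). ?v x*(K_kernel s (x - y)*?w y)) (x, y))))"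
 proof (rule Bochner_Integration.integrable_bound)
  show "integrable lborel (%x. C*?v x)" by (intro integrable_mult_right vi)
  have "\<bar>?v x\<bar>*(LINT y|lborel. \<bar>K_kernel s (x - y)*?w y\<bar>) <= \<bar>C*?v x\<bar>" for x
  proof (cases "x \<in> {-1<..<1}")
   case True
   have "\<bar>?v x\<bar>*(LINT y|lborel. \<bar>K_kernel s (x - y)*?w y\<bar>) <= \<bar>?v x\<bar>*C"
    using C(2)[OF True] by (intro mult_left_mono) auto
   then show ?thesis using C(1) by (simp add: abs_mult mult_ac)
  qed (simp add: jacobi_outside)
  then show "AE x in lborel. norm (LINT y|lborel. norm ((%(x, y). ?v x*(K_kernel s (x - y)*?w y)) (x, y))) <= norm (C*?v x)"
   by (simp only: inner prod.case) (simp add: abs_mult)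
 qed measurable
 show "AE x in lborel. integrable lborel (%y. (%(x, y). ?v x*(K_kernel s (x - y)*?w y)) (x, y))"
 proof (rule AE_I2)
  fix x
  show "integrable lborel (%y. (%(x, y). ?v x*(K_kernel s (x - y)*?w y)) (x, y))"
  proof (cases "x \<in> {-1<..<1}")
   case True
   show ?thesis unfolding prod.case
    by (intro integrable_mult_right riesz_integrable[OF s True q])
  qed (simp add: jacobi_outside)
 qed
qed

lemma weighted_poly_zero_ends:
 assumes "0 < s"
 shows "continuous_on {-1..1} (%x::real. (1 - x\<^sup>2) powr s*poly p x)"
proof (intro continuous_on_mult continuous_on_powr')
 show "\<forall>x\<in>{-1..1}. (0::real) <= 1 - x\<^sup>2 \<and> (1 - x\<^sup>2 = 0 --> 0 < s)"
  using assms by (auto simp: abs_square_le_1)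
qed (intro continuous_intros)+

lemma K_poly_by_parts:
 assumes s: "0 < s" "s < 1"
 shows "wint s (%x. poly (K_poly s p) x*poly r x)
   = - (LINT x|lborel. jacobi (s - 1) x*poly (weight_deriv s r) x*riesz_op s (poly (weight_deriv s p)) x)"
proof -
 let ?R = "riesz_poly s (weight_deriv s p)"
 let ?A = "%x. poly (K_poly s p) x*poly r x" and ?B = "%x. poly ?R x*poly (weight_deriv s r) x"
 have s1: "s > -1" "s - 1 > -1" using s by auto
 have cA: "continuous_on {-1..1} ?A" and cB: "continuous_on {-1..1} ?B"
  by (intro continuous_intros)+
 have "((%x. (1 - x\<^sup>2) powr s*?A x + (1 - x\<^sup>2) powr (s - 1)*?B x) has_integral
   (wint s ?A + wint (s - 1) ?B)) {-1..1}"
  by (intro has_integral_add wint_eq_integral s1 cA cB)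
 moreover have "((%x. (1 - x\<^sup>2) powr s*?A x + (1 - x\<^sup>2) powr (s - 1)*?B x) has_integral
   (poly ?R 1*((1 - 1\<^sup>2) powr s*poly r 1) - poly ?R (-1)*((1 - (-1)\<^sup>2) powr s*poly r (-1)))) {-1..1}"
 proof (rule fundamental_theorem_of_calculus_interior)
  show "continuous_on {-1..1} (%x. poly ?R x*((1 - x\<^sup>2) powr s*poly r x))"
   by (intro continuous_on_mult[OF continuous_on_poly[OF continuous_on_id]] weighted_poly_zero_ends s)
  fix x :: real assume x: "x \<in> {-1<..<1}"
  have "((%x. poly ?R x*((1 - x\<^sup>2) powr s*poly r x)) has_real_derivative
    (poly ?R x*((1 - x\<^sup>2) powr (s - 1)*poly (weight_deriv s r) x) + poly (pderiv ?R) x*((1 - x\<^sup>2) powr s*poly r x))) (at x)"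
   by (intro DERIV_mult' poly_DERIV weight_poly_deriv x)
  then show "((%x. poly ?R x*((1 - x\<^sup>2) powr s*poly r x)) has_vector_derivative
    (1 - x\<^sup>2) powr s*?A x + (1 - x\<^sup>2) powr (s - 1)*?B x) (at x)"
   by (simp add: has_real_derivative_iff_has_vector_derivative K_poly_def algebra_simps)
 qed simp
 ultimately have "wint s ?A + wint (s - 1) ?B
   = poly ?R 1*((1 - 1\<^sup>2) powr s*poly r 1) - poly ?R (-1)*((1 - (-1)\<^sup>2) powr s*poly r (-1))"
  by (rule has_integral_unique)
 then have "wint s ?A = - wint (s - 1) ?B"
  by simp
 also have "wint (s - 1) ?B = (LINT x|lborel. jacobi (s - 1) x*?B x)"
  by (rule wint_lborel[OF cB])
 also have "... = (LINT x|lborel. jacobi (s - 1) x*poly (weight_deriv s r) x*riesz_op s (poly (weight_deriv s p)) x)"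
 proof (rule Bochner_Integration.integral_cong[OF refl])
  fix x
  show "jacobi (s - 1) x*?B x = jacobi (s - 1) x*poly (weight_deriv s r) x*riesz_op s (poly (weight_deriv s p)) x"
   by (cases "x \<in> {-1<..<1}") (simp_all add: riesz_poly(2)[OF s] jacobi_outside)
 qed
 finally show ?thesis .
qed

text \<open>In this form \<open>p\<close> and \<open>r\<close> enter alike, because the kernel is even; integration by
 parts produces no boundary terms since \<open>(1 - x\<^sup>2) powr s\<close> vanishes at the end points.\<close>

lemma K_poly_form:
 assumes s: "0 < s" "s < 1"
 shows "wint s (%x. poly (K_poly s p) x*poly r x)
   = - (LINT x|lborel. (LINT y|lborel. jacobi (s - 1) x*poly (weight_deriv s r) x *
     (K_kernel s (x - y)*(jacobi (s - 1) y*poly (weight_deriv s p) y))))"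
 unfolding K_poly_by_parts[OF s] riesz_op_def Bochner_Integration.integral_mult_right_zero ..

lemma K_poly_symmetric:
 assumes s: "0 < s" "s < 1"
 shows "wint s (%x. poly (K_poly s p) x*poly r x) = wint s (%x. poly (K_poly s r) x*poly p x)"
proof -
 let ?v = "%p x. jacobi (s - 1) x*poly (weight_deriv s p) x"
 have "integrable (lborel \<Otimes>\<^sub>M lborel) (%(x, y). ?v r x*(K_kernel s (x - y)*?v p y))"
  by (intro riesz_pair_integrable s continuous_intros)
 then have "(LINT x|lborel. (LINT y|lborel. ?v r x*(K_kernel s (x - y)*?v p y)))
   = (LINT y|lborel. (LINT x|lborel. ?v r x*(K_kernel s (x - y)*?v p y)))"
  by (rule lborel_pair.Fubini_integral[symmetric])
 also have "... = (LINT y|lborel. (LINT x|lborel. ?v p y*(K_kernel s (y - x)*?v r x)))"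
  by (intro Bochner_Integration.integral_cong refl) (simp add: K_kernel_def abs_minus_commute mult_ac)
 finally show ?thesis
  unfolding K_poly_form[OF s] by (rule arg_cong)
qed

lemma gegenbauer_orthogonal_lower:
 assumes s: "s >= 0" and r: "degree r < n"
 shows "wint s (%x. poly r x*poly (geg s n) x) = 0"
proof -
 obtain c where c: "r = (\<Sum>j\<le>degree r. smult (c j) (geg s j))"
  using gegenbauer_span[of "s + 1/2" r "degree r"] s by auto
 have "wint s (%x. poly r x*poly (geg s n) x)
   = wint s (%x. \<Sum>j\<le>degree r. c j*(poly (geg s j) x*poly (geg s n) x))"
 proof (rule wint_cong)
  fix x
  have "poly r x = (\<Sum>j\<le>degree r. c j*poly (geg s j) x)"
   by (subst c) (simp add: poly_sum)
  then show "poly r x*poly (geg s n) x = (\<Sum>j\<le>degree r. c j*(poly (geg s j) x*poly (geg s n) x))"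
   by (simp add: sum_distrib_right mult.assoc)
 qed
 also have "... = (\<Sum>j\<le>degree r. wint s (%x. c j*(poly (geg s j) x*poly (geg s n) x)))"
  using s by (intro wint_sum continuous_intros) auto
 also have "... = 0"
  unfolding wint_scale using r s
  by (intro sum.neutral ballI) (auto intro!: gegenbauer_orthogonal)
 finally show ?thesis .
qed

text \<open>For \<open>i < j\<close> the image of \<open>geg s i\<close> has too low a degree to meet \<open>geg s
 j\<close>, and \<open>j < i\<close> follows by symmetry; on the diagonal the image minus the multiple of \<open>geg s
 j\<close> has lower degree.\<close>

lemma K_poly_gegenbauer:
 assumes s: "0 < s" "s < 1"
 shows "wint s (%x. poly (K_poly s (geg s i)) x*poly (geg s j) x)
  = K_eigenvalue s j*wint s (%x. poly (geg s i) x*poly (geg s j) x)"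
proof -
 have d: "degree (geg s n) <= n" for n
  using gegenbauer_degree_lead[of "s + 1/2" n] s by auto
 have lt: "wint s (%x. poly (K_poly s (geg s i)) x*poly (geg s j) x) = 0" if "i < j" for i j
  using K_poly_degree(1)[OF s d[of i]] that s by (intro gegenbauer_orthogonal_lower) auto
 consider "i < j" | "j < i" | "i = j" by linarith
 then show ?thesis
 proof cases
  case 1
  then show ?thesis using lt[OF 1] gegenbauer_orthogonal[of s i j] s by simp
 next
  case 2
  then show ?thesis
   unfolding K_poly_symmetric[OF s, of "geg s i"] using lt[OF 2] gegenbauer_orthogonal[of s i j] s by simp
 next
  case 3
  let ?l = "K_eigenvalue s j" and ?c = "geg s j"
  let ?D = "K_poly s ?c - smult ?l ?c"
  have dD: "degree ?D <= j"
   by (rule degree_diff_le[OF K_poly_degree(1)[OF s d] order_trans[OF degree_smult_le d]])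
  have cD: "coeff ?D j = 0"
   by (simp add: K_poly_degree(2)[OF s d] del: gegenbauer.simps)
  have "wint s (%x. poly ?D x*poly ?c x) = 0"
  proof (cases j)
   case 0
   with dD cD have "?D = 0"
    by (metis leading_coeff_0_iff le_zero_eq)
   then show ?thesis by (simp only: poly_0 mult_zero_left) (simp add: wint_def)
  next
   case (Suc k)
   with dD cD have "degree ?D < j"
    using Suc by (metis degree_0 leading_coeff_0_iff le_neq_implies_less zero_less_Suc)
   then show ?thesis using s by (intro gegenbauer_orthogonal_lower) auto
  qed
  moreover have "wint s (%x. poly ?D x*poly ?c x)
    = wint s (%x. poly (K_poly s ?c) x*poly ?c x) - ?l*wint s (%x. poly ?c x*poly ?c x)"
  proof -
   have "wint s (%x. poly ?D x*poly ?c x)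
     = wint s (%x. poly (K_poly s ?c) x*poly ?c x - ?l*(poly ?c x*poly ?c x))"
    by (rule wint_cong) (simp add: algebra_simps)
   also have "... = wint s (%x. poly (K_poly s ?c) x*poly ?c x) - wint s (%x. ?l*(poly ?c x*poly ?c x))"
    using s by (intro wint_diff continuous_intros) auto
   finally show ?thesis unfolding wint_scale .
  qed
  ultimately show ?thesis using 3 by simp
 qed
qed

lemma riesz_op_linear:
 assumes s: "0 < s" "s < 1" and x: "x \<in> {-1<..<1}" and q: "continuous_on {-1..1} q" "continuous_on {-1..1} r"
 shows "riesz_op s (%y. q y + c*r y) x = riesz_op s q x + c*riesz_op s r x"
proof -
 have e: "K_kernel s (x - y)*(jacobi (s - 1) y*(q y + c*r y))
   = K_kernel s (x - y)*(jacobi (s - 1) y*q y) + c*(K_kernel s (x - y)*(jacobi (s - 1) y*r y))" for y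
  by (simp add: algebra_simps)
 show ?thesis
  unfolding riesz_op_def e using riesz_integrable[OF s x q(1)] riesz_integrable[OF s x q(2)] by simp
qed

lemma poly_eq_on_interval:
 fixes p q :: "real poly"
 assumes "!!x. x \<in> {-1<..<1} ==> poly p x = poly q x" shows "p = q"
proof (rule ccontr)
 assume "p ~= q"
 then have "finite {x. poly (p - q) x = 0}" by (intro poly_roots_finite) simp
 moreover have "{-1<..<1} \<subseteq> {x. poly (p - q) x = 0}" using assms by auto
 ultimately have "finite {-1<..<1::real}" by (rule finite_subset[rotated])
 then show False by (simp add: infinite_Ioo)
qed

lemma weight_deriv_linear: "weight_deriv s (p + smult c q) = weight_deriv s p + smult c (weight_deriv s q)"
 by (simp add: weight_deriv_def pderiv_add pderiv_smult algebra_simps smult_add_right smult_diff_right)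

lemma K_poly_linear:
 assumes s: "0 < s" "s < 1"
 shows "K_poly s (p + smult c q) = K_poly s p + smult c (K_poly s q)"
proof -
 have "riesz_poly s (weight_deriv s (p + smult c q)) = riesz_poly s (weight_deriv s p) + smult c (riesz_poly s (weight_deriv s q))"
 proof (rule poly_eq_on_interval)
  fix x :: real assume x: "x \<in> {-1<..<1}"
  have "poly (riesz_poly s (weight_deriv s (p + smult c q))) x = riesz_op s (%y. poly (weight_deriv s p) y + c*poly (weight_deriv s q) y) x"
  proof -
   have "poly (weight_deriv s (p + smult c q)) = (%y. poly (weight_deriv s p) y + c*poly (weight_deriv s q) y)"
    by (simp add: weight_deriv_linear fun_eq_iff)
   then show ?thesis
    using riesz_poly(2)[OF s x, of "weight_deriv s (p + smult c q)"] by simp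
  qed
  also have "... = poly (riesz_poly s (weight_deriv s p) + smult c (riesz_poly s (weight_deriv s q))) x"
   by (subst riesz_op_linear[OF s x]) (auto intro!: continuous_intros simp: riesz_poly(2)[OF s x])
  finally show "poly (riesz_poly s (weight_deriv s (p + smult c q))) x = poly (riesz_poly s (weight_deriv s p) + smult c (riesz_poly s (weight_deriv s q))) x" .
 qed
 then show ?thesis by (simp add: K_poly_def pderiv_add pderiv_smult)
qed

text \<open>The operator preserves degrees and is symmetric for the weight, so it is diagonal in the
 orthogonal polynomials.\<close>

theorem K_poly_coefficient:
 assumes s: "0 < s" "s < 1"
 shows "wint s (%x. poly (K_poly s p) x*poly (geg s j) x)
  = K_eigenvalue s j*wint s (%x. poly p x*poly (geg s j) x)"
proof -
 have s1: "s > -1" using s by simp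
 obtain c where c: "p = (\<Sum>i\<le>degree p. smult (c i) (geg s i))"
  using gegenbauer_span[of "s + 1/2" p "degree p"] s by auto
 have "wint s (%x. poly (K_poly s (\<Sum>i\<le>n. smult (c i) (geg s i))) x*poly (geg s j) x)
  = K_eigenvalue s j*wint s (%x. poly (\<Sum>i\<le>n. smult (c i) (geg s i)) x*poly (geg s j) x)" for n
 proof (induction n)
  case 0
  have "K_poly s (smult (c 0) (geg s 0)) = smult (c 0) (K_poly s (geg s 0))"
   using K_poly_linear[OF s, of 0 "c 0" "geg s 0"] K_poly_linear[OF s, of 0 "-1" 0] by simp
  then show ?case
   using K_poly_gegenbauer[OF s, of 0 j]
   by (simp add: wint_scale mult.assoc mult.left_commute)
 next
  case (Suc n)
  let ?p = "\<Sum>i\<le>n. smult (c i) (geg s i)" and ?g = "geg s (Suc n)" and ?e = "poly (geg s j)"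
  have lin: "wint s (%x. poly (P + smult k Q) x*?e x)
    = wint s (%x. poly P x*?e x) + k*wint s (%x. poly Q x*?e x)" for P Q k
  proof -
   have "wint s (%x. poly (P + smult k Q) x*?e x)
     = wint s (%x. poly P x*?e x + k*(poly Q x*?e x))"
    by (rule wint_cong) (simp add: algebra_simps)
   also have "... = wint s (%x. poly P x*?e x) + wint s (%x. k*(poly Q x*?e x))"
    by (intro wint_add s1 continuous_intros)
   finally show ?thesis unfolding wint_scale .
  qed
  have e: "(\<Sum>i\<le>Suc n. smult (c i) (geg s i)) = ?p + smult (c (Suc n)) ?g" by simp
  show ?case
   unfolding e K_poly_linear[OF s] lin Suc.IH K_poly_gegenbauer[OF s] by (simp add: algebra_simps)
 qed
 from this[of "degree p"] show ?thesis using c by simp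
qed

text \<open>Gauss's product for the Gamma function gives the growth of the eigenvalues.\<close>

theorem K_eigenvalue_bounds:
 assumes s: "0 < s" "s < 1"
 obtains c1 c2 where "0 < c1" "0 < c2"
  "!!n. c1*(1 + (real n)\<^sup>2) powr s <= K_eigenvalue s n" "!!n. K_eigenvalue s n <= c2*(1 + (real n)\<^sup>2) powr s"
proof -
 let ?r = "%n. K_eigenvalue s n/(1 + (real n)\<^sup>2) powr s"
 have p: "0 < (1 + (real n)\<^sup>2) powr s" for n
  by (simp add: add_pos_nonneg less_imp_neq[symmetric])
 have rp: "?r n > 0" for n using K_eigenvalue_pos[OF s] p by simp
 have G: "Gamma_series (2 * s) \<longlonglongrightarrow> Gamma (2 * s)" by (rule Gamma_series_LIMSEQ)
 have Gp: "Gamma (2 * s) > 0" using s by (intro Gamma_real_pos) simp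
 have q: "(%n. ((real n)\<^sup>2/(1 + (real n)\<^sup>2)) powr s) \<longlonglongrightarrow> 1 powr s"
 proof (intro tendsto_powr tendsto_const)
  show "(%n. (real n)\<^sup>2/(1 + (real n)\<^sup>2)) \<longlonglongrightarrow> 1"
   by real_asymp
 qed simp
 have lim: "(%n. riesz_const s/Gamma_series (2 * s) n*((real n)\<^sup>2/(1 + (real n)\<^sup>2)) powr s) \<longlonglongrightarrow> riesz_const s/Gamma (2 * s)*1 powr s"
  using Gp by (intro tendsto_mult tendsto_divide tendsto_const G q) auto
 have ev: "\<forall>\<^sub>F n in sequentially. riesz_const s/Gamma_series (2 * s) n*((real n)\<^sup>2/(1 + (real n)\<^sup>2)) powr s = ?r n"
  using eventually_gt_at_top[of 0]
 proof eventually_elim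
  case (elim n)
  have "exp (2 * s*ln (real n)) = (real n) powr (2 * s)" using elim by (simp add: powr_def)
  also have "... = ((real n) powr 2) powr s" by (simp only: powr_powr)
  also have "(real n) powr 2 = (real n)\<^sup>2" using elim by simp
  finally have e: "Gamma_series (2 * s) n = fact n*((real n)\<^sup>2) powr s/pochhammer (2 * s) (n + 1)"
   unfolding Gamma_series_def by (simp only: of_real_eq_id id_apply)
  have n2: "((real n)\<^sup>2) powr s > 0" using elim by simp
  have "((real n)\<^sup>2/(1 + (real n)\<^sup>2)) powr s = ((real n)\<^sup>2) powr s/(1 + (real n)\<^sup>2) powr s"
   by (simp add: powr_divide add_nonneg_nonneg)
  then show ?case
   unfolding e K_eigenvalue_def using n2 by (simp add: field_simps)
 qed
 have L: "?r \<longlonglongrightarrow> riesz_const s/Gamma (2 * s)"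
  using Lim_transform_eventually[OF lim ev] by simp
 have Lp: "riesz_const s/Gamma (2 * s) > 0" using riesz_const_pos[OF s] Gp by simp
 from convergent_imp_Bseq[OF convergentI[OF L]] obtain c2 where c2: "c2 > 0" "!!n. norm (?r n) <= c2"
  unfolding Bseq_def by blast
 have "(%n. inverse (?r n)) \<longlonglongrightarrow> inverse (riesz_const s/Gamma (2 * s))"
  using Lp by (intro tendsto_inverse L) auto
 from convergent_imp_Bseq[OF convergentI[OF this]] obtain d where d: "d > 0" "!!n. norm (inverse (?r n)) <= d"
  unfolding Bseq_def by blast
 show ?thesis
 proof (rule that[of "1/d" c2])
  fix n
  have "inverse (?r n) <= d" using d(2)[of n] K_eigenvalue_pos[OF s, of n] by simp
  moreover have "0 < inverse (?r n)" using rp[of n] by (rule positive_imp_inverse_positive)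
  ultimately have "inverse d <= inverse (inverse (?r n))" by (rule le_imp_inverse_le)
  then have "1/d <= ?r n" by (simp only: inverse_inverse_eq inverse_eq_divide[of d])
  then show "1/d*(1 + (real n)\<^sup>2) powr s <= K_eigenvalue s n"
   using p[of n] by (simp add: pos_le_divide_eq)
  have "?r n <= c2" using c2(2)[of n] K_eigenvalue_pos[OF s, of n] by simp
  then show "K_eigenvalue s n <= c2*(1 + (real n)\<^sup>2) powr s"
   using p[of n] by (simp add: pos_divide_le_eq)
 qed (use c2 d in auto)
qed

section \<open>A Hardy inequality on one interval\<close>

lemma C1_pos:
 assumes s: "0 < s" "s < 1" shows "C1 s > 0"
proof -
 have "Gamma (s + 1/2) > 0" "Gamma (1 - s) > 0" "(2::real) powr (2 * s) > 0"
  using s by (auto intro: Gamma_real_pos)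
 then show ?thesis unfolding C1_def using s by simp
qed

text \<open>Legendre duplication and the reflection formula for the Gamma function identify the constant
 of the singular integral with the second derivative of the kernel.\<close>

lemma C1_eq:
 assumes s: "0 < s" "s < 1" shows "C1 s = 2 * s*(Gamma (2 * s) * sin (pi * s)/pi)"
proof -
 have dup: "Gamma s*Gamma (s + 1/2) = 2 powr (1 - 2 * s) * sqrt pi*Gamma (2 * s)"
 proof -
  have "complex_of_real s \<notin> \<int>\<^sub>\<le>\<^sub>0" "complex_of_real s + 1/2 \<notin> \<int>\<^sub>\<le>\<^sub>0"
   using s by (auto elim!: nonpos_Ints_cases simp: complex_eq_iff)
  from Gamma_legendre_duplication[OF this]
  have "Gamma (complex_of_real s)*Gamma (complex_of_real (s + 1/2))
    = complex_of_real (exp ((1 - 2 * s)*ln 2))*complex_of_real (sqrt pi)*Gamma (complex_of_real (2 * s))"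
   by (simp add: exp_of_real[symmetric])
  then have "complex_of_real (Gamma s*Gamma (s + 1/2)) = complex_of_real (exp ((1 - 2 * s)*ln 2) * sqrt pi*Gamma (2 * s))"
   unfolding Gamma_complex_of_real of_real_mult[of "Gamma s"] of_real_mult[of _ "Gamma (2 * s)"] of_real_mult[of _ "sqrt pi"] .
  then have "Gamma s*Gamma (s + 1/2) = exp ((1 - 2 * s)*ln 2) * sqrt pi*Gamma (2 * s)"
   by (simp only: of_real_eq_iff)
  then show ?thesis by (simp add: powr_def)
 qed
 have ref: "Gamma s*Gamma (1 - s) = pi/sin (pi * s)"
 proof -
  have "Gamma (complex_of_real s)*Gamma (complex_of_real (1 - s)) = complex_of_real (pi/sin (pi * s))"
   using Gamma_reflection_complex[of "complex_of_real s"] by (simp add: sin_of_real[symmetric])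
  then have "complex_of_real (Gamma s*Gamma (1 - s)) = complex_of_real (pi/sin (pi * s))"
   by (simp only: Gamma_complex_of_real of_real_mult)
  then show ?thesis by (simp only: of_real_eq_iff)
 qed
 have sp: "sin (pi * s) > 0"
  using s by (intro sin_gt_zero) auto
 have g: "Gamma s > 0" "Gamma (1 - s) > 0" "Gamma (s + 1/2) > 0"
  using s by (auto intro!: Gamma_real_pos)
 have "2 powr (2 * s)*(2 powr (1 - 2 * s)) = (2::real)"
  by (simp add: powr_add[symmetric])
 then have p: "2 powr (2 * s) = 2/2 powr (1 - 2 * s :: real)"
  by (simp add: field_simps)
 have gs: "Gamma (2 * s) = Gamma s*Gamma (s + 1/2)/(2 powr (1 - 2 * s) * sqrt pi)"
  unfolding dup by simp
 have g1: "1/Gamma (1 - s) = Gamma s * sin (pi * s)/pi"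
  using ref g sp by (simp add: field_simps)
 have "C1 s = 2 powr (2 * s) * s*Gamma (s + 1/2)/sqrt pi*(1/Gamma (1 - s))"
  by (simp add: C1_def)
 then show ?thesis unfolding g1 gs p by simp
qed

lemma C1_Cs: assumes s: "0 < s" "s < 1" "s ~= 1/2" shows "C1 s = 2 * s*(1 - 2 * s)*Cs s"
proof -
 have "C1 s = 2 * s*(Cs s*(1 - 2 * s))"
  unfolding Cs_times[OF s] by (rule C1_eq[OF s(1,2)])
 then show ?thesis by (simp only: mult_ac)
qed

lemma C1_half: "C1 (1/2) = 1/pi"
 using C1_eq[of "1/2"] by simp

lemma K_kernel_deriv_pos:
 assumes s: "0 < s" "s < 1" and t: "t > 0"
 shows "(K_kernel s has_real_derivative (C1 s/(2 * s))*t powr (- 2 * s)) (at t)"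
proof (cases "s = 1/2")
 case True
 have "((%t. ln t/pi) has_real_derivative (1/t)/pi) (at t)"
  using t by (auto intro!: derivative_eq_intros)
 then have "(K_kernel (1/2) has_real_derivative (1/t)/pi) (at t)"
  by (rule has_field_derivative_transform_within_open[where S="{0<..}"]) (use t in \<open>auto simp: K_kernel_def\<close>)
 then show ?thesis using t unfolding True C1_half by (simp add: powr_minus_divide mult.commute)
next
 case False
 have "((%t. Cs s*t powr (1 - 2 * s)) has_real_derivative Cs s*((1 - 2 * s)*t powr (1 - 2 * s - 1))) (at t)"
  by (intro DERIV_cmult has_real_derivative_powr t)
 then have "(K_kernel s has_real_derivative Cs s*((1 - 2 * s)*t powr (1 - 2 * s - 1))) (at t)"
  by (rule has_field_derivative_transform_within_open[where S="{0<..}"]) (use t False in \<open>auto simp: K_kernel_def\<close>)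
 moreover have "Cs s*((1 - 2 * s)*t powr (1 - 2 * s - 1)) = (C1 s/(2 * s))*t powr (- 2 * s)"
  using s unfolding C1_Cs[OF s False] by simp
 ultimately show ?thesis by (simp only:)
qed

text \<open>A density on tent widths whose superposition of tents \<open>max 0 (d - \<bar>t\<bar>)\<close> reproduces minus
 the kernel up to a constant for \<open>\<bar>t\<bar> \<le> 2\<close>. Tents wider than the interval contribute linearly
 in \<open>\<bar>t\<bar>\<close>, so all of them may be gathered in the widths between 2 and 3.\<close>

definition tent_density :: "real => real => real" where
 "tent_density s d = (if 0 < d \<and> d < 2 then d powr (- 1 - 2 * s)
   else if 2 <= d \<and> d <= 3 then 2 powr (- 2 * s)/(2 * s) else 0)"

lemma tent_density_borel [measurable]: "tent_density s \<in> borel_measurable borel"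
 unfolding tent_density_def by measurable

lemma tent_density_nonneg: "0 < s ==> 0 <= tent_density s d"
 by (simp add: tent_density_def)

lemma has_integral_combine_2_3:
 fixes f :: "real => real"
 assumes "(f has_integral i) {t..2}" "(g has_integral j) {2..3}" "t <= 2"
  "!!d. d \<in> {t..<2} ==> h d = f d" "!!d. d \<in> {2..3} ==> h d = g d"
 shows "(h has_integral (i + j)) {t..3}"
proof (rule has_integral_combine[of t 2 3])
 show "(h has_integral i) {t..2}"
  by (rule has_integral_spike[OF _ _ assms(1), of "{2}"]) (use assms in auto)
 show "(h has_integral j) {2..3}"
  by (rule has_integral_eq[OF _ assms(2)]) (use assms in auto)
qed (use assms in auto)

lemma tent_density_tail:
 assumes s: "0 < s" "s < 1" and t: "0 < t" "t <= 2"
 shows "(\<integral>\<^sup>+d. ennreal (tent_density s d*indicator {t..} d) \<partial>lborel) = ennreal (t powr (- 2 * s)/(2 * s))"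
proof -
 have 1: "((%d. d powr (- 1 - 2 * s)) has_integral (- (2 powr (- 2 * s)/(2 * s)) - - (t powr (- 2 * s)/(2 * s)))) {t..2}"
 proof (rule fundamental_theorem_of_calculus)
  fix d assume "d \<in> {t..2}"
  then have d: "d > 0" using t by auto
  have "((%d. - (d powr (- 2 * s)/(2 * s))) has_real_derivative - ((- 2 * s)*d powr (- 2 * s - 1)/(2 * s))) (at d)"
   by (intro DERIV_minus DERIV_cdivide has_real_derivative_powr d)
  also have "- ((- 2 * s)*d powr (- 2 * s - 1)/(2 * s)) = d powr (- 1 - 2 * s)"
  proof -
   have "- 2 * s - 1 = - 1 - 2 * s" by simp
   then have "d powr (- 2 * s - 1) = d powr (- 1 - 2 * s)" by (simp only:)
   then show ?thesis using s by simp
  qed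
  finally show "((%d. - (d powr (- 2 * s)/(2 * s))) has_vector_derivative d powr (- 1 - 2 * s)) (at d within {t..2})"
   by (simp add: has_real_derivative_iff_has_vector_derivative has_vector_derivative_at_within)
 qed (use t in auto)
 have 2: "((%d::real. 2 powr (- 2 * s)/(2 * s)) has_integral (3 - 2)*(2 powr (- 2 * s)/(2 * s))) {2..3}"
  using has_integral_const_real[of "2 powr (- 2 * s)/(2 * s)" 2 3] by simp
 have "(tent_density s has_integral ((- (2 powr (- 2 * s)/(2 * s)) - - (t powr (- 2 * s)/(2 * s))) + (3 - 2)*(2 powr (- 2 * s)/(2 * s)))) {t..3}"
  by (rule has_integral_combine_2_3[OF 1 2]) (use t in \<open>auto simp: tent_density_def\<close>)
 then have h: "(tent_density s has_integral (t powr (- 2 * s)/(2 * s))) {t..3}"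
  by simp
 have "(\<integral>\<^sup>+d. ennreal (tent_density s d*indicator {t..} d) \<partial>lborel) = (\<integral>\<^sup>+d. ennreal (indicator {t..3} d*tent_density s d) \<partial>lborel)"
  by (intro nn_integral_cong) (auto simp: tent_density_def indicator_def)
 also have "... = ennreal (t powr (- 2 * s)/(2 * s))"
  by (rule nn_integral_has_integral_lebesgue[OF _ h]) (auto intro!: mult_nonneg_nonneg tent_density_nonneg s)
 finally show ?thesis .
qed

text \<open>The second derivative in \<open>t\<close> of a superposition of tents is the density, and that of the
 kernel is \<open>- C1 s * t powr (- 1 - 2 s)\<close>; the integration constants are fixed at \<open>t =
 2\<close>.\<close>

lemma tent_superposition:
 assumes s: "0 < s" "s < 1"
 obtains C where "!!t. 0 < \<bar>t\<bar> ==> \<bar>t\<bar> <= 2 ==> K_kernel s t <= C1 s*C \<and>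
  (\<integral>\<^sup>+d. ennreal (tent_density s d*max 0 (d - \<bar>t\<bar>)) \<partial>lborel) = ennreal (C - K_kernel s t/C1 s)"
proof -
 let ?c = "2 powr (- 2 * s)/(2 * s)"
 define k where "k = (if s = 1/2 then 1 else 0 :: real)"
 have cp: "C1 s > 0" by (rule C1_pos[OF s])
 define C where "C = 2 * s/C1 s*K_kernel s 2 + ?c*(5/2) - k"
 have main: "K_kernel s t <= C1 s*C \<and> (\<integral>\<^sup>+d. ennreal (tent_density s d*max 0 (d - t)) \<partial>lborel) = ennreal (C - K_kernel s t/C1 s)"
  if t: "0 < t" "t <= 2" for t
 proof -
  let ?A = "%d. 2 * s/C1 s*K_kernel s d + t*(d powr (- 2 * s)/(2 * s))"
  have 1: "((%d. d powr (- 1 - 2 * s)*(d - t)) has_integral (?A 2 - ?A t)) {t..2}"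
  proof (rule fundamental_theorem_of_calculus)
   fix d assume "d \<in> {t..2}"
   then have d: "d > 0" using t by auto
   have "(?A has_real_derivative 2 * s/C1 s*((C1 s/(2 * s))*d powr (- 2 * s)) + t*((- 2 * s)*d powr (- 2 * s - 1)/(2 * s))) (at d)"
    by (intro DERIV_add DERIV_cmult DERIV_cdivide has_real_derivative_powr d K_kernel_deriv_pos s)
   also have "2 * s/C1 s*((C1 s/(2 * s))*d powr (- 2 * s)) + t*((- 2 * s)*d powr (- 2 * s - 1)/(2 * s))
     = d powr (- 2 * s) - t*d powr (- 1 - 2 * s)"
   proof -
    have "- 2 * s - 1 = - 1 - 2 * s" by simp
    then have "d powr (- 2 * s - 1) = d powr (- 1 - 2 * s)" by (simp only:)
    then show ?thesis using s cp by simp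
   qed
   also have "d powr (- 2 * s) = d powr (- 1 - 2 * s)*d"
    using powr_add[of d "- 1 - 2 * s" 1] d by simp
   finally show "(?A has_vector_derivative d powr (- 1 - 2 * s)*(d - t)) (at d within {t..2})"
    by (simp add: has_real_derivative_iff_has_vector_derivative has_vector_derivative_at_within algebra_simps)
  qed (use t in auto)
  have 2: "((%d. ?c*(d - t)) has_integral (?c*(3\<^sup>2/2 - t*3) - ?c*(2\<^sup>2/2 - t*2))) {2..3}"
  proof (rule fundamental_theorem_of_calculus)
   fix d :: real
   have "((%d. ?c*(d\<^sup>2/2 - t*d)) has_real_derivative ?c*(d - t)) (at d)"
    using s by (auto intro!: derivative_eq_intros)
   then show "((%d. ?c*(d\<^sup>2/2 - t*d)) has_vector_derivative ?c*(d - t)) (at d within {2..3})"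
    by (simp add: has_real_derivative_iff_has_vector_derivative has_vector_derivative_at_within)
  qed simp
  have "((%d. tent_density s d*max 0 (d - t)) has_integral
    ((?A 2 - ?A t) + (?c*(3\<^sup>2/2 - t*3) - ?c*(2\<^sup>2/2 - t*2)))) {t..3}"
   by (rule has_integral_combine_2_3[OF 1 2]) (use t in \<open>auto simp: tent_density_def\<close>)
  also have "(?A 2 - ?A t) + (?c*(3\<^sup>2/2 - t*3) - ?c*(2\<^sup>2/2 - t*2))
    = (2 * s/C1 s*K_kernel s 2 + ?c*(5/2)) - (2 * s/C1 s*K_kernel s t + t*(t powr (- 2 * s)/(2 * s)))"
  proof -
   have "(A + t*c - (B + D)) + (c*(3\<^sup>2/2 - t*3) - c*(2\<^sup>2/2 - t*2)) = (A + c*(5/2)) - (B + D)"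
    for A B D c :: real
    by (simp add: algebra_simps)
   then show ?thesis by blast
  qed
  also have "2 * s/C1 s*K_kernel s t + t*(t powr (- 2 * s)/(2 * s)) = K_kernel s t/C1 s + k"
  proof (cases "s = 1/2")
   case True
   have e: "2 * s = 1" "- 2 * s = - 1" using True by simp_all
   show ?thesis unfolding e k_def using t True by (simp add: powr_neg_one)
  next
   case False
   have "t*t powr (- 2 * s) = t powr (1 - 2 * s)"
   proof -
    have "t powr (1 + - 2 * s) = t powr 1*t powr (- 2 * s)" by (rule powr_add)
    then show ?thesis using t by simp
   qed
   also have "... = K_kernel s t/Cs s"
   proof -
    have "Cs s ~= 0" using C1_Cs[OF s False] cp by force
    moreover have "K_kernel s t = Cs s*t powr (1 - 2 * s)"
     using False t unfolding K_kernel_def by simp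
    ultimately show ?thesis by simp
   qed
   finally have "t*(t powr (- 2 * s)/(2 * s)) = K_kernel s t/(2 * s*Cs s)"
    by simp
   also have "... = (1 - 2 * s)*(K_kernel s t/C1 s)"
    unfolding C1_Cs[OF s False] using False by simp
   finally show ?thesis using False by (simp add: k_def algebra_simps)
  qed
  also have "(2 * s/C1 s*K_kernel s 2 + ?c*(5/2)) - (K_kernel s t/C1 s + k) = C - K_kernel s t/C1 s"
   by (simp add: C_def)
  finally have h: "((%d. tent_density s d*max 0 (d - t)) has_integral (C - K_kernel s t/C1 s)) {t..3}" .
  have nn: "0 <= C - K_kernel s t/C1 s"
   by (rule has_integral_nonneg[OF h]) (auto intro!: mult_nonneg_nonneg tent_density_nonneg s)
  have "(\<integral>\<^sup>+d. ennreal (tent_density s d*max 0 (d - t)) \<partial>lborel) = (\<integral>\<^sup>+d. ennreal (indicator {t..3} d*(tent_density s d*max 0 (d - t))) \<partial>lborel)"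
   by (intro nn_integral_cong) (auto simp: tent_density_def indicator_def)
  also have "... = ennreal (C - K_kernel s t/C1 s)"
   by (rule nn_integral_has_integral_lebesgue[OF _ h]) (auto intro!: mult_nonneg_nonneg tent_density_nonneg s)
  finally have "(\<integral>\<^sup>+d. ennreal (tent_density s d*max 0 (d - t)) \<partial>lborel) = ennreal (C - K_kernel s t/C1 s)" .
  moreover have "K_kernel s t <= C1 s*C"
   using nn cp by (simp add: pos_divide_le_eq mult.commute)
  ultimately show ?thesis by simp
 qed
 show ?thesis
 proof (rule that[of C])
  fix t :: real assume t: "0 < \<bar>t\<bar>" "\<bar>t\<bar> <= 2"
  have "K_kernel s \<bar>t\<bar> = K_kernel s t" by (simp add: K_kernel_def)
  then show "K_kernel s t <= C1 s*C \<and>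
   (\<integral>\<^sup>+d. ennreal (tent_density s d*max 0 (d - \<bar>t\<bar>)) \<partial>lborel) = ennreal (C - K_kernel s t/C1 s)"
   using main[OF t] by simp
 qed
qed

text \<open>\<open>weighted_poly s p\<close> is \<open>(1 - x\<^sup>2) powr s * p\<close> extended by zero to the line.\<close>

definition weighted_poly :: "real => real poly => real => real" where
 "weighted_poly s p x = (max 0 (1 - x\<^sup>2)) powr s*poly p x"

lemma weighted_poly_eq: "weighted_poly s p x = jacobi s x*poly p x"
proof (cases "x \<in> {-1<..<1}")
 case True
 then show ?thesis using one_minus_sq_pos[OF True] by (simp add: weighted_poly_def jacobi_def)
next
 case False
 then have "1 <= \<bar>x\<bar>" by auto
 then have "1 <= x\<^sup>2" using abs_le_square_iff[of 1 x] by simp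
 then have "max 0 (1 - x\<^sup>2) = 0" by simp
 then show ?thesis unfolding weighted_poly_def jacobi_outside[OF False] by (simp only: powr_0 mult_zero_left)
qed

lemma weighted_poly_continuous: "0 < s ==> continuous_on A (weighted_poly s p)"
 unfolding weighted_poly_def
 by (rule continuous_on_mult, rule continuous_on_powr') (auto intro!: continuous_intros)

lemma poly_borel [measurable]: "poly (p :: real poly) \<in> borel_measurable borel"
 by (intro borel_measurable_continuous_onI continuous_intros)

lemma weighted_poly_borel [measurable]: "weighted_poly s p \<in> borel_measurable borel"
 unfolding weighted_poly_def by measurable

lemma weighted_poly_increment:
 assumes s: "0 < s" "s < 1" and d: "d >= 0"
 shows "(LINT x|lborel. indicator {z<..<z + d} x*(jacobi (s - 1) x*poly (weight_deriv s p) x))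
  = weighted_poly s p (z + d) - weighted_poly s p z"
proof -
 let ?v = "%x. jacobi (s - 1) x*poly (weight_deriv s p) x"
 have vi: "integrable lborel ?v"
  using s by (intro integrable_lborel_jacobi_mult continuous_intros) auto
 have h: "(?v has_integral (weighted_poly s p (z + d) - weighted_poly s p z)) {z..z + d}"
 proof (rule fundamental_theorem_of_calculus_interior_strong[where S="{-1, 1}"])
  show "continuous_on {z..z + d} (weighted_poly s p)" using s by (intro weighted_poly_continuous)
  fix x assume x: "x \<in> {z<..<z + d} - {-1, 1}"
  show "(weighted_poly s p has_vector_derivative ?v x) (at x)"
  proof (cases "x \<in> {-1<..<1}")
   case True
   have "(weighted_poly s p has_real_derivative (1 - x\<^sup>2) powr (s - 1)*poly (weight_deriv s p) x) (at x)"
    by (rule has_field_derivative_transform_within_open[OF weight_poly_deriv[OF True, of s p], where S="{-1<..<1}"])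
      (use True in \<open>auto simp: weighted_poly_eq jacobi_def\<close>)
   then show ?thesis
    using True by (simp add: has_real_derivative_iff_has_vector_derivative jacobi_def)
  next
   case False
   have "(weighted_poly s p has_real_derivative 0) (at x)"
    by (rule has_field_derivative_transform_within_open[OF DERIV_const[of 0], where S="- {-1..1}"])
      (use False x in \<open>auto simp: weighted_poly_eq jacobi_outside\<close>)
   then show ?thesis
    using False by (simp add: has_real_derivative_iff_has_vector_derivative jacobi_outside)
  qed
 qed (use d in auto)
 have "set_integrable lborel {z<..<z + d} ?v"
  using vi unfolding set_integrable_def by (rule Bochner_Integration.integrable_bound) (auto simp: indicator_def)
 from set_borel_integral_eq_integral(2)[OF this]
 have "(LINT x|lborel. indicator {z<..<z + d} x*?v x) = integral {z<..<z + d} ?v"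
  by (simp add: set_lebesgue_integral_def)
 also have "... = weighted_poly s p (z + d) - weighted_poly s p z"
  using h has_integral_Icc_iff_Ioo by (metis Henstock_Kurzweil_Integration.integral_unique)
 finally show ?thesis .
qed

text \<open>The integral of \<open>\<bar>z - y\<bar> powr (- 1 - 2 s)\<close> over the \<open>y\<close> outside
 \<open>(-1, 1)\<close>.\<close>

definition exit_density :: "real => real => real" where
 "exit_density s z = ((1 - z) powr (- 2 * s) + (1 + z) powr (- 2 * s))/(2 * s)"

lemma exit_density_nonneg: "0 < s ==> 0 <= exit_density s z"
 by (simp add: exit_density_def)

lemma exit_density_borel [measurable]: "exit_density s \<in> borel_measurable borel"
 unfolding exit_density_def by measurable

lemma AE_pair_distinct: "AE (x, y) in lborel \<Otimes>\<^sub>M lborel. x ~= (y :: real)"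
proof -
 have "AE x in lborel. AE y in lborel. (case (x, y) of (x, y) => x ~= (y::real))"
 proof (rule AE_I2)
  fix x :: real
  have "AE y in lborel. y ~= x" by (rule AE_lborel_singleton)
  then show "AE y in lborel. (case (x, y) of (x, y) => x ~= (y::real))"
   by eventually_elim auto
 qed
 moreover have "{x \<in> space (lborel \<Otimes>\<^sub>M lborel). case x of (x, y) => x ~= (y::real)} \<in> sets (lborel \<Otimes>\<^sub>M lborel)"
  unfolding case_prod_unfold by measurable
 ultimately show ?thesis
  by (intro lborel_pair.AE_pair_measure)
qed

text \<open>A tent is the overlap length of two intervals of width \<open>d\<close>.\<close>

lemma tent_area:
 fixes x y d :: real
 shows "(\<integral>\<^sup>+z. (if z < x \<and> x < z + d \<and> z < y \<and> y < z + d then 1 else 0) \<partial>lborel) = ennreal (max 0 (d - \<bar>x - y\<bar>))"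
proof -
 have "(\<integral>\<^sup>+z. (if z < x \<and> x < z + d \<and> z < y \<and> y < z + d then 1 else 0) \<partial>lborel)
   = (\<integral>\<^sup>+z. indicator {max x y - d<..<min x y} z \<partial>lborel)"
  by (intro nn_integral_cong) (auto simp: indicator_def)
 also have "... = emeasure lborel {max x y - d<..<min x y}"
  by (rule nn_integral_indicator) simp
 also have "... = ennreal (max 0 (d - \<bar>x - y\<bar>))"
 proof (cases "max x y - d <= min x y")
  case True
  then have "emeasure lborel {max x y - d<..<min x y} = ennreal (min x y - (max x y - d))"
   by (rule emeasure_lborel_Ioo)
  moreover have "min x y - (max x y - d) = max 0 (d - \<bar>x - y\<bar>)" using True by (auto simp: max_def min_def)
  ultimately show ?thesis by simp
 next
  case False
  then have e: "{max x y - d<..<min x y} = {}" by auto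
  have "max 0 (d - \<bar>x - y\<bar>) = 0" using False by (cases "x <= y") auto
  then show ?thesis unfolding e by simp
 qed
 finally show ?thesis .
qed

text \<open>Writing each tent as \<open>\<integral> 1\<^sub>(\<^sub>z\<^sub>,\<^sub>z\<^sub>+\<^sub>d\<^sub>)(x) 1\<^sub>(\<^sub>z\<^sub>,\<^sub>z\<^sub>+\<^sub>d\<^sub>)(y) dz\<close> turns the quadratic form of the kernel
 into a superposition of the squares \<open>(u(z + d) - u(z))\<^sup>2\<close>.\<close>

lemma K_poly_energy:
 assumes s: "0 < s" "s < 1"
 shows "(\<integral>\<^sup>+d. (\<integral>\<^sup>+z. ennreal (tent_density s d*(weighted_poly s p (z + d) - weighted_poly s p z)\<^sup>2) \<partial>lborel) \<partial>lborel)
  = ennreal (wint s (%x. poly (K_poly s p) x*poly p x)/C1 s)"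
proof -
 define v where "v x = jacobi (s - 1) x*poly (weight_deriv s p) x" for x
 let ?u = "weighted_poly s p" and ?om = "tent_density s"
 let ?P = "lborel \<Otimes>\<^sub>M lborel :: (real \<times> real) measure"
 interpret PP: pair_sigma_finite ?P ?P
  unfolding lborel_prod ..
 have vm [measurable]: "v \<in> borel_measurable borel"
  unfolding v_def by measurable
 have vi: "integrable lborel v"
  unfolding v_def using s by (intro integrable_lborel_jacobi_mult continuous_intros) auto
 have v0: "v x = 0" if "x \<notin> {-1<..<1}" for x
  using that by (simp add: v_def jacobi_outside)
 obtain C where C: "!!t. 0 < \<bar>t\<bar> ==> \<bar>t\<bar> <= 2 ==> K_kernel s t <= C1 s*C \<and>
  (\<integral>\<^sup>+d. ennreal (?om d*max 0 (d - \<bar>t\<bar>)) \<partial>lborel) = ennreal (C - K_kernel s t/C1 s)"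
  using tent_superposition[OF s] by blast
 define b :: "real => real => real => real => real" where
  "b x y d z = (if z < x \<and> x < z + d \<and> z < y \<and> y < z + d then 1 else 0)" for x y d z
 have bm [measurable]: "(%w. b (fst (fst w)) (snd (fst w)) (fst (snd w)) (snd (snd w))) \<in> borel_measurable (?P \<Otimes>\<^sub>M ?P)"
  unfolding b_def by measurable
 have bm2 [measurable]: "(%w. b x y (fst w) (snd w)) \<in> borel_measurable ?P" for x y
  unfolding b_def by measurable
 have A: "(\<integral>\<^sup>+w. ennreal (?om (fst w)*b x y (fst w) (snd w)) \<partial>?P) = ennreal (C - K_kernel s (x - y)/C1 s)"
  if "x ~= y" "x \<in> {-1<..<1}" "y \<in> {-1<..<1}" for x y
 proof -
  have "(\<integral>\<^sup>+w. ennreal (?om (fst w)*b x y (fst w) (snd w)) \<partial>?P)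
    = (\<integral>\<^sup>+d. (\<integral>\<^sup>+z. ennreal (?om d*b x y d z) \<partial>lborel) \<partial>lborel)"
   by (subst lborel.nn_integral_fst[symmetric]) auto
  also have "... = (\<integral>\<^sup>+d. ennreal (?om d*max 0 (d - \<bar>x - y\<bar>)) \<partial>lborel)"
  proof (rule nn_integral_cong)
   fix d
   have "(\<integral>\<^sup>+z. ennreal (?om d*b x y d z) \<partial>lborel)
     = (\<integral>\<^sup>+z. ennreal (?om d)*(if z < x \<and> x < z + d \<and> z < y \<and> y < z + d then 1 else 0) \<partial>lborel)"
    by (intro nn_integral_cong) (auto simp: b_def)
   also have "... = ennreal (?om d)*ennreal (max 0 (d - \<bar>x - y\<bar>))"
    by (subst nn_integral_cmult) (auto simp: tent_area)
   also have "... = ennreal (?om d*max 0 (d - \<bar>x - y\<bar>))"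
    by (rule ennreal_mult'[symmetric]) (rule tent_density_nonneg[OF s(1)])
   finally show "(\<integral>\<^sup>+z. ennreal (?om d*b x y d z) \<partial>lborel) = ennreal (?om d*max 0 (d - \<bar>x - y\<bar>))" .
  qed
  also have "... = ennreal (C - K_kernel s (x - y)/C1 s)"
   using C[of "x - y"] that by auto
  finally show ?thesis .
 qed
 have Ann: "0 <= C - K_kernel s (x - y)/C1 s" if "x ~= y" "x \<in> {-1<..<1}" "y \<in> {-1<..<1}" for x y
  using C[of "x - y"] that C1_pos[OF s] by (auto simp: pos_divide_le_eq mult.commute)
 have omb: "0 <= ?om d*b x y d z" for d x y z
  using tent_density_nonneg[OF s(1)] by (simp add: b_def)
 have A2: "(LINT w|?P. ?om (fst w)*b x y (fst w) (snd w)) = C - K_kernel s (x - y)/C1 s"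
  and A3: "integrable ?P (%w. ?om (fst w)*b x y (fst w) (snd w))"
  if xy: "x ~= y" "x \<in> {-1<..<1}" "y \<in> {-1<..<1}" for x y
 proof -
  have m: "(%w. ?om (fst w)*b x y (fst w) (snd w)) \<in> borel_measurable ?P" by measurable
  show "integrable ?P (%w. ?om (fst w)*b x y (fst w) (snd w))"
   by (rule integrableI_nn_integral_finite[OF m _ A[OF xy]]) (use omb in auto)
  show "(LINT w|?P. ?om (fst w)*b x y (fst w) (snd w)) = C - K_kernel s (x - y)/C1 s"
   unfolding integral_eq_nn_integral[OF m AE_I2[OF omb]] A[OF xy]
   using Ann[OF xy] by simp
 qed
 define f :: "real \<times> real => real \<times> real => real" where
  "f q w = (v (fst q) * v (snd q))*(?om (fst w)*b (fst q) (snd q) (fst w) (snd w))" for q w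
 have AEq: "AE q in ?P. fst q ~= snd q"
  using AE_pair_distinct by (simp add: case_prod_unfold)
 have inner: "(LINT w|?P. f q w) = v (fst q) * v (snd q)*(C - K_kernel s (fst q - snd q)/C1 s)"
  "(LINT w|?P. norm (f q w)) = \<bar>v (fst q) * v (snd q)\<bar>*(C - K_kernel s (fst q - snd q)/C1 s)"
  "integrable ?P (f q)"
  if q: "fst q ~= snd q" for q
 proof -
  have "(LINT w|?P. f q w) = v (fst q) * v (snd q)*(C - K_kernel s (fst q - snd q)/C1 s) \<and>
    (LINT w|?P. norm (f q w)) = \<bar>v (fst q) * v (snd q)\<bar>*(C - K_kernel s (fst q - snd q)/C1 s) \<and> integrable ?P (f q)"
  proof (cases "v (fst q) * v (snd q) = 0")
   case True
   then have "f q w = 0" for w unfolding f_def by (simp only: mult_zero_left)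
   then have "f q = (%w. 0)" by auto
   with True show ?thesis by simp
  next
   case False
   then have m: "fst q \<in> {-1<..<1}" "snd q \<in> {-1<..<1}" using v0 by auto
   have nf: "norm (f q w) = \<bar>v (fst q) * v (snd q)\<bar>*(?om (fst w)*b (fst q) (snd q) (fst w) (snd w))" for w
    unfolding f_def real_norm_def abs_mult[of "v (fst q) * v (snd q)"] using omb by simp
   show ?thesis
    unfolding nf unfolding f_def using A2[OF q m] A3[OF q m] by simp
  qed
  then show "(LINT w|?P. f q w) = v (fst q) * v (snd q)*(C - K_kernel s (fst q - snd q)/C1 s)"
   "(LINT w|?P. norm (f q w)) = \<bar>v (fst q) * v (snd q)\<bar>*(C - K_kernel s (fst q - snd q)/C1 s)"
   "integrable ?P (f q)" by auto
 qed
 have vKv: "integrable ?P (%(x, y). v x*(K_kernel s (x - y) * v y))"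
  unfolding v_def by (intro riesz_pair_integrable s continuous_intros)
 have vv: "integrable ?P (%(x, y). v x * v y)"
 proof (rule lborel_pair.Fubini_integrable)
  show "integrable lborel (%x. (LINT y|lborel. norm ((%(x, y). v x * v y) (x, y))))"
   using vi by (simp add: abs_mult)
  show "AE x in lborel. integrable lborel (%y. (%(x, y). v x * v y) (x, y))"
   using vi by simp
 qed measurable
 have H: "integrable ?P (%q. \<bar>v (fst q) * v (snd q)\<bar>*(C - K_kernel s (fst q - snd q)/C1 s))"
 proof -
  have "integrable ?P (%q. C*\<bar>v (fst q) * v (snd q)\<bar>)"
   using integrable_abs[OF vv] by (simp add: case_prod_unfold)
  moreover have "integrable ?P (%q. \<bar>v (fst q) * v (snd q)\<bar>*K_kernel s (fst q - snd q))"
   by (rule Bochner_Integration.integrable_bound[OF vKv]) (auto simp: abs_mult case_prod_unfold)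
  ultimately have "integrable ?P (%q. C*\<bar>v (fst q) * v (snd q)\<bar> - \<bar>v (fst q) * v (snd q)\<bar>*K_kernel s (fst q - snd q)/C1 s)"
   by (intro Bochner_Integration.integrable_diff integrable_divide)
  then show ?thesis by (simp add: algebra_simps)
 qed
 have fm [measurable]: "(%(q, w). f q w) \<in> borel_measurable (?P \<Otimes>\<^sub>M ?P)"
  unfolding f_def case_prod_unfold by measurable
 have B: "integrable (?P \<Otimes>\<^sub>M ?P) (%(q, w). f q w)"
 proof (rule PP.Fubini_integrable[OF fm])
  have m: "(%q. (LINT w|?P. norm (case (q, w) of (q, w) => f q w))) \<in> borel_measurable ?P"
   by measurable
  have ae: "AE q in ?P. (LINT w|?P. norm (case (q, w) of (q, w) => f q w)) = \<bar>v (fst q) * v (snd q)\<bar>*(C - K_kernel s (fst q - snd q)/C1 s)"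
   using AEq by eventually_elim (simp add: inner(2)[unfolded real_norm_def])
  show "integrable ?P (%q. (LINT w|?P. norm (case (q, w) of (q, w) => f q w)))"
   using integrable_cong_AE[OF m borel_measurable_integrable[OF H] ae] H by blast
  show "AE q in ?P. integrable ?P (%w. case (q, w) of (q, w) => f q w)"
   using AEq by eventually_elim (simp add: inner(3))
 qed
 (* The constant C of the superposition drops out of the energy because v is the derivative
   of a function that vanishes at both ends. *)
 have I0: "(LINT x|lborel. v x) = 0"
 proof -
  have "(LINT x|lborel. v x) = (LINT x|lborel. indicator {-1<..<-1 + 2} x*(jacobi (s - 1) x*poly (weight_deriv s p) x))"
  proof (intro Bochner_Integration.integral_cong refl)
   fix x :: real
   show "v x = indicator {-1<..<-1 + 2} x*(jacobi (s - 1) x*poly (weight_deriv s p) x)"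
    by (cases "x \<in> {-1<..<1}") (simp_all add: v_def jacobi_outside)
  qed
  also have "... = ?u (-1 + 2) - ?u (-1)"
   by (rule weighted_poly_increment[OF s]) simp
  also have "... = 0" by (simp add: weighted_poly_eq jacobi_def)
  finally show ?thesis .
 qed
 have E1: "(LINT q|?P. (LINT w|?P. f q w)) = wint s (%x. poly (K_poly s p) x*poly p x)/C1 s"
 proof -
  have "(LINT q|?P. (LINT w|?P. f q w)) = (LINT q|?P. C*(v (fst q) * v (snd q)) - v (fst q)*(K_kernel s (fst q - snd q) * v (snd q))/C1 s)"
  proof (rule integral_cong_AE)
   show "AE q in ?P. (LINT w|?P. f q w) = C*(v (fst q) * v (snd q)) - v (fst q)*(K_kernel s (fst q - snd q) * v (snd q))/C1 s"
    using AEq by eventually_elim (simp add: inner(1) algebra_simps)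
  qed (measurable)
  also have "... = C*(LINT q|?P. v (fst q) * v (snd q)) - (LINT q|?P. v (fst q)*(K_kernel s (fst q - snd q) * v (snd q)))/C1 s"
   using vv vKv by (simp add: case_prod_unfold)
  also have "(LINT q|?P. v (fst q) * v (snd q)) = (LINT x|lborel. (LINT y|lborel. v x * v y))"
   using lborel_pair.integral_fst[OF vv] by (simp add: case_prod_unfold)
  also have "... = 0" by (simp add: I0)
  also have "(LINT q|?P. v (fst q)*(K_kernel s (fst q - snd q) * v (snd q))) = (LINT x|lborel. (LINT y|lborel. v x*(K_kernel s (x - y) * v y)))"
   using lborel_pair.integral_fst[OF vKv] by (simp add: case_prod_unfold)
  also have "... = - wint s (%x. poly (K_poly s p) x*poly p x)"
   unfolding K_poly_form[OF s] v_def by simp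
  finally show ?thesis by simp
 qed
 let ?G = "%w. ?om (fst w)*(?u (snd w + fst w) - ?u (snd w))\<^sup>2"
 have G: "(LINT q|?P. f q w) = ?G w" for w
 proof (cases "fst w >= 0")
  case True
  define g where "g x = indicator {snd w<..<snd w + fst w} x * v x" for x
  have gi: "integrable lborel g"
   unfolding g_def by (rule Bochner_Integration.integrable_bound[OF vi]) (auto simp: indicator_def)
  have gI: "(LINT x|lborel. g x) = ?u (snd w + fst w) - ?u (snd w)"
   unfolding g_def v_def by (rule weighted_poly_increment[OF s True])
  have gg: "integrable ?P (%(x, y). g x*g y)"
  proof (rule lborel_pair.Fubini_integrable)
   have "g \<in> borel_measurable borel" unfolding g_def by measurable
   then show "(%(x, y). g x*g y) \<in> borel_measurable ?P" by measurable
  qed (use gi in \<open>simp_all add: abs_mult\<close>)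
  have "f q w = ?om (fst w)*(case q of (x, y) => g x*g y)" for q
   by (cases q) (auto simp: f_def b_def g_def indicator_def)
  then have "(LINT q|?P. f q w) = ?om (fst w)*(LINT q|?P. (case q of (x, y) => g x*g y))"
   by simp
  also have "(LINT q|?P. (case q of (x, y) => g x*g y)) = (LINT x|lborel. (LINT y|lborel. g x*g y))"
   by (rule lborel_pair.integral_fst[OF gg, symmetric])
  also have "... = (LINT x|lborel. g x)\<^sup>2" by (simp add: power2_eq_square)
  finally show ?thesis by (simp add: gI)
 next
  case False
  then show ?thesis by (simp add: f_def tent_density_def)
 qed
 have Gi: "integrable ?P ?G"
  using PP.integrable_snd[OF B] unfolding G .
 have GI: "(LINT w|?P. ?G w) = wint s (%x. poly (K_poly s p) x*poly p x)/C1 s"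
  using PP.Fubini_integral[OF B] unfolding G E1 .
 have "(\<integral>\<^sup>+d. (\<integral>\<^sup>+z. ennreal (?om d*(?u (z + d) - ?u z)\<^sup>2) \<partial>lborel) \<partial>lborel) = (\<integral>\<^sup>+w. ennreal (?G w) \<partial>?P)"
  by (subst lborel.nn_integral_fst[symmetric]) auto
 also have "... = ennreal (LINT w|?P. ?G w)"
  by (rule nn_integral_eq_integral[OF Gi]) (use tent_density_nonneg[OF s(1)] in auto)
 finally show ?thesis unfolding GI .
qed

text \<open>In the energy, the increments with one end point inside the interval and the other one outside
 contribute \<open>u\<^sup>2\<close> times the kernel mass of the complement of the interval.\<close>

theorem Hardy_inequality:
 assumes s: "0 < s" "s < 1"
 shows "(\<integral>\<^sup>+z. ennreal ((weighted_poly s p z)\<^sup>2*exit_density s z) \<partial>lborel)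
  <= ennreal (wint s (%x. poly (K_poly s p) x*poly p x)/C1 s)"
proof -
 let ?u = "weighted_poly s p" and ?om = "tent_density s"
 have u0: "?u z = 0" if "z \<notin> {-1<..<1}" for z
  using that by (simp add: weighted_poly_eq jacobi_outside)
 have omn: "0 <= ?om d" for d by (rule tent_density_nonneg[OF s(1)])
 have "(\<integral>\<^sup>+z. ennreal ((?u z)\<^sup>2*exit_density s z) \<partial>lborel)
   = (\<integral>\<^sup>+z. (\<integral>\<^sup>+d. ennreal (?om d*indicator {1 - z..} d*(?u z)\<^sup>2) + ennreal (?om d*indicator {1 + z..} d*(?u z)\<^sup>2) \<partial>lborel) \<partial>lborel)"
 proof (rule nn_integral_cong)
  fix z
  show "ennreal ((?u z)\<^sup>2*exit_density s z)
   = (\<integral>\<^sup>+d. ennreal (?om d*indicator {1 - z..} d*(?u z)\<^sup>2) + ennreal (?om d*indicator {1 + z..} d*(?u z)\<^sup>2) \<partial>lborel)"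
  proof (cases "z \<in> {-1<..<1}")
   case True
   have t: "(\<integral>\<^sup>+d. ennreal (?om d*indicator {t..} d*(?u z)\<^sup>2) \<partial>lborel) = ennreal ((?u z)\<^sup>2*(t powr (- 2 * s)/(2 * s)))"
    if "0 < t" "t <= 2" for t
   proof -
    have "(\<integral>\<^sup>+d. ennreal (?om d*indicator {t..} d*(?u z)\<^sup>2) \<partial>lborel) = (\<integral>\<^sup>+d. ennreal ((?u z)\<^sup>2)*ennreal (?om d*indicator {t..} d) \<partial>lborel)"
     by (intro nn_integral_cong) (simp add: ennreal_mult'[symmetric] omn mult.commute)
    also have "... = ennreal ((?u z)\<^sup>2)*ennreal (t powr (- 2 * s)/(2 * s))"
     by (subst nn_integral_cmult) (auto simp: tent_density_tail[OF s that])
    also have "... = ennreal ((?u z)\<^sup>2*(t powr (- 2 * s)/(2 * s)))"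
     by (rule ennreal_mult'[symmetric]) simp
    finally show ?thesis .
   qed
   have "(\<integral>\<^sup>+d. ennreal (?om d*indicator {1 - z..} d*(?u z)\<^sup>2) + ennreal (?om d*indicator {1 + z..} d*(?u z)\<^sup>2) \<partial>lborel)
    = ennreal ((?u z)\<^sup>2*((1 - z) powr (- 2 * s)/(2 * s))) + ennreal ((?u z)\<^sup>2*((1 + z) powr (- 2 * s)/(2 * s)))"
    using True by (subst nn_integral_add) (auto simp: t)
   also have "... = ennreal ((?u z)\<^sup>2*exit_density s z)"
    using s by (subst ennreal_plus[symmetric]) (auto simp: exit_density_def add_divide_distrib distrib_left)
   finally show ?thesis ..
  qed (simp add: u0)
 qed
 also have "... = (\<integral>\<^sup>+d. (\<integral>\<^sup>+z. ennreal (?om d*indicator {1 - z..} d*(?u z)\<^sup>2) + ennreal (?om d*indicator {1 + z..} d*(?u z)\<^sup>2) \<partial>lborel) \<partial>lborel)"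
  unfolding indicator_def atLeast_iff by (rule lborel_pair.Fubini') measurable
 also have "... <= (\<integral>\<^sup>+d. (\<integral>\<^sup>+z. ennreal (?om d*(?u (z + d) - ?u z)\<^sup>2) \<partial>lborel) \<partial>lborel)"
 proof (rule nn_integral_mono)
  fix d :: real
  have "(\<integral>\<^sup>+z. ennreal (?om d*indicator {1 - z..} d*(?u z)\<^sup>2) + ennreal (?om d*indicator {1 + z..} d*(?u z)\<^sup>2) \<partial>lborel)
   = (\<integral>\<^sup>+z. ennreal (?om d*indicator {1 - z..} d*(?u z)\<^sup>2) \<partial>lborel) + (\<integral>\<^sup>+z. ennreal (?om d*indicator {1 + z..} d*(?u z)\<^sup>2) \<partial>lborel)"
   unfolding indicator_def atLeast_iff by (rule nn_integral_add) measurable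
  also have "(\<integral>\<^sup>+z. ennreal (?om d*indicator {1 + z..} d*(?u z)\<^sup>2) \<partial>lborel)
    = (\<integral>\<^sup>+z. ennreal (?om d*indicator {1 + (d + 1*z)..} d*(?u (d + 1*z))\<^sup>2) \<partial>lborel)"
   using nn_integral_real_affine[of "%z. ennreal (?om d*indicator {1 + z..} d*(?u z)\<^sup>2)" 1 d]
   unfolding indicator_def atLeast_iff by simp
  also have "(\<integral>\<^sup>+z. ennreal (?om d*indicator {1 - z..} d*(?u z)\<^sup>2) \<partial>lborel) + ...
    = (\<integral>\<^sup>+z. ennreal (?om d*indicator {1 - z..} d*(?u z)\<^sup>2) + ennreal (?om d*indicator {1 + (d + 1*z)..} d*(?u (d + 1*z))\<^sup>2) \<partial>lborel)"
   unfolding indicator_def atLeast_iff by (rule nn_integral_add[symmetric]) measurable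
  also have "... <= (\<integral>\<^sup>+z. ennreal (?om d*(?u (z + d) - ?u z)\<^sup>2) \<partial>lborel)"
  proof (rule nn_integral_mono)
   fix z :: real
   have "?om d*indicator {1 - z..} d*(?u z)\<^sup>2 + ?om d*indicator {1 + (d + 1*z)..} d*(?u (d + 1*z))\<^sup>2
     <= ?om d*(?u (z + d) - ?u z)\<^sup>2"
   proof (cases "z <= -1")
    case True
    then have "?u z = 0" by (intro u0) auto
    then show ?thesis using omn[of d] by (auto simp: indicator_def add.commute)
   next
    case False
    then have i: "indicator {1 + (d + 1*z)..} d = (0::real)" by (simp add: indicator_def)
    show ?thesis
    proof (cases "1 - z <= d")
     case True
     then have "?u (z + d) = 0" by (intro u0) auto
     then show ?thesis unfolding i using omn[of d] by (auto simp: indicator_def)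
    next
     case False
     then show ?thesis unfolding i using omn[of d] by (simp add: indicator_def)
    qed
   qed
   moreover have "0 <= ?om d*indicator {1 - z..} d*(?u z)\<^sup>2"
    "0 <= ?om d*indicator {1 + (d + 1*z)..} d*(?u (d + 1*z))\<^sup>2"
    using omn[of d] by simp_all
   ultimately show "ennreal (?om d*indicator {1 - z..} d*(?u z)\<^sup>2) + ennreal (?om d*indicator {1 + (d + 1*z)..} d*(?u (d + 1*z))\<^sup>2)
     <= ennreal (?om d*(?u (z + d) - ?u z)\<^sup>2)"
    by (metis ennreal_plus ennreal_leI)
  qed
  finally show "(\<integral>\<^sup>+z. ennreal (?om d*indicator {1 - z..} d*(?u z)\<^sup>2) + ennreal (?om d*indicator {1 + z..} d*(?u z)\<^sup>2) \<partial>lborel)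
   <= (\<integral>\<^sup>+z. ennreal (?om d*(?u (z + d) - ?u z)\<^sup>2) \<partial>lborel)" .
 qed
 also have "... = ennreal (wint s (%x. poly (K_poly s p) x*poly p x)/C1 s)"
  by (rule K_poly_energy[OF s])
 finally show ?thesis .
qed

section \<open>Gegenbauer coefficients of analytic functions\<close>

text \<open>The neighbourhoods of \<open>[-1, 1]\<close> on which Cauchy's estimates are iterated; discs around the
 points of the segment fit them better than ellipses.\<close>

definition segment_nbhd :: "real => complex set" where
 "segment_nbhd r = (\<Union>x\<in>{-1..1}. ball (complex_of_real x) r)"

lemma open_segment_nbhd [simp]: "open (segment_nbhd r)"
 unfolding segment_nbhd_def by auto

lemma real_in_segment_nbhd: "x \<in> {-1..1} ==> r > 0 ==> complex_of_real x \<in> segment_nbhd r"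
 unfolding segment_nbhd_def by (auto intro!: bexI[of _ x])

definition gegenbauer_op :: "real => (complex => complex) => complex => complex" where
 "gegenbauer_op s F z = (1 - z\<^sup>2)*deriv (deriv F) z - of_real (2 * s + 2)*z*deriv F z"

lemma gegenbauer_op_holomorphic:
 "F holomorphic_on segment_nbhd r ==> gegenbauer_op s F holomorphic_on segment_nbhd r"
 unfolding gegenbauer_op_def[abs_def]
 by (intro holomorphic_intros holomorphic_deriv) auto

text \<open>Cauchy's inequality for the first and second derivative on discs of radius \<open>d\<close>.\<close>

lemma gegenbauer_op_bound:
 assumes s: "0 <= s" "s <= 1" and F: "F holomorphic_on segment_nbhd r"
  and M: "!!z. z \<in> segment_nbhd r ==> cmod (F z) <= M"
  and d: "0 < d" "d < r" "r <= 1" and z: "z \<in> segment_nbhd (r - d)"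
 shows "cmod (gegenbauer_op s F z) <= 18/d\<^sup>2*M"
proof -
 obtain x where x: "x \<in> {-1..1}" "dist (complex_of_real x) z < r - d"
  using z unfolding segment_nbhd_def by auto
 have sub: "cball z d \<subseteq> segment_nbhd r"
 proof
  fix w assume "w \<in> cball z d"
  then have "dist (complex_of_real x) w < r"
   using x(2) dist_triangle[of "complex_of_real x" w z] by simp
  then show "w \<in> segment_nbhd r" using x(1) unfolding segment_nbhd_def by auto
 qed
 have M0: "M >= 0" using M[of z] sub d by (meson centre_in_cball less_imp_le norm_ge_zero order_trans subsetD)
 have h: "F holomorphic_on ball z d" by (rule holomorphic_on_subset[OF F]) (use sub ball_subset_cball in blast)
 have c: "continuous_on (cball z d) F"
  by (rule continuous_on_subset[OF holomorphic_on_imp_continuous_on[OF F] sub])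
 have C: "cmod ((deriv ^^ n) F z) <= fact n*M/d^n" for n
  by (rule Cauchy_inequality[OF h c d(1)]) (use sub M in \<open>auto simp: dist_norm\<close>)
 have d1: "cmod (deriv F z) <= M/d" using C[of 1] by simp
 have d2: "cmod (deriv (deriv F) z) <= 2*M/d\<^sup>2" using C[of 2] by (simp add: numeral_2_eq_2)
 have "cmod z <= cmod (complex_of_real x) + cmod (z - complex_of_real x)"
  using norm_triangle_ineq[of "complex_of_real x" "z - complex_of_real x"] by simp
 also have "... <= 1 + 1" using x d by (intro add_mono) (auto simp: dist_norm norm_minus_commute abs_le_iff)
 finally have z2: "cmod z <= 2" by simp
 then have "(cmod z)\<^sup>2 <= 2\<^sup>2" by (intro power_mono) auto
 then have q: "cmod (1 - z\<^sup>2) <= 5"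
  using norm_triangle_ineq4[of 1 "z\<^sup>2"] by (simp add: norm_power)
 have "cmod (gegenbauer_op s F z) <= cmod ((1 - z\<^sup>2)*deriv (deriv F) z) + cmod (of_real (2 * s + 2)*z*deriv F z)"
  unfolding gegenbauer_op_def by (rule norm_triangle_ineq4)
 also have "... <= 5*(2*M/d\<^sup>2) + (4*2)*(M/d)"
  unfolding norm_mult norm_of_real using q d1 d2 z2 s
  by (intro add_mono mult_mono) auto
 also have "M/d <= M/d\<^sup>2"
  using d M0 by (intro divide_left_mono) (auto simp: power2_eq_square mult_left_le)
 finally show ?thesis by (simp add: mult_ac)
qed

lemma gegenbauer_op_iterate_bound:
 assumes s: "0 <= s" "s <= 1" and F: "F holomorphic_on segment_nbhd r"
  and M: "!!z. z \<in> segment_nbhd r ==> cmod (F z) <= M" and d: "0 < d" "r <= 1" "real k*d < r"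
 shows "(gegenbauer_op s ^^ k) F holomorphic_on segment_nbhd r \<and>
  (\<forall>z \<in> segment_nbhd (r - real k*d). cmod ((gegenbauer_op s ^^ k) F z) <= (18/d\<^sup>2)^k*M)"
 using d(3)
proof (induction k)
 case 0
 then show ?case using F M by simp
next
 case (Suc k)
 have kd: "real k*d < r" using Suc.prems d by (simp add: algebra_simps)
 let ?G = "(gegenbauer_op s ^^ k) F"
 have IH: "?G holomorphic_on segment_nbhd r" "!!z. z \<in> segment_nbhd (r - real k*d) ==> cmod (?G z) <= (18/d\<^sup>2)^k*M"
  using Suc.IH[OF kd] by auto
 have "segment_nbhd (r - real k*d) \<subseteq> segment_nbhd r"
  unfolding segment_nbhd_def using d by (intro UN_mono subset_ball) auto
 then have h: "?G holomorphic_on segment_nbhd (r - real k*d)"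
  using IH(1) holomorphic_on_subset by blast
 have "cmod (gegenbauer_op s ?G z) <= 18/d\<^sup>2*((18/d\<^sup>2)^k*M)" if "z \<in> segment_nbhd (r - real (Suc k)*d)" for z
 proof (rule gegenbauer_op_bound[OF s h IH(2) d(1)])
  show "d < r - real k*d" using Suc.prems by (simp add: algebra_simps)
  have "0 <= real k*d" using d by simp
  then show "r - real k*d <= 1" using d by linarith
  show "z \<in> segment_nbhd (r - real k*d - d)" using that by (simp add: algebra_simps)
 qed
 then show ?case using gegenbauer_op_holomorphic[OF IH(1)] by (simp add: mult.assoc)
qed

lemma gegenbauer_op_coefficient:
 assumes s: "s > -1" and F: "F holomorphic_on segment_nbhd r" and r: "r > 0"
 shows "wint s (%x. Re (gegenbauer_op s F (of_real x))*poly (geg s n) x)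
  = - (real n*(real n + 2 * s + 1))*wint s (%x. Re (F (of_real x))*poly (geg s n) x)"
proof -
 let ?g = "%x::real. Re (F (of_real x))" and ?g1 = "%x::real. Re (deriv F (of_real x))"
  and ?g2 = "%x::real. Re (deriv (deriv F) (of_real x))"
 have F1: "deriv F holomorphic_on segment_nbhd r" by (intro holomorphic_deriv F) simp
 have F2: "deriv (deriv F) holomorphic_on segment_nbhd r" by (intro holomorphic_deriv F1) simp
 have c: "continuous_on {-1..1} (%x::real. Re (H (of_real x)))" if "H holomorphic_on segment_nbhd r" for H
 proof (intro continuous_on_Re)
  show "continuous_on {-1..1} (%x::real. H (of_real x))"
   by (rule continuous_on_compose2[OF holomorphic_on_imp_continuous_on[OF that]])
     (use r in \<open>auto intro!: continuous_intros real_in_segment_nbhd\<close>)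
 qed
 have dd: "((%x::real. Re (H (of_real x))) has_real_derivative Re (deriv H (of_real x))) (at x)"
  if "H holomorphic_on segment_nbhd r" "x \<in> {-1<..<1}" for H x
 proof -
  have "(H has_field_derivative deriv H (of_real x)) (at (of_real x))"
   using that r by (intro holomorphic_derivI[OF that(1)]) (auto intro: real_in_segment_nbhd)
  then show ?thesis
   by (intro has_field_derivative_Re has_vector_derivative_real_field)
 qed
 have e: "Re (gegenbauer_op s F (of_real x)) = (1 - x\<^sup>2)*?g2 x - (2 * s + 2)*x*?g1 x" for x :: real
 proof -
  have "gegenbauer_op s F (of_real x) = of_real (1 - x\<^sup>2)*deriv (deriv F) (of_real x) - of_real ((2 * s + 2)*x)*deriv F (of_real x)"
   by (simp add: gegenbauer_op_def)
  then show ?thesis by (simp only: minus_complex.simps Re_complex_of_real times_complex.simps Im_complex_of_real)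
 qed
 show ?thesis
  unfolding e using s by (intro gegenbauer_operator_coefficient c F F1 F2 dd) auto
qed

lemma normalized_gegenbauer_L1:
 assumes "s >= 0"
 shows "wint s (%x. \<bar>normalized_gegenbauer s n x\<bar>) <= sqrt (measure (jacobi_measure s) UNIV)"
proof -
 interpret B: L2_basis "jacobi_measure s" "normalized_gegenbauer s" by (rule gegenbauer_basis[OF assms])
 have "L2_norm (jacobi_measure s) (normalized_gegenbauer s n) = 1"
  using B.e_on[of n n] by (simp add: L2_norm_def L2_inner_def power2_eq_square)
 moreover have "(LINT x|jacobi_measure s. \<bar>normalized_gegenbauer s n x\<bar>) = wint s (%x. \<bar>normalized_gegenbauer s n x\<bar>)"
  unfolding wint_def using B.e_sq[of n] by (intro integral_jacobi) auto
 ultimately show ?thesis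
  using L1_le_L2(2)[OF B.finite_measure_axioms B.e_sq, of n] by simp
qed

lemma gegenbauer_coeff_eq: "gegenbauer_coeff s v j = wint s (%x. v x*normalized_gegenbauer s j x)"
 unfolding gegenbauer_coeff_def wint_def set_lebesgue_integral_def
 by (simp add: jacobi_def mult_ac)

text \<open>Applying the differential operator \<open>k\<close> times multiplies the coefficient by about \<open>j\<^bsup>2 k\<^esup>\<close>, and
 Cauchy's estimates on \<open>k\<close> nested neighbourhoods bound the result by \<open>(C k\<^sup>2)\<^bsup>k\<^esup>\<close>; a \<open>k\<close> that is a
 small multiple of \<open>j\<close> gives exponential decay.\<close>

theorem analytic_coeff_decay:
 assumes s: "0 <= s" "s <= 1" and r: "0 < r" "r <= 1" and F: "F holomorphic_on segment_nbhd r"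
  and M: "!!z. z \<in> segment_nbhd r ==> cmod (F z) <= M"
 shows "\<bar>gegenbauer_coeff s (%x. Re (F (of_real x))) j\<bar>
  <= 16 * sqrt (measure (jacobi_measure s) UNIV)*M*(4 powr (- r/9))^j"
proof -
 let ?A = "sqrt (measure (jacobi_measure s) UNIV)"
 let ?c = "%F. wint s (%x. Re (F (of_real x))*normalized_gegenbauer s j x)"
 have s1: "s > -1" using s by simp
 have M0: "M >= 0"
  using M[OF real_in_segment_nbhd[of 0]] r by (meson atLeastAtMost_iff norm_ge_zero order_trans neg_le_0_iff_le zero_le_one)
 have A0: "?A >= 0" by simp
 have cn: "?c F = 1/sqrt (geg_sqnorm s j)*wint s (%x. Re (F (of_real x))*poly (geg s j) x)" for F
  unfolding normalized_gegenbauer_alt wint_scale[symmetric] by (simp add: mult_ac)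
 have step: "?c (gegenbauer_op s G) = - (real j*(real j + 2 * s + 1))*?c G" if "G holomorphic_on segment_nbhd r" for G
  unfolding cn gegenbauer_op_coefficient[OF s1 that r(1)] by simp
 have main: "\<bar>?c F\<bar>*(real j)\<^sup>2^k <= (18*(real k + 1)\<^sup>2/r\<^sup>2)^k*M*?A" for k
 proof -
  define d where "d = r/(real k + 1)"
  have d: "0 < d" "real k*d < r"
   using r by (auto simp: d_def field_simps)
  have hol: "(gegenbauer_op s ^^ i) F holomorphic_on segment_nbhd r" for i
   by (induction i) (auto intro: gegenbauer_op_holomorphic F)
  have it: "\<bar>?c ((gegenbauer_op s ^^ i) F)\<bar> = (real j*(real j + 2 * s + 1))^i*\<bar>?c F\<bar>" for i
  proof (induction i)
   case (Suc i)
   have "?c ((gegenbauer_op s ^^ Suc i) F) = - (real j*(real j + 2 * s + 1))*?c ((gegenbauer_op s ^^ i) F)"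
    using step[OF hol[of i]] by simp
   then have "\<bar>?c ((gegenbauer_op s ^^ Suc i) F)\<bar> = (real j*(real j + 2 * s + 1))*\<bar>?c ((gegenbauer_op s ^^ i) F)\<bar>"
    using s by (simp only: abs_mult) simp
   then show ?case unfolding Suc.IH by (simp only: power_Suc mult.assoc)
  qed simp
  let ?G = "(gegenbauer_op s ^^ k) F"
  let ?B = "(18/d\<^sup>2)^k*M"
  have B: "\<bar>Re (?G (of_real x))\<bar> <= ?B" if "x \<in> {-1<..<1}" for x
  proof -
   have "of_real x \<in> segment_nbhd (r - real k*d)"
    using that d by (intro real_in_segment_nbhd) auto
   then have "cmod (?G (of_real x)) <= ?B"
    using gegenbauer_op_iterate_bound[OF s F M d(1) r(2) d(2)] by blast
   then show ?thesis using abs_Re_le_cmod order_trans by blast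
  qed
  have cG: "continuous_on {-1..1} (%x::real. Re (?G (of_real x)))"
  proof (intro continuous_on_Re)
   show "continuous_on {-1..1} (%x::real. ?G (of_real x))"
    by (rule continuous_on_compose2[OF holomorphic_on_imp_continuous_on[OF hol[of k]]])
      (use r in \<open>auto intro!: continuous_intros real_in_segment_nbhd\<close>)
  qed
  have ce: "continuous_on {-1..1} (normalized_gegenbauer s j)" by (rule normalized_gegenbauer_continuous)
  have "\<bar>?c ?G\<bar> <= wint s (%x. ?B*\<bar>normalized_gegenbauer s j x\<bar>)"
  proof -
   have up: "\<bar>Re (?G (of_real x))*normalized_gegenbauer s j x\<bar> <= ?B*\<bar>normalized_gegenbauer s j x\<bar>" if "x \<in> {-1<..<1}" for x
    unfolding abs_mult using B[OF that] by (intro mult_right_mono) auto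
   have "?c ?G <= wint s (%x. ?B*\<bar>normalized_gegenbauer s j x\<bar>)"
    by (intro wint_mono s1 continuous_intros cG ce) (use up in \<open>force simp: abs_le_iff\<close>)
   moreover have "wint s (%x. (-1)*(Re (?G (of_real x))*normalized_gegenbauer s j x)) <= wint s (%x. ?B*\<bar>normalized_gegenbauer s j x\<bar>)"
    by (intro wint_mono s1 continuous_intros cG ce) (use up in \<open>force simp: abs_le_iff\<close>)
   ultimately show ?thesis unfolding wint_scale[of _ "-1"] by linarith
  qed
  also have "... <= ?B*?A"
   unfolding wint_scale using normalized_gegenbauer_L1[OF s(1), of j] M0 by (intro mult_left_mono) auto
  finally have le: "(real j*(real j + 2 * s + 1))^k*\<bar>?c F\<bar> <= ?B*?A"
   unfolding it .
  have "((real j)\<^sup>2)^k <= (real j*(real j + 2 * s + 1))^k"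
   using s by (intro power_mono) (auto simp: power2_eq_square mult_left_mono)
  then have "\<bar>?c F\<bar>*((real j)\<^sup>2)^k <= \<bar>?c F\<bar>*(real j*(real j + 2 * s + 1))^k"
   by (intro mult_left_mono) auto
  also have "... <= ?B*?A" using le by (simp add: mult.commute)
  also have "18/d\<^sup>2 = 18*(real k + 1)\<^sup>2/r\<^sup>2"
   using r by (simp add: d_def power_divide)
  finally show ?thesis .
 qed
 have "\<bar>?c F\<bar> <= 16*?A*M*(4 powr (- r/9))^j"
 proof -
  define t where "t = r*real j/9"
  have pw: "(4 powr (- r/9))^j = 4 powr (- t)"
   by (simp add: powr_realpow[symmetric] powr_powr t_def)
  have AM: "0 <= ?A*M" using M0 by simp
  show ?thesis
  proof (cases "t < 1")
   case True
   have "(4::real) powr (-1) <= 4 powr (- t)" using True by (intro powr_mono) auto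
   then have "1 <= 16*4 powr (- t)" by (simp add: powr_neg_one)
   then have "?A*M*1 <= ?A*M*(16*4 powr (- t))" using AM by (rule mult_left_mono)
   then show ?thesis using main[of 0] unfolding pw by (simp add: mult_ac)
  next
   case False
   (* By main the coefficient is at most (18 (k + 1)^2 / (r j)^2)^k up to a constant, and k + 1 <= t = r j / 9
      makes the base smaller than 1/4. *)
   define k where "k = nat \<lfloor>t\<rfloor> - 1"
   have k1: "real k + 1 = of_int \<lfloor>t\<rfloor>"
    using False by (simp add: k_def of_nat_diff le_nat_iff)
   then have kt: "real k + 1 <= t" "t <= real k + 2" by linarith+
   have j: "real j > 0" using False r by (cases j) (auto simp: t_def)
   have "18*(real k + 1)\<^sup>2/r\<^sup>2 <= (real j)\<^sup>2/4"
   proof -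
    have "(real k + 1)\<^sup>2 <= t\<^sup>2" using kt by (intro power_mono) auto
    then have "18*(real k + 1)\<^sup>2/r\<^sup>2 <= 18*t\<^sup>2/r\<^sup>2"
     by (intro divide_right_mono mult_left_mono) auto
    also have "... = 18/81*(real j)\<^sup>2"
     using r by (simp add: t_def power_mult_distrib power_divide)
    also have "... <= (real j)\<^sup>2/4" by simp
    finally show ?thesis .
   qed
   then have "(18*(real k + 1)\<^sup>2/r\<^sup>2)^k <= ((real j)\<^sup>2/4)^k"
    by (intro power_mono) auto
   then have "\<bar>?c F\<bar>*(real j)\<^sup>2^k <= ((real j)\<^sup>2/4)^k*(M*?A)"
    using main[of k] mult_right_mono[of "(18*(real k + 1)\<^sup>2/r\<^sup>2)^k" "((real j)\<^sup>2/4)^k" "M*?A"] AM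
    by (simp add: mult_ac)
   also have "... = (real j)\<^sup>2^k*((1/4)^k*(M*?A))"
    by (simp add: power_divide)
   finally have "\<bar>?c F\<bar> <= (1/4)^k*(M*?A)"
    using j by (simp add: mult.commute)
   also have "(1/4::real)^k = 4 powr (- real k)"
    by (simp add: powr_minus_divide powr_realpow power_one_over)
   also have "... <= 4 powr (2 - t)" using kt by (intro powr_mono) auto
   also have "4 powr (2 - t) = 16*4 powr (- t)" by (simp add: powr_diff powr_minus_divide)
   finally show ?thesis using AM unfolding pw by (simp add: mult_ac mult_right_mono)
  qed
 qed
 then show ?thesis unfolding gegenbauer_coeff_eq .
qed

section \<open>Gegenbauer series with exponentially decaying coefficients\<close>

fun complex_gegenbauer :: "real => nat => complex => complex" where
 "complex_gegenbauer \<alpha> 0 z = 1"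
| "complex_gegenbauer \<alpha> (Suc 0) z = 2 * of_real \<alpha>*z"
| "complex_gegenbauer \<alpha> (Suc (Suc n)) z =
   (2*(of_nat n + 1 + of_real \<alpha>)*z*complex_gegenbauer \<alpha> (Suc n) z
   - (of_nat n + 2 * of_real \<alpha>)*complex_gegenbauer \<alpha> n z)/(of_nat n + 2)"

lemma complex_gegenbauer_of_real:
 "complex_gegenbauer \<alpha> n (of_real x) = of_real (poly (gegenbauer \<alpha> n) x)"
proof (induction \<alpha> n "complex_of_real x" rule: complex_gegenbauer.induct)
 case (3 \<alpha> n)
 let ?c = "%k. poly (gegenbauer \<alpha> k) x"
 have nz: "of_nat n + 2 ~= (0::complex)"
  by (metis of_nat_add of_nat_numeral of_nat_eq_0_iff add_is_0 zero_neq_numeral)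
 have "complex_of_real ((real n + 2)*?c (Suc (Suc n)))
   = complex_of_real (2*(real n + 1 + \<alpha>)*(x*?c (Suc n)) - (real n + 2*\<alpha>)*?c n)"
  by (simp only: gegenbauer_recurrence)
 then have "2*(of_nat n + 1 + of_real \<alpha>) * of_real x * of_real (?c (Suc n)) - (of_nat n + 2 * of_real \<alpha>) * of_real (?c n)
   = (of_nat n + 2)*complex_of_real (?c (Suc (Suc n)))"
  by (simp add: mult.assoc del: gegenbauer.simps)
 then show ?case
  unfolding complex_gegenbauer.simps(3) 3 using nz by (simp del: gegenbauer.simps)
qed auto

lemma complex_gegenbauer_holomorphic: "complex_gegenbauer \<alpha> n holomorphic_on A"
proof (induction n rule: less_induct)
 case (less n)
 consider "n = 0" | "n = 1" | m where "n = Suc (Suc m)" by (cases n; cases "n - 1") auto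
 then show ?case
 proof cases
  case 1
  then have "complex_gegenbauer \<alpha> n = (%z. 1)" by auto
  then show ?thesis by simp
 next
  case 2
  then have "complex_gegenbauer \<alpha> n = (%z. 2 * of_real \<alpha>*z)" by auto
  then show ?thesis by (simp add: holomorphic_intros)
 next
  case (3 m)
  have nz: "of_nat m + 2 ~= (0::complex)"
   by (metis of_nat_add of_nat_numeral of_nat_eq_0_iff add_is_0 zero_neq_numeral)
  have "complex_gegenbauer \<alpha> n = (%z. (2*(of_nat m + 1 + of_real \<alpha>)*z*complex_gegenbauer \<alpha> (Suc m) z
   - (of_nat m + 2 * of_real \<alpha>)*complex_gegenbauer \<alpha> m z)/(of_nat m + 2))"
   using 3 by auto
  moreover have "... holomorphic_on A"
   using less.IH[of m] less.IH[of "Suc m"] 3 nz by (intro holomorphic_intros) auto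
  ultimately show ?thesis by simp
 qed
qed

text \<open>The power series of \<open>(1 - w t) powr (- \<alpha>)\<close> in \<open>t\<close>.\<close>

definition binomial_coeff_series :: "real => complex => complex fps" where
 "binomial_coeff_series \<alpha> w = Abs_fps (%k. of_real (pochhammer \<alpha> k/fact k)*w^k)"

lemma binomial_coeff_series_ode:
 "(1 - fps_const w*fps_X)*fps_deriv (binomial_coeff_series \<alpha> w) = fps_const (of_real \<alpha>*w)*binomial_coeff_series \<alpha> w"
proof (rule fps_ext)
 fix n
 let ?a = "%k. complex_of_real (pochhammer \<alpha> k/fact k)"
 have rec: "of_nat (Suc n)*?a (Suc n) = (of_real \<alpha> + of_nat n)*?a n"
 proof -
  have "real (Suc n)*(pochhammer \<alpha> (Suc n)/fact (Suc n)) = (\<alpha> + real n)*(pochhammer \<alpha> n/fact n)"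
   by (simp add: pochhammer_Suc field_simps del: of_nat_Suc)
  then have "complex_of_real (real (Suc n)*(pochhammer \<alpha> (Suc n)/fact (Suc n))) = complex_of_real ((\<alpha> + real n)*(pochhammer \<alpha> n/fact n))"
   by (simp only:)
  then show ?thesis by (simp only: of_real_mult of_real_add of_real_of_nat_eq)
 qed
 have l: "fps_nth ((1 - fps_const w*fps_X)*fps_deriv (binomial_coeff_series \<alpha> w)) n
   = (of_nat (Suc n)*?a (Suc n) - of_nat n*?a n)*w^Suc n"
  by (cases n) (simp_all add: binomial_coeff_series_def left_diff_distrib mult.assoc algebra_simps del: of_nat_Suc)
 show "fps_nth ((1 - fps_const w*fps_X)*fps_deriv (binomial_coeff_series \<alpha> w)) n
   = fps_nth (fps_const (of_real \<alpha>*w)*binomial_coeff_series \<alpha> w) n"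
  unfolding l rec by (simp add: binomial_coeff_series_def algebra_simps add_divide_distrib)
qed

text \<open>The generating function \<open>(1 - 2 z t + t\<^sup>2) powr (- \<alpha>)\<close> factors as
 \<open>(1 - w t) powr (- \<alpha>) * (1 - t / w) powr (- \<alpha>)\<close> when \<open>2 z = w + 1 / w\<close>; this is checked on the
 differential equations of the formal power series.\<close>

lemma complex_gegenbauer_Joukowski:
 assumes w: "w ~= 0" and z: "2*z = w + 1/w"
 shows "complex_gegenbauer \<alpha> n z = (\<Sum>k\<le>n. of_real (pochhammer \<alpha> k/fact k)*w^k *
   (of_real (pochhammer \<alpha> (n - k)/fact (n - k))*(1/w)^(n - k)))"
proof -
 let ?A = "binomial_coeff_series \<alpha> w" and ?B = "binomial_coeff_series \<alpha> (1/w)"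
 define D where "D = ?A*?B"
 have nth: "fps_nth D n = (\<Sum>k\<le>n. of_real (pochhammer \<alpha> k/fact k)*w^k *
   (of_real (pochhammer \<alpha> (n - k)/fact (n - k))*(1/w)^(n - k)))" for n
  by (simp add: D_def fps_mult_nth binomial_coeff_series_def atLeast0AtMost)
 define U V where "U = 1 - fps_const w*fps_X" and "V = 1 - fps_const (1/w)*fps_X"
 have UV: "U*V = 1 - fps_const (2*z)*fps_X + fps_X^2"
 proof -
  have "U*V = 1 - (fps_const w + fps_const (1/w))*fps_X + (fps_const w*fps_const (1/w))*fps_X^2"
   unfolding U_def V_def by (simp add: algebra_simps power2_eq_square del: fps_const_mult fps_const_add)
  also have "fps_const w*fps_const (1/w) = 1" using w by simp
  also have "fps_const w + fps_const (1/w) = fps_const (2*z)" using z by simp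
  finally show ?thesis by simp
 qed
 have "(U*V)*fps_deriv D = V*(U*fps_deriv ?A)*?B + U*(V*fps_deriv ?B)*?A"
  unfolding D_def by (simp add: algebra_simps)
 also have "U*fps_deriv ?A = fps_const (of_real \<alpha>*w)*?A"
  unfolding U_def by (rule binomial_coeff_series_ode)
 also have "V*fps_deriv ?B = fps_const (of_real \<alpha>*(1/w))*?B"
  unfolding V_def by (rule binomial_coeff_series_ode)
 also have "V*(fps_const (of_real \<alpha>*w)*?A)*?B + U*(fps_const (of_real \<alpha>*(1/w))*?B)*?A
   = (V*fps_const (of_real \<alpha>*w) + U*fps_const (of_real \<alpha>*(1/w)))*D"
  unfolding D_def by (simp add: algebra_simps)
 also have "V*fps_const (of_real \<alpha>*w) + U*fps_const (of_real \<alpha>*(1/w))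
   = fps_const (of_real \<alpha>*(2*z)) - fps_const (2 * of_real \<alpha>)*fps_X"
 proof -
  have "V*fps_const (of_real \<alpha>*w) + U*fps_const (of_real \<alpha>*(1/w))
    = (fps_const (of_real \<alpha>*w) + fps_const (of_real \<alpha>*(1/w)))
     - (fps_const (1/w)*fps_const (of_real \<alpha>*w) + fps_const w*fps_const (of_real \<alpha>*(1/w)))*fps_X"
   unfolding U_def V_def by (simp add: algebra_simps del: fps_const_mult fps_const_add)
  also have "fps_const (of_real \<alpha>*w) + fps_const (of_real \<alpha>*(1/w)) = fps_const (of_real \<alpha>*(2*z))"
   unfolding z by (simp add: distrib_left)
  also have "fps_const (1/w)*fps_const (of_real \<alpha>*w) + fps_const w*fps_const (of_real \<alpha>*(1/w)) = fps_const (2 * of_real \<alpha>)"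
   using w by simp
  finally show ?thesis .
 qed
 finally have ode: "(1 - fps_const (2*z)*fps_X + fps_X^2)*fps_deriv D
   = (fps_const (of_real \<alpha>*(2*z)) - fps_const (2 * of_real \<alpha>)*fps_X)*D"
  unfolding UV .
 have rec: "(of_nat m + 2)*fps_nth D (Suc (Suc m))
   = 2*(of_nat m + 1 + of_real \<alpha>)*z*fps_nth D (Suc m) - (of_nat m + 2 * of_real \<alpha>)*fps_nth D m" for m
 proof -
  have e: "fps_nth ((1 - fps_const (2*z)*fps_X + fps_X^2)*fps_deriv D) (Suc m)
    = fps_nth ((fps_const (of_real \<alpha>*(2*z)) - fps_const (2 * of_real \<alpha>)*fps_X)*D) (Suc m)"
   unfolding ode ..
  have l: "fps_nth ((1 - fps_const (2*z)*fps_X + fps_X^2)*fps_deriv D) (Suc m)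
    = (of_nat m + 2)*fps_nth D (Suc (Suc m)) - 2*z*((of_nat m + 1)*fps_nth D (Suc m)) + of_nat m*fps_nth D m"
  proof -
   have "fps_nth (fps_X^2*fps_deriv D) (Suc m) = of_nat m*fps_nth D m"
    by (cases m) (simp_all add: fps_X_power_mult_nth)
   then show ?thesis
    by (simp add: distrib_right left_diff_distrib mult.assoc add.commute)
  qed
  have r: "fps_nth ((fps_const (of_real \<alpha>*(2*z)) - fps_const (2 * of_real \<alpha>)*fps_X)*D) (Suc m)
    = of_real \<alpha>*(2*z)*fps_nth D (Suc m) - 2 * of_real \<alpha>*fps_nth D m"
   by (simp add: left_diff_distrib mult.assoc)
  show ?thesis using e unfolding l r by (simp add: algebra_simps)
 qed
 have nz: "of_nat m + 2 ~= (0::complex)" for m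
  by (metis of_nat_add of_nat_numeral of_nat_eq_0_iff add_is_0 zero_neq_numeral)
 have "complex_gegenbauer \<alpha> n z = fps_nth D n \<and> complex_gegenbauer \<alpha> (Suc n) z = fps_nth D (Suc n)"
 proof (induction n)
  case 0
  have "2 * of_real \<alpha>*z = of_real \<alpha>*(2*z)" by simp
  then show ?case unfolding z by (simp add: nth algebra_simps)
 next
  case (Suc m)
  then show ?case using rec[of m] nz[of m] by (simp add: field_simps)
 qed
 then show ?thesis unfolding nth by blast
qed

text \<open>The Joukowski map takes the circle of radius \<open>R\<close> to the ellipse with foci
 \<open>\<plusminus>1\<close> and semiaxis sum \<open>R\<close>, so \<open>cmod w\<close> tells on which confocal
 ellipse \<open>z\<close> lies.\<close>

lemma Joukowski_root:
 obtains w where "w ~= 0" "2*z = w + 1/w" "1 <= cmod w" "cmod (z - 1) + cmod (z + 1) = cmod w + 1/cmod w"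
proof -
 have ex: "\<exists>w. w ~= 0 \<and> 2*z = w + 1/w"
 proof -
  define w where "w = z + csqrt (z\<^sup>2 - 1)"
  have "w*(2*z - w) = z\<^sup>2 - (csqrt (z\<^sup>2 - 1))\<^sup>2"
   by (simp add: w_def algebra_simps power2_eq_square)
  then have e: "w*(2*z - w) = 1" by simp
  then have "w ~= 0" by auto
  with e have "2*z - w = 1/w" by (simp add: field_simps)
  with \<open>w \<noteq> 0\<close> show ?thesis by (intro exI[of _ w]) (simp add: algebra_simps)
 qed
 have "\<exists>w. w ~= 0 \<and> 2*z = w + 1/w \<and> 1 <= cmod w"
 proof -
  from ex obtain w where w: "w ~= 0" "2*z = w + 1/w" by blast
  show ?thesis
  proof (cases "1 <= cmod w")
   case False
   then have "1 <= cmod (1/w)" using w(1) by (simp add: norm_divide)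
   then show ?thesis using w by (intro exI[of _ "1/w"]) (simp add: add.commute)
  qed (use w in blast)
 qed
 then obtain w where w: "w ~= 0" "2*z = w + 1/w" "1 <= cmod w" by blast
 have e: "cmod (z - c) = (cmod (w - c))\<^sup>2/(2*cmod w)" if "c*c = 1" for c
 proof -
  have "z - c = (w - c)\<^sup>2/(2*w)"
  proof -
   have "(2*w)*(z - c) = w*(2*z) - 2*w*c" by (simp add: algebra_simps)
   also have "w*(2*z) = w*w + 1" unfolding w(2) using w(1) by (simp add: algebra_simps)
   also have "w*w + 1 - 2*w*c = (w - c)\<^sup>2" using that by (simp add: power2_eq_square algebra_simps)
   finally show ?thesis using w(1) by (simp add: field_simps)
  qed
  then show ?thesis by (simp add: norm_divide norm_power norm_mult)
 qed
 have "cmod (z - 1) + cmod (z - (-1)) = ((cmod (w - 1))\<^sup>2 + (cmod (w + 1))\<^sup>2)/(2*cmod w)"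
  using e[of 1] e[of "-1"] by (simp add: add_divide_distrib)
 also have "(cmod (w - 1))\<^sup>2 + (cmod (w + 1))\<^sup>2 = 2*((cmod w)\<^sup>2 + 1)"
  unfolding cmod_power2 by (simp add: power2_eq_square algebra_simps)
 also have "2*((cmod w)\<^sup>2 + 1)/(2*cmod w) = cmod w + 1/cmod w"
  using w(1) by (simp add: field_simps power2_eq_square)
 finally show ?thesis using that w by simp
qed

lemma Joukowski_strict_mono:
 fixes a b :: real
 assumes "1 <= a" "a < b" shows "a + 1/a < b + 1/b"
proof -
 have ab: "1 < a*b" using assms by (metis less_1_mult less_eq_real_def less_le_trans mult_1)
 then have "(b - a)*(1 - 1/(a*b)) > 0"
  using assms by (intro mult_pos_pos) auto
 moreover have "(b - a)*(1 - 1/(a*b)) = (b - a) - (1/a - 1/b)"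
  using assms by (simp add: field_simps)
 ultimately show ?thesis by linarith
qed

lemma Joukowski_mono_less:
 fixes a b :: real
 assumes "1 <= a" "1 <= b" "a + 1/a < b + 1/b" shows "a < b"
 using Joukowski_strict_mono[OF assms(2), of a] assms(3) by (cases "a = b") force+

lemma pochhammer_over_fact_le:
 assumes "0 <= \<alpha>" "\<alpha> <= (2::real)"
 shows "0 <= pochhammer \<alpha> k/fact k \<and> pochhammer \<alpha> k/fact k <= real k + 1"
proof (induction k)
 case (Suc k)
 have e: "pochhammer \<alpha> (Suc k)/fact (Suc k) = pochhammer \<alpha> k/fact k*((\<alpha> + real k)/(real k + 1))"
  by (simp add: pochhammer_Suc add.commute)
 have "pochhammer \<alpha> k/fact k*((\<alpha> + real k)/(real k + 1)) <= (real k + 1)*((2 + real k)/(real k + 1))"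
  using Suc assms by (intro mult_mono divide_right_mono) auto
 also have "... = real (Suc k) + 1" by simp
 finally have "pochhammer \<alpha> k/fact k*((\<alpha> + real k)/(real k + 1)) <= real (Suc k) + 1" .
 moreover have "0 <= pochhammer \<alpha> k/fact k*((\<alpha> + real k)/(real k + 1))"
  using Suc assms by (intro mult_nonneg_nonneg) auto
 ultimately show ?case unfolding e by simp
qed simp

text \<open>The powers \<open>w\<close> to \<open>2 k - n\<close> in the product formula are at most
 \<open>R\<^sup>n\<close>, and for \<open>\<alpha> \<le> 2\<close> the binomial coefficients grow at most
 linearly.\<close>

lemma complex_gegenbauer_bound:
 assumes \<alpha>: "0 <= \<alpha>" "\<alpha> <= 2" and R: "R >= 1" and z: "cmod (z - 1) + cmod (z + 1) < R + 1/R"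
 shows "cmod (complex_gegenbauer \<alpha> n z) <= (real n + 1)^3 * R^n"
proof -
 obtain w where w: "w ~= 0" "2*z = w + 1/w" "1 <= cmod w" "cmod (z - 1) + cmod (z + 1) = cmod w + 1/cmod w"
  by (rule Joukowski_root)
 have wR: "cmod w < R" using Joukowski_mono_less[OF w(3) R] z w(4) by simp
 have "cmod (complex_gegenbauer \<alpha> n z) <= (\<Sum>k\<le>n. cmod (of_real (pochhammer \<alpha> k/fact k)*w^k *
   (of_real (pochhammer \<alpha> (n - k)/fact (n - k))*(1/w)^(n - k))))"
  unfolding complex_gegenbauer_Joukowski[OF w(1,2)] by (rule norm_sum)
 also have "... <= (\<Sum>k\<le>n. (real n + 1)*(real n + 1) * R^n)"
 proof (rule sum_mono)
  fix k assume k: "k \<in> {..n}"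
  have p: "cmod (of_real (pochhammer \<alpha> i/fact i)) <= real n + 1" if "i <= n" for i
  proof -
   have "cmod (of_real (pochhammer \<alpha> i/fact i)) = pochhammer \<alpha> i/fact i"
    using pochhammer_over_fact_le[OF \<alpha>, of i] by (simp only: norm_of_real abs_of_nonneg)
   also have "... <= real n + 1" using pochhammer_over_fact_le[OF \<alpha>, of i] that by linarith
   finally show ?thesis .
  qed
  have a: "cmod (w^k) <= R^n"
  proof -
   have "cmod (w^k) <= R^k" unfolding norm_power using wR by (intro power_mono) auto
   also have "... <= R^n" using R k by (intro power_increasing) auto
   finally show ?thesis .
  qed
  have b: "cmod ((1/w)^(n - k)) <= 1"
   unfolding norm_power using w by (intro power_le_one) (auto simp: norm_divide)
  have "cmod (of_real (pochhammer \<alpha> k/fact k)*w^k*(of_real (pochhammer \<alpha> (n - k)/fact (n - k))*(1/w)^(n - k)))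
    <= (real n + 1) * R^n*((real n + 1)*1)"
   unfolding norm_mult using p[of k] p[of "n - k"] a b k R
   by (intro mult_mono) auto
  then show "cmod (of_real (pochhammer \<alpha> k/fact k)*w^k*(of_real (pochhammer \<alpha> (n - k)/fact (n - k))*(1/w)^(n - k)))
    <= (real n + 1)*(real n + 1) * R^n" by (simp add: mult_ac)
 qed
 also have "... = (real n + 1)^3 * R^n" by (simp add: power3_eq_cube mult_ac)
 finally show ?thesis .
qed

lemma segment_in_ellipse:
 assumes "x \<in> {-1..1}" "R > 1"
 shows "cmod (of_real x - 1) + cmod (of_real x + 1) < R + 1/R"
proof -
 have "cmod (of_real x - 1) + cmod (of_real x + 1) = \<bar>x - 1\<bar> + \<bar>x + 1\<bar>"
 proof -
  have "complex_of_real x - 1 = of_real (x - 1)" "complex_of_real x + 1 = of_real (x + 1)" by simp_all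
  then show ?thesis by (simp only: norm_of_real)
 qed
 also have "... = 2" using assms by auto
 also have "2 < R + 1/R"
 proof -
  have "0 < (R - 1)\<^sup>2/R" using assms by simp
  also have "(R - 1)\<^sup>2/R = R + 1/R - 2" using assms by (simp add: power2_eq_square field_simps)
  finally show ?thesis by simp
 qed
 finally show ?thesis .
qed

lemma L2_norm_jacobi_bounded:
 assumes "s > -1" "f \<in> borel_measurable lebesgue" "!!x. x \<in> {-1<..<1} ==> \<bar>f x\<bar> <= e"
 shows "L2_norm (jacobi_measure s) f <= e * sqrt (measure (jacobi_measure s) UNIV)"
proof -
 interpret finite_measure "jacobi_measure s" by (rule finite_jacobi_measure[OF assms(1)])
 have e: "e >= 0" using assms(3)[of 0] by simp
 have "f \<in> L2 (jacobi_measure s)" by (rule L2_jacobi_bounded[OF assms])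
 then have "(LINT x|jacobi_measure s. (f x)\<^sup>2) <= (LINT x|jacobi_measure s. e\<^sup>2)"
 proof (intro integral_mono_AE)
  show "AE x in jacobi_measure s. (f x)\<^sup>2 <= e\<^sup>2"
   using AE_jacobi_interval by eventually_elim (metis assms(3) abs_ge_zero power2_abs power_mono)
 qed (auto simp: L2_def)
 also have "... = e\<^sup>2*measure (jacobi_measure s) UNIV" by (simp add: mult.commute)
 finally have "L2_norm (jacobi_measure s) f <= sqrt (e\<^sup>2*measure (jacobi_measure s) UNIV)"
  unfolding L2_norm_def by (rule real_sqrt_le_mono)
 then show ?thesis using e by (simp add: real_sqrt_mult)
qed

text \<open>On the ellipse with parameter \<open>R = q powr (-1/2)\<close> the polynomials grow at most like
 \<open>R\<^sup>j\<close> up to polynomial factors, against coefficients \<open>q\<^sup>j\<close>, so the series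
 converges uniformly. On the interval its sum agrees almost everywhere with the \<open>L\<^sup>2\<close> limit of the
 partial sums.\<close>

theorem gegenbauer_series_analytic:
 assumes s: "0 <= s" "s <= 1" and q: "0 < q" "q < 1" and c: "!!j. \<bar>c j\<bar> <= A*q^j"
  and \<phi>: "\<phi> \<in> L2 (jacobi_measure s)"
   "!!j. L2_inner (jacobi_measure s) \<phi> (normalized_gegenbauer s j) = c j"
 obtains \<nu> F where "\<nu> > 1" "F analytic_on ellipse_region \<nu>"
  "!!x. x \<in> {-1<..<1} ==> F (of_real x) = of_real (Re (F (of_real x)))"
  "AE x in jacobi_measure s. \<phi> x = Re (F (of_real x))"
proof -
 interpret B: L2_basis "jacobi_measure s" "normalized_gegenbauer s" by (rule gegenbauer_basis[OF s(1)])
 let ?M = "jacobi_measure s"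
 have s1: "s > -1" using s by simp
 define R where "R = 1/sqrt q"
 have R: "R > 1" and qR: "q * R = sqrt q" "0 < sqrt q" "sqrt q < 1"
  using q real_sqrt_mult_self[of q] by (auto simp: R_def field_simps)
 define E where "E = {z. cmod (z - 1) + cmod (z + 1) < R + 1/R}"
 have openE: "open E" unfolding E_def by (intro open_Collect_less continuous_intros)
 define h0 where "h0 = geg_sqnorm s 0*(s + 1/2)"
 have h0: "h0 > 0" using geg_sqnorm_0_pos[OF s1] s by (simp add: h0_def)
 have A0: "A >= 0" using c[of 0] by simp
 have nb: "1/sqrt (geg_sqnorm s j) <= (real j + 2)/sqrt h0" for j
 proof -
  have "h0 <= geg_sqnorm s j*(real j + s + 1/2)" unfolding h0_def by (rule geg_sqnorm_lower(1)[OF s(1)])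
  also have "... <= geg_sqnorm s j*(real j + 2)\<^sup>2"
  proof (rule mult_left_mono)
   have "real j + s + 1/2 <= real j + 2" using s by simp
   also have "... <= (real j + 2)\<^sup>2" by (simp add: power2_eq_square)
   finally show "real j + s + 1/2 <= (real j + 2)\<^sup>2" .
  qed (use geg_sqnorm_lower(2)[OF s(1), of j] in simp)
  finally have "sqrt h0 <= sqrt (geg_sqnorm s j)*(real j + 2)"
   using real_sqrt_le_mono by (fastforce simp: real_sqrt_mult)
  then show ?thesis using h0 geg_sqnorm_lower(2)[OF s(1), of j] by (simp add: field_simps)
 qed
 define t where "t j z = of_real (c j/sqrt (geg_sqnorm s j))*complex_gegenbauer (s + 1/2) j z" for j z
 define m where "m j = A/sqrt h0*((real j + 2)^4 * sqrt q^j)" for j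
 have tb: "cmod (t j z) <= m j" if "z \<in> E" for j z
 proof -
  have "cmod (t j z) = \<bar>c j\<bar>*(1/sqrt (geg_sqnorm s j))*cmod (complex_gegenbauer (s + 1/2) j z)"
   using geg_sqnorm_lower(2)[OF s(1), of j] by (simp add: t_def norm_mult norm_divide)
  also have "... <= (A*q^j)*((real j + 2)/sqrt h0)*((real j + 1)^3 * R^j)"
   using c[of j] nb[of j] complex_gegenbauer_bound[of "s + 1/2" R z j] that R s A0 q h0
   by (intro mult_mono) (auto simp: E_def less_imp_le[OF geg_sqnorm_lower(2)[OF s(1)]])
  also have "... = A/sqrt h0*((real j + 2)*(real j + 1)^3*(q * R)^j)"
   by (simp add: power_mult_distrib)
  also have "... <= A/sqrt h0*((real j + 2)*(real j + 2)^3*(q * R)^j)"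
   using A0 h0 qR by (intro mult_left_mono mult_right_mono power_mono) auto
  finally show ?thesis by (simp add: m_def qR power_Suc[symmetric])
 qed
 have sm: "summable m"
 proof -
  have "summable (%j. (real j + 2)^4 * sqrt q^j)"
  proof -
   have "(%j. ((real j + 3)/(real j + 2))^4) \<longlonglongrightarrow> 1" by real_asymp
   then have "(%j. ((real j + 3)/(real j + 2))^4 * sqrt q) \<longlonglongrightarrow> 1 * sqrt q"
    by (rule tendsto_mult_right)
   then have "\<forall>\<^sub>F j in sequentially. ((real j + 3)/(real j + 2))^4 * sqrt q < (1 + sqrt q)/2"
    using qR by (intro order_tendstoD(2)) auto
   then obtain N where N: "!!j. j >= N ==> ((real j + 3)/(real j + 2))^4 * sqrt q < (1 + sqrt q)/2"
    unfolding eventually_sequentially by blast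
   show ?thesis
   proof (rule summable_ratio_test[of "(1 + sqrt q)/2" N])
    show "(1 + sqrt q)/2 < 1" using qR by simp
    fix j assume j: "j >= N"
    have "(real (Suc j) + 2)^4 * sqrt q^Suc j = ((real j + 3)/(real j + 2))^4 * sqrt q*((real j + 2)^4 * sqrt q^j)"
     by (simp add: power_divide add.commute)
    also have "... <= (1 + sqrt q)/2*((real j + 2)^4 * sqrt q^j)"
     using N[OF j] qR by (intro mult_right_mono) auto
    finally show "norm ((real (Suc j) + 2)^4 * sqrt q^Suc j) <= (1 + sqrt q)/2*norm ((real j + 2)^4 * sqrt q^j)"
     using qR by simp
   qed
  qed
  then show ?thesis unfolding m_def by (rule summable_mult)
 qed
 define G where "G z = (\<Sum>j. t j z)" for z
 have ul: "uniform_limit E (%n z. \<Sum>j<n. t j z) G sequentially"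
  unfolding G_def by (rule Weierstrass_m_test[OF tb sm])
 have hG: "G holomorphic_on E"
 proof (rule holomorphic_uniform_sequence[OF openE])
  show "(%z. \<Sum>j<n. t j z) holomorphic_on E" for n
   unfolding t_def by (intro holomorphic_intros complex_gegenbauer_holomorphic)
  fix z assume "z \<in> E"
  then obtain d where "d > 0" "cball z d \<subseteq> E" using openE open_contains_cball by blast
  then show "\<exists>d>0. cball z d \<subseteq> E \<and> uniform_limit (cball z d) (%n z. \<Sum>j<n. t j z) G sequentially"
   using uniform_limit_on_subset[OF ul] by blast
 qed
 define \<nu> where "\<nu> = (1 + R)/2"
 have \<nu>: "1 < \<nu>" "\<nu> < R" using R by (auto simp: \<nu>_def)
 have sub: "ellipse_region \<nu> \<subseteq> E"
 proof -
  have "\<nu> + 1/\<nu> < R + 1/R"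
   using \<nu> by (intro Joukowski_strict_mono) auto
  then show ?thesis unfolding ellipse_region_def E_def by auto
 qed
 have an: "G analytic_on ellipse_region \<nu>"
  using hG openE sub analytic_on_open analytic_on_subset by blast
 have segE: "of_real x \<in> E" if "x \<in> {-1..1}" for x
  unfolding E_def using segment_in_ellipse[OF that R] by simp
 have tr: "t j (of_real x) = of_real (c j*normalized_gegenbauer s j x)" for j x
  by (simp add: t_def complex_gegenbauer_of_real normalized_gegenbauer_alt)
 have Gr: "(%n. \<Sum>j<n. c j*normalized_gegenbauer s j x) \<longlonglongrightarrow> Re (G (of_real x))"
  and Gi: "G (of_real x) = of_real (Re (G (of_real x)))" if "x \<in> {-1..1}" for x
 proof -
  have "(%n. \<Sum>j<n. t j (of_real x)) \<longlonglongrightarrow> G (of_real x)"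
   by (rule tendsto_uniform_limitI[OF ul segE[OF that]])
  then have l: "(%n. complex_of_real (\<Sum>j<n. c j*normalized_gegenbauer s j x)) \<longlonglongrightarrow> G (of_real x)"
   by (simp add: tr)
  show r: "(%n. \<Sum>j<n. c j*normalized_gegenbauer s j x) \<longlonglongrightarrow> Re (G (of_real x))"
   using tendsto_Re[OF l] by simp
  from LIMSEQ_unique[OF l tendsto_of_real[OF r]] show "G (of_real x) = of_real (Re (G (of_real x)))" .
 qed
 define g where "g x = indicator {-1<..<1} x * Re (G (of_real x))" for x
 have gm: "g \<in> borel_measurable lebesgue"
 proof -
  have "continuous_on {-1<..<1} (%x::real. Re (G (of_real x)))"
   by (intro continuous_on_Re continuous_on_compose2[OF holomorphic_on_imp_continuous_on[OF hG]])
     (auto intro!: continuous_intros segE)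
  then have "(%x. indicator {-1<..<1} x *\<^sub>R Re (G (of_real x))) \<in> borel_measurable borel"
   by (intro borel_measurable_continuous_on_indicator) auto
  then show ?thesis unfolding g_def[abs_def] by (intro lebesgue_measurableI) simp
 qed
 let ?S = "%n x. \<Sum>j<n. c j*normalized_gegenbauer s j x"
 have gdiff: "(%x. ?S n x - g x) \<in> L2 ?M \<and> L2_norm ?M (%x. ?S n x - g x) <= e * sqrt (measure ?M UNIV)"
  if "!!x. x \<in> {-1<..<1} ==> \<bar>?S n x - Re (G (of_real x))\<bar> <= e" for n e
 proof -
  have m: "(%x. ?S n x - g x) \<in> borel_measurable lebesgue"
   using B.partial_sq[where c=c and J="{..<n}"] gm by (auto simp: L2_def)
  have b: "\<bar>?S n x - g x\<bar> <= e" if "x \<in> {-1<..<1}" for x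
   using that by (simp add: g_def \<open>\<And>x. x \<in> {-1<..<1} \<Longrightarrow> \<bar>?S n x - Re (G (of_real x))\<bar> \<le> e\<close>)
  show ?thesis
   using L2_jacobi_bounded[OF s1 m b] L2_norm_jacobi_bounded[OF s1 m b] by simp
 qed
 have Sg: "(%n. L2_norm ?M (%x. ?S n x - g x)) \<longlonglongrightarrow> 0"
 proof (rule LIMSEQ_I)
  fix e :: real assume e: "e > 0"
  define d where "d = e/(2*(sqrt (measure ?M UNIV) + 1))"
  have mp: "0 <= sqrt (measure ?M UNIV)" by simp
  have d: "d > 0" "d * sqrt (measure ?M UNIV) < e"
   using e mp by (auto simp: d_def field_simps add_pos_nonneg)
  from uniform_limitD[OF ul d(1)] obtain N where N: "!!n z. n >= N ==> z \<in> E ==> dist (\<Sum>j<n. t j z) (G z) < d"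
   unfolding eventually_sequentially by blast
  have "L2_norm ?M (%x. ?S n x - g x) < e" if n: "n >= N" for n
  proof -
   have "\<bar>?S n x - Re (G (of_real x))\<bar> <= d" if x: "x \<in> {-1<..<1}" for x
   proof -
    have x': "x \<in> {-1..1}" using x by auto
    have "dist (complex_of_real (?S n x)) (complex_of_real (Re (G (of_real x)))) < d"
     using N[OF n segE[OF x']] Gi[OF x'] by (simp add: tr)
    then show ?thesis by (simp only: dist_of_real dist_real_def)
   qed
   then show ?thesis using gdiff[of n d] d by fastforce
  qed
  then show "\<exists>no. \<forall>n\<ge>no. norm (L2_norm ?M (%x. ?S n x - g x) - 0) < e" by auto
 qed
 have gs: "g \<in> L2 ?M"
 proof -
  from uniform_limitD[OF ul, of 1] obtain n where n: "!!z. z \<in> E ==> dist (\<Sum>j<n. t j z) (G z) < 1"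
   unfolding eventually_sequentially by auto
  have "\<bar>?S n x - Re (G (of_real x))\<bar> <= 1" if x: "x \<in> {-1<..<1}" for x
  proof -
   have x': "x \<in> {-1..1}" using x by auto
   have "dist (complex_of_real (?S n x)) (complex_of_real (Re (G (of_real x)))) < 1"
    using n[OF segE[OF x']] Gi[OF x'] by (simp add: tr)
   then show ?thesis by (simp only: dist_of_real dist_real_def)
  qed
  then have "(%x. ?S n x - g x) \<in> L2 ?M" using gdiff by blast
  from L2_diff[OF B.partial_sq[where c=c and J="{..<n}"] this] show ?thesis by simp
 qed
 have "AE x in ?M. \<phi> x = g x"
 proof (rule B.coeff_unique[OF \<phi>(1) gs])
  fix j
  have "(%n. L2_inner ?M (?S n) (normalized_gegenbauer s j)) \<longlonglongrightarrow> L2_inner ?M g (normalized_gegenbauer s j)"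
   by (rule L2_inner_tendsto[OF B.partial_sq gs B.e_sq Sg])
  moreover have "(%n. L2_inner ?M (?S n) (normalized_gegenbauer s j)) \<longlonglongrightarrow> c j"
  proof (rule tendsto_eventually)
   show "\<forall>\<^sub>F n in sequentially. L2_inner ?M (?S n) (normalized_gegenbauer s j) = c j"
    using eventually_gt_at_top[of j] by eventually_elim (simp add: B.inner_partial)
  qed
  ultimately show "L2_inner ?M \<phi> (normalized_gegenbauer s j) = L2_inner ?M g (normalized_gegenbauer s j)"
   unfolding \<phi>(2) by (rule LIMSEQ_unique[symmetric])
 qed
 then have "AE x in ?M. \<phi> x = Re (G (of_real x))"
  using AE_jacobi_interval by eventually_elim (simp add: g_def)
 with \<nu> an Gi that show ?thesis by force
qed

section \<open>Transfer to the reference interval\<close>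

definition affine_map :: "real => real => real => real" where
 "affine_map a b z = (a + b)/2 + (b - a)/2*z"

text \<open>The function in the coordinate of the reference interval, set to zero outside; membership in spaces over
 the interval becomes membership in one space over the line.\<close>

definition ref_fun :: "real => real => (real => real) => real => real" where
 "ref_fun a b v z = indicator {-1<..<1} z * v (affine_map a b z)"

lemma pullback_affine: "pullback a b v z = v (affine_map a b z)"
 unfolding pullback_def affine_map_def by (rule arg_cong[where f=v]) (simp add: field_simps)

lemma ref_fun_inside: "z \<in> {-1<..<1} ==> ref_fun a b v z = v (affine_map a b z)"
 by (simp add: ref_fun_def)

lemma indicator_mult_measurable:
 "f \<in> borel_measurable lebesgue ==> (%z. indicator {-1<..<1::real} z*f z :: real) \<in> borel_measurable lebesgue"
 by (intro borel_measurable_times borel_measurable_indicator) auto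

lemma affine_map_measurable:
 assumes "a < b" shows "affine_map a b \<in> lebesgue \<rightarrow>\<^sub>M lebesgue"
 using lebesgue_affine_measurable[of "%_. (b - a)/2" "(a + b)/2"] assms
 by (simp add: affine_map_def[abs_def])

lemma ref_fun_measurable_iff:
 assumes ab: "a < b"
 shows "ref_fun a b v \<in> borel_measurable lebesgue \<longleftrightarrow> (%x. indicator {a<..<b} x * v x) \<in> borel_measurable lebesgue"
proof
 have r: "ref_fun a b v z = indicator {a<..<b} (affine_map a b z) * v (affine_map a b z)" for z
  using affine_mem_iff[OF ab, of z] unfolding ref_fun_def affine_map_def[symmetric] by (simp add: indicator_def)
 assume "(%x. indicator {a<..<b} x * v x) \<in> borel_measurable lebesgue"
 from measurable_compose[OF affine_map_measurable[OF ab] this]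
 show "ref_fun a b v \<in> borel_measurable lebesgue"
  unfolding r[abs_def, symmetric] by (simp add: r[symmetric])
next
 define m h where "m = (a + b)/2" and "h = (b - a)/2"
 have h: "h > 0" using ab by (simp add: h_def)
 have inv: "affine_map a b ((x - m)/h) = x" for x
  unfolding affine_map_def m_def[symmetric] h_def[symmetric] using h by simp
 have r: "indicator {a<..<b} x * v x = ref_fun a b v ((x - m)/h)" for x
  using affine_mem_iff[OF ab, of "(x - m)/h"] unfolding affine_map_def[symmetric] ref_fun_def inv
  by (simp add: indicator_def)
 have "(%x. - m/h + 1/h*x) \<in> lebesgue \<rightarrow>\<^sub>M lebesgue"
  using lebesgue_affine_measurable[of "%_. 1/h" "- m/h"] h by simp
 also have "(%x. - m/h + 1/h*x) = (%x. (x - m)/h)"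
  by (simp add: fun_eq_iff diff_divide_distrib)
 finally have im: "(%x. (x - m)/h) \<in> lebesgue \<rightarrow>\<^sub>M lebesgue" .
 assume "ref_fun a b v \<in> borel_measurable lebesgue"
 from measurable_compose[OF im this]
 show "(%x. indicator {a<..<b} x * v x) \<in> borel_measurable lebesgue"
  unfolding r .
qed

lemma ivl_weight_borel [measurable]: "ivl_weight s a b \<in> borel_measurable borel"
 unfolding ivl_weight_def by measurable

lemma weighted_square_affine:
 assumes "a < b"
 shows "indicator {a<..<b} (affine_map a b z)*((v (affine_map a b z))\<^sup>2*ivl_weight s a b (affine_map a b z))
  = ((b - a)/2) powr (2 * s)*(jacobi s z*(ref_fun a b v z)\<^sup>2)"
 using affine_mem_iff[OF assms, of z] ivl_weight_affine[OF assms, of s z] unfolding affine_map_def[symmetric]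
 by (cases "z \<in> {-1<..<1}") (simp_all add: ref_fun_def jacobi_outside)

lemma weighted_L2_iff:
 assumes ab: "a < b"
 shows "v \<in> weighted_L2 {a<..<b} (ivl_weight s a b) \<longleftrightarrow> ref_fun a b v \<in> L2 (jacobi_measure s)"
proof -
 let ?h = "(b - a)/2"
 have h: "?h > 0" using ab by simp
 let ?f = "%x. indicator {a<..<b} x*((v x)\<^sup>2*ivl_weight s a b x)"
 have "integrable lebesgue ?f \<longleftrightarrow> integrable lebesgue (%z. ?f ((a + b)/2 + ?h*z))"
  by (rule lebesgue_integrable_real_affine_iff[symmetric]) (use h in simp)
 also have "... \<longleftrightarrow> integrable lebesgue (%z. ?h powr (2 * s)*(jacobi s z*(ref_fun a b v z)\<^sup>2))"
  using weighted_square_affine[OF ab, of _ v s] unfolding affine_map_def by (simp only:)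
 also have "... \<longleftrightarrow> integrable lebesgue (%z. jacobi s z*(ref_fun a b v z)\<^sup>2)"
  using h by simp
 finally have i: "integrable lebesgue ?f \<longleftrightarrow> integrable lebesgue (%z. jacobi s z*(ref_fun a b v z)\<^sup>2)" .
 show ?thesis
  unfolding weighted_L2_def L2_def set_borel_measurable_def set_integrable_def
  using i ref_fun_measurable_iff[OF ab, of v] integrable_jacobi_iff[of "%z. (ref_fun a b v z)\<^sup>2" s] by auto
qed

lemma ref_fun_unit: "ref_fun (-1) 1 v = (%z. indicator {-1<..<1} z * v z)"
 by (simp add: ref_fun_def affine_map_def fun_eq_iff)

lemma weighted_L2_ref_iff:
 "v \<in> weighted_L2 {-1<..<1} (%x. (1 - x\<^sup>2) powr s) \<longleftrightarrow> (%z. indicator {-1<..<1} z * v z) \<in> L2 (jacobi_measure s)"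
proof -
 have "set_integrable lebesgue {-1<..<1} (%x. \<bar>v x\<bar>\<^sup>2*(1 - x\<^sup>2) powr s) = set_integrable lebesgue {-1<..<1} (%x. \<bar>v x\<bar>\<^sup>2*ivl_weight s (-1) 1 x)"
 proof (rule set_integrable_cong)
  fix x :: real assume "x \<in> {-1<..<1}"
  then show "\<bar>v x\<bar>\<^sup>2*(1 - x\<^sup>2) powr s = \<bar>v x\<bar>\<^sup>2*ivl_weight s (-1) 1 x"
   using ivl_weight_affine[of "-1" 1 s x] by (simp add: jacobi_def)
 qed auto
 then have "v \<in> weighted_L2 {-1<..<1} (%x. (1 - x\<^sup>2) powr s) \<longleftrightarrow> v \<in> weighted_L2 {-1<..<1} (ivl_weight s (-1) 1)"
  unfolding weighted_L2_def by simp
 then show ?thesis using weighted_L2_iff[of "-1" 1 v s] by (simp add: ref_fun_unit)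
qed

lemma pullback_weighted_L2_iff:
 "pullback a b v \<in> weighted_L2 {-1<..<1} (%x. (1 - x\<^sup>2) powr s) \<longleftrightarrow> ref_fun a b v \<in> L2 (jacobi_measure s)"
 unfolding weighted_L2_ref_iff by (simp add: ref_fun_def[abs_def] pullback_affine)

lemma gegenbauer_coeff_inner:
 assumes "s > -1" "ref_fun a b v \<in> L2 (jacobi_measure s)"
 shows "gegenbauer_coeff s (pullback a b v) j = L2_inner (jacobi_measure s) (ref_fun a b v) (normalized_gegenbauer s j)"
proof -
 have "gegenbauer_coeff s (pullback a b v) j = wint s (%x. ref_fun a b v x*normalized_gegenbauer s j x)"
  unfolding gegenbauer_coeff_eq by (rule wint_cong) (simp add: ref_fun_inside pullback_affine)
 also have "... = L2_inner (jacobi_measure s) (ref_fun a b v) (normalized_gegenbauer s j)"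
  using assms normalized_gegenbauer_L2 by (intro wint_eq_L2_inner) auto
 finally show ?thesis .
qed

lemma sobolev_term_ref_fun:
 assumes "s > -1" "ref_fun a b u \<in> L2 (jacobi_measure s)"
 shows "sobolev_term s r (pullback a b u) j
  = (1 + (real j)\<^sup>2) powr r*(L2_inner (jacobi_measure s) (ref_fun a b u) (normalized_gegenbauer s j))\<^sup>2"
 unfolding sobolev_term_def gegenbauer_coeff_inner[OF assms] by simp

lemma pullback_Hs_ref_iff:
 assumes "s > -1"
 shows "pullback a b u \<in> Hs_ref s r \<longleftrightarrow> ref_fun a b u \<in> L2 (jacobi_measure s) \<and>
  summable (%j. (1 + (real j)\<^sup>2) powr r*(L2_inner (jacobi_measure s) (ref_fun a b u) (normalized_gegenbauer s j))\<^sup>2)"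
proof (cases "ref_fun a b u \<in> L2 (jacobi_measure s)")
 case True
 have "sobolev_term s r (pullback a b u) = (%j. (1 + (real j)\<^sup>2) powr r*(L2_inner (jacobi_measure s) (ref_fun a b u) (normalized_gegenbauer s j))\<^sup>2)"
  using sobolev_term_ref_fun[OF assms True] by blast
 then show ?thesis by (simp add: Hs_ref_def pullback_weighted_L2_iff)
qed (simp add: Hs_ref_def pullback_weighted_L2_iff)

lemma L2_inner_cong_inside:
 assumes "u \<in> borel_measurable lebesgue" "v \<in> borel_measurable lebesgue" "w \<in> borel_measurable lebesgue"
  "!!x. x \<in> {-1<..<1} ==> u x = v x"
 shows "L2_inner (jacobi_measure s) u w = L2_inner (jacobi_measure s) v w"
 unfolding L2_inner_def
proof (rule integral_cong_AE)
 show "AE x in jacobi_measure s. u x*w x = v x*w x"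
  using AE_jacobi_interval by eventually_elim (simp add: assms(4))
qed (use assms in auto)

lemma K_poly_inner:
 assumes s: "0 < s" "s < 1"
 shows "L2_inner (jacobi_measure s) (poly (K_poly s p)) (normalized_gegenbauer s j)
  = K_eigenvalue s j*L2_inner (jacobi_measure s) (poly p) (normalized_gegenbauer s j)"
proof -
 have s1: "s > -1" using s by simp
 have e: "L2_inner (jacobi_measure s) (poly q) (normalized_gegenbauer s j)
   = (1/sqrt (geg_sqnorm s j))*wint s (%x. poly q x*poly (geg s j) x)" for q
 proof -
  have "wint s (%x. poly q x*normalized_gegenbauer s j x)
    = wint s (%x. (1/sqrt (geg_sqnorm s j))*(poly q x*poly (geg s j) x))"
   by (simp add: normalized_gegenbauer_alt mult_ac)
  then show ?thesis
   unfolding wint_scale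
   using wint_eq_L2_inner[OF L2_jacobi_poly[OF s1] normalized_gegenbauer_L2[OF s1]] by metis
 qed
 show ?thesis unfolding e K_poly_coefficient[OF s] by simp
qed

lemma poly_coeff_eventually_zero:
 assumes s: "0 <= s" and j: "degree p < j"
 shows "L2_inner (jacobi_measure s) (poly p) (normalized_gegenbauer s j) = 0"
proof -
 have s1: "s > -1" using s by simp
 have "wint s (%x. poly p x*normalized_gegenbauer s j x)
   = wint s (%x. (1/sqrt (geg_sqnorm s j))*(poly p x*poly (geg s j) x))"
  by (simp add: normalized_gegenbauer_alt mult_ac)
 also have "... = 0" unfolding wint_scale using gegenbauer_orthogonal_lower[OF s j] by simp
 finally show ?thesis
  using wint_eq_L2_inner[OF L2_jacobi_poly[OF s1] normalized_gegenbauer_L2[OF s1]] by metis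
qed

text \<open>The second limit in the definition of \<open>K_ext\<close> is convergence in the weighted
 \<open>L\<^sup>2\<close> norm of the reference interval.\<close>

lemma K_residual_nn_integral:
 fixes p :: "real poly"
 assumes s: "0 < s" "s < 1" and ab: "a < b" and g: "ref_fun a b g \<in> L2 (jacobi_measure s)"
 defines "ph \<equiv> pcompose p [:(a + b)/2, (b - a)/2:]"
 shows "(\<integral>\<^sup>+x\<in>{a<..<b}. ennreal (\<bar>K_integral s a b (poly p) x - g x\<bar>\<^sup>2*ivl_weight s a b x) \<partial>lebesgue)
  = ennreal (((b - a)/2) powr (1 + 2 * s)*(L2_norm (jacobi_measure s) (%z. poly (K_poly s ph) z - ref_fun a b g z))\<^sup>2)"
proof -
 let ?h = "(b - a)/2"
 let ?M = "jacobi_measure s"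
 have h: "?h > 0" using ab by simp
 have s1: "s > -1" using s by simp
 let ?D = "%z. poly (K_poly s ph) z - ref_fun a b g z"
 let ?r = "%x. K_integral s a b (poly p) x - g x"
 let ?f = "%x. indicator {a<..<b} x*((?r x)\<^sup>2*ivl_weight s a b x)"
 have D: "?D \<in> L2 ?M" by (intro L2_diff L2_jacobi_poly s1 g)
 then have Dm: "?D \<in> borel_measurable lebesgue" by auto
 have inside: "ref_fun a b ?r z = indicator {-1<..<1} z*?D z" for z
  using K_integral_poly[OF s ab, of z p] unfolding affine_map_def[symmetric] ph_def[symmetric]
  by (cases "z \<in> {-1<..<1}") (simp_all add: ref_fun_def)
 have rm: "ref_fun a b ?r \<in> borel_measurable lebesgue"
  unfolding inside[abs_def] by (rule indicator_mult_measurable[OF Dm])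
 have fe: "?f (affine_map a b z) = ?h powr (2 * s)*(jacobi s z*(?D z)\<^sup>2)" for z
  unfolding weighted_square_affine[OF ab, of z ?r s] inside
  by (cases "z \<in> {-1<..<1}") (simp_all add: jacobi_outside)
 have fm: "?f \<in> borel_measurable lebesgue"
 proof -
  have "(%x. indicator {a<..<b} x*?r x) \<in> borel_measurable lebesgue"
   using rm ref_fun_measurable_iff[OF ab, of ?r] by blast
  from borel_measurable_times[OF borel_measurable_power[OF this] lebesgue_measurableI[OF ivl_weight_borel]]
  have "(%x. (indicator {a<..<b} x*?r x)\<^sup>2*ivl_weight s a b x) \<in> borel_measurable lebesgue"
   .
  also have "(%x. (indicator {a<..<b} x*?r x)\<^sup>2*ivl_weight s a b x) = ?f"
   by (auto simp: fun_eq_iff indicator_def)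
  finally show ?thesis .
 qed
 have "(\<integral>\<^sup>+x\<in>{a<..<b}. ennreal (\<bar>?r x\<bar>\<^sup>2*ivl_weight s a b x) \<partial>lebesgue) = (\<integral>\<^sup>+x. ennreal (?f x) \<partial>lebesgue)"
  by (intro nn_integral_cong) (auto simp: indicator_def)
 also have "... = ennreal \<bar>?h\<bar>*(\<integral>\<^sup>+z. ennreal (?f ((a + b)/2 + ?h*z)) \<partial>lebesgue)"
  by (rule nn_integral_real_affine_lebesgue) (use fm h in auto)
 also have "(\<integral>\<^sup>+z. ennreal (?f ((a + b)/2 + ?h*z)) \<partial>lebesgue) = (\<integral>\<^sup>+z. ennreal (?h powr (2 * s)*(jacobi s z*(?D z)\<^sup>2)) \<partial>lebesgue)"
  using fe unfolding affine_map_def by (simp only:)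
 also have "... = ennreal (LINT z|lebesgue. ?h powr (2 * s)*(jacobi s z*(?D z)\<^sup>2))"
 proof (rule nn_integral_eq_integral)
  have "integrable ?M (%z. (?D z)\<^sup>2)" using D by (simp add: L2_def)
  then have "integrable lebesgue (%z. jacobi s z*(?D z)\<^sup>2)"
   using Dm by (subst (asm) integrable_jacobi_iff) auto
  then show "integrable lebesgue (%z. ?h powr (2 * s)*(jacobi s z*(?D z)\<^sup>2))"
   by (rule integrable_mult_right)
 qed auto
 also have "(LINT z|lebesgue. ?h powr (2 * s)*(jacobi s z*(?D z)\<^sup>2)) = ?h powr (2 * s)*(L2_norm ?M ?D)\<^sup>2"
  unfolding L2_norm_sq using Dm by (subst integral_jacobi) auto
 also have "ennreal \<bar>?h\<bar>*ennreal (?h powr (2 * s)*(L2_norm ?M ?D)\<^sup>2) = ennreal (\<bar>?h\<bar>*(?h powr (2 * s)*(L2_norm ?M ?D)\<^sup>2))"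
  by (rule ennreal_mult'[symmetric]) simp
 also have "\<bar>?h\<bar>*(?h powr (2 * s)*(L2_norm ?M ?D)\<^sup>2) = ?h powr (1 + 2 * s)*(L2_norm ?M ?D)\<^sup>2"
  using h by (simp add: powr_add)
 finally show ?thesis .
qed

lemma ref_fun_poly:
 assumes "s > -1"
 shows "ref_fun a b (poly p) \<in> L2 (jacobi_measure s)"
  "L2_inner (jacobi_measure s) (ref_fun a b (poly p)) (normalized_gegenbauer s j)
   = L2_inner (jacobi_measure s) (poly (pcompose p [:(a + b)/2, (b - a)/2:])) (normalized_gegenbauer s j)"
proof -
 let ?ph = "pcompose p [:(a + b)/2, (b - a)/2:]"
 have e: "ref_fun a b (poly p) z = indicator {-1<..<1} z*poly ?ph z" for z
  by (simp add: ref_fun_def affine_map_def poly_pcompose mult.commute)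
 have pm: "poly ?ph \<in> borel_measurable lebesgue" by (intro lebesgue_measurableI poly_borel)
 have m: "ref_fun a b (poly p) \<in> borel_measurable lebesgue"
  unfolding e[abs_def] by (rule indicator_mult_measurable[OF pm])
 have "continuous_on {-1..1} (poly ?ph)" by (rule continuous_on_poly[OF continuous_on_id])
 then obtain B where B: "!!x. x \<in> {-1..1} ==> \<bar>poly ?ph x\<bar> <= B"
  using continuous_bounded_Icc by blast
 show "ref_fun a b (poly p) \<in> L2 (jacobi_measure s)"
 proof (rule L2_jacobi_bounded[OF assms m])
  fix x :: real assume x: "x \<in> {-1<..<1}"
  then have "ref_fun a b (poly p) x = poly ?ph x" unfolding e by (simp only: indicator_simps mult_1)
  moreover have "x \<in> {-1..1}" using x by auto
  ultimately show "\<bar>ref_fun a b (poly p) x\<bar> <= B" using B[of x] by (simp only:)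
 qed
 show "L2_inner (jacobi_measure s) (ref_fun a b (poly p)) (normalized_gegenbauer s j) = L2_inner (jacobi_measure s) (poly ?ph) (normalized_gegenbauer s j)"
 proof (rule L2_inner_cong_inside[OF m pm])
  show "normalized_gegenbauer s j \<in> borel_measurable lebesgue"
   unfolding normalized_gegenbauer_poly by (intro lebesgue_measurableI poly_borel)
  show "ref_fun a b (poly p) x = poly ?ph x" if "x \<in> {-1<..<1}" for x
   unfolding e using that by (simp only: indicator_simps mult_1)
 qed
qed

lemma ref_fun_diff: "ref_fun a b (%x. u x - v x) = (%z. ref_fun a b u z - ref_fun a b v z)"
 by (simp add: ref_fun_def fun_eq_iff right_diff_distrib)

text \<open>The extended operator acts on Gegenbauer coefficients as multiplication by the eigenvalues.
 Both modes of convergence in its definition imply convergence of the coefficients; conversely the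
 partial sums of the Gegenbauer expansion are an approximating sequence.\<close>

theorem K_ext_iff:
 assumes s: "0 < s" "s < 1" and ab: "a < b"
 shows "K_ext s a b \<phi> g \<longleftrightarrow>
  ref_fun a b \<phi> \<in> L2 (jacobi_measure s) \<and> ref_fun a b g \<in> L2 (jacobi_measure s) \<and>
  (\<forall>j. L2_inner (jacobi_measure s) (ref_fun a b g) (normalized_gegenbauer s j)
   = K_eigenvalue s j*L2_inner (jacobi_measure s) (ref_fun a b \<phi>) (normalized_gegenbauer s j))"
proof -
 let ?M = "jacobi_measure s" and ?e = "normalized_gegenbauer s" and ?l = "K_eigenvalue s"
 let ?v = "ref_fun a b \<phi>" and ?w = "ref_fun a b g"
 let ?m = "(a + b)/2" and ?h = "(b - a)/2"
 let ?ph = "%p. pcompose p [:?m, ?h:]"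
 have s0: "0 <= s" "s > -1" using s by auto
 have h: "?h > 0" using ab by simp
 interpret B: L2_basis ?M ?e by (rule gegenbauer_basis[OF s0(1)])
 obtain c1 c2 where c12: "0 < c1" "0 < c2" "!!n. c1*(1 + (real n)\<^sup>2) powr s <= ?l n"
  "!!n. ?l n <= c2*(1 + (real n)\<^sup>2) powr s"
  using K_eigenvalue_bounds[OF s] by blast
 note sob = sobolev_term_ref_fun[OF s0(2)] and Hs = pullback_Hs_ref_iff[OF s0(2)]
 show ?thesis
 proof
  assume K: "K_ext s a b \<phi> g"
  then have v: "?v \<in> L2 ?M" and vs: "summable (%j. (1 + (real j)\<^sup>2) powr (2 * s)*(L2_inner ?M ?v (?e j))\<^sup>2)"
   and w: "?w \<in> L2 ?M"
   unfolding K_ext_def Hs by (auto simp: weighted_L2_iff[OF ab])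
  from K obtain p where p1: "(%n. \<Sum>j. sobolev_term s (2 * s) (pullback a b (%x. poly (p n) x - \<phi> x)) j) \<longlonglongrightarrow> 0"
   and p2: "(%n. \<integral>\<^sup>+x\<in>{a<..<b}. ennreal (\<bar>K_integral s a b (poly (p n)) x - g x\<bar>\<^sup>2*ivl_weight s a b x) \<partial>lebesgue) \<longlonglongrightarrow> 0"
   unfolding K_ext_def by blast
  have pr: "ref_fun a b (poly q) \<in> L2 ?M" for q by (rule ref_fun_poly(1)[OF s0(2)])
  have df: "ref_fun a b (%x. poly q x - \<phi> x) \<in> L2 ?M" for q
   unfolding ref_fun_diff by (intro L2_diff pr v)
  have di: "L2_inner ?M (ref_fun a b (%x. poly q x - \<phi> x)) (?e j) = L2_inner ?M (poly (?ph q)) (?e j) - L2_inner ?M ?v (?e j)" for q j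
   unfolding ref_fun_diff using pr v B.e_sq by (simp add: L2_inner_diff_left ref_fun_poly(2)[OF s0(2)])
  have dsum: "summable (%j. sobolev_term s (2 * s) (pullback a b (%x. poly q x - \<phi> x)) j)" for q
  proof (rule summable_comparison_test_ev[OF _ vs])
   show "\<forall>\<^sub>F j in sequentially. norm (sobolev_term s (2 * s) (pullback a b (%x. poly q x - \<phi> x)) j)
     <= (1 + (real j)\<^sup>2) powr (2 * s)*(L2_inner ?M ?v (?e j))\<^sup>2"
    using eventually_gt_at_top[of "degree (?ph q)"]
   proof eventually_elim
    case (elim j)
    then show ?case
     unfolding sob[OF df] di using poly_coeff_eventually_zero[OF s0(1) elim] by simp
   qed
  qed
  have "L2_inner ?M ?w (?e j) = ?l j*L2_inner ?M ?v (?e j)" for j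
  proof -
   have t: "(%n. (L2_inner ?M (poly (?ph (p n))) (?e j) - L2_inner ?M ?v (?e j))\<^sup>2) \<longlonglongrightarrow> 0"
   proof (rule Lim_null_comparison[OF _ p1])
    show "\<forall>\<^sub>F n in sequentially. norm ((L2_inner ?M (poly (?ph (p n))) (?e j) - L2_inner ?M ?v (?e j))\<^sup>2)
      <= (\<Sum>j. sobolev_term s (2 * s) (pullback a b (%x. poly (p n) x - \<phi> x)) j)"
    proof (intro always_eventually allI)
     fix n
     let ?t = "sobolev_term s (2 * s) (pullback a b (%x. poly (p n) x - \<phi> x))"
     have "1*(L2_inner ?M (poly (?ph (p n))) (?e j) - L2_inner ?M ?v (?e j))\<^sup>2 <= ?t j"
      unfolding sob[OF df] di using s by (intro mult_right_mono ge_one_powr_ge_zero) auto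
     also have "?t j = sum ?t {j}" by simp
     also have "... <= (\<Sum>j. ?t j)"
      by (rule sum_le_suminf[OF dsum]) (auto simp: sobolev_term_def)
     finally show "norm ((L2_inner ?M (poly (?ph (p n))) (?e j) - L2_inner ?M ?v (?e j))\<^sup>2) <= (\<Sum>j. ?t j)" by simp
    qed
   qed
   then have "(%n. sqrt ((L2_inner ?M (poly (?ph (p n))) (?e j) - L2_inner ?M ?v (?e j))\<^sup>2)) \<longlonglongrightarrow> sqrt 0"
    by (rule tendsto_real_sqrt)
   then have "(%n. L2_inner ?M (poly (?ph (p n))) (?e j) - L2_inner ?M ?v (?e j)) \<longlonglongrightarrow> 0"
    by (simp add: tendsto_rabs_zero_iff)
   then have "(%n. L2_inner ?M (poly (?ph (p n))) (?e j)) \<longlonglongrightarrow> L2_inner ?M ?v (?e j)"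
    by (simp add: LIM_zero_iff)
   then have l1: "(%n. L2_inner ?M (poly (K_poly s (?ph (p n)))) (?e j)) \<longlonglongrightarrow> ?l j*L2_inner ?M ?v (?e j)"
    unfolding K_poly_inner[OF s] by (rule tendsto_mult_left)
   let ?N = "%n. L2_norm ?M (%z. poly (K_poly s (?ph (p n))) z - ?w z)"
   have "(%n. ennreal (?h powr (1 + 2 * s)*(?N n)\<^sup>2)) \<longlonglongrightarrow> ennreal 0"
    using p2 unfolding K_residual_nn_integral[OF s ab w] by simp
   then have "(%n. ?h powr (1 + 2 * s)*(?N n)\<^sup>2) \<longlonglongrightarrow> 0"
    by (subst (asm) tendsto_ennreal_iff) auto
   then have "(%n. (?h powr (1 + 2 * s)*(?N n)\<^sup>2)/?h powr (1 + 2 * s)) \<longlonglongrightarrow> 0/?h powr (1 + 2 * s)"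
    using h by (intro tendsto_divide tendsto_const) auto
   then have "(%n. (?N n)\<^sup>2) \<longlonglongrightarrow> 0" using h by simp
   then have "(%n. sqrt ((?N n)\<^sup>2)) \<longlonglongrightarrow> sqrt 0" by (rule tendsto_real_sqrt)
   then have N: "?N \<longlonglongrightarrow> 0" by simp
   have "(%n. L2_inner ?M (poly (K_poly s (?ph (p n)))) (?e j)) \<longlonglongrightarrow> L2_inner ?M ?w (?e j)"
    by (rule L2_inner_tendsto[OF L2_jacobi_poly[OF s0(2)] w B.e_sq N])
   from LIMSEQ_unique[OF this l1] show ?thesis .
  qed
  with v w show "?v \<in> L2 ?M \<and> ?w \<in> L2 ?M \<and>
    (\<forall>j. L2_inner ?M ?w (?e j) = ?l j*L2_inner ?M ?v (?e j))" by blast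
 next
  assume R: "?v \<in> L2 ?M \<and> ?w \<in> L2 ?M \<and>
    (\<forall>j. L2_inner ?M ?w (?e j) = ?l j*L2_inner ?M ?v (?e j))"
  then have v: "?v \<in> L2 ?M" and w: "?w \<in> L2 ?M"
   and eq: "!!j. L2_inner ?M ?w (?e j) = ?l j*L2_inner ?M ?v (?e j)" by auto
  let ?c = "%j. L2_inner ?M ?v (?e j)"
  have vs: "summable (%j. (1 + (real j)\<^sup>2) powr (2 * s)*(?c j)\<^sup>2)"
  proof (rule summable_comparison_test'[of "%j. (1/c1\<^sup>2)*(L2_inner ?M ?w (?e j))\<^sup>2" 0])
   show "summable (%j. (1/c1\<^sup>2)*(L2_inner ?M ?w (?e j))\<^sup>2)"
    by (intro summable_mult B.Bessel w)
   fix j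
   have "(c1*(1 + (real j)\<^sup>2) powr s)\<^sup>2 <= (?l j)\<^sup>2"
    using c12 by (intro power_mono) auto
   moreover have "(c1*(1 + (real j)\<^sup>2) powr s)\<^sup>2 = c1\<^sup>2*(1 + (real j)\<^sup>2) powr (2 * s)"
   proof -
    have "(1 + (real j)\<^sup>2) powr (s + s) = (1 + (real j)\<^sup>2) powr s*(1 + (real j)\<^sup>2) powr s"
     by (rule powr_add)
    then show ?thesis by (simp add: power_mult_distrib power2_eq_square)
   qed
   ultimately have "(1 + (real j)\<^sup>2) powr (2 * s) <= 1/c1\<^sup>2*(?l j)\<^sup>2"
    using c12(1) by (simp add: field_simps)
   then have "(1 + (real j)\<^sup>2) powr (2 * s)*(?c j)\<^sup>2 <= 1/c1\<^sup>2*(?l j)\<^sup>2*(?c j)\<^sup>2"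
    by (intro mult_right_mono) auto
   then show "norm ((1 + (real j)\<^sup>2) powr (2 * s)*(?c j)\<^sup>2) <= 1/c1\<^sup>2*(L2_inner ?M ?w (?e j))\<^sup>2"
    unfolding eq by (simp add: power_mult_distrib)
  qed
  define P where "P n = (\<Sum>j<n. smult (?c j/sqrt (geg_sqnorm s j)) (geg s j))" for n
  have Pe: "poly (P n) = (%x. \<Sum>j<n. ?c j*?e j x)" for n
   by (simp add: P_def fun_eq_iff poly_sum normalized_gegenbauer_alt)
  (* The partial sums live on the reference interval; p n is pulled back to the given one. *)
  define p where "p n = pcompose (P n) [:- ?m/?h, 1/?h:]" for n
  have php: "?ph (p n) = P n" for n
  proof -
   have pc: "pcompose [:- m/k, 1/k:] [:m, k:] = [:0, 1:]" if "k ~= 0" for m k :: real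
    using that by (simp add: pcompose_pCons)
   have "pcompose [:- ?m/?h, 1/?h:] [:?m, ?h:] = [:0, 1:]"
    by (rule pc) (use ab in simp)
   then show ?thesis unfolding p_def pcompose_assoc[symmetric] by (simp add: pcompose_idR)
  qed
  have pr: "ref_fun a b (poly q) \<in> L2 ?M" for q by (rule ref_fun_poly(1)[OF s0(2)])
  have df: "ref_fun a b (%x. poly q x - \<phi> x) \<in> L2 ?M" for q
   unfolding ref_fun_diff by (intro L2_diff pr v)
  have di: "L2_inner ?M (ref_fun a b (%x. poly (p n) x - \<phi> x)) (?e j) = (if j < n then 0 else - ?c j)" for n j
   unfolding ref_fun_diff using pr v B.e_sq
   by (simp add: L2_inner_diff_left ref_fun_poly(2)[OF s0(2)] php Pe B.inner_partial)
  let ?t = "%j. (1 + (real j)\<^sup>2) powr (2 * s)*(?c j)\<^sup>2"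
  have "(\<Sum>j. sobolev_term s (2 * s) (pullback a b (%x. poly (p n) x - \<phi> x)) j) = (\<Sum>j. ?t j) - (\<Sum>j<n. ?t j)" for n
  proof -
   have e: "sobolev_term s (2 * s) (pullback a b (%x. poly (p n) x - \<phi> x)) j = ?t j - (if j \<in> {..<n} then ?t j else 0)" for j
    unfolding sob[OF df] di by simp
   have f: "summable (%j. if j \<in> {..<n} then ?t j else 0)" "(\<Sum>j. if j \<in> {..<n} then ?t j else 0) = (\<Sum>j<n. ?t j)"
    using sums_If_finite_set[of "{..<n}" ?t] by (auto simp: sums_iff)
   show ?thesis unfolding e using suminf_diff[OF vs f(1)] f(2) by simp
  qed
  moreover have "(%n. (\<Sum>j. ?t j) - (\<Sum>j<n. ?t j)) \<longlonglongrightarrow> (\<Sum>j. ?t j) - (\<Sum>j. ?t j)"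
   by (intro tendsto_intros summable_LIMSEQ vs)
  ultimately have 1: "(%n. \<Sum>j. sobolev_term s (2 * s) (pullback a b (%x. poly (p n) x - \<phi> x)) j) \<longlonglongrightarrow> 0"
   by simp
  have Kn: "L2_norm ?M (%z. poly (K_poly s (P n)) z - ?w z) = L2_norm ?M (%x. (\<Sum>j<n. L2_inner ?M ?w (?e j)*?e j x) - ?w x)" for n
  proof -
   have ae: "AE x in ?M. poly (K_poly s (P n)) x = (\<Sum>j<n. L2_inner ?M ?w (?e j)*?e j x)"
   proof (rule B.coeff_unique)
    show "poly (K_poly s (P n)) \<in> L2 ?M" by (rule L2_jacobi_poly[OF s0(2)])
    show "(%x. \<Sum>j<n. L2_inner ?M ?w (?e j)*?e j x) \<in> L2 ?M" by (rule B.partial_sq)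
    show "L2_inner ?M (poly (K_poly s (P n))) (?e j) = L2_inner ?M (%x. \<Sum>j<n. L2_inner ?M ?w (?e j)*?e j x) (?e j)" for j
     unfolding K_poly_inner[OF s] Pe using B.inner_partial[of "{..<n}"] eq by simp
   qed
   show ?thesis unfolding L2_norm_def
   proof (intro arg_cong[where f=sqrt] integral_cong_AE)
    show "AE x in ?M. (poly (K_poly s (P n)) x - ?w x)\<^sup>2 = ((\<Sum>j<n. L2_inner ?M ?w (?e j)*?e j x) - ?w x)\<^sup>2"
     using ae by eventually_elim simp
   qed (use L2_jacobi_poly[OF s0(2), of "K_poly s (P n)"] w B.partial_sq[where J="{..<n}"] in
      \<open>auto intro!: borel_measurable_power borel_measurable_diff simp: L2_def\<close>)
  qed
  have "(%n. ennreal (?h powr (1 + 2 * s)*(L2_norm ?M (%x. (\<Sum>j<n. L2_inner ?M ?w (?e j)*?e j x) - ?w x))\<^sup>2)) \<longlonglongrightarrow> ennreal (?h powr (1 + 2 * s)*0\<^sup>2)"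
   by (intro tendsto_ennrealI tendsto_mult_left tendsto_power B.expansion_tendsto w)
  then have 2: "(%n. \<integral>\<^sup>+x\<in>{a<..<b}. ennreal (\<bar>K_integral s a b (poly (p n)) x - g x\<bar>\<^sup>2*ivl_weight s a b x) \<partial>lebesgue) \<longlonglongrightarrow> 0"
   unfolding K_residual_nn_integral[OF s ab w] php Kn by simp
  show "K_ext s a b \<phi> g"
   unfolding K_ext_def Hs weighted_L2_iff[OF ab] using v w vs 1 2 by blast
 qed
qed

section \<open>The off-diagonal remainder\<close>

lemma pair_sigma_finite_jacobi:
 assumes "c > -1" "d > -1" shows "pair_sigma_finite (jacobi_measure c) (jacobi_measure d)"
 using finite_jacobi_measure[OF assms(1)] finite_jacobi_measure[OF assms(2)]
 by (simp add: pair_sigma_finite_def finite_measure_def)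

lemma AE_jacobi_pair_interval:
 "c > -1 ==> d > -1 ==> AE w in jacobi_measure c \<Otimes>\<^sub>M jacobi_measure d. fst w \<in> {-1<..<1} \<and> snd w \<in> {-1<..<1}"
proof -
 assume cd: "c > -1" "d > -1"
 interpret pair_sigma_finite "jacobi_measure c" "jacobi_measure d" by (rule pair_sigma_finite_jacobi[OF cd])
 have S: "{-1<..<1::real} \<in> sets lebesgue" by simp
 have m: "{w \<in> space (jacobi_measure c \<Otimes>\<^sub>M jacobi_measure d). fst w \<in> {-1<..<1} \<and> snd w \<in> {-1<..<1}} \<in> sets (jacobi_measure c \<Otimes>\<^sub>M jacobi_measure d)"
 proof -
  have "{w \<in> space (jacobi_measure c \<Otimes>\<^sub>M jacobi_measure d). fst w \<in> {-1<..<1} \<and> snd w \<in> {-1<..<1}} = {-1<..<1::real} \<times> {-1<..<1::real}"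
   by (auto simp: space_pair_measure)
  also have "... \<in> sets (jacobi_measure c \<Otimes>\<^sub>M jacobi_measure d)"
   by (rule pair_measureI) (use S in simp_all)
  finally show ?thesis .
 qed
 show ?thesis
 proof (rule AE_pair_measure[OF m])
  show "AE x in jacobi_measure c. AE y in jacobi_measure d. fst (x, y) \<in> {-1<..<1} \<and> snd (x, y) \<in> {-1<..<1}"
   using AE_jacobi_interval[of c]
  proof eventually_elim
   case (elim x)
   show ?case using AE_jacobi_interval[of d] by eventually_elim (use elim in simp)
  qed
 qed
qed

lemma kernel_pair_measurable:
 assumes k: "(%w. k (fst w) (snd w)) \<in> borel_measurable (borel \<Otimes>\<^sub>M borel)"
 shows "(%w. k (fst w) (snd w) :: real) \<in> borel_measurable (jacobi_measure c \<Otimes>\<^sub>M jacobi_measure d)"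
proof -
 have id: "(%x. x) \<in> jacobi_measure c \<rightarrow>\<^sub>M borel" for c
 proof -
  have "(%x::real. x) \<in> borel_measurable lebesgue" by (rule lebesgue_measurableI) simp
  then show ?thesis by simp
 qed
 have "(%w. (fst w, snd w)) \<in> jacobi_measure c \<Otimes>\<^sub>M jacobi_measure d \<rightarrow>\<^sub>M borel \<Otimes>\<^sub>M borel"
  by (intro measurable_Pair measurable_compose[OF measurable_fst id] measurable_compose[OF measurable_snd id])
 from measurable_compose[OF this k] show ?thesis by simp
qed

text \<open>Dominated by the product of the two integrable functions; this is the integrability behind every exchange
 of integrals with the coupling kernel.\<close>

lemma bounded_kernel_integrable:
 assumes cd: "c > -1" "d > -1"
  and k: "(%w. k (fst w) (snd w)) \<in> borel_measurable (borel \<Otimes>\<^sub>M borel)"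
  and B: "!!x y. x \<in> {-1<..<1} ==> y \<in> {-1<..<1} ==> \<bar>k x y\<bar> <= B"
  and g: "integrable (jacobi_measure c) g" and h: "integrable (jacobi_measure d) h"
 shows "integrable (jacobi_measure c \<Otimes>\<^sub>M jacobi_measure d) (%(x, y). k x y*(g x*h y :: real))"
proof -
 interpret pair_sigma_finite "jacobi_measure c" "jacobi_measure d" by (rule pair_sigma_finite_jacobi[OF cd])
 have gm [measurable]: "g \<in> borel_measurable (jacobi_measure c)" and hm [measurable]: "h \<in> borel_measurable (jacobi_measure d)"
  using g h by (auto intro: borel_measurable_integrable)
 have gh: "integrable (jacobi_measure c \<Otimes>\<^sub>M jacobi_measure d) (%(x, y). g x*h y)"
 proof (rule Fubini_integrable)
  show "(%(x, y). g x*h y) \<in> borel_measurable (jacobi_measure c \<Otimes>\<^sub>M jacobi_measure d)"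
   by measurable
  show "integrable (jacobi_measure c) (%x. (LINT y|jacobi_measure d. norm ((%(x, y). g x*h y) (x, y))))"
   using g by (simp add: abs_mult)
  show "AE x in jacobi_measure c. integrable (jacobi_measure d) (%y. (%(x, y). g x*h y) (x, y))"
   using h by simp
 qed
 show ?thesis
 proof (rule Bochner_Integration.integrable_bound)
  show "integrable (jacobi_measure c \<Otimes>\<^sub>M jacobi_measure d) (%w. B*(case w of (x, y) => g x*h y))"
   by (intro integrable_mult_right gh)
  have [measurable]: "(%w. k (fst w) (snd w)) \<in> borel_measurable (jacobi_measure c \<Otimes>\<^sub>M jacobi_measure d)"
   by (rule kernel_pair_measurable[OF k])
  show "(%(x, y). k x y*(g x*h y)) \<in> borel_measurable (jacobi_measure c \<Otimes>\<^sub>M jacobi_measure d)"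
   unfolding case_prod_unfold by measurable
  show "AE w in jacobi_measure c \<Otimes>\<^sub>M jacobi_measure d. norm (case w of (x, y) => k x y*(g x*h y)) <= norm (B*(case w of (x, y) => g x*h y))"
   using AE_jacobi_pair_interval[OF cd]
  proof eventually_elim
   case (elim w)
   have "\<bar>k (fst w) (snd w)\<bar>*\<bar>g (fst w)*h (snd w)\<bar> <= B*\<bar>g (fst w)*h (snd w)\<bar>"
    using B elim by (intro mult_right_mono) auto
   also have "... <= \<bar>B\<bar>*\<bar>g (fst w)*h (snd w)\<bar>" by (intro mult_right_mono) auto
   finally show ?case by (simp add: case_prod_unfold abs_mult)
  qed
 qed
qed

lemma jacobi_0: "x \<in> {-1<..<1} ==> jacobi 0 x = 1"
 using one_minus_sq_pos[of x] by (simp add: jacobi_def)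

lemma jacobi_le_1: "0 <= s ==> jacobi s x <= 1"
proof (cases "x \<in> {-1<..<1}")
 case True
 assume "0 <= s"
 then have "(1 - x\<^sup>2) powr s <= 1 powr s" using one_minus_sq_pos[OF True] by (intro powr_mono2) auto
 then show ?thesis using True by (simp add: jacobi_def)
qed (simp add: jacobi_outside)

lemma integral_jacobi_0:
 fixes f :: "real => real"
 assumes "f \<in> borel_measurable lebesgue"
 shows "(LINT x|jacobi_measure 0. jacobi s x*f x) = (LINT x|jacobi_measure s. f x)"
  and "integrable (jacobi_measure 0) (%x. jacobi s x*f x) \<longleftrightarrow> integrable (jacobi_measure s) f"
proof -
 have e: "jacobi 0 x*(jacobi s x*f x) = jacobi s x*f x" for x
  by (cases "x \<in> {-1<..<1}") (simp_all add: jacobi_0 jacobi_outside)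
 have m: "(%x. jacobi s x*f x) \<in> borel_measurable lebesgue"
  by (intro borel_measurable_times jacobi_lebesgue assms)
 show "(LINT x|jacobi_measure 0. jacobi s x*f x) = (LINT x|jacobi_measure s. f x)"
  unfolding integral_jacobi[OF m] integral_jacobi[OF assms] e ..
 show "integrable (jacobi_measure 0) (%x. jacobi s x*f x) \<longleftrightarrow> integrable (jacobi_measure s) f"
  unfolding integrable_jacobi_iff[OF m] integrable_jacobi_iff[OF assms] e ..
qed

text \<open>Letters with an interval index: \<open>X i\<close> maps the reference interval onto the
 \<open>i\<close>-th one and \<open>hl i\<close> is its half length. \<open>\<mu>\<close> is the weighted measure and
 \<open>\<nu>\<close> Lebesgue measure on \<open>(-1, 1)\<close>.\<close>

locale multi_interval =
 fixes s :: real and M :: nat and a b :: "nat => real"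
 assumes s: "0 < s" "s < 1"
  and intervals: "!!i. i < M ==> a i < b i"
  and disjoint: "!!i j. i < M ==> j < M ==> i ~= j ==> {a i..b i} \<inter> {a j..b j} = {}"
begin

abbreviation "\<mu> \<equiv> jacobi_measure s"
abbreviation "\<nu> \<equiv> jacobi_measure 0"
abbreviation "e \<equiv> normalized_gegenbauer s"
abbreviation "ev \<equiv> K_eigenvalue s"
abbreviation "X i \<equiv> affine_map (a i) (b i)"
abbreviation "hl i \<equiv> (b i - a i)/2"

definition kern :: "nat => nat => real => real => real" where
 "kern i k z t = \<bar>X i z - X k t\<bar> powr (- 1 - 2 * s)"

lemma s1: "s > -1" "0 <= s" using s by auto

lemma hl_pos: "i < M ==> 0 < hl i" using intervals[of i] by simp

lemma X_mem: "i < M ==> z \<in> {-1<..<1} ==> X i z \<in> {a i<..<b i}"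
 unfolding affine_map_def using affine_mem_iff[OF intervals] by blast

lemma separation: "\<exists>d>0. \<forall>i<M. \<forall>k<M. i ~= k --> (\<forall>x\<in>{a i..b i}. \<forall>y\<in>{a k..b k}. d <= \<bar>x - y\<bar>)"
proof -
 have "\<exists>d>0. \<forall>x\<in>{a i..b i}. \<forall>y\<in>{a k..b k}. d <= dist x y" if "i < M" "k < M" "i ~= k" for i k
  by (rule separate_compact_closed) (use disjoint[OF that] in auto)
 then obtain D where D: "!!i k. i < M ==> k < M ==> i ~= k ==> D i k > 0 \<and> (\<forall>x\<in>{a i..b i}. \<forall>y\<in>{a k..b k}. D i k <= dist x y)"
  by metis
 define S where "S = insert 1 ((%(i, k). D i k) ` {(i, k). i < M \<and> k < M \<and> i ~= k})"
 have "finite {(i, k). i < M \<and> k < M \<and> i ~= k}"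
  by (rule finite_subset[of _ "{..<M} \<times> {..<M}"]) auto
 then have fS: "finite S" unfolding S_def by simp
 show ?thesis
 proof (intro exI[of _ "Min S"] conjI allI impI ballI)
  show "0 < Min S" using fS D by (subst Min_gr_iff) (auto simp: S_def)
  fix i k x y assume ik: "i < M" "k < M" "i ~= k" "x \<in> {a i..b i}" "y \<in> {a k..b k}"
  have "Min S <= D i k" using fS ik by (intro Min_le) (auto simp: S_def)
  also have "... <= \<bar>x - y\<bar>" using D[OF ik(1-3)] ik(4,5) by (auto simp: dist_real_def)
  finally show "Min S <= \<bar>x - y\<bar>" .
 qed
qed

definition gap :: real where
 "gap = (SOME d. d > 0 \<and> (\<forall>i<M. \<forall>k<M. i ~= k --> (\<forall>x\<in>{a i..b i}. \<forall>y\<in>{a k..b k}. d <= \<bar>x - y\<bar>)))"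

lemma gap: "gap > 0" "i < M ==> k < M ==> i ~= k ==> x \<in> {a i..b i} ==> y \<in> {a k..b k} ==> gap <= \<bar>x - y\<bar>"
proof -
 have "gap > 0 \<and> (\<forall>i<M. \<forall>k<M. i ~= k --> (\<forall>x\<in>{a i..b i}. \<forall>y\<in>{a k..b k}. gap <= \<bar>x - y\<bar>))"
  unfolding gap_def by (rule someI_ex) (use separation in blast)
 then show "gap > 0" "i < M ==> k < M ==> i ~= k ==> x \<in> {a i..b i} ==> y \<in> {a k..b k} ==> gap <= \<bar>x - y\<bar>"
  by blast+
qed

abbreviation "kern_bound \<equiv> gap powr (- 1 - 2 * s)"

lemma kern_nonneg: "0 <= kern i k z t" by (simp add: kern_def)

lemma kern_sym: "kern i k z t = kern k i t z"
 by (simp add: kern_def abs_minus_commute)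

lemma kern_le:
 assumes "i < M" "k < M" "i ~= k" "z \<in> {-1<..<1}" "t \<in> {-1<..<1}"
 shows "\<bar>kern i k z t\<bar> <= kern_bound"
proof -
 have "gap <= \<bar>X i z - X k t\<bar>"
  using X_mem[OF assms(1,4)] X_mem[OF assms(2,5)] by (intro gap(2)[OF assms(1-3)]) auto
 then show ?thesis
  unfolding kern_def using gap(1) s by (simp add: powr_mono2')
qed

lemma kern_measurable: "(%w. kern i k (fst w) (snd w)) \<in> borel_measurable (borel \<Otimes>\<^sub>M borel)"
 unfolding kern_def affine_map_def by measurable

text \<open>The kernel operator from the \<open>k\<close>-th to the \<open>i\<close>-th interval, in reference coordinates.\<close>

definition coupling :: "nat => nat => (real => real) => real => real" where
 "coupling i k v z = indicator {-1<..<1} z*(LINT t|\<mu>. kern i k z t * v t)"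

lemma L1_le: "v \<in> L2 \<mu> ==> integrable \<mu> v" "v \<in> L2 \<mu> ==> (LINT x|\<mu>. \<bar>v x\<bar>) <= sqrt (measure \<mu> UNIV)*L2_norm \<mu> v"
 using L1_le_L2[OF finite_jacobi_measure[OF s1(1)], of v] by auto

lemma kern_section_integrable:
 assumes ik: "i < M" "k < M" "i ~= k" and z: "z \<in> {-1<..<1}" and v: "integrable (jacobi_measure c) v"
 shows "integrable (jacobi_measure c) (%t. kern i k z t * v t)"
proof (rule Bochner_Integration.integrable_bound)
 show "integrable (jacobi_measure c) (%t. kern_bound * v t)" using v by simp
 have "(%t. kern i k z t) \<in> borel_measurable borel" unfolding kern_def affine_map_def by measurable
 then show "(%t. kern i k z t * v t) \<in> borel_measurable (jacobi_measure c)"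
  using borel_measurable_integrable[OF v] by (intro borel_measurable_times) (auto intro: lebesgue_measurableI)
 show "AE t in jacobi_measure c. norm (kern i k z t * v t) <= norm (kern_bound * v t)"
  using AE_jacobi_interval
 proof eventually_elim
  case (elim t)
  have "\<bar>kern i k z t\<bar>*\<bar>v t\<bar> <= kern_bound*\<bar>v t\<bar>"
   by (intro mult_right_mono kern_le ik z elim) simp
  then show ?case by (simp add: abs_mult)
 qed
qed

lemma coupling_measurable:
 assumes v: "integrable \<mu> v"
 shows "coupling i k v \<in> borel_measurable lebesgue"
proof -
 interpret F: finite_measure \<mu> by (rule finite_jacobi_measure[OF s1(1)])
 have [measurable]: "(%w. kern i k (fst w) (snd w)) \<in> borel_measurable (\<mu> \<Otimes>\<^sub>M \<mu>)"
  by (rule kernel_pair_measurable[OF kern_measurable])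
 have [measurable]: "v \<in> borel_measurable \<mu>" using v by (rule borel_measurable_integrable)
 have "(%z. (LINT t|\<mu>. kern i k z t * v t)) \<in> borel_measurable \<mu>"
 proof (rule F.borel_measurable_lebesgue_integral)
  have "(%w. kern i k (fst w) (snd w) * v (snd w)) \<in> borel_measurable (\<mu> \<Otimes>\<^sub>M \<mu>)" by measurable
  then show "(%(z, t). kern i k z t * v t) \<in> borel_measurable (\<mu> \<Otimes>\<^sub>M \<mu>)" by (simp add: case_prod_unfold)
 qed
 then show ?thesis unfolding coupling_def[abs_def]
  by (intro indicator_mult_measurable) simp
qed

lemma coupling_bound:
 assumes ik: "i < M" "k < M" "i ~= k" and v: "v \<in> L2 \<mu>"
 shows "\<bar>coupling i k v z\<bar> <= kern_bound * sqrt (measure \<mu> UNIV)*L2_norm \<mu> v"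
proof (cases "z \<in> {-1<..<1}")
 case True
 have "\<bar>(LINT t|\<mu>. kern i k z t * v t)\<bar> <= (LINT t|\<mu>. \<bar>kern i k z t * v t\<bar>)"
  by (rule integral_abs_bound)
 also have "... <= (LINT t|\<mu>. kern_bound*\<bar>v t\<bar>)"
 proof (rule integral_mono_AE)
  show "AE t in \<mu>. \<bar>kern i k z t * v t\<bar> <= kern_bound*\<bar>v t\<bar>"
   using AE_jacobi_interval
  proof eventually_elim
   case (elim t)
   show ?case unfolding abs_mult by (intro mult_right_mono kern_le ik True elim) simp
  qed
 qed (use kern_section_integrable[OF ik True L1_le(1)[OF v]] L1_le(1)[OF v] in auto)
 also have "... = kern_bound*(LINT t|\<mu>. \<bar>v t\<bar>)" by simp
 also have "... <= kern_bound*(sqrt (measure \<mu> UNIV)*L2_norm \<mu> v)"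
  by (intro mult_left_mono L1_le v) simp
 finally show ?thesis using True by (simp add: coupling_def mult.assoc)
qed (simp add: coupling_def)

lemma coupling_L2:
 assumes ik: "i < M" "k < M" "i ~= k" and v: "v \<in> L2 \<mu>"
 shows "coupling i k v \<in> L2 \<mu>"
 by (rule L2_jacobi_bounded[OF s1(1) coupling_measurable[OF L1_le(1)[OF v]] coupling_bound[OF ik v]])

lemma coupling_norm:
 assumes ik: "i < M" "k < M" "i ~= k" and v: "v \<in> L2 \<mu>"
 shows "L2_norm \<mu> (coupling i k v) <= kern_bound*measure \<mu> UNIV*L2_norm \<mu> v"
proof -
 have "L2_norm \<mu> (coupling i k v) <= kern_bound * sqrt (measure \<mu> UNIV)*L2_norm \<mu> v * sqrt (measure \<mu> UNIV)"
  by (rule L2_norm_jacobi_bounded[OF s1(1) coupling_measurable[OF L1_le(1)[OF v]] coupling_bound[OF ik v]])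
 also have "... = kern_bound*(sqrt (measure \<mu> UNIV) * sqrt (measure \<mu> UNIV))*L2_norm \<mu> v"
  by (simp only: mult_ac)
 finally show ?thesis by simp
qed

lemma coupling_diff:
 assumes ik: "i < M" "k < M" "i ~= k" and v: "v \<in> L2 \<mu>" and w: "w \<in> L2 \<mu>"
 shows "coupling i k (%x. v x - w x) z = coupling i k v z - coupling i k w z"
 using kern_section_integrable[OF ik _ L1_le(1)[OF v]] kern_section_integrable[OF ik _ L1_le(1)[OF w]]
 by (cases "z \<in> {-1<..<1}") (simp_all add: coupling_def right_diff_distrib)

definition kern_mass :: "nat => nat => real => real" where
 "kern_mass i k z = (LINT t|\<nu>. kern i k z t)"

definition kern_form :: "nat => nat => (real => real) => real" where
 "kern_form i k u = (LINT z|\<nu>. (jacobi s z*u z)\<^sup>2 * kern_mass i k z)"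

lemma weighted_square_integrable:
 assumes "u \<in> L2 \<mu>"
 shows "integrable \<nu> (%z. (jacobi s z*u z)\<^sup>2)"
proof -
 have um: "u \<in> borel_measurable lebesgue" using assms by (auto simp: L2_def)
 have "integrable \<nu> (%z. jacobi s z*(u z)\<^sup>2)"
  using assms by (subst integral_jacobi_0(2)) (auto simp: L2_def)
 then show ?thesis
 proof (rule Bochner_Integration.integrable_bound)
  show "(%z. (jacobi s z*u z)\<^sup>2) \<in> borel_measurable \<nu>"
   using um by (simp add: borel_measurable_power borel_measurable_times)
  have "(jacobi s z*u z)\<^sup>2 <= jacobi s z*(u z)\<^sup>2" for z
  proof -
   have "jacobi s z*(jacobi s z*(u z)\<^sup>2) <= 1*(jacobi s z*(u z)\<^sup>2)"
    by (intro mult_right_mono jacobi_le_1 s1) simp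
   then show ?thesis by (simp add: power2_eq_square mult_ac)
  qed
  then show "AE z in \<nu>. norm ((jacobi s z*u z)\<^sup>2) <= norm (jacobi s z*(u z)\<^sup>2)"
   by simp
 qed
qed

text \<open>The arithmetic-geometric mean inequality with the scale factors of the two intervals splits the
 interaction into two potential terms.\<close>

lemma coupling_am_gm:
 assumes ik: "i < M" "k < M" "i ~= k" and v: "v \<in> L2 \<mu>" and u: "u \<in> L2 \<mu>"
  and c: "\<alpha> > 0" "\<beta> > 0"
 shows "\<alpha>*\<beta>*\<bar>L2_inner \<mu> (coupling i k v) u\<bar> <= (\<alpha>\<^sup>2 * kern_form i k u + \<beta>\<^sup>2 * kern_form k i v)/2"
proof -
 let ?P = "\<nu> \<Otimes>\<^sub>M \<nu>"
 let ?U = "%z. jacobi s z*u z" and ?V = "%t. jacobi s t * v t"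
 have gt: "(0::real) > -1" by simp
 interpret PP: pair_sigma_finite \<nu> \<nu> by (rule pair_sigma_finite_jacobi[OF gt gt])
 have um: "u \<in> borel_measurable lebesgue" and vm: "v \<in> borel_measurable lebesgue"
  using u v by (auto simp: L2_def)
 have Ui: "integrable \<nu> ?U" and Vi: "integrable \<nu> ?V"
  using L1_le(1)[OF u] L1_le(1)[OF v] um vm by (auto simp: integral_jacobi_0(2))
 have U2: "integrable \<nu> (%z. (?U z)\<^sup>2)" and V2: "integrable \<nu> (%z. (?V z)\<^sup>2)"
  by (intro weighted_square_integrable u v)+
 have one: "integrable \<nu> (%x. 1 :: real)"
 proof -
  interpret finite_measure \<nu> by (rule finite_jacobi_measure[OF gt])
  show ?thesis by simp
 qed
 have kB: "\<bar>kern i k x y\<bar> <= kern_bound" if "x \<in> {-1<..<1}" "y \<in> {-1<..<1}" for x y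
  by (rule kern_le[OF ik that])
 note bki = bounded_kernel_integrable[OF gt gt kern_measurable kB]
 have I1: "integrable ?P (%(x, y). kern i k x y*(?U x*?V y))" by (rule bki[OF _ _ Ui Vi])
 have I2: "integrable ?P (%(x, y). kern i k x y*((?U x)\<^sup>2*1))" by (rule bki[OF _ _ U2 one])
 have I3: "integrable ?P (%(x, y). kern i k x y*(1*(?V y)\<^sup>2))" by (rule bki[OF _ _ one V2])
 have L: "L2_inner \<mu> (coupling i k v) u = (LINT w|?P. (case w of (x, y) => kern i k x y*(?U x*?V y)))"
 proof -
  have "L2_inner \<mu> (coupling i k v) u = (LINT z|\<nu>. jacobi s z*(coupling i k v z*u z))"
   unfolding L2_inner_def using coupling_measurable[OF L1_le(1)[OF v]] um
   by (intro integral_jacobi_0(1)[symmetric] borel_measurable_times)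
  also have "... = (LINT z|\<nu>. (LINT t|\<nu>. kern i k z t*(?U z*?V t)))"
  proof (rule integral_cong_AE)
   show "(%z. jacobi s z*(coupling i k v z*u z)) \<in> borel_measurable \<nu>"
    using coupling_measurable[OF L1_le(1)[OF v], of i k] um by (simp add: borel_measurable_times)
   show "(%z. (LINT t|\<nu>. kern i k z t*(?U z*?V t))) \<in> borel_measurable \<nu>"
    using PP.integrable_fst[OF I1] by (rule borel_measurable_integrable)
   show "AE z in \<nu>. jacobi s z*(coupling i k v z*u z) = (LINT t|\<nu>. kern i k z t*(?U z*?V t))"
    using AE_jacobi_interval
   proof eventually_elim
    case (elim z)
    have km: "(%t. kern i k z t) \<in> borel_measurable lebesgue"
     unfolding kern_def affine_map_def by (intro lebesgue_measurableI) measurable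
    have "(LINT t|\<nu>. kern i k z t*(?U z*?V t)) = (LINT t|\<nu>. ?U z*(jacobi s t*(kern i k z t * v t)))"
     by (simp add: mult_ac)
    also have "... = ?U z*(LINT t|\<mu>. kern i k z t * v t)"
     using integral_jacobi_0(1)[of "%t. kern i k z t * v t" s] km vm by (simp add: borel_measurable_times)
    finally have "(LINT t|\<nu>. kern i k z t*(?U z*?V t)) = ?U z*coupling i k v z"
     using elim by (simp add: coupling_def)
    then show ?case by (simp only: mult_ac)
   qed
  qed
  also have "... = (LINT w|?P. (case w of (x, y) => kern i k x y*(?U x*?V y)))"
   by (rule PP.integral_fst[OF I1])
  finally show ?thesis .
 qed
 have A: "(LINT w|?P. (case w of (x, y) => kern i k x y*((?U x)\<^sup>2*1))) = kern_form i k u"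
  unfolding kern_form_def kern_mass_def PP.integral_fst[OF I2, symmetric]
  by (intro Bochner_Integration.integral_cong refl) (simp add: mult.commute)
 have B: "(LINT w|?P. (case w of (x, y) => kern i k x y*(1*(?V y)\<^sup>2))) = kern_form k i v"
  unfolding kern_form_def kern_mass_def PP.integral_snd[OF I3, symmetric]
  by (intro Bochner_Integration.integral_cong refl) (simp add: mult.commute kern_sym[of i k])
 let ?R = "%w. (\<alpha>\<^sup>2*(case w of (x, y) => kern i k x y*((?U x)\<^sup>2*1)) + \<beta>\<^sup>2*(case w of (x, y) => kern i k x y*(1*(?V y)\<^sup>2)))/2"
 have "\<alpha>*\<beta>*\<bar>L2_inner \<mu> (coupling i k v) u\<bar> <= \<alpha>*\<beta>*(LINT w|?P. \<bar>case w of (x, y) => kern i k x y*(?U x*?V y)\<bar>)"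
  unfolding L using c by (intro mult_left_mono integral_abs_bound) auto
 also have "... = (LINT w|?P. \<alpha>*\<beta>*\<bar>case w of (x, y) => kern i k x y*(?U x*?V y)\<bar>)" by simp
 also have "... <= (LINT w|?P. ?R w)"
 proof (rule integral_mono)
  show "integrable ?P (%w. \<alpha>*\<beta>*\<bar>case w of (x, y) => kern i k x y*(?U x*?V y)\<bar>)"
   by (intro integrable_mult_right integrable_abs I1)
  show "integrable ?P ?R" by (intro integrable_divide Bochner_Integration.integrable_add integrable_mult_right I2 I3)
  fix w
  show "\<alpha>*\<beta>*\<bar>case w of (x, y) => kern i k x y*(?U x*?V y)\<bar> <= ?R w"
  proof (cases w)
   case (Pair x y)
   have "2*(\<alpha>*\<bar>?U x\<bar>)*(\<beta>*\<bar>?V y\<bar>) <= (\<alpha>*\<bar>?U x\<bar>)\<^sup>2 + (\<beta>*\<bar>?V y\<bar>)\<^sup>2"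
    by (rule sum_squares_bound)
   then have "\<alpha>*\<beta>*(\<bar>?U x\<bar>*\<bar>?V y\<bar>) <= (\<alpha>\<^sup>2*(?U x)\<^sup>2 + \<beta>\<^sup>2*(?V y)\<^sup>2)/2"
    unfolding power_mult_distrib[of \<alpha>] power_mult_distrib[of \<beta>] power2_abs by (simp add: mult_ac)
   then have "kern i k x y*(\<alpha>*\<beta>*(\<bar>?U x\<bar>*\<bar>?V y\<bar>)) <= kern i k x y*((\<alpha>\<^sup>2*(?U x)\<^sup>2 + \<beta>\<^sup>2*(?V y)\<^sup>2)/2)"
    by (intro mult_left_mono kern_nonneg)
   moreover have "\<bar>kern i k x y*(?U x*?V y)\<bar> = kern i k x y*(\<bar>?U x\<bar>*\<bar>?V y\<bar>)"
    unfolding abs_mult using kern_nonneg[of i k x y] by simp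
   ultimately show ?thesis unfolding Pair prod.case by (simp add: algebra_simps add_divide_distrib)
  qed
 qed
 also have "... = (\<alpha>\<^sup>2 * kern_form i k u + \<beta>\<^sup>2 * kern_form k i v)/2"
  unfolding A[symmetric] B[symmetric] using I2 I3
  by (subst Bochner_Integration.integral_divide_zero, subst Bochner_Integration.integral_add) auto
 finally show ?thesis .
qed

end

lemma nn_integral_powr_tail:
 assumes s: "0 < s" and c: "0 < c"
 shows "(\<integral>\<^sup>+t. ennreal (indicator {c..} t*\<bar>t\<bar> powr (- 1 - 2 * s)) \<partial>lborel) = ennreal (c powr (- 2 * s)/(2 * s))"
proof -
 have "(\<integral>\<^sup>+t. ennreal (indicator {c..} t*\<bar>t\<bar> powr (- 1 - 2 * s)) \<partial>lborel)
  = (\<integral>\<^sup>+t. ennreal (\<bar>t\<bar> powr (- 1 - 2 * s))*indicator {c..} t \<partial>lborel)"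
  by (intro nn_integral_cong) (auto simp: indicator_def)
 also have "... = ennreal (0 - (- (c powr (- 2 * s)/(2 * s))))"
 proof (rule nn_integral_FTC_atLeast)
  show "((%t. - (t powr (- 2 * s)/(2 * s))) has_real_derivative \<bar>x\<bar> powr (- 1 - 2 * s)) (at x)" if "c <= x" for x
   using that c s by (auto intro!: derivative_eq_intros simp: field_simps powr_diff powr_minus)
  have "((%t. t powr (- 2 * s)) \<longlongrightarrow> 0) at_top"
   using s by (intro tendsto_neg_powr filterlim_ident) simp
  then have "((%t. - (t powr (- 2 * s)/(2 * s))) \<longlongrightarrow> - (0/(2 * s))) at_top"
   using s by (intro tendsto_intros) auto
  then show "((%t. - (t powr (- 2 * s)/(2 * s))) \<longlongrightarrow> 0) at_top" by simp
 qed auto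
 finally show ?thesis by simp
qed

lemma L2_bounded_mult:
 assumes m: "m \<in> borel_measurable M" "!!x. \<bar>m x\<bar> <= B" and v: "v \<in> L2 M"
 shows "(%x. m x * v x) \<in> L2 M"
proof -
 have [measurable]: "v \<in> borel_measurable M" "m \<in> borel_measurable M" using v m by auto
 have "integrable M (%x. (m x * v x)\<^sup>2)"
 proof (rule Bochner_Integration.integrable_bound)
  show "integrable M (%x. B\<^sup>2*(v x)\<^sup>2)" using v by (simp add: L2_def)
  have "(m x)\<^sup>2 <= B\<^sup>2" for x using power_mono[OF m(2)[of x], of 2] by simp
  then show "AE x in M. norm ((m x * v x)\<^sup>2) <= norm (B\<^sup>2*(v x)\<^sup>2)"
   by (simp add: power_mult_distrib mult_right_mono)
 qed measurable
 then show ?thesis by (simp add: L2_def)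
qed

context multi_interval
begin

text \<open>Up to the half length of the target interval this is the kernel mass of the \<open>k\<close>-th interval
 seen from a point of the \<open>i\<close>-th one.\<close>

lemma kern_mass_eq:
 assumes ik: "i < M" "k < M" "i ~= k" and z: "z \<in> {-1<..<1}"
 shows "ennreal (hl k * kern_mass i k z)
  = (\<integral>\<^sup>+y. ennreal (indicator {a k<..<b k} y*\<bar>X i z - y\<bar> powr (- 1 - 2 * s)) \<partial>lborel)"
proof -
 have gt: "(0::real) > -1" by simp
 interpret finite_measure \<nu> by (rule finite_jacobi_measure[OF gt])
 have km: "(%t. kern i k z t) \<in> borel_measurable borel"
  unfolding kern_def affine_map_def by measurable
 have int: "integrable \<nu> (%t. kern i k z t)"
  using kern_section_integrable[OF ik z, of 0 "%_. 1"] by simp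
 have "ennreal (kern_mass i k z) = (\<integral>\<^sup>+t. ennreal (kern i k z t) \<partial>\<nu>)"
  unfolding kern_mass_def by (rule nn_integral_eq_integral[symmetric]) (use int kern_nonneg in auto)
 also have "... = (\<integral>\<^sup>+t. ennreal (jacobi 0 t)*ennreal (kern i k z t) \<partial>lebesgue)"
  unfolding jacobi_measure_def using km by (intro nn_integral_density) (auto intro!: lebesgue_measurableI)
 also have "... = (\<integral>\<^sup>+t. ennreal (jacobi 0 t)*ennreal (kern i k z t) \<partial>lborel)"
  using km by (intro nn_integral_completion)
 also have "... = (\<integral>\<^sup>+t. ennreal (indicator {a k<..<b k} ((a k + b k)/2 + hl k*t)*\<bar>X i z - ((a k + b k)/2 + hl k*t)\<bar> powr (- 1 - 2 * s)) \<partial>lborel)"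
 proof (rule nn_integral_cong)
  fix t :: real
  show "ennreal (jacobi 0 t)*ennreal (kern i k z t) = ennreal (indicator {a k<..<b k} ((a k + b k)/2 + hl k*t)*\<bar>X i z - ((a k + b k)/2 + hl k*t)\<bar> powr (- 1 - 2 * s))"
  proof (cases "t \<in> {-1<..<1}")
   case True
   then have "(a k + b k)/2 + hl k*t \<in> {a k<..<b k}" using affine_mem_iff[OF intervals[OF ik(2)]] by blast
   then show ?thesis using True by (simp only: jacobi_0 kern_def affine_map_def indicator_simps ennreal_1 mult_1)
  next
   case False
   then have "(a k + b k)/2 + hl k*t \<notin> {a k<..<b k}" using affine_mem_iff[OF intervals[OF ik(2)]] by blast
   then show ?thesis using False by (simp only: jacobi_outside indicator_simps ennreal_0 mult_zero_left not_False_eq_True)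
  qed
 qed
 finally have "ennreal (hl k * kern_mass i k z) = ennreal \<bar>hl k\<bar>*..."
  using hl_pos[OF ik(2)] by (simp only: abs_of_pos ennreal_mult' less_imp_le)
 also have "... = (\<integral>\<^sup>+y. ennreal (indicator {a k<..<b k} y*\<bar>X i z - y\<bar> powr (- 1 - 2 * s)) \<partial>lborel)"
  by (rule nn_integral_real_affine[symmetric]) (use hl_pos[OF ik(2)] in auto)
 finally show ?thesis .
qed

text \<open>The kernel mass of all other intervals, scaled to be compared with \<open>exit_density\<close>, which is
 the mass of the complement in reference coordinates.\<close>

definition potential :: "nat => real => real" where
 "potential i z = hl i powr (2 * s)*(\<Sum>k\<in>{..<M} - {i}. hl k * kern_mass i k z)"

text \<open>Enlarging the \<open>i\<close>-th interval by the gap increases the distance from each of its points to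
 each of its ends by at least the factor in parentheses, because that distance is at most \<open>2 * hl
 i\<close>.\<close>

definition contraction :: real where
 "contraction = (1 + gap/(2*(1 + (\<Sum>i<M. hl i)))) powr (- 2 * s)"

lemma total_length: "0 <= (\<Sum>i<M. hl i)" "i < M ==> hl i <= 1 + (\<Sum>i<M. hl i)"
proof -
 have p: "0 <= hl i" if "i < M" for i using hl_pos[OF that] by simp
 show "0 <= (\<Sum>i<M. hl i)" using p by (intro sum_nonneg) auto
 show "hl i <= 1 + (\<Sum>i<M. hl i)" if "i < M"
  using member_le_sum[of i "{..<M}" hl] p that by auto
qed

lemma contraction: "0 < contraction" "contraction < 1"
proof -
 have "0 < gap/(2*(1 + (\<Sum>i<M. hl i)))" using gap(1) total_length(1) by simp
 then show "0 < contraction" "contraction < 1"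
  unfolding contraction_def using s powr_less_mono2_neg[of "- 2 * s" 1] by auto
qed

lemma gap_ratio:
 assumes "i < M" "0 < t" "t <= 2"
 shows "hl i powr (2 * s)*(hl i*t + gap) powr (- 2 * s) <= contraction*t powr (- 2 * s)"
proof -
 let ?h = "hl i" and ?L = "1 + (\<Sum>i<M. hl i)"
 have h: "0 < ?h" "?h <= ?L" "0 < ?L" using hl_pos[OF assms(1)] total_length(2)[OF assms(1)] total_length(1) by auto
 have "?h*t*(gap/(2*?L)) <= ?L*2*(gap/(2*?L))"
  using h assms gap(1) by (intro mult_right_mono mult_mono) auto
 also have "... = gap"
 proof -
  have "L*2*(g/(2*L)) = g" if "0 < L" for L g :: real using that by simp
  from this[OF h(3)] show ?thesis .
 qed
 finally have le: "?h*t*(1 + gap/(2*?L)) <= ?h*t + gap" by (simp add: distrib_left)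
 have pos: "0 < 1 + gap/(2*?L)" using gap(1) h by (simp add: add_pos_pos)
 then have "(?h*t + gap) powr (- 2 * s) <= (?h*t*(1 + gap/(2*?L))) powr (- 2 * s)"
  using le s h assms by (intro powr_mono2') auto
 also have "... = ?h powr (- 2 * s)*t powr (- 2 * s)*contraction"
 proof -
  have "(h*t*q) powr c = h powr c*t powr c*q powr c" if "0 < h" "0 < t" "0 < q" for h t q c :: real
   using that by (simp add: powr_mult)
  from this[OF h(1) assms(2) pos] show ?thesis unfolding contraction_def .
 qed
 finally have "?h powr (2 * s)*(?h*t + gap) powr (- 2 * s) <= ?h powr (2 * s)*(?h powr (- 2 * s)*t powr (- 2 * s)*contraction)"
  by (rule mult_left_mono) simp
 also have "... = contraction*t powr (- 2 * s)"
  using h by (simp add: powr_minus field_simps)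
 finally show ?thesis .
qed

text \<open>The other intervals stay at distance \<open>gap\<close> from the \<open>i\<close>-th one, so the mass they carry is the mass
 outside an enlarged interval; compared with the whole complement this gains a factor smaller than one.\<close>

lemma potential_bound:
 assumes i: "i < M" and z: "z \<in> {-1<..<1}"
 shows "potential i z <= contraction*exit_density s z"
proof -
 let ?x = "X i z" and ?p = "- 1 - 2 * s" and ?K = "{..<M} - {i}"
 define S where "S = (\<Sum>k\<in>?K. hl k * kern_mass i k z)"
 have x: "?x \<in> {a i<..<b i}" by (rule X_mem[OF i z])
 have x1: "b i - ?x = hl i*(1 - z)" "?x - a i = hl i*(1 + z)" by (simp_all add: affine_map_def field_simps)
 have n: "0 <= hl k * kern_mass i k z" if "k \<in> ?K" for k
  using hl_pos[of k] that kern_nonneg unfolding kern_mass_def by (intro mult_nonneg_nonneg integral_nonneg_AE) auto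
 have pt: "(\<Sum>k\<in>?K. indicator {a k<..<b k} y) <= (indicator {b i + gap..} y + indicator {..a i - gap} y :: real)" for y
 proof (cases "\<exists>k\<in>?K. y \<in> {a k<..<b k}")
  case True
  then obtain k where k: "k < M" "k ~= i" "y \<in> {a k<..<b k}" by auto
  have "(\<Sum>l\<in>?K. indicator {a l<..<b l} y) = (\<Sum>l\<in>?K. if l = k then 1 else 0 :: real)"
  proof (rule sum.cong[OF refl])
   fix l assume l: "l \<in> ?K"
   have "y \<notin> {a l<..<b l}" if "l ~= k" using disjoint[of l k] l k that by auto
   then show "indicator {a l<..<b l} y = (if l = k then 1 else 0 :: real)" using k by auto
  qed
  also have "... = 1" using k by simp
  finally have 1: "(\<Sum>l\<in>?K. indicator {a l<..<b l} y) = (1::real)" .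
  have "gap <= \<bar>a i - y\<bar>" "gap <= \<bar>b i - y\<bar>"
   using gap(2)[OF i k(1), of "a i" y] gap(2)[OF i k(1), of "b i" y] k intervals[OF i] by auto
  moreover have "y \<notin> {a i..b i}" using disjoint[OF k(1) i k(2)] k(3) by auto
  ultimately have "y \<in> {b i + gap..} \<or> y \<in> {..a i - gap}" using intervals[OF i] by auto
  then show ?thesis unfolding 1 by (auto simp: indicator_def)
 next
  case False
  then have "(\<Sum>k\<in>?K. indicator {a k<..<b k} y) = (0::real)" by (intro sum.neutral) auto
  then show ?thesis by (simp only:) simp
 qed
 have "ennreal S = (\<Sum>k\<in>?K. ennreal (hl k * kern_mass i k z))"
  unfolding S_def using n by (intro sum_ennreal[symmetric]) auto
 also have "... = (\<Sum>k\<in>?K. \<integral>\<^sup>+y. ennreal (indicator {a k<..<b k} y*\<bar>?x - y\<bar> powr ?p) \<partial>lborel)"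
  using i z by (intro sum.cong refl kern_mass_eq) auto
 also have "... = (\<integral>\<^sup>+y. (\<Sum>k\<in>?K. ennreal (indicator {a k<..<b k} y*\<bar>?x - y\<bar> powr ?p)) \<partial>lborel)"
  by (rule nn_integral_sum[symmetric]) measurable
 also have "... <= (\<integral>\<^sup>+y. ennreal (indicator {b i + gap..} y*\<bar>?x - y\<bar> powr ?p) + ennreal (indicator {..a i - gap} y*\<bar>?x - y\<bar> powr ?p) \<partial>lborel)"
 proof (rule nn_integral_mono)
  fix y
  have "(\<Sum>k\<in>?K. ennreal (indicator {a k<..<b k} y*\<bar>?x - y\<bar> powr ?p)) = ennreal ((\<Sum>k\<in>?K. indicator {a k<..<b k} y)*\<bar>?x - y\<bar> powr ?p)"
   unfolding sum_distrib_right by (intro sum_ennreal) auto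
  also have "... <= ennreal ((indicator {b i + gap..} y + indicator {..a i - gap} y)*\<bar>?x - y\<bar> powr ?p)"
   by (intro ennreal_leI mult_right_mono pt) auto
  also have "... = ennreal (indicator {b i + gap..} y*\<bar>?x - y\<bar> powr ?p) + ennreal (indicator {..a i - gap} y*\<bar>?x - y\<bar> powr ?p)"
   unfolding distrib_right by (intro ennreal_plus) auto
  finally show "(\<Sum>k\<in>?K. ennreal (indicator {a k<..<b k} y*\<bar>?x - y\<bar> powr ?p)) <= ..." .
 qed
 also have "... = (\<integral>\<^sup>+y. ennreal (indicator {b i + gap..} y*\<bar>?x - y\<bar> powr ?p) \<partial>lborel) + (\<integral>\<^sup>+y. ennreal (indicator {..a i - gap} y*\<bar>?x - y\<bar> powr ?p) \<partial>lborel)"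
  by (rule nn_integral_add) measurable
 also have "(\<integral>\<^sup>+y. ennreal (indicator {b i + gap..} y*\<bar>?x - y\<bar> powr ?p) \<partial>lborel) = (\<integral>\<^sup>+t. ennreal (indicator {hl i*(1 - z) + gap..} t*\<bar>t\<bar> powr ?p) \<partial>lborel)"
  by (subst nn_integral_real_affine[where c=1 and t="?x"]) (use x1 in \<open>auto simp: indicator_def intro!: nn_integral_cong\<close>)
 also have "... = ennreal ((hl i*(1 - z) + gap) powr (- 2 * s)/(2 * s))"
  using s gap(1) hl_pos[OF i] z by (intro nn_integral_powr_tail) (auto intro!: add_nonneg_pos)
 also have "(\<integral>\<^sup>+y. ennreal (indicator {..a i - gap} y*\<bar>?x - y\<bar> powr ?p) \<partial>lborel) = (\<integral>\<^sup>+t. ennreal (indicator {hl i*(1 + z) + gap..} t*\<bar>t\<bar> powr ?p) \<partial>lborel)"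
  by (subst nn_integral_real_affine[where c="-1" and t="?x"]) (use x1 in \<open>auto simp: indicator_def intro!: nn_integral_cong\<close>)
 also have "... = ennreal ((hl i*(1 + z) + gap) powr (- 2 * s)/(2 * s))"
  using s gap(1) hl_pos[OF i] z by (intro nn_integral_powr_tail) (auto intro!: add_nonneg_pos)
 also have "ennreal ((hl i*(1 - z) + gap) powr (- 2 * s)/(2 * s)) + ...
  = ennreal ((hl i*(1 - z) + gap) powr (- 2 * s)/(2 * s) + (hl i*(1 + z) + gap) powr (- 2 * s)/(2 * s))"
  using s by (intro ennreal_plus[symmetric]) auto
 finally have "S <= (hl i*(1 - z) + gap) powr (- 2 * s)/(2 * s) + (hl i*(1 + z) + gap) powr (- 2 * s)/(2 * s)"
  using s by (subst (asm) ennreal_le_iff) auto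
 then have "potential i z <= hl i powr (2 * s)*((hl i*(1 - z) + gap) powr (- 2 * s)/(2 * s) + (hl i*(1 + z) + gap) powr (- 2 * s)/(2 * s))"
  unfolding potential_def S_def by (rule mult_left_mono) simp
 also have "... = (hl i powr (2 * s)*(hl i*(1 - z) + gap) powr (- 2 * s) + hl i powr (2 * s)*(hl i*(1 + z) + gap) powr (- 2 * s))/(2 * s)"
  by (simp add: distrib_left add_divide_distrib)
 also have "... <= (contraction*(1 - z) powr (- 2 * s) + contraction*(1 + z) powr (- 2 * s))/(2 * s)"
  using s z by (intro divide_right_mono add_mono gap_ratio i) auto
 also have "... = contraction*exit_density s z" by (simp add: exit_density_def distrib_left)
 finally show ?thesis .
qed

lemma kern_mass_nonneg: "0 <= kern_mass i k z"
 unfolding kern_mass_def by (intro integral_nonneg_AE) (simp add: kern_nonneg)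

lemma kern_mass_weight_measurable: "(%z. jacobi c z * kern_mass i k z) \<in> borel_measurable lebesgue"
proof -
 have gt: "(0::real) > -1" by simp
 interpret F: finite_measure \<nu> by (rule finite_jacobi_measure[OF gt])
 have [measurable]: "(%w. kern i k (fst w) (snd w)) \<in> borel_measurable (\<nu> \<Otimes>\<^sub>M \<nu>)"
  by (rule kernel_pair_measurable[OF kern_measurable])
 have "(%z. (LINT t|\<nu>. kern i k z t)) \<in> borel_measurable \<nu>"
 proof (rule F.borel_measurable_lebesgue_integral)
  have "(%w. kern i k (fst w) (snd w)) \<in> borel_measurable (\<nu> \<Otimes>\<^sub>M \<nu>)" by measurable
  then show "(%(z, t). kern i k z t) \<in> borel_measurable (\<nu> \<Otimes>\<^sub>M \<nu>)" by (simp add: case_prod_unfold)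
 qed
 then show ?thesis unfolding kern_mass_def by (intro borel_measurable_times jacobi_lebesgue) simp
qed

lemma kern_mass_weight_bounded:
 assumes ik: "i < M" "k < M" "i ~= k"
 shows "\<bar>jacobi s z * kern_mass i k z\<bar> <= kern_bound*measure \<nu> UNIV"
proof (cases "z \<in> {-1<..<1}")
 case True
 have gt: "(0::real) > -1" by simp
 interpret F: finite_measure \<nu> by (rule finite_jacobi_measure[OF gt])
 have "kern_mass i k z <= (LINT t|\<nu>. kern_bound)"
  unfolding kern_mass_def
 proof (rule integral_mono_AE)
  show "integrable \<nu> (%t. kern i k z t)" using kern_section_integrable[OF ik True, of 0 "%_. 1"] by simp
  show "AE t in \<nu>. kern i k z t <= kern_bound"
   using AE_jacobi_interval by eventually_elim (use kern_le[OF ik True] in \<open>auto simp: abs_le_iff\<close>)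
 qed simp
 also have "... = kern_bound*measure \<nu> UNIV" by simp
 finally have "jacobi s z * kern_mass i k z <= 1*(kern_bound*measure \<nu> UNIV)"
  by (intro mult_mono jacobi_le_1 s1 kern_mass_nonneg) auto
 then show ?thesis using kern_mass_nonneg[of i k z] by simp
qed (simp add: jacobi_outside)

lemma kern_form_integrable:
 assumes ik: "i < M" "k < M" "i ~= k" and u: "u \<in> L2 \<mu>"
 shows "integrable \<nu> (%z. (jacobi s z*u z)\<^sup>2 * kern_mass i k z)"
proof -
 have "(%z. (jacobi s z * kern_mass i k z)*u z) \<in> L2 \<mu>"
  by (rule L2_bounded_mult[OF _ kern_mass_weight_bounded[OF ik] u]) (simp add: kern_mass_weight_measurable)
 from L2_mult[OF this u]
 have i: "integrable \<mu> (%z. (jacobi s z * kern_mass i k z)*u z*u z)" .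
 then have "integrable \<nu> (%z. jacobi s z*((jacobi s z * kern_mass i k z)*u z*u z))"
  using borel_measurable_integrable[OF i] by (subst integral_jacobi_0(2)) auto
 then show ?thesis by (simp add: power2_eq_square mult_ac)
qed

definition potential_form :: "nat => (real => real) => real" where
 "potential_form i u = (LINT z|\<nu>. (jacobi s z*u z)\<^sup>2*potential i z)"

lemma potential_expand:
 "(jacobi s z*u z)\<^sup>2*potential i z = (\<Sum>k\<in>{..<M} - {i}. hl i powr (2 * s)*hl k*((jacobi s z*u z)\<^sup>2 * kern_mass i k z))"
 unfolding potential_def by (simp add: sum_distrib_left mult_ac)

lemma potential_form_sum:
 assumes i: "i < M" and u: "u \<in> L2 \<mu>"
 shows "potential_form i u = (\<Sum>k\<in>{..<M} - {i}. hl i powr (2 * s)*hl k * kern_form i k u)"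
  "integrable \<nu> (%z. (jacobi s z*u z)\<^sup>2*potential i z)"
proof -
 have I: "integrable \<nu> (%z. hl i powr (2 * s)*hl k*((jacobi s z*u z)\<^sup>2 * kern_mass i k z))" if "k \<in> {..<M} - {i}" for k
  using that i u by (intro integrable_mult_right kern_form_integrable) auto
 show "integrable \<nu> (%z. (jacobi s z*u z)\<^sup>2*potential i z)"
  unfolding potential_expand by (intro Bochner_Integration.integrable_sum I)
 show "potential_form i u = (\<Sum>k\<in>{..<M} - {i}. hl i powr (2 * s)*hl k * kern_form i k u)"
  unfolding potential_form_def potential_expand kern_form_def
  by (subst Bochner_Integration.integral_sum[OF I]) auto
qed

lemma potential_nonneg: "i < M ==> 0 <= potential i z"
 unfolding potential_def using hl_pos kern_mass_nonneg
 by (intro mult_nonneg_nonneg sum_nonneg) (auto simp: less_imp_le)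

lemma potential_form_poly:
 assumes i: "i < M" and nonneg: "0 <= L2_inner \<mu> (poly (K_poly s p)) (poly p)"
 shows "C1 s*potential_form i (poly p) <= contraction*L2_inner \<mu> (poly (K_poly s p)) (poly p)"
proof -
 let ?Q = "wint s (%x. poly (K_poly s p) x*poly p x)"
 have p: "poly p \<in> L2 \<mu>" by (rule L2_jacobi_poly[OF s1(1)])
 have C: "0 < C1 s" by (rule C1_pos[OF s])
 have int: "integrable \<nu> (%z. (jacobi s z*poly p z)\<^sup>2*potential i z)" by (rule potential_form_sum(2)[OF i p])
 have "ennreal (potential_form i (poly p)) = (\<integral>\<^sup>+z. ennreal ((jacobi s z*poly p z)\<^sup>2*potential i z) \<partial>\<nu>)"
  unfolding potential_form_def by (rule nn_integral_eq_integral[symmetric, OF int]) (simp add: potential_nonneg[OF i])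
 also have "... = (\<integral>\<^sup>+z. ennreal (jacobi 0 z)*ennreal ((jacobi s z*poly p z)\<^sup>2*potential i z) \<partial>lebesgue)"
  using borel_measurable_integrable[OF int] unfolding jacobi_measure_def by (intro nn_integral_density) auto
 also have "... <= (\<integral>\<^sup>+z. ennreal contraction*ennreal ((weighted_poly s p z)\<^sup>2*exit_density s z) \<partial>lebesgue)"
 proof (rule nn_integral_mono)
  fix z :: real
  show "ennreal (jacobi 0 z)*ennreal ((jacobi s z*poly p z)\<^sup>2*potential i z) <= ennreal contraction*ennreal ((weighted_poly s p z)\<^sup>2*exit_density s z)"
  proof (cases "z \<in> {-1<..<1}")
   case True
   have "(jacobi s z*poly p z)\<^sup>2*potential i z <= (jacobi s z*poly p z)\<^sup>2*(contraction*exit_density s z)"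
    by (intro mult_left_mono potential_bound i True) simp
   then show ?thesis
    using contraction exit_density_nonneg[OF s(1)] True
    by (simp add: jacobi_0 weighted_poly_eq mult_ac flip: ennreal_mult)
  qed (simp add: jacobi_outside)
 qed
 also have "... = (\<integral>\<^sup>+z. ennreal contraction*ennreal ((weighted_poly s p z)\<^sup>2*exit_density s z) \<partial>lborel)"
  unfolding weighted_poly_eq by (rule nn_integral_completion) (use poly_borel in measurable)
 also have "... = ennreal contraction*(\<integral>\<^sup>+z. ennreal ((weighted_poly s p z)\<^sup>2*exit_density s z) \<partial>lborel)"
  unfolding weighted_poly_eq by (rule nn_integral_cmult) (use poly_borel in measurable)
 also have "... <= ennreal contraction*ennreal (?Q/C1 s)"
  by (intro mult_left_mono Hardy_inequality s) simp
 finally have A: "ennreal (potential_form i (poly p)) <= ennreal contraction*ennreal (?Q/C1 s)" .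
 have nn: "0 <= potential_form i (poly p)"
  unfolding potential_form_def using potential_nonneg[OF i] by (intro integral_nonneg_AE) auto
 have Q: "?Q = L2_inner \<mu> (poly (K_poly s p)) (poly p)"
  by (intro wint_eq_L2_inner L2_jacobi_poly s1)
 have "potential_form i (poly p) <= contraction*(?Q/C1 s)"
 proof -
  have "0 <= ?Q/C1 s" using nonneg C unfolding Q by simp
  then have p0: "0 <= contraction*(?Q/C1 s)" using contraction by (intro mult_nonneg_nonneg) auto
  have "ennreal (potential_form i (poly p)) <= ennreal (contraction*(?Q/C1 s))"
   using A contraction by (simp only: ennreal_mult' less_imp_le)
  then show ?thesis using p0 by (simp only: ennreal_le_iff)
 qed
 then show ?thesis unfolding Q using C by (simp add: field_simps)
qed

text \<open>For polynomials this is the Hardy inequality and the potential bound. It passes to the limit of the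
 partial sums without convergence of the forms: \<open>2 S\<^sub>n v \<le> S\<^sub>n\<^sup>2 + v\<^sup>2\<close>
 bounds the form by the limit of a linear functional.\<close>

theorem potential_form_energy:
 assumes i: "i < M" and v: "v \<in> L2 \<mu>" and E: "summable (%j. ev j*(L2_inner \<mu> v (e j))\<^sup>2)"
 shows "C1 s*potential_form i v <= contraction*(\<Sum>j. ev j*(L2_inner \<mu> v (e j))\<^sup>2)"
proof -
 interpret L2_basis \<mu> e by (rule gegenbauer_basis[OF s1(2)])
 let ?c = "%j. L2_inner \<mu> v (e j)" and ?m = "%z. jacobi s z*potential i z"
 define S where "S = (%n x. \<Sum>j<n. ?c j*e j x)"
 define P where "P = (%n. \<Sum>j<n. smult (?c j) (smult (1/sqrt (geg_sqnorm s j)) (geg s j)))"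
 have SP: "S n = poly (P n)" for n
  by (rule ext) (simp add: S_def P_def poly_sum normalized_gegenbauer_poly)
 have Ssq: "S n \<in> L2 \<mu>" for n unfolding S_def by (rule partial_sq)
 have conv: "(%n. L2_norm \<mu> (%x. S n x - v x)) \<longlonglongrightarrow> 0"
  unfolding S_def by (rule expansion_tendsto[OF v])
 have en: "L2_inner \<mu> (poly (K_poly s (P n))) (poly (P n)) = (\<Sum>j<n. ev j*(?c j)\<^sup>2)" for n
 proof -
  have "L2_inner \<mu> (poly (K_poly s (P n))) (poly (P n)) = L2_inner \<mu> (%x. \<Sum>j<n. ?c j*e j x) (poly (K_poly s (P n)))"
   unfolding SP[symmetric] S_def by (rule L2_inner_commute)
  also have "... = (\<Sum>j<n. ?c j*L2_inner \<mu> (poly (K_poly s (P n))) (e j))"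
   by (intro inner_partial2 L2_jacobi_poly s1) simp
  also have "... = (\<Sum>j<n. ?c j*(ev j*L2_inner \<mu> (%x. \<Sum>j<n. ?c j*e j x) (e j)))"
   unfolding K_poly_inner[OF s] SP[symmetric] S_def ..
  also have "... = (\<Sum>j<n. ev j*(?c j)\<^sup>2)"
   by (intro sum.cong refl) (simp add: inner_partial power2_eq_square)
  finally show ?thesis .
 qed
 have pos: "0 <= ev j*(?c j)\<^sup>2" for j using K_eigenvalue_pos[OF s, of j] by simp
 define G where "G = contraction*(\<Sum>j. ev j*(?c j)\<^sup>2)/C1 s"
 have bound: "potential_form i (S n) <= G" for n
 proof -
  have "C1 s*potential_form i (S n) <= contraction*(\<Sum>j<n. ev j*(?c j)\<^sup>2)"
   using potential_form_poly[OF i, of "P n"] unfolding en SP by (simp add: pos sum_nonneg)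
  also have "... <= contraction*(\<Sum>j. ev j*(?c j)\<^sup>2)"
   using contraction by (intro mult_left_mono sum_le_suminf E) (auto simp: pos)
  finally show ?thesis unfolding G_def using C1_pos[OF s] by (simp add: field_simps)
 qed
 have mm: "?m = (%z. \<Sum>k\<in>{..<M} - {i}. hl i powr (2 * s)*hl k*(jacobi s z * kern_mass i k z))"
  unfolding potential_def by (simp add: sum_distrib_left mult_ac)
 have k: "(%z. c*(jacobi s z * kern_mass i k z)) \<in> borel_measurable lebesgue" for c k
  by (rule borel_measurable_times[OF borel_measurable_const kern_mass_weight_measurable])
 have mM: "?m \<in> borel_measurable lebesgue"
  unfolding mm by (intro borel_measurable_sum k)
 have mv: "(%z. ?m z * v z) \<in> L2 \<mu>"
 proof (rule L2_bounded_mult[OF _ _ v])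
  show "?m \<in> borel_measurable \<mu>"
   using mM by simp
  show "\<bar>?m z\<bar> <= (\<Sum>k\<in>{..<M} - {i}. hl i powr (2 * s)*hl k*(kern_bound*measure \<nu> UNIV))" for z
  proof -
   have "\<bar>?m z\<bar> <= (\<Sum>k\<in>{..<M} - {i}. \<bar>hl i powr (2 * s)*hl k*(jacobi s z * kern_mass i k z)\<bar>)"
    unfolding fun_cong[OF mm, of z] by (rule sum_abs)
   also have "... <= (\<Sum>k\<in>{..<M} - {i}. hl i powr (2 * s)*hl k*(kern_bound*measure \<nu> UNIV))"
   proof (rule sum_mono)
    fix k assume k: "k \<in> {..<M} - {i}"
    have "\<bar>hl i powr (2 * s)*hl k*(jacobi s z * kern_mass i k z)\<bar> = hl i powr (2 * s)*hl k*\<bar>jacobi s z * kern_mass i k z\<bar>"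
     unfolding abs_mult[of "hl i powr (2 * s)*hl k"] using hl_pos[of k] k by simp
    also have "... <= hl i powr (2 * s)*hl k*(kern_bound*measure \<nu> UNIV)"
     using hl_pos[of k] k i by (intro mult_left_mono kern_mass_weight_bounded) auto
    finally show "\<bar>hl i powr (2 * s)*hl k*(jacobi s z * kern_mass i k z)\<bar> <= ..." .
   qed
   finally show ?thesis .
  qed
 qed
 have form: "potential_form i u = (LINT z|\<mu>. ?m z*(u z)\<^sup>2)" "integrable \<mu> (%z. ?m z*(u z)\<^sup>2)" if u: "u \<in> L2 \<mu>" for u
 proof -
  have m: "(%z. ?m z*(u z)\<^sup>2) \<in> borel_measurable lebesgue"
   using u by (intro borel_measurable_times[OF mM] borel_measurable_power) (auto dest!: L2_measurable)
  have eq: "(jacobi s z*u z)\<^sup>2*potential i z = jacobi s z*(?m z*(u z)\<^sup>2)" for z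
   by (simp add: power2_eq_square mult_ac)
  show "potential_form i u = (LINT z|\<mu>. ?m z*(u z)\<^sup>2)"
   unfolding potential_form_def eq by (rule integral_jacobi_0(1)[OF m])
  show "integrable \<mu> (%z. ?m z*(u z)\<^sup>2)"
   using potential_form_sum(2)[OF i u] unfolding eq integral_jacobi_0(2)[OF m] .
 qed
 have half: "L2_inner \<mu> (S n) (%z. ?m z * v z) <= (G + potential_form i v)/2" for n
 proof -
  have "L2_inner \<mu> (S n) (%z. ?m z * v z) <= (LINT z|\<mu>. (?m z*(S n z)\<^sup>2 + ?m z*(v z)\<^sup>2)/2)"
   unfolding L2_inner_def
  proof (rule integral_mono)
   show "integrable \<mu> (%z. S n z*(?m z * v z))" by (rule L2_mult[OF Ssq mv])
   show "integrable \<mu> (%z. (?m z*(S n z)\<^sup>2 + ?m z*(v z)\<^sup>2)/2)"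
    by (intro integrable_divide Bochner_Integration.integrable_add form(2) Ssq v)
   fix z
   have "?m z*(2*S n z * v z) <= ?m z*((S n z)\<^sup>2 + (v z)\<^sup>2)"
    by (intro mult_left_mono sum_squares_bound mult_nonneg_nonneg potential_nonneg i) simp
   then show "S n z*(?m z * v z) <= (?m z*(S n z)\<^sup>2 + ?m z*(v z)\<^sup>2)/2"
    by (simp add: algebra_simps)
  qed
  also have "... = (potential_form i (S n) + potential_form i v)/2"
   using form[OF Ssq] form[OF v] by simp
  also have "... <= (G + potential_form i v)/2" using bound[of n] by simp
  finally show ?thesis .
 qed
 have "L2_inner \<mu> v (%z. ?m z * v z) <= (G + potential_form i v)/2"
  by (rule LIMSEQ_le_const2[OF L2_inner_tendsto[OF Ssq v mv conv]]) (use half in blast)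
 moreover have "L2_inner \<mu> v (%z. ?m z * v z) = potential_form i v"
  unfolding form(1)[OF v] L2_inner_def by (simp add: power2_eq_square mult_ac)
 ultimately have "potential_form i v <= G" by simp
 then show ?thesis unfolding G_def using C1_pos[OF s] by (simp add: field_simps)
qed

end

text \<open>The increments are summed as a geometric series.\<close>

lemma L2_geometric_limit:
 assumes M: "finite_measure M" and S: "!!n. S n \<in> L2 M"
  and step: "!!n. L2_norm M (%x. S (Suc n) x - S n x) <= C*r^n" and r: "0 <= r" "r < 1"
 obtains v where "v \<in> L2 M" "(%n. L2_norm M (%x. S n x - v x)) \<longlonglongrightarrow> 0"
proof -
 have C: "0 <= C" using order_trans[OF L2_norm_nonneg step[of 0]] by simp
 have d: "L2_norm M (%x. S (n + k) x - S n x) <= C*r^n/(1 - r)*(1 - r^k)" for n k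
 proof (induction k)
  case 0
  show ?case by (simp add: L2_norm_def)
 next
  case (Suc k)
  have "L2_norm M (%x. S (n + Suc k) x - S n x) <= L2_norm M (%x. S (n + Suc k) x - S (n + k) x) + L2_norm M (%x. S (n + k) x - S n x)"
   by (intro L2_norm_triangle_diff S)
  also have "... <= C*r^(n + k) + C*r^n/(1 - r)*(1 - r^k)"
   using step[of "n + k"] Suc by simp
  also have "... = C*r^n/(1 - r)*(1 - r^Suc k)"
   using r by (simp add: field_simps power_add)
  finally show ?case .
 qed
 show thesis
 proof (rule L2_complete[OF M S])
  show "L2_norm M (%x. S m x - S n x) <= C/(1 - r)*r^n" if "n <= m" for m n
  proof -
   have "L2_norm M (%x. S m x - S n x) <= C*r^n/(1 - r)*(1 - r^(m - n))"
    using d[of n "m - n"] that by simp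
   also have "... <= C*r^n/(1 - r)*1"
    using C r by (intro mult_left_mono) auto
   finally show ?thesis by simp
  qed
  show "(%n. C/(1 - r)*r^n) \<longlonglongrightarrow> 0"
   using tendsto_mult_right_zero[OF LIMSEQ_power_zero[of r]] r by simp
 qed (rule that)
qed

lemma (in L2_basis) inner_sums:
 assumes u: "u \<in> L2 M" and w: "w \<in> L2 M"
 shows "(%j. L2_inner M u (e j)*L2_inner M w (e j)) sums L2_inner M u w"
proof -
 have "(%n. L2_inner M (%x. \<Sum>j<n. L2_inner M u (e j)*e j x) w) \<longlonglongrightarrow> L2_inner M u w"
  by (rule L2_inner_tendsto[OF partial_sq u w expansion_tendsto[OF u]])
 then show ?thesis unfolding sums_def by (simp add: inner_partial2[OF _ w])
qed

context multi_interval
begin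

sublocale basis: L2_basis "jacobi_measure s" "normalized_gegenbauer s"
 by (rule gegenbauer_basis[OF s1(2)])

lemma ev_pos: "0 < ev j" by (rule K_eigenvalue_pos[OF s])

lemma ev_lower: obtains c where "0 < c" "!!j. c <= ev j"
proof -
 obtain c1 where c1: "0 < c1" "!!n. c1*(1 + (real n)\<^sup>2) powr s <= ev n" by (rule K_eigenvalue_bounds[OF s]) blast
 have "c1 <= ev j" for j
 proof -
  have "c1*1 <= c1*(1 + (real j)\<^sup>2) powr s"
   using c1(1) s by (intro mult_left_mono ge_one_powr_ge_zero) auto
  then show ?thesis using c1(2)[of j] by simp
 qed
 then show thesis using that c1(1) by blast
qed

definition scale :: "nat => real" where "scale i = hl i powr (1 + 2 * s)"

lemma scale_pos: "i < M ==> 0 < scale i" using hl_pos[of i] by (simp add: scale_def)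

text \<open>The remainder on the \<open>i\<close>-th interval in reference coordinates; \<open>scale k\<close>
 collects the factors that weight and volume produce under the map to the \<open>k\<close>-th interval.\<close>

definition remainder :: "nat => (nat => real => real) => real => real" where
 "remainder i v z = (\<Sum>k\<in>{..<M} - {i}. - C1 s * scale k*coupling i k (v k) z)"

text \<open>The factors \<open>scale i\<close> turn the energies on the reference interval into the energies on the
 intervals themselves, for which the remainder is symmetric.\<close>

definition energy :: "(nat => real => real) => real" where
 "energy v = (\<Sum>i<M. scale i*(\<Sum>j. ev j*(L2_inner \<mu> (v i) (e j))\<^sup>2))"

definition finite_energy :: "(nat => real => real) => bool" where
 "finite_energy v \<longleftrightarrow> (\<forall>i<M. v i \<in> L2 \<mu> \<and> summable (%j. ev j*(L2_inner \<mu> (v i) (e j))\<^sup>2))"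

definition system_solution :: "(nat => real => real) => (nat => real => real) => bool" where
 "system_solution F v \<longleftrightarrow> (\<forall>i<M. v i \<in> L2 \<mu> \<and>
   (\<forall>j. ev j*L2_inner \<mu> (v i) (e j) = L2_inner \<mu> (F i) (e j) - L2_inner \<mu> (remainder i v) (e j)))"

lemma remainder_sq:
 assumes "i < M" "!!k. k < M ==> v k \<in> L2 \<mu>"
 shows "remainder i v \<in> L2 \<mu>"
 unfolding remainder_def[abs_def] using assms
 by (intro L2_sum L2_scale coupling_L2) auto

lemma remainder_inner:
 assumes "i < M" "!!k. k < M ==> v k \<in> L2 \<mu>" "w \<in> L2 \<mu>"
 shows "L2_inner \<mu> (remainder i v) w = (\<Sum>k\<in>{..<M} - {i}. - C1 s * scale k*L2_inner \<mu> (coupling i k (v k)) w)"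
proof -
 have "L2_inner \<mu> (remainder i v) w = (\<Sum>k\<in>{..<M} - {i}. L2_inner \<mu> (%z. - C1 s * scale k*coupling i k (v k) z) w)"
  unfolding remainder_def[abs_def] using assms
  by (intro L2_inner_sum_left L2_scale coupling_L2) auto
 then show ?thesis by (simp only: L2_inner_scale_left)
qed

lemma remainder_diff:
 assumes "i < M" "!!k. k < M ==> v k \<in> L2 \<mu>" "!!k. k < M ==> w k \<in> L2 \<mu>"
 shows "remainder i (%k x. v k x - w k x) = (%z. remainder i v z - remainder i w z)"
proof
 fix z
 have "coupling i k (%x. v k x - w k x) z = coupling i k (v k) z - coupling i k (w k) z" if "k \<in> {..<M} - {i}" for k
  using that assms by (intro coupling_diff) auto
 then have "remainder i (%k x. v k x - w k x) z = (\<Sum>k\<in>{..<M} - {i}. - C1 s * scale k*(coupling i k (v k) z - coupling i k (w k) z))"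
  unfolding remainder_def by (intro sum.cong refl) simp
 then show "remainder i (%k x. v k x - w k x) z = remainder i v z - remainder i w z"
  unfolding remainder_def sum_subtractf[symmetric] by (simp only: right_diff_distrib)
qed

text \<open>The two terms of \<open>coupling_am_gm\<close>, taken with \<open>hl i powr (2 s)\<close> and \<open>hl k
 powr (2 s)\<close>, sum over the other intervals to the potential forms of \<open>u\<close> and
 \<open>v\<close>.\<close>

lemma remainder_pairing:
 assumes v: "finite_energy v" and u: "finite_energy u"
 shows "\<bar>\<Sum>i<M. scale i*L2_inner \<mu> (remainder i v) (u i)\<bar> <= contraction/2*(energy u + energy v)"
proof -
 have vs: "v k \<in> L2 \<mu>" and us: "u k \<in> L2 \<mu>" if "k < M" for k
  using that u v by (auto simp: finite_energy_def)
 have C: "0 < C1 s" by (rule C1_pos[OF s])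
 have pf: "scale i*(C1 s*potential_form i (w i)) <= contraction*(scale i*(\<Sum>j. ev j*(L2_inner \<mu> (w i) (e j))\<^sup>2))"
  if w: "finite_energy w" and i: "i < M" for w i
 proof -
  have "C1 s*potential_form i (w i) <= contraction*(\<Sum>j. ev j*(L2_inner \<mu> (w i) (e j))\<^sup>2)"
   using w i by (intro potential_form_energy) (auto simp: finite_energy_def)
  then have "scale i*(C1 s*potential_form i (w i)) <= scale i*(contraction*(\<Sum>j. ev j*(L2_inner \<mu> (w i) (e j))\<^sup>2))"
   using scale_pos[OF i] by (intro mult_left_mono) auto
  then show ?thesis by (simp add: mult_ac)
 qed
 define P where "P = (%i k w. C1 s * scale i*(hl i powr (2 * s)*hl k * kern_form i k (w i)))"
 have Psum: "(\<Sum>i<M. \<Sum>k\<in>{..<M} - {i}. P i k w) <= contraction*energy w" if w: "finite_energy w" for w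
 proof -
  have "(\<Sum>i<M. \<Sum>k\<in>{..<M} - {i}. P i k w) = (\<Sum>i<M. scale i*(C1 s*potential_form i (w i)))"
  proof (rule sum.cong[OF refl])
   fix i assume i: "i \<in> {..<M}"
   have "(\<Sum>k\<in>{..<M} - {i}. P i k w) = C1 s * scale i*potential_form i (w i)"
    unfolding P_def using w i by (subst potential_form_sum(1)) (auto simp: finite_energy_def sum_distrib_left)
   then show "(\<Sum>k\<in>{..<M} - {i}. P i k w) = scale i*(C1 s*potential_form i (w i))" by (simp only: mult_ac)
  qed
  also have "... <= (\<Sum>i<M. contraction*(scale i*(\<Sum>j. ev j*(L2_inner \<mu> (w i) (e j))\<^sup>2)))"
   by (intro sum_mono pf w) simp
  also have "... = contraction*energy w" unfolding energy_def by (rule sum_distrib_left[symmetric])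
  finally show ?thesis .
 qed
 have pair: "scale i*\<bar>- C1 s * scale k*L2_inner \<mu> (coupling i k (v k)) (u i)\<bar> <= (P i k u + P k i v)/2"
  if ik: "i < M" "k < M" "i ~= k" for i k
 proof -
  let ?T = "\<bar>L2_inner \<mu> (coupling i k (v k)) (u i)\<bar>"
  have h: "0 < hl i" "0 < hl k" using hl_pos ik by auto
  have sc: "scale i = hl i*hl i powr (2 * s)" "scale k = hl k*hl k powr (2 * s)"
   using h by (simp_all add: scale_def powr_add)
  have A: "hl i powr (2 * s)*hl k powr (2 * s)*?T
   <= ((hl i powr (2 * s))\<^sup>2 * kern_form i k (u i) + (hl k powr (2 * s))\<^sup>2 * kern_form k i (v k))/2"
   using h by (intro coupling_am_gm ik vs us) auto
  have "scale i*\<bar>- C1 s * scale k*L2_inner \<mu> (coupling i k (v k)) (u i)\<bar>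
   = C1 s*hl i*hl k*(hl i powr (2 * s)*hl k powr (2 * s)*?T)"
  proof -
   have r: "x*p*(c*(y*q)*t) = c*x*y*(p*q*t)" for x y p q c t :: real by (simp add: mult_ac)
   have "\<bar>- C1 s * scale k*L2_inner \<mu> (coupling i k (v k)) (u i)\<bar> = C1 s * scale k*?T"
    using C scale_pos[OF ik(2)] by (simp add: abs_mult)
   then show ?thesis unfolding sc by (simp only: r)
  qed
  also have "... <= C1 s*hl i*hl k*(((hl i powr (2 * s))\<^sup>2 * kern_form i k (u i) + (hl k powr (2 * s))\<^sup>2 * kern_form k i (v k))/2)"
   using C h by (intro mult_left_mono A) auto
  also have "... = (P i k u + P k i v)/2"
  proof -
   have "c*x*y*((p\<^sup>2*A + q\<^sup>2*B)/2) = (c*(x*p)*(p*y*A) + c*(y*q)*(q*x*B))/2" for c x y p q A B :: real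
    by (simp add: power2_eq_square field_simps)
   then show ?thesis unfolding P_def sc by blast
  qed
  finally show ?thesis .
 qed
 have "\<bar>\<Sum>i<M. scale i*L2_inner \<mu> (remainder i v) (u i)\<bar> <= (\<Sum>i<M. \<bar>scale i*L2_inner \<mu> (remainder i v) (u i)\<bar>)"
  by (rule sum_abs)
 also have "... <= (\<Sum>i<M. \<Sum>k\<in>{..<M} - {i}. (P i k u + P k i v)/2)"
 proof (rule sum_mono)
  fix i assume i: "i \<in> {..<M}"
  have "\<bar>scale i*L2_inner \<mu> (remainder i v) (u i)\<bar> = scale i*\<bar>\<Sum>k\<in>{..<M} - {i}. - C1 s * scale k*L2_inner \<mu> (coupling i k (v k)) (u i)\<bar>"
   using i scale_pos[of i] vs us by (subst remainder_inner) (auto simp: abs_mult)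
  also have "... <= scale i*(\<Sum>k\<in>{..<M} - {i}. \<bar>- C1 s * scale k*L2_inner \<mu> (coupling i k (v k)) (u i)\<bar>)"
   using scale_pos[of i] i by (intro mult_left_mono sum_abs) auto
  also have "... <= (\<Sum>k\<in>{..<M} - {i}. (P i k u + P k i v)/2)"
   unfolding sum_distrib_left using i by (intro sum_mono pair) auto
  finally show "\<bar>scale i*L2_inner \<mu> (remainder i v) (u i)\<bar> <= (\<Sum>k\<in>{..<M} - {i}. (P i k u + P k i v)/2)" .
 qed
 also have "... = ((\<Sum>i<M. \<Sum>k\<in>{..<M} - {i}. P i k u) + (\<Sum>i<M. \<Sum>k\<in>{..<M} - {i}. P k i v))/2"
  by (simp add: sum.distrib flip: sum_divide_distrib)
 also have "(\<Sum>i<M. \<Sum>k\<in>{..<M} - {i}. P k i v) = (\<Sum>i<M. \<Sum>k<M. if i = k then 0 else P k i v)"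
  by (intro sum.cong refl sum.mono_neutral_cong_left) auto
 also have "... = (\<Sum>k<M. \<Sum>i<M. if i = k then 0 else P k i v)" by (rule sum.swap)
 also have "... = (\<Sum>k<M. \<Sum>i\<in>{..<M} - {k}. P k i v)"
  by (intro sum.cong refl sum.mono_neutral_cong_right) auto
 also have "((\<Sum>i<M. \<Sum>k\<in>{..<M} - {i}. P i k u) + ...)/2 <= (contraction*energy u + contraction*energy v)/2"
  by (intro divide_right_mono add_mono Psum u v) simp
 also have "... = contraction/2*(energy u + energy v)" by (simp add: distrib_left)
 finally show ?thesis .
qed

lemma energy_norm:
 assumes v: "finite_energy v" and i: "i < M" and c: "0 < c" "!!j. c <= ev j"
 shows "scale i*c*(L2_norm \<mu> (v i))\<^sup>2 <= energy v"
proof -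
 have sm: "summable (%j. ev j*(L2_inner \<mu> (v k) (e j))\<^sup>2)" "v k \<in> L2 \<mu>" if "k < M" for k
  using v that by (auto simp: finite_energy_def)
 have "c*(L2_norm \<mu> (v i))\<^sup>2 = (\<Sum>j. c*(L2_inner \<mu> (v i) (e j))\<^sup>2)"
  using sums_mult[OF basis.Parseval[OF sm(2)[OF i]], of c] by (simp add: sums_iff)
 also have "... <= (\<Sum>j. ev j*(L2_inner \<mu> (v i) (e j))\<^sup>2)"
  using basis.Bessel[OF sm(2)[OF i]] sm(1)[OF i] c by (intro suminf_le mult_right_mono summable_mult) auto
 finally have "scale i*(c*(L2_norm \<mu> (v i))\<^sup>2) <= scale i*(\<Sum>j. ev j*(L2_inner \<mu> (v i) (e j))\<^sup>2)"
  using scale_pos[OF i] by (intro mult_left_mono) auto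
 also have "... <= energy v"
  unfolding energy_def using i scale_pos ev_pos sm
  by (intro member_le_sum mult_nonneg_nonneg suminf_nonneg) (auto simp: less_imp_le)
 finally show ?thesis by (simp add: mult.assoc)
qed

abbreviation "rate \<equiv> contraction/(2 - contraction)"

lemma rate: "0 < rate" "rate < 1" using contraction by auto

text \<open>Pairing the equation with \<open>w\<close> gives \<open>E w \<le> \<theta> / 2 (E w + E v)\<close>; solve
 for \<open>E w\<close>.\<close>

lemma energy_contraction:
 assumes v: "finite_energy v" and w: "finite_energy w"
  and eq: "!!i j. i < M ==> ev j*L2_inner \<mu> (w i) (e j) = - L2_inner \<mu> (remainder i v) (e j)"
 shows "energy w <= rate*energy v"
proof -
 have vs: "v k \<in> L2 \<mu>" and ws: "w k \<in> L2 \<mu>" if "k < M" for k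
  using that w v by (auto simp: finite_energy_def)
 have "(\<Sum>j. ev j*(L2_inner \<mu> (w i) (e j))\<^sup>2) = - L2_inner \<mu> (remainder i v) (w i)" if i: "i < M" for i
 proof -
  have "ev j*(L2_inner \<mu> (w i) (e j))\<^sup>2 = - (L2_inner \<mu> (remainder i v) (e j)*L2_inner \<mu> (w i) (e j))" for j
   using eq[OF i, of j] by (simp add: power2_eq_square flip: mult.assoc)
  then show ?thesis
   using sums_minus[OF basis.inner_sums[OF remainder_sq[OF i vs] ws[OF i]]] by (simp add: sums_iff)
 qed
 then have "energy w = - (\<Sum>i<M. scale i*L2_inner \<mu> (remainder i v) (w i))"
  unfolding energy_def by (simp add: sum_negf[symmetric])
 also have "... <= contraction/2*(energy w + energy v)"
  using remainder_pairing[OF v w] by linarith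
 finally have "(2 - contraction)*energy w <= contraction*energy v" by (simp add: algebra_simps)
 then show ?thesis using contraction by (simp add: field_simps)
qed

lemma K_inverse:
 assumes g: "g \<in> L2 \<mu>"
 shows "\<exists>w\<in>L2 \<mu>. (\<forall>j. ev j*L2_inner \<mu> w (e j) = L2_inner \<mu> g (e j))"
proof -
 obtain c where c: "0 < c" "!!j. c <= ev j" by (rule ev_lower) blast
 have "summable (%j. (L2_inner \<mu> g (e j)/ev j)\<^sup>2)"
 proof (rule summable_comparison_test')
  show "summable (%j. (1/c)\<^sup>2*(L2_inner \<mu> g (e j))\<^sup>2)" by (intro summable_mult basis.Bessel g)
  show "norm ((L2_inner \<mu> g (e j)/ev j)\<^sup>2) <= (1/c)\<^sup>2*(L2_inner \<mu> g (e j))\<^sup>2" if "0 <= j" for j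
  proof -
   have "(1/ev j)\<^sup>2 <= (1/c)\<^sup>2" using c ev_pos[of j] by (intro power_mono divide_left_mono) auto
   from mult_right_mono[OF this, of "(L2_inner \<mu> g (e j))\<^sup>2"] show ?thesis by (simp add: power_divide)
  qed
 qed
 then obtain w where "w \<in> L2 \<mu>" "!!j. L2_inner \<mu> w (e j) = L2_inner \<mu> g (e j)/ev j"
  by (rule basis.Riesz_Fischer) blast
 moreover have "ev j ~= 0" for j using ev_pos[of j] by simp
 ultimately show ?thesis by (intro bexI[of _ w]) auto
qed

text \<open>If \<open>K w\<close> is represented by a square-integrable \<open>g\<close>, the energy of
 \<open>w\<close> is the convergent pairing of \<open>g\<close> with \<open>w\<close>.\<close>

lemma finite_energyI:
 assumes "!!i. i < M ==> w i \<in> L2 \<mu>" "!!i. i < M ==> g i \<in> L2 \<mu>"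
  and eq: "!!i j. i < M ==> ev j*L2_inner \<mu> (w i) (e j) = L2_inner \<mu> (g i) (e j)"
 shows "finite_energy w"
 unfolding finite_energy_def
proof (intro allI impI conjI assms(1))
 fix i assume i: "i < M"
 have "ev j*(L2_inner \<mu> (w i) (e j))\<^sup>2 = L2_inner \<mu> (g i) (e j)*L2_inner \<mu> (w i) (e j)" for j
  using eq[OF i, of j] by (simp add: power2_eq_square flip: mult.assoc)
 then show "summable (%j. ev j*(L2_inner \<mu> (w i) (e j))\<^sup>2)"
  using sums_summable[OF basis.inner_sums[OF assms(2,1)[OF i]]] by simp
qed

lemma finite_energy_diff_step:
 assumes w: "!!i. i < M ==> w i \<in> L2 \<mu>" and w': "!!i. i < M ==> w' i \<in> L2 \<mu>"
  and v: "!!i. i < M ==> v i \<in> L2 \<mu>" and v': "!!i. i < M ==> v' i \<in> L2 \<mu>"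
  and eq: "!!i j. i < M ==> ev j*L2_inner \<mu> (w i) (e j) = L2_inner \<mu> (F i) (e j) - L2_inner \<mu> (remainder i v) (e j)"
  and eq': "!!i j. i < M ==> ev j*L2_inner \<mu> (w' i) (e j) = L2_inner \<mu> (F i) (e j) - L2_inner \<mu> (remainder i v') (e j)"
 shows "finite_energy (%i x. w i x - w' i x)"
  "i < M ==> ev j*L2_inner \<mu> (%x. w i x - w' i x) (e j) = - L2_inner \<mu> (remainder i (%i x. v i x - v' i x)) (e j)"
proof -
 have R: "ev j*L2_inner \<mu> (%x. w i x - w' i x) (e j) = L2_inner \<mu> (%x. remainder i v' x - remainder i v x) (e j)" if i: "i < M" for i j
  using eq[OF i, of j] eq'[OF i, of j]
  by (simp add: L2_inner_diff_left[OF w[OF i] w'[OF i] basis.e_sq] L2_inner_diff_left[OF remainder_sq[OF i v'] remainder_sq[OF i v] basis.e_sq] right_diff_distrib)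
 show "finite_energy (%i x. w i x - w' i x)"
  by (rule finite_energyI[where g="%i x. remainder i v' x - remainder i v x"])
   (auto intro!: L2_diff w w' remainder_sq v v' R)
 show "ev j*L2_inner \<mu> (%x. w i x - w' i x) (e j) = - L2_inner \<mu> (remainder i (%i x. v i x - v' i x)) (e j)" if i: "i < M"
  unfolding R[OF i] remainder_diff[of i v v', OF i v v', simplified]
  by (simp add: L2_inner_diff_left[OF remainder_sq[OF i v'] remainder_sq[OF i v] basis.e_sq] L2_inner_diff_left[OF remainder_sq[OF i v] remainder_sq[OF i v'] basis.e_sq])
qed

text \<open>The difference of two solutions is a fixed point of the energy contraction, so its energy vanishes; the
 eigenvalues are bounded below, so the difference vanishes too.\<close>

theorem system_unique:
 assumes v: "system_solution F v" and w: "system_solution F w" and i: "i < M"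
 shows "AE x in \<mu>. v i x = w i x"
proof -
 have vs: "v k \<in> L2 \<mu>" and ws: "w k \<in> L2 \<mu>" if "k < M" for k
  using that w v by (auto simp: system_solution_def)
 let ?d = "%i x. v i x - w i x"
 have d: "finite_energy ?d"
  by (rule finite_energy_diff_step(1)[of v w v w F]) (use v w in \<open>auto simp: system_solution_def\<close>)
 have eq: "ev j*L2_inner \<mu> (?d i) (e j) = - L2_inner \<mu> (remainder i ?d) (e j)" if "i < M" for i j
  by (rule finite_energy_diff_step(2)[of v w v w F]) (use v w that in \<open>auto simp: system_solution_def\<close>)
 obtain c where c: "0 < c" "!!j. c <= ev j" by (rule ev_lower) blast
 have "energy ?d <= rate*energy ?d" by (rule energy_contraction[OF d d eq])
 then have "(1 - rate)*energy ?d <= 0" by (simp add: left_diff_distrib)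
 then have "energy ?d <= 0" using rate by (simp add: mult_le_0_iff)
 then have "scale i*c*(L2_norm \<mu> (?d i))\<^sup>2 <= 0" using energy_norm[OF d i c] by simp
 then have "L2_norm \<mu> (?d i) = 0" using scale_pos[OF i] c(1) by (simp add: mult_le_0_iff)
 then have "AE x in \<mu>. ?d i x = 0" by (intro L2_norm_eq_0 L2_diff vs ws i)
 then show ?thesis by eventually_elim simp
qed

lemma coupling_inner_tendsto:
 assumes ik: "i < M" "k < M" "i ~= k" and V: "!!n. V n \<in> L2 \<mu>" and v: "v \<in> L2 \<mu>"
  and lim: "(%n. L2_norm \<mu> (%x. V n x - v x)) \<longlonglongrightarrow> 0" and w: "w \<in> L2 \<mu>"
 shows "(%n. L2_inner \<mu> (coupling i k (V n)) w) \<longlonglongrightarrow> L2_inner \<mu> (coupling i k v) w"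
proof (rule L2_inner_tendsto[OF coupling_L2[OF ik V] coupling_L2[OF ik v] w])
 let ?B = "kern_bound*measure \<mu> UNIV"
 have "norm (L2_norm \<mu> (%x. coupling i k (V n) x - coupling i k v x)) <= ?B*L2_norm \<mu> (%x. V n x - v x)" for n
  using coupling_norm[OF ik L2_diff[OF V v]] by (simp add: coupling_diff[OF ik V v, symmetric] abs_of_nonneg)
 moreover have "(%n. ?B*L2_norm \<mu> (%x. V n x - v x)) \<longlonglongrightarrow> 0" by (rule tendsto_mult_right_zero[OF lim])
 ultimately show "(%n. L2_norm \<mu> (%x. coupling i k (V n) x - coupling i k v x)) \<longlonglongrightarrow> 0"
  by (rule Lim_null_comparison[OF always_eventually[OF allI]])
qed

text \<open>Existence: the fixed point iteration \<open>v \<mapsto> K\<^sup>-\<^sup>1 (F - R v)\<close> contracts the energy of differences.\<close>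

theorem system_solvable:
 assumes F: "!!i. i < M ==> F i \<in> L2 \<mu>"
 shows "\<exists>v. system_solution F v"
proof -
 define inv where "inv = (%g. SOME w. w \<in> L2 \<mu> \<and> (\<forall>j. ev j*L2_inner \<mu> w (e j) = L2_inner \<mu> g (e j)))"
 have inv: "inv g \<in> L2 \<mu> \<and> (\<forall>j. ev j*L2_inner \<mu> (inv g) (e j) = L2_inner \<mu> g (e j))" if "g \<in> L2 \<mu>" for g
  unfolding inv_def by (rule someI_ex[OF K_inverse[OF that, unfolded Bex_def]])
 define V where "V = rec_nat (%i x. 0) (%_ v i. inv (%z. F i z - remainder i v z))"
 have V0: "V 0 = (%i x. 0)" and VS: "V (Suc n) i = inv (%z. F i z - remainder i (V n) z)" for n i
  unfolding V_def by simp_all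
 have Vsq: "V n i \<in> L2 \<mu>" if "i < M" for n i
  using that
 proof (induction n arbitrary: i)
  case 0
  then show ?case by (simp add: V0 L2_zero)
 next
  case (Suc n)
  then show ?case unfolding VS using inv[OF L2_diff[OF F remainder_sq]] by blast
 qed
 have Veq: "ev j*L2_inner \<mu> (V (Suc n) i) (e j) = L2_inner \<mu> (F i) (e j) - L2_inner \<mu> (remainder i (V n)) (e j)" if i: "i < M" for n i j
  using inv[OF L2_diff[OF F[OF i] remainder_sq[OF i Vsq]]]
  by (simp add: VS L2_inner_diff_left[OF F[OF i] remainder_sq[OF i Vsq] basis.e_sq])
 (* The starting value solves no equation, so differences are taken from the first iterate on. *)
 let ?D = "%n i x. V (Suc (Suc n)) i x - V (Suc n) i x"
 note step = finite_energy_diff_step[OF Vsq Vsq Vsq Vsq Veq Veq]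
 have fe: "finite_energy (?D n)" for n by (rule step(1))
 have contr: "energy (?D (Suc n)) <= rate*energy (?D n)" for n
  by (rule energy_contraction[OF fe fe]) (rule step(2))
 have En: "energy (?D n) <= rate^n*energy (?D 0)" for n
 proof (induction n)
  case (Suc n)
  have "energy (?D (Suc n)) <= rate*energy (?D n)" by (rule contr)
  also have "... <= rate*(rate^n*energy (?D 0))" using rate by (intro mult_left_mono Suc) auto
  finally show ?case by (simp add: mult.assoc)
 qed simp
 obtain c where c: "0 < c" "!!j. c <= ev j" by (rule ev_lower) blast
 have ex: "\<exists>v. v \<in> L2 \<mu> \<and> (%n. L2_norm \<mu> (%x. V (Suc n) i x - v x)) \<longlonglongrightarrow> 0" if i: "i < M" for i
 proof -
  let ?C = "sqrt (energy (?D 0)/(scale i*c))"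
  have "L2_norm \<mu> (?D n i) <= ?C * sqrt rate^n" for n
  proof -
   have "scale i*c*(L2_norm \<mu> (?D n i))\<^sup>2 <= rate^n*energy (?D 0)"
    using energy_norm[OF fe i c, of n] En[of n] by simp
   then have "(L2_norm \<mu> (?D n i))\<^sup>2 <= energy (?D 0)/(scale i*c)*rate^n"
   proof -
    have "x <= E/r*q" if "r*x <= q*E" "0 < r" for x E r q :: real
     using that by (simp add: pos_le_divide_eq mult_ac)
    then show ?thesis using scale_pos[OF i] c(1) \<open>scale i * c * _ \<le> _\<close> by simp
   qed
   then have "L2_norm \<mu> (?D n i) <= sqrt (energy (?D 0)/(scale i*c)*rate^n)" by (rule real_le_rsqrt)
   then show ?thesis by (simp only: real_sqrt_mult real_sqrt_power)
  qed
  moreover have "0 <= sqrt rate" "sqrt rate < 1" using rate by auto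
  ultimately obtain v where "v \<in> L2 \<mu>" "(%n. L2_norm \<mu> (%x. V (Suc n) i x - v x)) \<longlonglongrightarrow> 0"
   using L2_geometric_limit[of \<mu> "%n. V (Suc n) i", OF basis.finite_measure_axioms Vsq[OF i]] by blast
  then show ?thesis by blast
 qed
 define v where "v = (%i. SOME v. v \<in> L2 \<mu> \<and> (%n. L2_norm \<mu> (%x. V (Suc n) i x - v x)) \<longlonglongrightarrow> 0)"
 have v: "v i \<in> L2 \<mu>" "(%n. L2_norm \<mu> (%x. V (Suc n) i x - v i x)) \<longlonglongrightarrow> 0" if i: "i < M" for i
  using someI_ex[OF ex[OF i]] unfolding v_def by blast+
 have "ev j*L2_inner \<mu> (v i) (e j) = L2_inner \<mu> (F i) (e j) - L2_inner \<mu> (remainder i v) (e j)" if i: "i < M" for i j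
 proof (rule LIMSEQ_unique)
  have lhs: "(%n. ev j*L2_inner \<mu> (V (Suc n) i) (e j)) \<longlonglongrightarrow> ev j*L2_inner \<mu> (v i) (e j)"
   by (intro tendsto_mult tendsto_const L2_inner_tendsto[OF Vsq[OF i] v(1)[OF i] basis.e_sq v(2)[OF i]])
  then show "(%n. ev j*L2_inner \<mu> (V (Suc (Suc n)) i) (e j)) \<longlonglongrightarrow> ev j*L2_inner \<mu> (v i) (e j)"
   by (rule LIMSEQ_Suc)
  have "(%n. L2_inner \<mu> (remainder i (V (Suc n))) (e j)) \<longlonglongrightarrow> L2_inner \<mu> (remainder i v) (e j)"
  proof -
   have r: "L2_inner \<mu> (remainder i w) (e j) = (\<Sum>k\<in>{..<M} - {i}. - C1 s * scale k*L2_inner \<mu> (coupling i k (w k)) (e j))"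
    if "!!k. k < M ==> w k \<in> L2 \<mu>" for w
    by (rule remainder_inner[OF i that basis.e_sq])
   have "(%n. L2_inner \<mu> (coupling i k (V (Suc n) k)) (e j)) \<longlonglongrightarrow> L2_inner \<mu> (coupling i k (v k)) (e j)" if "k \<in> {..<M} - {i}" for k
    using that i by (intro coupling_inner_tendsto Vsq v basis.e_sq) auto
   moreover have "L2_inner \<mu> (remainder i (V n)) (e j) = (\<Sum>k\<in>{..<M} - {i}. - C1 s * scale k*L2_inner \<mu> (coupling i k (V n k)) (e j))" for n
    by (rule r) (rule Vsq)
   moreover have "L2_inner \<mu> (remainder i v) (e j) = (\<Sum>k\<in>{..<M} - {i}. - C1 s * scale k*L2_inner \<mu> (coupling i k (v k)) (e j))"
    by (rule r) (rule v(1))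
   ultimately show ?thesis by (simp only: tendsto_sum tendsto_mult tendsto_const)
  qed
  then show "(%n. ev j*L2_inner \<mu> (V (Suc (Suc n)) i) (e j)) \<longlonglongrightarrow> L2_inner \<mu> (F i) (e j) - L2_inner \<mu> (remainder i v) (e j)"
   unfolding Veq[OF i] by (intro tendsto_diff tendsto_const)
 qed
 then have "system_solution F v" unfolding system_solution_def by (simp add: v(1))
 then show ?thesis by (rule exI[of _ v])
qed

end

text \<open>The property need not be measurable, so a null set is transported instead.\<close>

lemma AE_lebesgue_affine:
 fixes t c :: real
 assumes c: "c ~= 0" and P: "AE x in lebesgue. P x"
 shows "AE x in lebesgue. P (t + c*x)"
proof -
 obtain N where N: "!!x. x \<in> space lebesgue - N ==> P x" "N \<in> null_sets lebesgue" by (rule AE_E3[OF P]) blast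
 have Ns: "N \<in> sets lebesgue" using N(2) by auto
 have aff: "(%x. t + c*x) \<in> lebesgue \<rightarrow>\<^sub>M lebesgue"
  using lebesgue_affine_measurable[of "%_. c" t] c by simp
 have m: "(%x. indicator N (t + c*x) :: ennreal) \<in> borel_measurable lebesgue"
  by (rule measurable_compose[OF aff borel_measurable_indicator[OF Ns]])
 have "ennreal \<bar>c\<bar>*(\<integral>\<^sup>+x. indicator N (t + c*x) \<partial>lebesgue) = (\<integral>\<^sup>+x. indicator N x \<partial>lebesgue)"
  by (rule nn_integral_real_affine_lebesgue[symmetric, OF borel_measurable_indicator[OF Ns] c])
 also have "... = 0" using N(2) Ns by (simp add: null_setsD1)
 finally have "(\<integral>\<^sup>+x. indicator N (t + c*x) \<partial>lebesgue) = 0" using c by simp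
 then have "AE x in lebesgue. indicator N (t + c*x) = (0 :: ennreal)"
  by (subst (asm) nn_integral_0_iff_AE[OF m])
 then show ?thesis by eventually_elim (use N(1) in \<open>auto simp: indicator_def split: if_splits\<close>)
qed

lemma ae_eq_on_ref_iff:
 assumes ab: "a < b"
 shows "ae_eq_on {a<..<b} u v \<longleftrightarrow> (AE z in jacobi_measure s. ref_fun a b u z = ref_fun a b v z)"
proof -
 define m h where "m = (a + b)/2" and "h = (b - a)/2"
 have h: "h > 0" using ab by (simp add: h_def)
 have X: "affine_map a b z = m + h*z" for z by (simp add: affine_map_def m_def h_def)
 have mem: "m + h*z \<in> {a<..<b} \<longleftrightarrow> z \<in> {-1<..<1}" for z
  unfolding m_def h_def by (rule affine_mem_iff[OF ab])
 show ?thesis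
  unfolding ae_eq_on_def AE_jacobi_iff
 proof
  assume "AE x in lebesgue. x \<in> {a<..<b} --> u x = v x"
  from AE_lebesgue_affine[OF _ this, of h m] h
  have "AE z in lebesgue. m + h*z \<in> {a<..<b} --> u (m + h*z) = v (m + h*z)" by blast
  then show "AE z in lebesgue. z \<in> {-1<..<1} --> ref_fun a b u z = ref_fun a b v z"
  proof eventually_elim
   case (elim z)
   show ?case
   proof
    assume x: "z \<in> {-1<..<1}"
    then have "m + h*z \<in> {a<..<b}" using mem by blast
    with elim show "ref_fun a b u z = ref_fun a b v z" by (simp only: ref_fun_inside[OF x] X)
   qed
  qed
 next
  assume "AE z in lebesgue. z \<in> {-1<..<1} --> ref_fun a b u z = ref_fun a b v z"
  then have A: "AE x in lebesgue. - m/h + 1/h*x \<in> {-1<..<1} --> ref_fun a b u (- m/h + 1/h*x) = ref_fun a b v (- m/h + 1/h*x)"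
   by (rule AE_lebesgue_affine[rotated]) (use h in simp)
  have inv: "m + h*(- m/h + 1/h*x) = x" for x using h by (simp add: field_simps)
  show "AE x in lebesgue. x \<in> {a<..<b} --> u x = v x"
   using A
  proof eventually_elim
   case (elim x)
   show ?case
   proof
    assume "x \<in> {a<..<b}"
    then have "- m/h + 1/h*x \<in> {-1<..<1}" using mem[of "- m/h + 1/h*x"] unfolding inv by blast
    moreover from this elim have "ref_fun a b u (- m/h + 1/h*x) = ref_fun a b v (- m/h + 1/h*x)" by blast
    ultimately show "u x = v x" by (simp only: ref_fun_inside X inv)
   qed
  qed
 qed
qed

context multi_interval
begin

abbreviation "refs u \<equiv> (%i. ref_fun (a i) (b i) u)"

lemma interval_disjoint:
 "i < M ==> k < M ==> x \<in> {a i<..<b i} ==> x \<in> {a k<..<b k} ==> i = k"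
proof (rule ccontr)
 assume *: "i < M" "k < M" "x \<in> {a i<..<b i}" "x \<in> {a k<..<b k}" "i ~= k"
 then have "x \<in> {a i..b i}" "x \<in> {a k..b k}" by simp_all
 then show False using disjoint[OF *(1,2,5)] by blast
qed

lemma union_indicator: "indicator (ivl_union M a b) x = (\<Sum>i<M. indicator {a i<..<b i} x :: real)"
 unfolding ivl_union_def
proof (rule indicator_UN_disjoint)
 show "disjoint_family_on (%i. {a i<..<b i}) {..<M}"
  unfolding disjoint_family_on_def using interval_disjoint lessThan_iff by blast
qed simp

lemma sum_interval:
 fixes g :: "nat => real"
 assumes "k < M" "x \<in> {a k<..<b k}"
 shows "(\<Sum>i<M. indicator {a i<..<b i} x*g i) = g k"
proof -
 have "(\<Sum>i<M. indicator {a i<..<b i} x*g i) = (\<Sum>i<M. if i = k then g i else 0)"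
 proof (rule sum.cong[OF refl])
  fix i assume "i \<in> {..<M}"
  then have "i ~= k ==> x \<notin> {a i<..<b i}" using interval_disjoint[OF _ assms(1) _ assms(2)] by blast
  then show "indicator {a i<..<b i} x*g i = (if i = k then g i else 0)" using assms(2) by (cases "i = k") simp_all
 qed
 then show ?thesis using assms(1) by simp
qed

lemma weight_interval:
 assumes "k < M" "x \<in> {a k<..<b k}"
 shows "weight s M a b x = ivl_weight s (a k) (b k) x"
proof -
 have "weight s M a b x = (\<Sum>i<M. indicator {a i<..<b i} x*((x - a i) powr s*(b i - x) powr s))"
  unfolding weight_def ivl_weight_def by (intro sum.cong refl) (simp only: mult_ac)
 also have "... = (x - a k) powr s*(b k - x) powr s" by (rule sum_interval[OF assms])
 finally show ?thesis using assms(2) by (simp add: ivl_weight_def)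
qed

lemma L2s_iff: "v \<in> L2s s M a b \<longleftrightarrow> (\<forall>i<M. refs v i \<in> L2 \<mu>)"
proof -
 let ?U = "ivl_union M a b" and ?I = "%i. {a i<..<b i}" and ?w = "weight s M a b"
 have sub: "?I i \<subseteq> ?U" if "i < M" for i using that by (auto simp: ivl_union_def)
 have meas: "set_borel_measurable lebesgue ?U v \<longleftrightarrow> (\<forall>i<M. set_borel_measurable lebesgue (?I i) v)"
 proof
  assume m: "set_borel_measurable lebesgue ?U v"
  show "\<forall>i<M. set_borel_measurable lebesgue (?I i) v"
  proof (intro allI impI)
   fix i assume i: "i < M"
   have "(%x. indicator (?I i) x *\<^sub>R (indicator ?U x *\<^sub>R v x)) \<in> borel_measurable lebesgue"
    by (rule borel_measurable_scaleR[OF borel_measurable_indicator]) (use m in \<open>auto simp: set_borel_measurable_def\<close>)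
   also have "(%x. indicator (?I i) x *\<^sub>R (indicator ?U x *\<^sub>R v x)) = (%x. indicator (?I i) x *\<^sub>R v x)"
    using sub[OF i] by (auto simp: fun_eq_iff indicator_def)
   finally show "set_borel_measurable lebesgue (?I i) v" unfolding set_borel_measurable_def .
  qed
 next
  assume "\<forall>i<M. set_borel_measurable lebesgue (?I i) v"
  then have "(%x. \<Sum>i<M. indicator (?I i) x *\<^sub>R v x) \<in> borel_measurable lebesgue"
   unfolding set_borel_measurable_def by (intro borel_measurable_sum) auto
  then show "set_borel_measurable lebesgue ?U v"
   unfolding set_borel_measurable_def union_indicator scaleR_sum_left .
 qed
 have wcong: "set_integrable lebesgue (?I i) (%x. \<bar>v x\<bar>\<^sup>2*?w x) \<longleftrightarrow> set_integrable lebesgue (?I i) (%x. \<bar>v x\<bar>\<^sup>2*ivl_weight s (a i) (b i) x)" if "i < M" for i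
  by (rule set_integrable_cong) (use weight_interval[OF that] in auto)
 have "set_integrable lebesgue ?U (%x. \<bar>v x\<bar>\<^sup>2*?w x) \<longleftrightarrow> (\<forall>i<M. set_integrable lebesgue (?I i) (%x. \<bar>v x\<bar>\<^sup>2*?w x))"
 proof
  assume A: "set_integrable lebesgue ?U (%x. \<bar>v x\<bar>\<^sup>2*?w x)"
  show "\<forall>i<M. set_integrable lebesgue (?I i) (%x. \<bar>v x\<bar>\<^sup>2*?w x)"
   by (intro allI impI set_integrable_subset[OF A _ sub]) simp_all
 next
  assume "\<forall>i<M. set_integrable lebesgue (?I i) (%x. \<bar>v x\<bar>\<^sup>2*?w x)"
  then show "set_integrable lebesgue ?U (%x. \<bar>v x\<bar>\<^sup>2*?w x)"
   unfolding ivl_union_def by (intro set_integrable_UN) auto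
 qed
 then have "v \<in> L2s s M a b \<longleftrightarrow> (\<forall>i<M. v \<in> weighted_L2 (?I i) (ivl_weight s (a i) (b i)))"
  unfolding L2s_def weighted_L2_def using meas wcong by auto
 then show ?thesis using weighted_L2_iff[OF intervals] by auto
qed

text \<open>Affine changes of variables turn the remainder into the coupling of the reference functions.\<close>

lemma R_op_eq:
 assumes i: "i < M" and z: "z \<in> {-1<..<1}" and \<phi>: "!!k. k < M ==> refs \<phi> k \<in> L2 \<mu>"
 shows "R_op s M a b i \<phi> (X i z) = remainder i (refs \<phi>) z"
proof -
 let ?p = "- 1 - 2 * s" and ?x = "X i z" and ?K = "{..<M} - {i}"
 define G where "G = (%k y. indicator {a k<..<b k} y*(\<bar>?x - y\<bar> powr ?p*ivl_weight s (a k) (b k) y*\<phi> y))"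
 have ptw: "indicator (ivl_union M a b - {a i<..<b i}) y*(\<bar>?x - y\<bar> powr ?p*weight s M a b y*\<phi> y) = (\<Sum>k\<in>?K. G k y)" for y
 proof (cases "\<exists>k\<in>?K. y \<in> {a k<..<b k}")
  case True
  then obtain k where k: "k \<in> ?K" "y \<in> {a k<..<b k}" by auto
  have "(\<Sum>l\<in>?K. G l y) = (\<Sum>l\<in>?K. if l = k then G k y else 0)"
   using interval_disjoint[of _ k y] k by (intro sum.cong refl) (auto simp: G_def indicator_def)
  also have "... = G k y" using k by simp
  also have "... = indicator (ivl_union M a b - {a i<..<b i}) y*(\<bar>?x - y\<bar> powr ?p*weight s M a b y*\<phi> y)"
  proof -
   have "y \<in> ivl_union M a b - {a i<..<b i}" using k interval_disjoint[of i k y] i by (auto simp: ivl_union_def)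
   then show ?thesis using k weight_interval[of k y] by (simp add: G_def)
  qed
  finally show ?thesis by simp
 next
  case False
  then have "y \<notin> ivl_union M a b - {a i<..<b i}" by (auto simp: ivl_union_def)
  moreover have "(\<Sum>k\<in>?K. G k y) = 0" using False by (intro sum.neutral) (auto simp: G_def)
  ultimately show ?thesis by simp
 qed
 have aff: "G k ((a k + b k)/2 + hl k*t) = hl k powr (2 * s)*(jacobi s t*(kern i k z t*refs \<phi> k t))" if k: "k < M" for k t
 proof (cases "t \<in> {-1<..<1}")
  case True
  then have "(a k + b k)/2 + hl k*t \<in> {a k<..<b k}" using affine_mem_iff[OF intervals[OF k]] by blast
  then have "G k ((a k + b k)/2 + hl k*t) = kern i k z t*(hl k powr (2 * s)*jacobi s t)*refs \<phi> k t"
   unfolding ref_fun_inside[OF True] kern_def ivl_weight_affine[OF intervals[OF k], symmetric] by (simp add: G_def affine_map_def)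
  then show ?thesis by (simp only: mult_ac)
 next
  case False
  then have "(a k + b k)/2 + hl k*t \<notin> {a k<..<b k}" using affine_mem_iff[OF intervals[OF k]] by blast
  then show ?thesis using False by (simp only: G_def indicator_simps jacobi_outside not_False_eq_True mult_zero_left mult_zero_right)
 qed
 have int: "integrable lebesgue (G k)" "integral\<^sup>L lebesgue (G k) = scale k*coupling i k (refs \<phi> k) z" if k: "k \<in> ?K" for k
 proof -
  have kM: "k < M" "i ~= k" using k by auto
  have h: "hl k > 0" by (rule hl_pos[OF kM(1)])
  have ki: "integrable \<mu> (%t. kern i k z t*refs \<phi> k t)"
   by (rule kern_section_integrable[OF i kM z L1_le(1)[OF \<phi>[OF kM(1)]]])
  then have m: "(%t. kern i k z t*refs \<phi> k t) \<in> borel_measurable lebesgue" using borel_measurable_integrable[OF ki] by simp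
  have "integrable lebesgue (%t. G k ((a k + b k)/2 + hl k*t))"
   unfolding aff[OF kM(1)] using ki integrable_jacobi_iff[OF m] by simp
  then show "integrable lebesgue (G k)"
   by (subst (asm) lebesgue_integrable_real_affine_iff) (use h in auto)
  have "integral\<^sup>L lebesgue (G k) = \<bar>hl k\<bar> *\<^sub>R (LINT t|lebesgue. G k ((a k + b k)/2 + hl k*t))"
   by (rule lebesgue_integral_real_affine) (use h in auto)
  also have "... = hl k*(hl k powr (2 * s)*(LINT t|lebesgue. jacobi s t*(kern i k z t*refs \<phi> k t)))"
   unfolding aff[OF kM(1)] using h by simp
  also have "... = scale k*coupling i k (refs \<phi> k) z"
   unfolding integral_jacobi[OF m, symmetric] scale_def using h z by (simp add: powr_add coupling_def)
  finally show "integral\<^sup>L lebesgue (G k) = scale k*coupling i k (refs \<phi> k) z" .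
 qed
 have "R_op s M a b i \<phi> ?x = - C1 s*(LINT y|lebesgue. (\<Sum>k\<in>?K. G k y))"
  unfolding R_op_def set_lebesgue_integral_def real_scaleR_def ptw ..
 also have "(LINT y|lebesgue. (\<Sum>k\<in>?K. G k y)) = (\<Sum>k\<in>?K. integral\<^sup>L lebesgue (G k))"
  by (rule Bochner_Integration.integral_sum) (rule int)
 also have "... = (\<Sum>k\<in>?K. scale k*coupling i k (refs \<phi> k) z)" by (intro sum.cong refl int)
 finally show ?thesis unfolding remainder_def by (simp add: sum_distrib_left mult.assoc)
qed

lemma remainder_outside: "z \<notin> {-1<..<1} ==> remainder i v z = 0"
 unfolding remainder_def coupling_def by simp

text \<open>The existentially quantified \<open>g\<close> is determined up to null sets by the equation, namely
 \<open>f\<close> minus the remainder, and \<open>K_ext_iff\<close> compares its coefficients with those of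
 \<open>\<phi>\<close>.\<close>

theorem frac_laplace_eq_iff:
 assumes \<phi>: "\<phi> \<in> L2s s M a b" and f: "f \<in> L2s s M a b"
 shows "frac_laplace_eq s M a b \<phi> f \<longleftrightarrow> system_solution (refs f) (refs \<phi>)"
proof -
 have \<phi>r: "refs \<phi> i \<in> L2 \<mu>" and fr: "refs f i \<in> L2 \<mu>" if "i < M" for i
  using \<phi> f that by (auto simp: L2s_iff)
 have rr: "remainder i (refs \<phi>) \<in> L2 \<mu>" if "i < M" for i
  by (rule remainder_sq[OF that]) (rule \<phi>r)
 have R: "refs (R_op s M a b i \<phi>) i = remainder i (refs \<phi>)" if i: "i < M" for i
 proof
  fix z
  show "refs (R_op s M a b i \<phi>) i z = remainder i (refs \<phi>) z"
   by (cases "z \<in> {-1<..<1}") (simp_all add: ref_fun_inside R_op_eq[OF i _ \<phi>r] remainder_outside ref_fun_def)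
 qed
 have radd: "ref_fun c d (%x. u x + v x) z = ref_fun c d u z + ref_fun c d v z" for c d u v z
  by (simp add: ref_fun_def distrib_left)
 show ?thesis
 proof
  assume "frac_laplace_eq s M a b \<phi> f"
  then obtain g where g: "!!i. i < M ==> K_ext s (a i) (b i) \<phi> g" "!!i. i < M ==> ae_eq_on {a i<..<b i} (%x. g x + R_op s M a b i \<phi> x) f"
   unfolding frac_laplace_eq_def by blast
  show "system_solution (refs f) (refs \<phi>)"
   unfolding system_solution_def
  proof (intro allI impI conjI \<phi>r)
   fix i j assume i: "i < M"
   have gr: "refs g i \<in> L2 \<mu>" "L2_inner \<mu> (refs g i) (e j) = ev j*L2_inner \<mu> (refs \<phi> i) (e j)"
    using g(1)[OF i] unfolding K_ext_iff[OF s intervals[OF i]] by blast+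
   have "AE z in \<mu>. refs g i z = refs f i z - remainder i (refs \<phi>) z"
    using g(2)[OF i] unfolding ae_eq_on_ref_iff[OF intervals[OF i], of _ _ s] radd R[OF i] by eventually_elim simp
   then have "L2_inner \<mu> (refs g i) (e j) = L2_inner \<mu> (%z. refs f i z - remainder i (refs \<phi>) z) (e j)"
    unfolding L2_inner_def using gr(1) fr[OF i] rr[OF i] basis.e_sq[of j]
    by (intro integral_cong_AE borel_measurable_times borel_measurable_diff) auto
   also have "... = L2_inner \<mu> (refs f i) (e j) - L2_inner \<mu> (remainder i (refs \<phi>)) (e j)"
    by (rule L2_inner_diff_left[OF fr[OF i] rr[OF i] basis.e_sq])
   finally show "ev j*L2_inner \<mu> (refs \<phi> i) (e j) = ..." using gr(2) by simp
  qed
 next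
  assume sol: "system_solution (refs f) (refs \<phi>)"
  define g where "g = (%x. f x - (\<Sum>i<M. indicator {a i<..<b i} x * R_op s M a b i \<phi> x))"
  have gI: "g x = f x - R_op s M a b i \<phi> x" if "i < M" "x \<in> {a i<..<b i}" for i x
   unfolding g_def sum_interval[OF that] ..
  have gr: "refs g i = (%z. refs f i z - remainder i (refs \<phi>) z)" if i: "i < M" for i
  proof
   fix z
   show "refs g i z = refs f i z - remainder i (refs \<phi>) z"
   proof (cases "z \<in> {-1<..<1}")
    case True
    then show ?thesis using gI[OF i X_mem[OF i True]] fun_cong[OF R[OF i], of z] by (simp add: ref_fun_inside)
   qed (simp add: remainder_outside ref_fun_def)
  qed
  show "frac_laplace_eq s M a b \<phi> f"
   unfolding frac_laplace_eq_def
  proof (intro exI[of _ g] allI impI conjI)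
   fix i assume i: "i < M"
   show "K_ext s (a i) (b i) \<phi> g"
    unfolding K_ext_iff[OF s intervals[OF i]] gr[OF i]
    using sol i by (auto simp: system_solution_def L2_inner_diff_left[OF fr[OF i] rr[OF i] basis.e_sq] intro: L2_diff fr rr)
   show "ae_eq_on {a i<..<b i} (%x. g x + R_op s M a b i \<phi> x) f"
    unfolding ae_eq_on_def using gI[OF i] by simp
  qed
 qed
qed

text \<open>Assembles a function on the union from functions on the reference interval.\<close>

definition glue :: "(nat => real => real) => real => real" where
 "glue v x = (\<Sum>i<M. indicator {a i<..<b i} x * v i ((x - (a i + b i)/2)/hl i))"

lemma refs_glue:
 assumes i: "i < M"
 shows "refs (glue v) i = (%z. indicator {-1<..<1} z * v i z)"
proof
 fix z
 show "refs (glue v) i z = indicator {-1<..<1} z * v i z"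
 proof (cases "z \<in> {-1<..<1}")
  case True
  have "(X i z - (a i + b i)/2)/hl i = z"
  proof -
   have "(m + h*z - m)/h = z" if "0 < h" for m h :: real using that by simp
   from this[OF hl_pos[OF i]] show ?thesis unfolding affine_map_def .
  qed
  moreover have "glue v (X i z) = v i ((X i z - (a i + b i)/2)/hl i)"
   unfolding glue_def by (rule sum_interval[OF i X_mem[OF i True]])
  ultimately show ?thesis using True by (simp add: ref_fun_inside)
 qed (simp add: ref_fun_def)
qed

lemma ae_eq_on_union:
 "ae_eq_on (ivl_union M a b) u v \<longleftrightarrow> (\<forall>i<M. AE z in \<mu>. refs u i z = refs v i z)"
proof -
 have "ae_eq_on (ivl_union M a b) u v \<longleftrightarrow> (\<forall>i<M. ae_eq_on {a i<..<b i} u v)"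
 proof
  assume "\<forall>i<M. ae_eq_on {a i<..<b i} u v"
  then have "AE x in lebesgue. \<forall>i\<in>{..<M}. x \<in> {a i<..<b i} --> u x = v x"
   unfolding ae_eq_on_def by (intro AE_finite_allI) auto
  then show "ae_eq_on (ivl_union M a b) u v"
   unfolding ae_eq_on_def by eventually_elim (auto simp: ivl_union_def)
 qed (auto simp: ae_eq_on_def ivl_union_def elim!: eventually_mono)
 then show ?thesis using ae_eq_on_ref_iff[OF intervals] by auto
qed

theorem solution_exists:
 assumes f: "f \<in> L2s s M a b"
 obtains \<phi> where "\<phi> \<in> L2s s M a b" "frac_laplace_eq s M a b \<phi> f"
proof -
 have fr: "refs f i \<in> L2 \<mu>" if "i < M" for i using f that by (auto simp: L2s_iff)
 obtain v where v: "system_solution (refs f) v" using system_solvable[of "refs f"] fr by blast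
 have vs: "v i \<in> L2 \<mu>" if "i < M" for i using v that by (auto simp: system_solution_def)
 define w where "w = (%i z. indicator {-1<..<1} z * v i z)"
 have ws: "w i \<in> L2 \<mu>" if "i < M" for i
  unfolding w_def by (rule L2_bounded_mult[where B=1, OF _ _ vs[OF that]]) (rule borel_measurable_indicator, simp, simp add: indicator_def)
 have wr: "refs (glue v) i = w i" if "i < M" for i unfolding w_def by (rule refs_glue[OF that])
 have wc: "coupling i k (w k) = coupling i k (v k)" if "k < M" for i k
 proof -
  have "(LINT t|\<mu>. kern i k z t*w k t) = (LINT t|\<mu>. kern i k z t * v k t)" for z
  proof (rule integral_cong_AE)
   have "(%t. kern i k z t) \<in> borel_measurable lebesgue"
    unfolding kern_def affine_map_def by (intro lebesgue_measurableI) measurable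
   then show "(%t. kern i k z t*w k t) \<in> borel_measurable \<mu>" "(%t. kern i k z t * v k t) \<in> borel_measurable \<mu>"
    using ws[OF that] vs[OF that] by (auto intro!: borel_measurable_times dest: L2_measurable)
   show "AE t in \<mu>. kern i k z t*w k t = kern i k z t * v k t"
    using AE_jacobi_interval by eventually_elim (simp add: w_def)
  qed
  then show ?thesis by (simp add: coupling_def fun_eq_iff)
 qed
 have win: "L2_inner \<mu> (w i) (e j) = L2_inner \<mu> (v i) (e j)" if "i < M" for i j
  by (rule L2_inner_cong_inside) (use ws[OF that] vs[OF that] basis.e_sq[of j] in \<open>auto simp: w_def dest: L2_measurable\<close>)
 have "system_solution (refs f) (refs (glue v))"
 proof -
  have "remainder i (refs (glue v)) = remainder i v" for i
   unfolding remainder_def[abs_def] by (intro ext sum.cong refl) (simp add: wr wc)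
  then show ?thesis using v by (simp add: system_solution_def wr win ws)
 qed
 moreover have "glue v \<in> L2s s M a b" by (simp add: L2s_iff wr ws)
 ultimately show thesis using that frac_laplace_eq_iff[OF _ f] by blast
qed

theorem solution_unique:
 assumes f: "f \<in> L2s s M a b" and \<phi>: "\<phi> \<in> L2s s M a b" "frac_laplace_eq s M a b \<phi> f"
  and \<psi>: "\<psi> \<in> L2s s M a b" "frac_laplace_eq s M a b \<psi> f"
 shows "ae_eq_on (ivl_union M a b) \<psi> \<phi>"
 unfolding ae_eq_on_union
 using system_unique[of "refs f" "refs \<psi>" "refs \<phi>"] frac_laplace_eq_iff[OF \<phi>(1) f] frac_laplace_eq_iff[OF \<psi>(1) f] \<phi> \<psi> by blast

end

text \<open>One of the two geometric factors absorbs the polynomial growth.\<close>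

lemma summable_poly_geometric:
 fixes q r :: real
 assumes q: "0 < q" "q < 1"
 shows "summable (%j. (1 + (real j)\<^sup>2) powr r*(q^j)\<^sup>2)"
proof -
 define c where "c = - ln q"
 have c: "0 < c" using q by (simp add: c_def)
 have "((%x::real. (1 + x\<^sup>2) powr r*exp (- c*x)) \<longlongrightarrow> 0) at_top"
  using c by real_asymp
 from filterlim_compose[OF this filterlim_real_sequentially]
 have "(%j. (1 + (real j)\<^sup>2) powr r*exp (- c*real j)) \<longlonglongrightarrow> 0" .
 moreover have "exp (- c*real j) = q^j" for j
  using q by (simp add: c_def exp_of_nat_mult mult.commute)
 ultimately have "(%j. (1 + (real j)\<^sup>2) powr r*q^j) \<longlonglongrightarrow> 0" by simp
 then have "Bseq (%j. (1 + (real j)\<^sup>2) powr r*q^j)" by (rule convergent_imp_Bseq[OF convergentI])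
 then obtain B where B: "!!j. norm ((1 + (real j)\<^sup>2) powr r*q^j) <= B" unfolding Bseq_def by blast
 show ?thesis
 proof (rule summable_comparison_test')
  show "summable (%j. B*q^j)" using q by (intro summable_mult summable_geometric) simp
  fix j :: nat
  have "norm ((1 + (real j)\<^sup>2) powr r*(q^j)\<^sup>2) = norm ((1 + (real j)\<^sup>2) powr r*q^j)*q^j"
   using q by (simp add: power2_eq_square abs_mult)
  also have "... <= B*q^j" using q by (intro mult_right_mono B) simp
  finally show "norm ((1 + (real j)\<^sup>2) powr r*(q^j)\<^sup>2) <= B*q^j" .
 qed
qed

lemma analytic_coeff_decay_inner:
 assumes s: "0 <= s" "s <= 1" and r: "0 < r" "r <= 1" and F: "F holomorphic_on segment_nbhd r"
  and M: "!!z. z \<in> segment_nbhd r ==> cmod (F z) <= M"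
  and v: "v \<in> L2 (jacobi_measure s)" "!!x. x \<in> {-1<..<1} ==> v x = Re (F (of_real x))"
 shows "\<bar>L2_inner (jacobi_measure s) v (normalized_gegenbauer s j)\<bar>
  <= 16 * sqrt (measure (jacobi_measure s) UNIV)*M*(4 powr (- r/9))^j"
proof -
 have "L2_inner (jacobi_measure s) v (normalized_gegenbauer s j) = wint s (%x. v x*normalized_gegenbauer s j x)"
  using s by (intro wint_eq_L2_inner[symmetric] v normalized_gegenbauer_L2) simp
 also have "... = gegenbauer_coeff s (%x. Re (F (of_real x))) j"
  unfolding gegenbauer_coeff_eq by (intro wint_cong) (simp add: v(2))
 finally show ?thesis using analytic_coeff_decay[OF s r F M] by simp
qed

lemma cmod_powr_real: "w ~= 0 ==> cmod (w powr of_real p) = cmod w powr p"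
 by (simp add: powr_def norm_exp_eq_Re)

lemma segment_nbhd_subset_ellipse:
 assumes "\<rho> > 1" "r <= (\<rho> + 1/\<rho> - 2)/2"
 shows "segment_nbhd r \<subseteq> ellipse_region \<rho>"
proof
 fix z assume "z \<in> segment_nbhd r"
 then obtain x where x: "x \<in> {-1..1}" "cmod (of_real x - z) < r" by (auto simp: segment_nbhd_def dist_norm)
 have d: "cmod (z - w) <= r + cmod (of_real x - w)" for w
  using norm_triangle_ineq[of "z - of_real x" "of_real x - w"] x(2) by (simp add: norm_minus_commute)
 have "complex_of_real x - 1 = of_real (x - 1)" "complex_of_real x - (- 1) = of_real (x + 1)" by simp_all
 then have "cmod (of_real x - 1) + cmod (of_real x - (- 1)) = 2" using x(1) by (simp only: norm_of_real) auto
 then have "cmod (z - 1) + cmod (z - (- 1)) <= 2*r + 2" using d[of 1] d[of "- 1"] by linarith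
 also have "... <= \<rho> + 1/\<rho>" using assms by simp
 finally show "z \<in> ellipse_region \<rho>" by (simp add: ellipse_region_def)
qed

lemma ellipse_region_mono:
 assumes "1 < \<nu>" "\<nu> <= \<rho>" shows "ellipse_region \<nu> \<subseteq> ellipse_region \<rho>"
proof -
 have "\<nu> + 1/\<nu> <= \<rho> + 1/\<rho>"
  using Joukowski_strict_mono[of \<nu> \<rho>] assms by (cases "\<nu> = \<rho>") auto
 then show ?thesis by (auto simp: ellipse_region_def)
qed

lemma compact_ellipse_region: "compact (ellipse_region \<rho>)"
proof -
 have "bounded (ellipse_region \<rho>)"
  unfolding bounded_iff
 proof (intro exI[of _ "\<rho> + 1/\<rho> + 1"] ballI)
  fix z assume "z \<in> ellipse_region \<rho>"
  then have z: "cmod (z - 1) + cmod (z + 1) <= \<rho> + 1/\<rho>" by (simp add: ellipse_region_def)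
  have "norm z <= norm (z - 1) + norm (1::complex)" using norm_triangle_ineq[of "z - 1" 1] by simp
  then have "norm z <= norm (z - 1) + 1" by simp
  then show "norm z <= \<rho> + 1/\<rho> + 1" using z norm_ge_zero[of "z + 1"] by linarith
 qed
 moreover have "closed (ellipse_region \<rho>)"
  unfolding ellipse_region_def by (intro closed_Collect_le continuous_intros)
 ultimately show ?thesis by (simp add: compact_eq_bounded_closed)
qed

context multi_interval
begin

text \<open>Small enough that moving \<open>z\<close> by the radius moves its image in any interval by at most half
 the gap.\<close>

definition radius :: real where
 "radius = min 1 (gap/(2*(1 + (\<Sum>i<M. hl i))))"

lemma radius: "0 < radius" "radius <= 1" "i < M ==> hl i*radius <= gap/2"
proof -
 let ?L = "1 + (\<Sum>i<M. hl i)"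
 have L: "0 < ?L" using total_length(1) by simp
 show "0 < radius" "radius <= 1" using gap(1) L by (auto simp: radius_def)
 show "hl i*radius <= gap/2" if i: "i < M"
 proof -
  have "hl i*radius <= ?L*(gap/(2*?L))"
   using total_length(2)[OF i] L hl_pos[OF i] \<open>0 < radius\<close> by (intro mult_mono) (auto simp: radius_def)
  also have "... = gap/2"
  proof -
   have "L*(g/(2*L)) = g/2" if "0 < L" for L g :: real using that by simp
   from this[OF L] show ?thesis .
  qed
  finally show ?thesis .
 qed
qed

abbreviation "decay \<equiv> 4 powr (- radius/9)"

lemma decay: "0 < decay" "decay < 1"
 using radius(1) powr_less_mono[of "- radius/9" 0 4] by auto

lemma kern_section_sq:
 assumes ik: "i < M" "k < M" "i ~= k" and t: "t \<in> {-1<..<1}"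
 shows "(%z. kern i k z t) \<in> L2 \<mu>"
proof (rule L2_jacobi_bounded[OF s1(1)])
 show "(%z. kern i k z t) \<in> borel_measurable lebesgue"
  unfolding kern_def affine_map_def by (intro lebesgue_measurableI) measurable
 show "\<bar>kern i k x t\<bar> <= kern_bound" if "x \<in> {-1<..<1}" for x by (rule kern_le[OF ik that t])
qed

text \<open>In its first variable the kernel continues analytically to a complex neighbourhood of the interval,
 whose size is governed by the gap.\<close>

lemma kern_coeff_decay:
 assumes ik: "i < M" "k < M" "i ~= k" and t: "t \<in> {-1<..<1}"
 shows "\<bar>L2_inner \<mu> (%z. kern i k z t) (e j)\<bar> <= 16 * sqrt (measure \<mu> UNIV)*(gap/2) powr (- 1 - 2 * s)*decay^j"
proof -
 let ?p = "- 1 - 2 * s"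
 (* The sign makes the real part of the argument positive on the neighbourhood, away from the branch cut. *)
 define \<sigma> :: real where "\<sigma> = (if b k < a i then 1 else - 1)"
 have \<sigma>: "\<bar>\<sigma>\<bar> = 1" by (simp add: \<sigma>_def)
 have sep: "b k < a i \<or> b i < a k"
 proof (rule ccontr)
  assume "\<not> ?thesis"
  then have "max (a i) (a k) \<in> {a i..b i} \<inter> {a k..b k}" using intervals[OF ik(1)] intervals[OF ik(2)] by auto
  then show False using disjoint[OF ik] by blast
 qed
 have mem: "X l x \<in> {a l..b l}" if "l < M" "x \<in> {-1..1}" for l x
 proof -
  have "hl l*(- 1) <= hl l*x" "hl l*x <= hl l*1"
   using that hl_pos[of l] by (intro mult_left_mono; simp)+
  then show ?thesis by (auto simp: affine_map_def field_simps)
 qed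
 have real: "\<sigma>*(X i x - X k t) = \<bar>X i x - X k t\<bar>" "gap <= \<sigma>*(X i x - X k t)" if x: "x \<in> {-1..1}" for x
 proof -
  have m: "X i x \<in> {a i..b i}" "X k t \<in> {a k..b k}" using mem ik x t by auto
  show "\<sigma>*(X i x - X k t) = \<bar>X i x - X k t\<bar>" using m sep by (auto simp: \<sigma>_def)
  then show "gap <= \<sigma>*(X i x - X k t)" using gap(2)[OF ik m] by simp
 qed
 define w :: "complex => complex" where "w = (%z. of_real \<sigma>*(of_real ((a i + b i)/2 - X k t) + of_real (hl i)*z))"
 have wr: "w (of_real x) = of_real (\<sigma>*(X i x - X k t))" for x
 proof -
  have "X i x - X k t = ((a i + b i)/2 - X k t) + hl i*x" by (simp add: affine_map_def)
  then show ?thesis by (simp only: w_def of_real_mult of_real_add)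
 qed
 have Re_w: "gap/2 <= Re (w z)" if z: "z \<in> segment_nbhd radius" for z
 proof -
  obtain x where x: "x \<in> {-1..1}" "cmod (of_real x - z) < radius" using z by (auto simp: segment_nbhd_def dist_norm)
  have "w (of_real x) - w z = of_real (\<sigma>*hl i)*(of_real x - z)"
  proof -
   have "p*(m + h*y) - p*(m + h*z) = p*h*(y - z)" for p m h y :: complex by (simp add: algebra_simps)
   then show ?thesis unfolding w_def of_real_mult .
  qed
  then have "cmod (w (of_real x) - w z) = hl i*cmod (of_real x - z)"
   using \<sigma> hl_pos[OF ik(1)] by (simp only: norm_mult norm_of_real abs_mult abs_of_pos mult_1)
  also have "... <= hl i*radius" using x(2) hl_pos[OF ik(1)] by (intro mult_left_mono) auto
  also have "... <= gap/2" by (rule radius(3)[OF ik(1)])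
  finally have "Re (w (of_real x) - w z) <= gap/2" using complex_Re_le_cmod order_trans by blast
  then show ?thesis using real(2)[OF x(1)] unfolding wr by simp
 qed
 have wpos: "0 < Re (w z)" if "z \<in> segment_nbhd radius" for z using Re_w[OF that] gap(1) by simp
 have nz: "w z \<notin> \<real>\<^sub>\<le>\<^sub>0" if "z \<in> segment_nbhd radius" for z
  using wpos[OF that] by (auto simp: complex_nonpos_Reals_iff)
 show ?thesis
 proof (rule analytic_coeff_decay_inner[where F="%z. w z powr of_real ?p"])
  show "(%z. w z powr of_real ?p) holomorphic_on segment_nbhd radius"
   using nz unfolding w_def by (intro holomorphic_intros) auto
  show "cmod (w z powr of_real ?p) <= (gap/2) powr ?p" if "z \<in> segment_nbhd radius" for z
  proof -
   have "gap/2 <= cmod (w z)" using Re_w[OF that] complex_Re_le_cmod order_trans by blast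
   moreover have "w z ~= 0" using wpos[OF that] by auto
   ultimately show ?thesis using gap(1) s by (subst cmod_powr_real) (auto intro!: powr_mono2')
  qed
  show "kern i k x t = Re (w (of_real x) powr of_real ?p)" if "x \<in> {-1<..<1}" for x
  proof -
   have "x \<in> {-1..1}" using that by simp
   then have "w (of_real x) = of_real \<bar>X i x - X k t\<bar>" unfolding wr using real(1) by simp
   then have "w (of_real x) powr of_real ?p = of_real (\<bar>X i x - X k t\<bar> powr ?p)"
    by (simp only: powr_of_real[OF abs_ge_zero])
   then show ?thesis by (simp only: kern_def Re_complex_of_real)
  qed
 qed (use s radius kern_section_sq[OF ik t] in auto)
qed

text \<open>By Fubini, coefficients of the coupled function are averages of coefficients of kernel sections, so decay
 that is uniform in the section is inherited.\<close>

lemma coupling_coeff: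
 assumes ik: "i < M" "k < M" "i ~= k" and v: "v \<in> L2 \<mu>" and u: "u \<in> L2 \<mu>"
 shows "L2_inner \<mu> (coupling i k v) u = (LINT t|\<mu>. v t*L2_inner \<mu> (%z. kern i k z t) u)"
  "integrable \<mu> (%t. v t*L2_inner \<mu> (%z. kern i k z t) u)"
proof -
 interpret PP: pair_sigma_finite \<mu> \<mu> by (rule pair_sigma_finite_jacobi[OF s1(1) s1(1)])
 have I: "integrable (\<mu> \<Otimes>\<^sub>M \<mu>) (%(x, y). kern i k x y*(u x * v y))"
  by (rule bounded_kernel_integrable[OF s1(1) s1(1) kern_measurable kern_le[OF ik] L1_le(1)[OF u] L1_le(1)[OF v]])
 have um: "u \<in> borel_measurable lebesgue" using u by (auto dest: L2_measurable)
 have eq: "(LINT z|\<mu>. kern i k z t*(u z * v t)) = v t*L2_inner \<mu> (%z. kern i k z t) u" for t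
  unfolding L2_inner_def integral_mult_right_zero[symmetric] by (intro Bochner_Integration.integral_cong refl) (simp only: mult_ac)
 have "L2_inner \<mu> (coupling i k v) u = (LINT z|\<mu>. (LINT t|\<mu>. kern i k z t*(u z * v t)))"
  unfolding L2_inner_def
 proof (rule integral_cong_AE)
  show "(%z. coupling i k v z*u z) \<in> borel_measurable \<mu>"
   using coupling_measurable[OF L1_le(1)[OF v], of i k] um by (simp add: borel_measurable_times)
  show "(%z. (LINT t|\<mu>. kern i k z t*(u z * v t))) \<in> borel_measurable \<mu>"
   using PP.integrable_fst[OF I] by (rule borel_measurable_integrable)
  show "AE z in \<mu>. coupling i k v z*u z = (LINT t|\<mu>. kern i k z t*(u z * v t))"
   using AE_jacobi_interval
  proof eventually_elim
   case (elim z)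
   have "coupling i k v z = (LINT t|\<mu>. kern i k z t * v t)" using elim by (simp add: coupling_def)
   then have "coupling i k v z*u z = (LINT t|\<mu>. kern i k z t * v t*u z)" by simp
   also have "... = (LINT t|\<mu>. kern i k z t*(u z * v t))"
    by (intro Bochner_Integration.integral_cong refl) (simp only: mult_ac)
   finally show ?case .
  qed
 qed
 also have "... = (LINT t|\<mu>. (LINT z|\<mu>. kern i k z t*(u z * v t)))"
  using PP.integral_fst[OF I] PP.integral_snd[OF I] by simp
 finally show "L2_inner \<mu> (coupling i k v) u = (LINT t|\<mu>. v t*L2_inner \<mu> (%z. kern i k z t) u)" unfolding eq .
 show "integrable \<mu> (%t. v t*L2_inner \<mu> (%z. kern i k z t) u)"
  using PP.integrable_snd[OF I] unfolding eq .
qed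

lemma remainder_coeff_decay:
 assumes i: "i < M" and v: "!!k. k < M ==> v k \<in> L2 \<mu>"
 obtains A where "0 <= A" "!!j. \<bar>L2_inner \<mu> (remainder i v) (e j)\<bar> <= A*decay^j"
proof -
 define Q where "Q = 16 * sqrt (measure \<mu> UNIV)*(gap/2) powr (- 1 - 2 * s)"
 have Q: "0 <= Q" unfolding Q_def by simp
 define A where "A = (\<Sum>k\<in>{..<M} - {i}. C1 s * scale k*(Q*(LINT t|\<mu>. \<bar>v k t\<bar>)))"
 have C: "0 < C1 s" by (rule C1_pos[OF s])
 have sc: "0 < scale k" if "k \<in> {..<M} - {i}" for k using scale_pos[of k] that by auto
 have T: "\<bar>L2_inner \<mu> (coupling i k (v k)) (e j)\<bar> <= Q*decay^j*(LINT t|\<mu>. \<bar>v k t\<bar>)" if k: "k \<in> {..<M} - {i}" for k j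
 proof -
  have k': "k < M" "i ~= k" using k by auto
  note cc = coupling_coeff[OF i k' v[OF k'(1)] basis.e_sq[of j]]
  have "\<bar>L2_inner \<mu> (coupling i k (v k)) (e j)\<bar> <= (LINT t|\<mu>. \<bar>v k t*L2_inner \<mu> (%z. kern i k z t) (e j)\<bar>)"
   unfolding cc(1) by (rule integral_abs_bound)
  also have "... <= (LINT t|\<mu>. Q*decay^j*\<bar>v k t\<bar>)"
  proof (rule integral_mono_AE)
   show "integrable \<mu> (%t. \<bar>v k t*L2_inner \<mu> (%z. kern i k z t) (e j)\<bar>)" by (rule integrable_abs[OF cc(2)])
   show "integrable \<mu> (%t. Q*decay^j*\<bar>v k t\<bar>)" using L1_le(1)[OF v[OF k'(1)]] by (intro integrable_mult_right integrable_abs)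
   show "AE t in \<mu>. \<bar>v k t*L2_inner \<mu> (%z. kern i k z t) (e j)\<bar> <= Q*decay^j*\<bar>v k t\<bar>"
    using AE_jacobi_interval
   proof eventually_elim
    case (elim t)
    have "\<bar>v k t\<bar>*\<bar>L2_inner \<mu> (%z. kern i k z t) (e j)\<bar> <= \<bar>v k t\<bar>*(Q*decay^j)"
     unfolding Q_def by (intro mult_left_mono kern_coeff_decay i k' elim) simp
    then show ?case by (simp only: abs_mult mult_ac)
   qed
  qed
  also have "... = Q*decay^j*(LINT t|\<mu>. \<bar>v k t\<bar>)" by simp
  finally show ?thesis .
 qed
 have "0 <= A" unfolding A_def using C Q sc
  by (intro sum_nonneg mult_nonneg_nonneg integral_nonneg_AE) (auto simp: less_imp_le)
 moreover have "\<bar>L2_inner \<mu> (remainder i v) (e j)\<bar> <= A*decay^j" for j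
 proof -
  have "L2_inner \<mu> (remainder i v) (e j) = (\<Sum>k\<in>{..<M} - {i}. - C1 s * scale k*L2_inner \<mu> (coupling i k (v k)) (e j))"
   by (rule remainder_inner[OF i v basis.e_sq])
  then have "\<bar>L2_inner \<mu> (remainder i v) (e j)\<bar> <= (\<Sum>k\<in>{..<M} - {i}. \<bar>- C1 s * scale k*L2_inner \<mu> (coupling i k (v k)) (e j)\<bar>)"
   by (simp only: sum_abs)
  also have "... <= (\<Sum>k\<in>{..<M} - {i}. C1 s * scale k*(Q*(LINT t|\<mu>. \<bar>v k t\<bar>))*decay^j)"
  proof (rule sum_mono)
   fix k assume k: "k \<in> {..<M} - {i}"
   have "\<bar>- C1 s * scale k*L2_inner \<mu> (coupling i k (v k)) (e j)\<bar> = C1 s * scale k*\<bar>L2_inner \<mu> (coupling i k (v k)) (e j)\<bar>"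
    using C sc[OF k] by (simp add: abs_mult)
   also have "... <= C1 s * scale k*(Q*decay^j*(LINT t|\<mu>. \<bar>v k t\<bar>))"
    using C sc[OF k] by (intro mult_left_mono T k) auto
   finally show "\<bar>- C1 s * scale k*L2_inner \<mu> (coupling i k (v k)) (e j)\<bar> <= C1 s * scale k*(Q*(LINT t|\<mu>. \<bar>v k t\<bar>))*decay^j"
    by (simp only: mult_ac)
  qed
  also have "... = A*decay^j" unfolding A_def by (simp only: sum_distrib_right)
  finally show ?thesis .
 qed
 ultimately show thesis by (rule that)
qed

text \<open>The coefficient of \<open>\<phi>\<close> is that of \<open>f\<close> minus an exponentially small one,
 divided by an eigenvalue of size at least \<open>(1 + j\<^sup>2) powr s\<close> up to a constant.\<close>

theorem solution_Sobolev:
 assumes f: "f \<in> L2s s M a b" and \<phi>: "\<phi> \<in> L2s s M a b" "frac_laplace_eq s M a b \<phi> f"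
  and fr: "f \<in> Hs s r M a b"
 shows "\<phi> \<in> Hs s (r + 2 * s) M a b"
 unfolding Hs_def
proof (intro CollectI allI impI)
 fix i assume i: "i < M"
 let ?w = "%j. 1 + (real j)\<^sup>2" and ?f = "%j. L2_inner \<mu> (refs f i) (e j)" and ?R = "%j. L2_inner \<mu> (remainder i (refs \<phi>)) (e j)"
  and ?c = "%j. L2_inner \<mu> (refs \<phi> i) (e j)"
 have \<phi>r: "refs \<phi> k \<in> L2 \<mu>" if "k < M" for k using \<phi>(1) that by (auto simp: L2s_iff)
 have sol: "ev j*?c j = ?f j - ?R j" for j
  using frac_laplace_eq_iff[OF \<phi>(1) f] \<phi>(2) i by (auto simp: system_solution_def)
 obtain A where A: "0 <= A" "!!j. \<bar>?R j\<bar> <= A*decay^j" by (rule remainder_coeff_decay[OF i, of "refs \<phi>"]) (use \<phi>r in auto)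
 obtain c1 where c1: "0 < c1" "!!n. c1*?w n powr s <= ev n" by (rule K_eigenvalue_bounds[OF s]) blast
 have sf: "summable (%j. ?w j powr r*(?f j)\<^sup>2)"
  using fr i pullback_Hs_ref_iff[OF s1(1)] by (auto simp: Hs_def)
 have "summable (%j. ?w j powr (r + 2 * s)*(?c j)\<^sup>2)"
 proof (rule summable_comparison_test')
  show "summable (%j. 2/c1\<^sup>2*(?w j powr r*(?f j)\<^sup>2 + A\<^sup>2*(?w j powr r*(decay^j)\<^sup>2)))"
   by (intro summable_mult summable_add sf summable_poly_geometric decay)
  fix j :: nat
  have w: "0 < ?w j" by (simp add: add_pos_nonneg)
  have "(c1*?w j powr s*\<bar>?c j\<bar>)\<^sup>2 <= (ev j*\<bar>?c j\<bar>)\<^sup>2"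
   using c1 by (intro power_mono mult_right_mono) auto
  also have "... = (?f j - ?R j)\<^sup>2" unfolding sol[symmetric] by (simp add: power_mult_distrib)
  also have "... <= 2*((?f j)\<^sup>2 + (?R j)\<^sup>2)"
   using sum_squares_bound[of "?f j" "- ?R j"] by (simp add: power2_diff)
  also have "(?R j)\<^sup>2 <= A\<^sup>2*(decay^j)\<^sup>2"
   using power_mono[OF A(2)[of j], of 2] by (simp add: power_mult_distrib)
  finally have *: "(c1*?w j powr s*\<bar>?c j\<bar>)\<^sup>2 <= 2*((?f j)\<^sup>2 + A\<^sup>2*(decay^j)\<^sup>2)" by simp
  have "?w j powr (2 * s) = (?w j powr s)\<^sup>2" by (simp only: mult_2 powr_add power2_eq_square)
  then have "c1\<^sup>2*(?w j powr (2 * s)*(?c j)\<^sup>2) <= 2*((?f j)\<^sup>2 + A\<^sup>2*(decay^j)\<^sup>2)"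
   using * by (simp only: power_mult_distrib power2_abs mult.assoc)
  then have "?w j powr (2 * s)*(?c j)\<^sup>2 <= 2/c1\<^sup>2*((?f j)\<^sup>2 + A\<^sup>2*(decay^j)\<^sup>2)"
   using c1(1) by (simp add: field_simps)
  then have "?w j powr r*(?w j powr (2 * s)*(?c j)\<^sup>2) <= ?w j powr r*(2/c1\<^sup>2*((?f j)\<^sup>2 + A\<^sup>2*(decay^j)\<^sup>2))"
   by (rule mult_left_mono) simp
  also have "... = 2/c1\<^sup>2*(?w j powr r*(?f j)\<^sup>2 + A\<^sup>2*(?w j powr r*(decay^j)\<^sup>2))"
   by (simp only: distrib_left mult_ac)
  finally show "norm (?w j powr (r + 2 * s)*(?c j)\<^sup>2) <= 2/c1\<^sup>2*(?w j powr r*(?f j)\<^sup>2 + A\<^sup>2*(?w j powr r*(decay^j)\<^sup>2))"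
   by (simp add: powr_add mult.assoc)
 qed
 then show "pullback (a i) (b i) \<phi> \<in> Hs_ref s (r + 2 * s)"
  using pullback_Hs_ref_iff[OF s1(1)] \<phi>r[OF i] by blast
qed

text \<open>An analytic \<open>f\<close> is bounded and holomorphic on a neighbourhood of the segment inside the
 ellipse, so both terms of \<open>f - R \<phi>\<close> have exponentially decaying coefficients, and division by the
 eigenvalues preserves this.\<close>

theorem solution_analytic:
 assumes f: "f \<in> L2s s M a b" and \<phi>: "\<phi> \<in> L2s s M a b" "frac_laplace_eq s M a b \<phi> f"
  and \<rho>: "\<rho> > 1" and fA: "f \<in> A_space \<rho> M a b"
 shows "\<exists>\<nu>>1. \<exists>\<phi>'\<in>A_space \<nu> M a b. ae_eq_on (ivl_union M a b) \<phi>' \<phi>"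
proof -
 have \<phi>r: "refs \<phi> k \<in> L2 \<mu>" and fr: "refs f k \<in> L2 \<mu>" if "k < M" for k using f \<phi>(1) that by (auto simp: L2s_iff)
 have one: "\<exists>\<nu> F. \<nu> > 1 \<and> F analytic_on ellipse_region \<nu> \<and> (\<forall>x\<in>{-1<..<1}. F (of_real x) = of_real (Re (F (of_real x)))) \<and>
  (AE x in \<mu>. refs \<phi> i x = Re (F (of_real x)))" if i: "i < M" for i
 proof -
  let ?f = "%j. L2_inner \<mu> (refs f i) (e j)" and ?R = "%j. L2_inner \<mu> (remainder i (refs \<phi>)) (e j)" and ?c = "%j. L2_inner \<mu> (refs \<phi> i) (e j)"
  have sol: "ev j*?c j = ?f j - ?R j" for j
   using frac_laplace_eq_iff[OF \<phi>(1) f] \<phi>(2) i by (auto simp: system_solution_def)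
  obtain A where A: "0 <= A" "!!j. \<bar>?R j\<bar> <= A*decay^j" by (rule remainder_coeff_decay[OF i, of "refs \<phi>"]) (use \<phi>r in auto)
  obtain c where c: "0 < c" "!!j. c <= ev j" by (rule ev_lower) blast
  obtain F where F: "F analytic_on ellipse_region \<rho>" "!!z. z \<in> {-1<..<1} ==> complex_of_real (pullback (a i) (b i) f z) = F (of_real z)"
   using fA i by (auto simp: A_space_def)
  have "compact (F ` ellipse_region \<rho>)"
   by (intro compact_continuous_image compact_ellipse_region holomorphic_on_imp_continuous_on analytic_imp_holomorphic F(1))
  then obtain B where B: "!!z. z \<in> ellipse_region \<rho> ==> cmod (F z) <= B" using compact_imp_bounded by (fastforce simp: bounded_iff)
  define r where "r = min 1 ((\<rho> + 1/\<rho> - 2)/2)"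
  have "2 < \<rho> + 1/\<rho>" using segment_in_ellipse[of 1 \<rho>] \<rho> by simp
  then have r: "0 < r" "r <= 1" by (simp_all add: r_def)
  have r3: "r <= (\<rho> + 1/\<rho> - 2)/2" unfolding r_def by (rule min.cobounded2)
  have sub: "segment_nbhd r \<subseteq> ellipse_region \<rho>" by (rule segment_nbhd_subset_ellipse[OF \<rho> r3])
  define q where "q = 4 powr (- r/9)"
  have q: "0 < q" "q < 1" using r(1) powr_less_mono[of "- r/9" 0 4] by (auto simp: q_def)
  let ?C = "16 * sqrt (measure \<mu> UNIV)*B"
  have fd: "\<bar>?f j\<bar> <= ?C*q^j" for j
   unfolding q_def
  proof (rule analytic_coeff_decay_inner[where F=F])
   show "F holomorphic_on segment_nbhd r" using analytic_imp_holomorphic[OF F(1)] sub by (rule holomorphic_on_subset)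
   show "refs f i x = Re (F (of_real x))" if "x \<in> {-1<..<1}" for x
    using F(2)[OF that] that by (simp add: ref_fun_inside pullback_affine flip: F(2)[OF that])
  qed (use s r sub B fr[OF i] in auto)
  have C0: "0 <= ?C"
  proof -
   have "cmod (F 1) <= B" using \<open>2 < \<rho> + 1 / \<rho>\<close> by (intro B) (simp add: ellipse_region_def)
   then have "0 <= B" using norm_ge_zero[of "F 1"] by linarith
   then show ?thesis by simp
  qed
  let ?Q = "max q decay"
  have Q: "0 < ?Q" "?Q < 1" using q decay by auto
  have cd: "\<bar>?c j\<bar> <= (?C + A)/c*?Q^j" for j
  proof -
   have "c*\<bar>?c j\<bar> <= ev j*\<bar>?c j\<bar>" using c by (intro mult_right_mono) auto
   also have "... = \<bar>?f j - ?R j\<bar>" unfolding sol[symmetric] using ev_pos[of j] by (simp add: abs_mult)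
   also have "... <= \<bar>?f j\<bar> + \<bar>?R j\<bar>" by (rule abs_triangle_ineq4)
   also have "... <= ?C*q^j + A*decay^j" by (intro add_mono fd A(2))
   also have "... <= ?C*?Q^j + A*?Q^j"
    using C0 A(1) q decay by (intro add_mono mult_left_mono power_mono) auto
   finally have "c*\<bar>?c j\<bar> <= (?C + A)*?Q^j" by (simp only: distrib_right)
   then show ?thesis using c(1) by (simp add: pos_le_divide_eq mult.commute)
  qed
  show ?thesis
   by (rule gegenbauer_series_analytic[OF s1(2) less_imp_le[OF s(2)] Q cd \<phi>r[OF i] refl]) blast
 qed
 define P where "P = (%i \<nu> F. \<nu> > 1 \<and> F analytic_on ellipse_region \<nu> \<and> (\<forall>x\<in>{-1<..<1}. F (of_real x) = of_real (Re (F (of_real x)))) \<and>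
  (AE x in \<mu>. refs \<phi> i x = Re (F (of_real x))))"
 define N where "N = (%i. SOME \<nu>. \<exists>F. P i \<nu> F)"
 define G where "G = (%i. SOME F. P i (N i) F)"
 have G: "P i (N i) (G i)" if "i < M" for i
 proof -
  have "\<exists>\<nu> F. P i \<nu> F" using one[OF that] unfolding P_def .
  then have "\<exists>F. P i (N i) F" unfolding N_def by (rule someI_ex)
  then show ?thesis unfolding G_def by (rule someI_ex)
 qed
 (* The 2 is a default for M = 0. *)
 define \<nu> where "\<nu> = Min (insert 2 (N ` {..<M}))"
 have \<nu>: "1 < \<nu>" "!!i. i < M ==> \<nu> <= N i"
  using G unfolding \<nu>_def P_def by auto
 define \<phi>' where "\<phi>' = glue (%i x. Re (G i (of_real x)))"
 have r': "refs \<phi>' i = (%z. indicator {-1<..<1} z * Re (G i (of_real z)))" if "i < M" for i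
  unfolding \<phi>'_def by (rule refs_glue[OF that])
 have "\<phi>' \<in> A_space \<nu> M a b"
  unfolding A_space_def
 proof (intro CollectI allI impI exI conjI ballI)
  fix i assume i: "i < M"
  show "G i analytic_on ellipse_region \<nu>"
   using G[OF i] ellipse_region_mono[OF \<nu>(1) \<nu>(2)[OF i]] analytic_on_subset unfolding P_def by blast
  fix z :: real assume z: "z \<in> {-1<..<1}"
  have "pullback (a i) (b i) \<phi>' z = Re (G i (of_real z))"
   using z fun_cong[OF r'[OF i], of z] by (simp add: pullback_affine ref_fun_inside)
  then show "complex_of_real (pullback (a i) (b i) \<phi>' z) = G i (of_real z)"
   using G[OF i] z unfolding P_def by simp
 qed
 moreover have "ae_eq_on (ivl_union M a b) \<phi>' \<phi>"
  unfolding ae_eq_on_union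
 proof (intro allI impI)
  fix i assume i: "i < M"
  have "AE x in \<mu>. refs \<phi> i x = Re (G i (of_real x))" using G[OF i] unfolding P_def by blast
  with AE_jacobi_interval[of s] show "AE z in \<mu>. refs \<phi>' i z = refs \<phi> i z"
   by eventually_elim (simp add: r'[OF i])
 qed
 ultimately show ?thesis using \<nu>(1) by blast
qed

end

theorem theorem4p21:
  fixes s :: real and M :: nat and a b :: "nat \<Rightarrow> real" and f :: "real \<Rightarrow> real"
  assumes s: "0 < s" "s < 1"
    and intervals: "\<And>i. i < M \<Longrightarrow> a i < b i"
    and disjoint: "\<And>i j. i < M \<Longrightarrow> j < M \<Longrightarrow> i \<noteq> j \<Longrightarrow> {a i..b i} \<inter> {a j..b j} = {}"
    and f: "f \<in> L2s s M a b"
  shows "(\<exists>\<phi>\<in>L2s s M a b. frac_laplace_eq s M a b \<phi> f \<and>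
            (\<forall>\<psi>\<in>L2s s M a b. frac_laplace_eq s M a b \<psi> f \<longrightarrow> ae_eq_on (ivl_union M a b) \<psi> \<phi>)) \<and>
         (\<forall>\<phi>\<in>L2s s M a b. frac_laplace_eq s M a b \<phi> f \<longrightarrow>
            (\<forall>r\<ge>0. f \<in> Hs s r M a b \<longrightarrow> \<phi> \<in> Hs s (r + 2 * s) M a b) \<and>
            (\<forall>\<rho>>1. f \<in> A_space \<rho> M a b \<longrightarrow>
               (\<exists>\<nu>>1. \<exists>\<phi>'\<in>A_space \<nu> M a b. ae_eq_on (ivl_union M a b) \<phi>' \<phi>)))"
proof -
  interpret multi_interval s M a b by standard (fact s intervals disjoint)+
  obtain \<phi> where \<phi>: "\<phi> \<in> L2s s M a b" "frac_laplace_eq s M a b \<phi> f" by (rule solution_exists[OF f])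
  show ?thesis
  proof (intro conjI ballI impI allI)
    show "\<exists>\<phi>\<in>L2s s M a b. frac_laplace_eq s M a b \<phi> f \<and>
      (\<forall>\<psi>\<in>L2s s M a b. frac_laplace_eq s M a b \<psi> f \<longrightarrow> ae_eq_on (ivl_union M a b) \<psi> \<phi>)"
      using \<phi> solution_unique[OF f \<phi>] by blast
  qed (blast intro: solution_Sobolev[OF f] solution_analytic[OF f])+
qed

end
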